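(* Let $A$ be a complete discrete valuation ring whose residue field has characteristic $p>0$, let $K$ be its fraction field, let $A^{\mathrm g}$ be the generic residual perfection of $A$, and let $K^{\mathrm g}$ be the fraction field of $A^{\mathrm g}$. Then $K$ is algebraically closed in $K^{\mathrm g}$.
   Context: All rings are commutative with 1; $p$ is a fixed prime; $\mathfrak p_A$ is the maximal ideal of $A$. An $\mathbf F_p$-algebra is perfect if $x\mapsto x^p$ is bijective on it; $\mathsf{PfAlg}_S$ is the category of perfect $S$-algebras. $\mathsf{CRP}_A$ is the full subcategory of $A$-algebras $B$ that are flat over $A$, complete (and separated) with respect to $\mathfrak p_AB$, and such that $\overline B:=B/\mathfrak p_AB$ is perfect. This category has an initial object $A^{\mathrm u}$, the functor $B\mapsto\overline B$ from $\mathsf{CRP}_A$ to $\mathsf{PfAlg}_{\overline{A^{\mathrm u}}}$ is an equivalence, and $\overline{A^{\mathrm u}}$ is a domain. The generic residual perfection $A^{\mathrm g}$ is the object of $\mathsf{CRP}_A$ (unique up to unique isomorphism) corresponding to the fraction field of $\overline{A^{\mathrm u}}$; it is a complete discrete valuation ring with perfect residue field. *)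

theory Defs
  imports "HOL-Algebra.Algebra" "HOL-Computational_Algebra.Primes"
begin

section \<open>Rings: characteristic, fraction fields, completeness, discrete valuation rings\<close>

definition has_char :: "('a, 'm) ring_scheme \<Rightarrow> nat \<Rightarrow> bool" where
  "has_char R n \<longleftrightarrow> (\<forall>m::nat. [m] \<cdot>\<^bsub>R\<^esub> \<one>\<^bsub>R\<^esub> = \<zero>\<^bsub>R\<^esub> \<longleftrightarrow> n dvd m)"

definition fraction_field :: "('a, 'm) ring_scheme \<Rightarrow> ('b, 'n) ring_scheme \<Rightarrow> ('a \<Rightarrow> 'b) \<Rightarrow> bool" where
  "fraction_field R L i \<longleftrightarrow>
     domain R \<and> field L \<and> i \<in> ring_hom R L \<and> inj_on i (carrier R) \<and>
     (\<forall>x\<in>carrier L. \<exists>a\<in>carrier R. \<exists>b\<in>carrier R - {\<zero>\<^bsub>R\<^esub>}. x = i a \<otimes>\<^bsub>L\<^esub> inv\<^bsub>L\<^esub> (i b))"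

primrec ideal_power :: "('a, 'm) ring_scheme \<Rightarrow> 'a set \<Rightarrow> nat \<Rightarrow> 'a set" where
  "ideal_power R I 0 = carrier R"
| "ideal_power R I (Suc n) = I \<cdot>\<^bsub>R\<^esub> ideal_power R I n"

text \<open>Bijectivity of the canonical map from \<open>R\<close> to the inverse limit of the rings
  \<open>R / I^n\<close>; an element of the limit is given by a sequence of representatives.
  Uniqueness of the limit \<open>y\<close> is separatedness.\<close>

definition complete_separated :: "('a, 'm) ring_scheme \<Rightarrow> 'a set \<Rightarrow> bool" where
  "complete_separated R I \<longleftrightarrow>
     (\<forall>x. (\<forall>n. x n \<in> carrier R \<and> x (Suc n) \<ominus>\<^bsub>R\<^esub> x n \<in> ideal_power R I n) \<longrightarrow>
          (\<exists>!y. y \<in> carrier R \<and> (\<forall>n. y \<ominus>\<^bsub>R\<^esub> x n \<in> ideal_power R I n)))"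

definition dvr :: "('a, 'm) ring_scheme \<Rightarrow> bool" where
  "dvr R \<longleftrightarrow> principal_domain R \<and> (\<exists>!I. maximalideal I R) \<and> \<not> field R"

definition max_ideal :: "('a, 'm) ring_scheme \<Rightarrow> 'a set" where
  "max_ideal R = (THE I. maximalideal I R)"

definition complete_dvr :: "('a, 'm) ring_scheme \<Rightarrow> bool" where
  "complete_dvr R \<longleftrightarrow> dvr R \<and> complete_separated R (max_ideal R)"

definition perfect_algebra :: "nat \<Rightarrow> ('a, 'm) ring_scheme \<Rightarrow> bool" where
  "perfect_algebra p R \<longleftrightarrow>
     cring R \<and> [p] \<cdot>\<^bsub>R\<^esub> \<one>\<^bsub>R\<^esub> = \<zero>\<^bsub>R\<^esub> \<and>
     bij_betw (\<lambda>x. x [^]\<^bsub>R\<^esub> p) (carrier R) (carrier R)"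

definition algebraically_closed_in :: "'a set \<Rightarrow> ('a, 'm) ring_scheme \<Rightarrow> bool" where
  "algebraically_closed_in F L \<longleftrightarrow>
     subfield F L \<and> (\<forall>x\<in>carrier L. (ring.algebraic L over F) x \<longrightarrow> x \<in> F)"


section \<open>Tensor products and flatness\<close>

definition linear_maps ::
  "('a, 'm) ring_scheme \<Rightarrow> ('a, 'b, 'n) module_scheme \<Rightarrow> ('a, 'c, 'k) module_scheme \<Rightarrow> ('b \<Rightarrow> 'c) set" where
  "linear_maps R M N =
     {f \<in> carrier M \<rightarrow> carrier N.
        (\<forall>x\<in>carrier M. \<forall>y\<in>carrier M. f (x \<oplus>\<^bsub>M\<^esub> y) = f x \<oplus>\<^bsub>N\<^esub> f y) \<and>
        (\<forall>a\<in>carrier R. \<forall>x\<in>carrier M. f (a \<odot>\<^bsub>M\<^esub> x) = a \<odot>\<^bsub>N\<^esub> f x)}"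

definition tensor_relations ::
  "('a, 'm) ring_scheme \<Rightarrow> ('a, 'b, 'n) module_scheme \<Rightarrow> ('a, 'c, 'k) module_scheme \<Rightarrow> ('b \<times> 'c \<Rightarrow>\<^sub>0 int) set" where
  "tensor_relations R M P = generate (free_Abelian_group (carrier M \<times> carrier P))
     ({frag_of (x \<oplus>\<^bsub>M\<^esub> y, z) - frag_of (x, z) - frag_of (y, z) | x y z.
         x \<in> carrier M \<and> y \<in> carrier M \<and> z \<in> carrier P} \<union>
      {frag_of (x, y \<oplus>\<^bsub>P\<^esub> z) - frag_of (x, y) - frag_of (x, z) | x y z.
         x \<in> carrier M \<and> y \<in> carrier P \<and> z \<in> carrier P} \<union>
      {frag_of (a \<odot>\<^bsub>M\<^esub> x, z) - frag_of (x, a \<odot>\<^bsub>P\<^esub> z) | a x z.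
         a \<in> carrier R \<and> x \<in> carrier M \<and> z \<in> carrier P})"

definition tensor_product ::
  "('a, 'm) ring_scheme \<Rightarrow> ('a, 'b, 'n) module_scheme \<Rightarrow> ('a, 'c, 'k) module_scheme \<Rightarrow> ('b \<times> 'c \<Rightarrow>\<^sub>0 int) set monoid" where
  "tensor_product R M P =
     free_Abelian_group (carrier M \<times> carrier P) Mod tensor_relations R M P"

text \<open>The map from \<open>M \<otimes> P\<close> to \<open>N \<otimes> P\<close> induced by \<open>f\<close>.  All members \<open>z\<close> of a
  coset \<open>Z\<close> yield the same coset, so the union is that coset.\<close>

definition tensor_map ::
  "('a, 'm) ring_scheme \<Rightarrow> ('a, 'b, 'n) module_scheme \<Rightarrow> ('a, 'c, 'k) module_scheme \<Rightarrow>
   ('b \<Rightarrow> 'c) \<Rightarrow> ('a, 'd, 'l) module_scheme \<Rightarrow> ('b \<times> 'd \<Rightarrow>\<^sub>0 int) set \<Rightarrow> ('c \<times> 'd \<Rightarrow>\<^sub>0 int) set" where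
  "tensor_map R M N f P Z =
     (\<Union>z\<in>Z. tensor_relations R N P #>\<^bsub>free_Abelian_group (carrier N \<times> carrier P)\<^esub>
               frag_extend (\<lambda>(x, y). frag_of (f x, y)) z)"

text \<open>The test modules \<open>M\<close>, \<open>N\<close> have carriers in the type of the ring.  This is no
  restriction: flatness only has to be tested on inclusions of ideals into \<open>R\<close>.\<close>

definition flat :: "('a, 'm) ring_scheme \<Rightarrow> ('a, 'b, 'n) module_scheme \<Rightarrow> bool" where
  "flat R P \<longleftrightarrow> module R P \<and>
     (\<forall>(M :: ('a, 'a) module) (N :: ('a, 'a) module). \<forall>f \<in> linear_maps R M N.
        module R M \<and> module R N \<and> inj_on f (carrier M) \<longrightarrow>
        inj_on (tensor_map R M N f P) (carrier (tensor_product R M P)))"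


section \<open>Complete residually perfect algebras\<close>

text \<open>An \<open>A\<close>-algebra is a commutative ring \<open>B\<close> with a structure map \<open>s\<close> in
  \<open>ring_hom A B\<close>.\<close>

definition alg_module :: "('b, 'm) ring_scheme \<Rightarrow> ('a \<Rightarrow> 'b) \<Rightarrow> ('a, 'b) module" where
  "alg_module B s =
     \<lparr>carrier = carrier B, monoid.mult = (\<otimes>\<^bsub>B\<^esub>), one = \<one>\<^bsub>B\<^esub>,
      ring.zero = \<zero>\<^bsub>B\<^esub>, ring.add = (\<oplus>\<^bsub>B\<^esub>),
      smult = (\<lambda>a x. s a \<otimes>\<^bsub>B\<^esub> x)\<rparr>"

text \<open>Homomorphisms are taken to be \<open>undefined\<close> outside the carrier, so that equality
  of homomorphisms is equality of HOL functions.\<close>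

definition alg_homs :: "'a ring \<Rightarrow> 'b ring \<Rightarrow> ('a \<Rightarrow> 'b) \<Rightarrow> 'c ring \<Rightarrow> ('a \<Rightarrow> 'c) \<Rightarrow> ('b \<Rightarrow> 'c) set" where
  "alg_homs A B s C t =
     {h \<in> ring_hom B C \<inter> extensional (carrier B). \<forall>a\<in>carrier A. h (s a) = t a}"

definition ext_ideal :: "'a ring \<Rightarrow> 'b ring \<Rightarrow> ('a \<Rightarrow> 'b) \<Rightarrow> 'b set" where
  "ext_ideal A B s = Idl\<^bsub>B\<^esub> (s ` max_ideal A)"

definition residual_ring :: "'a ring \<Rightarrow> 'b ring \<Rightarrow> ('a \<Rightarrow> 'b) \<Rightarrow> 'b set ring" where
  "residual_ring A B s = B Quot ext_ideal A B s"

text \<open>The map of residue rings induced by \<open>h\<close>; as above, the union is over equal cosets.\<close>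

definition residual_map :: "'a ring \<Rightarrow> 'c ring \<Rightarrow> ('a \<Rightarrow> 'c) \<Rightarrow> ('b \<Rightarrow> 'c) \<Rightarrow> 'b set \<Rightarrow> 'c set" where
  "residual_map A C t h Z = (\<Union>z\<in>Z. ext_ideal A C t +>\<^bsub>C\<^esub> h z)"

definition CRP :: "nat \<Rightarrow> 'a ring \<Rightarrow> 'b ring \<Rightarrow> ('a \<Rightarrow> 'b) \<Rightarrow> bool" where
  "CRP p A B s \<longleftrightarrow>
     cring B \<and> s \<in> ring_hom A B \<and>
     flat A (alg_module B s) \<and>
     complete_separated B (ext_ideal A B s) \<and>
     perfect_algebra p (residual_ring A B s)"

text \<open>The category is formed by the objects with carrier in a type \<open>'b\<close>.  Nothing is
  lost by testing initiality of \<open>U\<close> only on objects carried by the type of \<open>U\<close> itself,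
  when \<open>A\<close> is a complete discrete valuation ring with residue field \<open>k\<close> of
  characteristic \<open>p\<close>.  The residue ring of the true initial object is
  the perfection of a polynomial ring over \<open>k\<close> in at most \<open>max |k| \<aleph>\<^sub>0\<close> variables, so the
  initial object has cardinality at most \<open>|k|^\<aleph>\<^sub>0 = |A|\<close>.  On the other hand
  every nonzero object is faithfully flat over \<open>A\<close>, hence has cardinality at least
  \<open>|A|\<close>.  Thus if \<open>'b\<close> carries any nonzero object, it carries a copy of the true initial
  object, and \<open>U\<close> is isomorphic to it.  If \<open>'b\<close> carries no nonzero object, then \<open>U\<close> is
  the zero ring, which is excluded in \<open>generic_residual_perfection\<close> below because its
  residue ring is not a domain.\<close>

definition CRP_initial :: "nat \<Rightarrow> 'a ring \<Rightarrow> 'b ring \<Rightarrow> ('a \<Rightarrow> 'b) \<Rightarrow> bool" where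
  "CRP_initial p A U u \<longleftrightarrow>
     CRP p A U u \<and>
     (\<forall>(B :: 'b ring) s. CRP p A B s \<longrightarrow> (\<exists>!h. h \<in> alg_homs A U u B s))"

text \<open>Under the equivalence between the category and perfect algebras over the residue
  ring of \<open>U\<close>, the object \<open>G\<close> corresponds to the residue ring of \<open>G\<close>, regarded as an
  algebra over that of \<open>U\<close> through the map induced by the unique \<open>h\<close>.  This algebra is
  required to be the fraction field of the residue ring of \<open>U\<close>.\<close>

definition generic_residual_perfection :: "nat \<Rightarrow> 'a ring \<Rightarrow> 'b ring \<Rightarrow> ('a \<Rightarrow> 'b) \<Rightarrow> bool" where
  "generic_residual_perfection p A G g \<longleftrightarrow>
     CRP p A G g \<and>
     (\<exists>(U :: 'b ring) u. CRP_initial p A U u \<and>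
        (\<exists>h \<in> alg_homs A U u G g.
           fraction_field (residual_ring A U u) (residual_ring A G g) (residual_map A G g h)))"

end

theory Submission
  imports Defs
begin

text \<open>Let \<open>U\<close> be the initial object, \<open>G\<close> the generic residual perfection, \<open>w\<close> a uniformizer and \<open>k\<close>
  the residue field of \<open>A\<close>.  An integral algebraic element of \<open>G\<close> is tested on other objects \<open>C\<close>,
  whose residue fields are purely inseparable over \<open>k\<close>.  Such \<open>C\<close> are built inside an algebraic
  closure of \<open>K\<close>, by adjoining \<open>p\<close>-power roots of prescribed lifts of \<open>p\<close>-independent elements of \<open>k\<close>,
  enlarging the result until its residue ring is perfect, and completing.  Minimality of \<open>U\<close> shows that
  its residue ring is generated over \<open>k\<close>, up to \<open>p\<close>-power roots, by the Teichmueller digits of a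
  \<open>p\<close>-basis.  The choice of the lifts prescribes the images of these digits in \<open>C\<close>, so for each
  nonzero residue of \<open>U\<close> there is a map to some \<open>C\<close> that does not kill it.

  Clearing a denominator by such a map shows that the residue of an algebraic element \<open>x\<close> is purely
  inseparable over \<open>k\<close>.  If \<open>x ^ p\<close> had a residue \<open>t\<close> that is not a \<open>p\<close>-th power in \<open>k\<close>, then the
  second digit of a lift of \<open>t\<close> would be purely inseparable over \<open>k\<close> in \<open>U\<close>; but it takes different
  values in the objects \<open>C\<close> in which \<open>t\<close> and \<open>t + w\<close>, respectively, are \<open>p\<close>-th powers.  Hence
  residues of algebraic elements lie in \<open>k\<close>, and successive approximation puts these elements into \<open>A\<close>.\<close>

section \<open>Congruences modulo powers of an element\<close>

text \<open>Initiality is stated only for objects carried by the type of \<open>U\<close>, while the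
  test objects arise as completions of orders in an algebraic closure. They are copied into that
  type: as their residue fields are purely inseparable over k, Teichmueller digits inject them into
  the carrier of \<open>U\<close>, and an injection of sets is enough to transport the structure.
  Neither the characteristic of \<open>A\<close> nor the size of a p-basis of k is restricted:
  \<open>p\<close> may vanish or be highly ramified, so it enters only as an element of the ideal of
  \<open>w\<close>, and a given residue of \<open>U\<close> is first expressed by finitely many
  digits. The pair t, t + w comes from a computation modulo the square of \<open>w\<close>: if t + w
  a is a p-th power in C, the second digit of t has residue - a there, and the values 0 and 1 of a
  stay incompatible after any p-power. Residue rings are handled through the relation
  \<open>cg\<close>, which also records that both sides lie in the carrier; exponent 1 is equality
  of residues, higher exponents measure precision.\<close>

definition cg :: "('a, 'm) ring_scheme \<Rightarrow> 'a \<Rightarrow> nat \<Rightarrow> 'a \<Rightarrow> 'a \<Rightarrow> bool" where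
  "cg R w n x y \<longleftrightarrow> x \<in> carrier R \<and> y \<in> carrier R \<and>
     (\<exists>z\<in>carrier R. x = y \<oplus>\<^bsub>R\<^esub> (w [^]\<^bsub>R\<^esub> n) \<otimes>\<^bsub>R\<^esub> z)"

lemma cg_carrier: "cg R w n x y \<Longrightarrow> x \<in> carrier R" "cg R w n x y \<Longrightarrow> y \<in> carrier R"
  by (auto simp: cg_def)

context cring
begin

lemma add_cancel:
  assumes "x \<in> carrier R" "y \<in> carrier R" "z \<in> carrier R"
  shows "x \<oplus> (y \<oplus> \<ominus> x) = y" "\<ominus> x \<oplus> (y \<oplus> x) = y"
    "x \<oplus> (y \<oplus> (\<ominus> x \<oplus> z)) = y \<oplus> z" "\<ominus> x \<oplus> (y \<oplus> (x \<oplus> z)) = y \<oplus> z"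
proof -
  have "y \<oplus> \<ominus> x = \<ominus> x \<oplus> y" "y \<oplus> x = x \<oplus> y" "y \<oplus> (\<ominus> x \<oplus> z) = \<ominus> x \<oplus> (y \<oplus> z)" "y \<oplus> (x \<oplus> z) = x \<oplus> (y \<oplus> z)"
    using assms by (simp_all add: a_ac)
  then show "x \<oplus> (y \<oplus> \<ominus> x) = y" "\<ominus> x \<oplus> (y \<oplus> x) = y"
    "x \<oplus> (y \<oplus> (\<ominus> x \<oplus> z)) = y \<oplus> z" "\<ominus> x \<oplus> (y \<oplus> (x \<oplus> z)) = y \<oplus> z"
    using assms by (simp_all add: r_neg1 r_neg2)
qed

text \<open>Cancellation in sums sorted by \<open>a_ac\<close> works if at most one summand separates \<open>x\<close> from \<open>\<ominus> x\<close>.\<close>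

lemmas ring_nf = a_minus_def l_distr r_distr l_minus r_minus minus_add minus_minus a_ac m_ac
  r_neg l_neg r_neg1 r_neg2 add_cancel

lemma cgI:
  assumes "y \<in> carrier R" "w \<in> carrier R" "z \<in> carrier R" "x = y \<oplus> (w [^] n) \<otimes> z"
  shows "cg R w n x y"
  using assms by (auto simp: cg_def)

lemma cg_refl: "x \<in> carrier R \<Longrightarrow> w \<in> carrier R \<Longrightarrow> cg R w n x x"
  by (rule cgI[of _ _ \<zero>]) auto

lemma cg_sym:
  assumes "cg R w n x y" "w \<in> carrier R" shows "cg R w n y x"
proof -
  from assms obtain z where z[simp]: "z \<in> carrier R" "x = y \<oplus> (w [^] n) \<otimes> z" by (auto simp: cg_def)
  have [simp]: "x \<in> carrier R" "y \<in> carrier R" using assms by (auto simp: cg_def)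
  define q where "q = w [^] n"
  have q: "q \<in> carrier R" using assms by (simp add: q_def)
  have "y = (y \<oplus> q \<otimes> z) \<oplus> q \<otimes> (\<ominus> z)" by (use q \<open>y \<in> carrier R\<close> z(1) in \<open>simp add: ring_nf\<close>)
  then show ?thesis using assms z by (intro cgI[of _ _ "\<ominus> z"]) (auto simp: q_def)
qed

lemma cg_trans:
  assumes "cg R w n x y" "cg R w n y z" "w \<in> carrier R" shows "cg R w n x z"
proof -
  from assms obtain a b where ab: "a \<in> carrier R" "x = y \<oplus> (w [^] n) \<otimes> a"
     "b \<in> carrier R" "y = z \<oplus> (w [^] n) \<otimes> b" by (auto simp: cg_def)
  have z: "z \<in> carrier R" using assms by (auto simp: cg_def)
  define q where "q = w [^] n"
  have q: "q \<in> carrier R" using assms by (simp add: q_def)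
  have "(z \<oplus> q \<otimes> b) \<oplus> q \<otimes> a = z \<oplus> q \<otimes> (b \<oplus> a)" by (use q z ab(1,3) in \<open>simp add: ring_nf\<close>)
  then show ?thesis using assms z ab by (intro cgI[of _ _ "b \<oplus> a"]) (auto simp: q_def)
qed

lemma cg_add:
  assumes "cg R w n x y" "cg R w n x' y'" "w \<in> carrier R" shows "cg R w n (x \<oplus> x') (y \<oplus> y')"
proof -
  from assms obtain a b where ab: "a \<in> carrier R" "x = y \<oplus> (w [^] n) \<otimes> a"
     "b \<in> carrier R" "x' = y' \<oplus> (w [^] n) \<otimes> b" by (auto simp: cg_def)
  have z: "y \<in> carrier R" "y' \<in> carrier R" using assms by (auto simp: cg_def)
  define q where "q = w [^] n"
  have q: "q \<in> carrier R" using assms by (simp add: q_def)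
  have "(y \<oplus> q \<otimes> a) \<oplus> (y' \<oplus> q \<otimes> b) = (y \<oplus> y') \<oplus> q \<otimes> (a \<oplus> b)" by (use q z ab(1,3) in \<open>simp add: ring_nf\<close>)
  then show ?thesis using assms z ab by (intro cgI[of _ _ "a \<oplus> b"]) (auto simp: q_def)
qed

lemma cg_mult:
  assumes "cg R w n x y" "cg R w n x' y'" "w \<in> carrier R" shows "cg R w n (x \<otimes> x') (y \<otimes> y')"
proof -
  from assms obtain a b where ab: "a \<in> carrier R" "x = y \<oplus> (w [^] n) \<otimes> a"
     "b \<in> carrier R" "x' = y' \<oplus> (w [^] n) \<otimes> b" by (auto simp: cg_def)
  have z: "y \<in> carrier R" "y' \<in> carrier R" using assms by (auto simp: cg_def)
  define q where "q = w [^] n"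
  have q: "q \<in> carrier R" using assms by (simp add: q_def)
  have "(y \<oplus> q \<otimes> a) \<otimes> (y' \<oplus> q \<otimes> b) = (y \<otimes> y') \<oplus> q \<otimes> (a \<otimes> y' \<oplus> y \<otimes> b \<oplus> q \<otimes> a \<otimes> b)" by (use q z ab(1,3) in \<open>simp add: ring_nf\<close>)
  then show ?thesis using assms z ab q
    by (intro cgI[of _ _ "a \<otimes> y' \<oplus> y \<otimes> b \<oplus> q \<otimes> a \<otimes> b"]) (auto simp: q_def)
qed

lemma cg_neg:
  assumes "cg R w n x y" "w \<in> carrier R" shows "cg R w n (\<ominus> x) (\<ominus> y)"
proof -
  from assms obtain a where ab: "a \<in> carrier R" "x = y \<oplus> (w [^] n) \<otimes> a" by (auto simp: cg_def)
  have z: "y \<in> carrier R" using assms by (auto simp: cg_def)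
  define q where "q = w [^] n"
  have q: "q \<in> carrier R" using assms by (simp add: q_def)
  have "\<ominus> (y \<oplus> q \<otimes> a) = (\<ominus> y) \<oplus> q \<otimes> (\<ominus> a)" by (use q z ab(1) in \<open>simp add: ring_nf\<close>)
  then show ?thesis using assms z ab by (intro cgI[of _ _ "\<ominus> a"]) (auto simp: q_def)
qed

lemma cg_minus:
  assumes "cg R w n x y" "cg R w n x' y'" "w \<in> carrier R" shows "cg R w n (x \<ominus> x') (y \<ominus> y')"
  unfolding a_minus_def using assms by (intro cg_add cg_neg)

lemma cg_pow:
  assumes "cg R w n x y" "w \<in> carrier R" shows "cg R w n (x [^] (k::nat)) (y [^] k)"
  using assms by (induction k) (auto intro!: cg_mult cg_refl)

lemma cg_mono:
  assumes "cg R w n x y" "m \<le> n" "w \<in> carrier R" shows "cg R w m x y"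
proof -
  from assms obtain a where ab: "a \<in> carrier R" "x = y \<oplus> (w [^] n) \<otimes> a" by (auto simp: cg_def)
  have z: "y \<in> carrier R" using assms by (auto simp: cg_def)
  have "w [^] n = w [^] m \<otimes> w [^] (n - m)" using assms by (simp add: nat_pow_mult)
  then have "x = y \<oplus> (w [^] m) \<otimes> (w [^] (n - m) \<otimes> a)" using ab assms by (simp add: m_assoc)
  then show ?thesis using assms z ab by (intro cgI[of _ _ "w [^] (n - m) \<otimes> a"]) auto
qed

lemma cg_0: "x \<in> carrier R \<Longrightarrow> y \<in> carrier R \<Longrightarrow> w \<in> carrier R \<Longrightarrow> cg R w 0 x y"
  proof (rule cgI[of _ _ "x \<ominus> y"])
  assume a: "x \<in> carrier R" "y \<in> carrier R" "w \<in> carrier R"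
  have "x = y \<oplus> (x \<ominus> y)" by (use a in \<open>simp add: ring_nf\<close>)
  then show "x = y \<oplus> w [^] (0::nat) \<otimes> (x \<ominus> y)" using a by simp
qed auto

lemma cg_multiple: "z \<in> carrier R \<Longrightarrow> w \<in> carrier R \<Longrightarrow> cg R w n ((w [^] n) \<otimes> z) \<zero>"
  by (rule cgI) auto

lemma cg_zeroE:
  assumes "cg R w n x \<zero>" "w \<in> carrier R"
  obtains z where "z \<in> carrier R" "x = (w [^] n) \<otimes> z"
  using assms by (auto simp: cg_def)

lemma cg_diff_iff:
  assumes "x \<in> carrier R" "y \<in> carrier R" "w \<in> carrier R"
  shows "cg R w n (x \<ominus> y) \<zero> \<longleftrightarrow> cg R w n x y"
proof
  assume "cg R w n (x \<ominus> y) \<zero>"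
  then have "cg R w n (x \<ominus> y \<oplus> y) (\<zero> \<oplus> y)" using assms by (intro cg_add cg_refl)
  moreover have "x \<ominus> y \<oplus> y = x" by (use assms(1,2) in \<open>simp add: ring_nf\<close>)
  ultimately show "cg R w n x y" using assms by simp
next
  assume "cg R w n x y"
  then have "cg R w n (x \<ominus> y) (y \<ominus> y)" using assms by (intro cg_minus cg_refl)
  moreover have "y \<ominus> y = \<zero>" by (use assms(2) in \<open>simp add: ring_nf\<close>)
  ultimately show "cg R w n (x \<ominus> y) \<zero>" by simp
qed

lemma cg_mult_pow:
  assumes "cg R w n x y" "w \<in> carrier R"
  shows "cg R w (m + n) (w [^] m \<otimes> x) (w [^] m \<otimes> y)"
proof -
  from assms obtain a where ab: "a \<in> carrier R" "x = y \<oplus> (w [^] n) \<otimes> a" by (auto simp: cg_def)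
  have z: "y \<in> carrier R" using assms by (auto simp: cg_def)
  define q r where "q = w [^] n" "r = w [^] m"
  have q: "q \<in> carrier R" "r \<in> carrier R" using assms by (auto simp: q_r_def)
  have "r \<otimes> (y \<oplus> q \<otimes> a) = r \<otimes> y \<oplus> (r \<otimes> q) \<otimes> a" by (use q z ab(1) in \<open>simp add: ring_nf\<close>)
  then show ?thesis using assms ab z
    by (intro cgI[of _ _ a]) (auto simp: q_r_def nat_pow_mult)
qed

lemma cg_shift_zero:
  assumes "cg R w n x \<zero>" "y \<in> carrier R" "w \<in> carrier R" shows "cg R w n (x \<otimes> y) \<zero>" "cg R w n (y \<otimes> x) \<zero>"
proof -
  show 1: "cg R w n (x \<otimes> y) \<zero>"
    using cg_mult[OF assms(1) cg_refl[OF assms(2,3)] assms(3)] assms by simp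
  show "cg R w n (y \<otimes> x) \<zero>" using 1 assms cg_carrier[OF assms(1)] by (simp add: m_comm)
qed

end

lemma cg_hom:
  assumes "cg R w n x y" "h \<in> ring_hom R S" "cring R" "cring S" "w \<in> carrier R"
  shows "cg S (h w) n (h x) (h y)"
proof -
  interpret R: cring R by fact
  interpret S: cring S by fact
  interpret h: ring_hom_cring R S h using assms by (intro ring_hom_cringI) auto
  from assms obtain a where ab: "a \<in> carrier R" "x = y \<oplus>\<^bsub>R\<^esub> (w [^]\<^bsub>R\<^esub> n) \<otimes>\<^bsub>R\<^esub> a" by (auto simp: cg_def)
  have z: "y \<in> carrier R" using assms by (auto simp: cg_def)
  have hom_pow': "h (w [^]\<^bsub>R\<^esub> k) = h w [^]\<^bsub>S\<^esub> k" for k :: nat using assms(5) by (induction k) auto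
  show ?thesis using ab z assms
    by (intro S.cgI[of _ _ "h a"]) (auto simp: hom_pow')
qed

section \<open>Teichmueller expansions\<close>

text \<open>Plays two roles: a partial sum of a \<open>w\<close>-adic expansion with digits
  \<open>d\<close>, and the value at \<open>w\<close> of the polynomial whose coefficients, in
  increasing degree, are the first n values of \<open>d\<close>. Binomial expansions, simple
  extensions and algebraic relations use the second one.\<close>

primrec psum :: "('a, 'm) ring_scheme \<Rightarrow> 'a \<Rightarrow> (nat \<Rightarrow> 'a) \<Rightarrow> nat \<Rightarrow> 'a" where
  "psum R w d 0 = \<zero>\<^bsub>R\<^esub>"
| "psum R w d (Suc n) = psum R w d n \<oplus>\<^bsub>R\<^esub> (w [^]\<^bsub>R\<^esub> n) \<otimes>\<^bsub>R\<^esub> d n"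

context cring
begin

lemma psum_closed [simp, intro]:
  assumes "w \<in> carrier R" "\<And>j. j < n \<Longrightarrow> d j \<in> carrier R"
  shows "psum R w d n \<in> carrier R"
  using assms(2) by (induction n) (auto simp: assms(1))

lemma psum_shift:
  assumes "w \<in> carrier R" "\<And>j. j \<le> n \<Longrightarrow> d j \<in> carrier R"
  shows "psum R w d (Suc n) = d 0 \<oplus> w \<otimes> psum R w (d \<circ> Suc) n"
  using assms(2)
proof (induction n)
  case 0
  then show ?case using assms(1) by simp
next
  case (Suc n)
  define a b e q where "a = d 0" and "b = psum R w (d \<circ> Suc) n" and "e = d (Suc n)" and "q = w [^] n"
  have c: "w \<in> carrier R" "a \<in> carrier R" "b \<in> carrier R" "e \<in> carrier R" "q \<in> carrier R"
    using assms(1) Suc.prems by (auto simp: a_def b_def e_def q_def)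
  have "(a \<oplus> w \<otimes> b) \<oplus> (q \<otimes> w) \<otimes> e = a \<oplus> w \<otimes> (b \<oplus> q \<otimes> e)"
    by (use c in \<open>simp add: ring_nf\<close>)
  then show ?case using Suc by (simp add: a_def b_def e_def q_def comp_def)
qed

lemma psum_cong: "(\<And>j. j < n \<Longrightarrow> d j = e j) \<Longrightarrow> psum R x d n = psum R x e n"
  by (induction n) auto

lemma psum_add:
  assumes "x \<in> carrier R" "\<And>i. c i \<in> carrier R" "\<And>i. d i \<in> carrier R"
  shows "psum R x c n \<oplus> psum R x d n = psum R x (\<lambda>i. c i \<oplus> d i) n"
proof (induction n)
  case (Suc n)
  define q a b u v where "q = x [^] n" and "a = psum R x c n" and "b = psum R x d n" and "u = c n" and "v = d n"
  have k: "q \<in> carrier R" "a \<in> carrier R" "b \<in> carrier R" "u \<in> carrier R" "v \<in> carrier R"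
    using assms by (auto simp: q_def a_def b_def u_def v_def)
  have "(a \<oplus> q \<otimes> u) \<oplus> (b \<oplus> q \<otimes> v) = (a \<oplus> b) \<oplus> q \<otimes> (u \<oplus> v)"
    by (use k in \<open>simp add: ring_nf\<close>)
  then show ?case using Suc by (simp add: q_def a_def b_def u_def v_def)
qed simp

lemma psum_smult:
  assumes "x \<in> carrier R" "\<And>i. i < n \<Longrightarrow> c i \<in> carrier R" "e \<in> carrier R"
  shows "e \<otimes> psum R x c n = psum R x (\<lambda>i. e \<otimes> c i) n"
  using assms(2)
proof (induction n)
  case (Suc n)
  then have "c n \<in> carrier R" "psum R x c n \<in> carrier R" using assms(1) by auto
  then show ?case using Suc assms(1,3) by (simp add: r_distr m_lcomm)
qed (use assms in simp)

text \<open>Induction on the exponent: the factor \<open>x\<close> shifts the coefficients by one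
  place, the factor \<open>y\<close> leaves them in place, and Pascal's rule adds the two
  contributions (\<open>step\<close>).\<close>

lemma binomial_psum:
  assumes x: "x \<in> carrier R" and y: "y \<in> carrier R"
  shows "(x \<oplus> y) [^] (n::nat) = psum R x (\<lambda>k. [(n choose k)] \<cdot> (y [^] (n - k))) (Suc n)"
proof (induction n)
  case 0
  then show ?case using x y by simp
next
  case (Suc n)
  define c where "c = (\<lambda>n k. [(n choose k)] \<cdot> (y [^] (n - k :: nat)))"
  have cc: "c m k \<in> carrier R" for m k using y by (simp add: c_def)
  define S T where "S = psum R x (c n) (Suc n)" and "T = psum R x (c n \<circ> Suc) (Suc n)"
  have ST: "S \<in> carrier R" "T \<in> carrier R" "y [^] n \<in> carrier R" using x y cc by (auto simp: S_def T_def simp del: psum.simps)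
  have "c n (Suc n) = \<zero>" using y by (simp add: c_def binomial_eq_0)
  then have "S = psum R x (c n) (Suc (Suc n))" using x cc by (simp add: S_def)
  also have "\<dots> = c n 0 \<oplus> x \<otimes> T" unfolding T_def by (rule psum_shift[OF x cc])
  finally have S: "S = y [^] n \<oplus> x \<otimes> T" using y by (simp add: c_def)
  have step: "(c (Suc n) \<circ> Suc) k = c n k \<oplus> y \<otimes> (c n \<circ> Suc) k" for k
  proof (cases "k < n")
    case True
    then have "y [^] (n - k) = y \<otimes> y [^] (n - Suc k)" using y by (metis Suc_diff_Suc nat_pow_Suc2)
    then have "[(n choose Suc k)] \<cdot> (y [^] (n - k)) = y \<otimes> [(n choose Suc k)] \<cdot> (y [^] (n - Suc k))"
      using y by (simp add: add_pow_rdistr)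
    then show ?thesis using y by (simp add: c_def add.nat_pow_mult[symmetric])
  qed (use y in \<open>simp add: c_def binomial_eq_0\<close>)
  have "psum R x (c (Suc n)) (Suc (Suc n)) = c (Suc n) 0 \<oplus> x \<otimes> psum R x (c (Suc n) \<circ> Suc) (Suc n)"
    by (rule psum_shift[OF x cc])
  also have "psum R x (c (Suc n) \<circ> Suc) (Suc n) = psum R x (\<lambda>k. c n k \<oplus> y \<otimes> (c n \<circ> Suc) k) (Suc n)"
    by (rule psum_cong) (rule step)
  also have "\<dots> = S \<oplus> psum R x (\<lambda>k. y \<otimes> (c n \<circ> Suc) k) (Suc n)"
    unfolding S_def by (rule psum_add[symmetric]) (use x y cc in auto)
  also have "psum R x (\<lambda>k. y \<otimes> (c n \<circ> Suc) k) (Suc n) = y \<otimes> T"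
    unfolding T_def by (rule psum_smult[symmetric]) (use x y cc in auto)
  also have "c (Suc n) 0 = y \<otimes> y [^] n" using nat_pow_Suc2[OF y, of n] y by (simp add: c_def del: nat_pow_Suc)
  also have "y \<otimes> y [^] n \<oplus> x \<otimes> (S \<oplus> y \<otimes> T) = S \<otimes> x \<oplus> y \<otimes> (y [^] n \<oplus> x \<otimes> T)"
  proof -
    define z where "z = y [^] n"
    have z: "z \<in> carrier R" using y by (simp add: z_def)
    show ?thesis unfolding z_def[symmetric] by (use z x y ST in \<open>simp add: ring_nf\<close>)
  qed
  also have "\<dots> = S \<otimes> (x \<oplus> y)" unfolding S[symmetric] using x y ST by (simp add: r_distr m_comm)
  finally show ?case using Suc by (simp add: S_def c_def del: psum.simps)
qed

text \<open>The inner binomial coefficients are divisible by \<open>p\<close>. The error stays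
  visible as a multiple of \<open>p\<close>, so that one formula serves in characteristic
  \<open>p\<close>, modulo \<open>w\<close>, and modulo \<open>p\<close> itself.\<close>

lemma add_power_prime:
  assumes x: "x \<in> carrier R" and y: "y \<in> carrier R" and p: "Factorial_Ring.prime (p::nat)"
  obtains q where "q \<in> carrier R" "(x \<oplus> y) [^] p = x [^] p \<oplus> y [^] p \<oplus> [p] \<cdot> q"
proof -
  obtain m where m: "p = Suc m" using prime_gt_0_nat[OF p] by (cases p) auto
  \<comment> \<open>\<open>c\<close> lists the coefficients of \<open>binomial_psum\<close>;
    \<open>e\<close> lists those of index 1 to p - 1 with the factor \<open>p\<close> taken out, so
    that x times the polynomial \<open>e\<close> accounts for the cross terms.\<close>
  define c e where "c = (\<lambda>k. [(p choose k)] \<cdot> (y [^] (p - k)))" and "e = (\<lambda>k. [((p choose Suc k) div p)] \<cdot> (y [^] (p - Suc k)))"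
  have cc: "c k \<in> carrier R" "e k \<in> carrier R" for k using y by (auto simp: c_def e_def)
  define P q where "P = [p] \<cdot> \<one>" and "q = x \<otimes> psum R x e m"
  have P: "P \<in> carrier R" "P \<otimes> z = [p] \<cdot> z" if "z \<in> carrier R" for z
    using that add_pow_ldistr[OF one_closed that, of p] by (simp_all add: P_def)
  have qc: "q \<in> carrier R" using x cc by (simp add: q_def)
  have ce: "(c \<circ> Suc) k = P \<otimes> e k" if "k < m" for k
  proof -
    have "p dvd (p choose Suc k)" using that m p by (intro dvd_choose_prime) auto
    then have d: "((p choose Suc k) div p) * p = p choose Suc k" by simp
    have "c (Suc k) = [p] \<cdot> e k" using add.nat_pow_pow[of "y [^] (p - Suc k)" p "(p choose Suc k) div p"] y by (simp add: c_def e_def d)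
    then show ?thesis using P(2)[OF cc(2)] by simp
  qed
  have "psum R x (c \<circ> Suc) m = P \<otimes> psum R x e m"
    using psum_smult[where c = e and n = m, OF x cc(2) P(1)[OF x]]
      psum_cong[where d = "c \<circ> Suc" and n = m, OF ce] by simp
  then have "psum R x c p = y [^] p \<oplus> x \<otimes> (P \<otimes> psum R x e m)"
    using psum_shift[where d = c and n = m, OF x cc(1)] y by (simp add: m c_def del: psum.simps)
  also have "x \<otimes> (P \<otimes> psum R x e m) = [p] \<cdot> q"
    using x cc P(1)[OF x] P(2)[OF qc] by (simp add: q_def m_lcomm)
  finally have "psum R x c (Suc p) = y [^] p \<oplus> [p] \<cdot> q \<oplus> x [^] p" using x by (simp add: c_def)
  then have "(x \<oplus> y) [^] p = x [^] p \<oplus> y [^] p \<oplus> [p] \<cdot> q"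
    using binomial_psum[OF x y, of p] x y qc by (simp add: c_def a_ac)
  then show thesis using that qc by blast
qed

end

lemma ring_hom_pow:
  assumes "h \<in> ring_hom R S" "cring R" "cring S" "x \<in> carrier R"
  shows "h (x [^]\<^bsub>R\<^esub> (n::nat)) = h x [^]\<^bsub>S\<^esub> n"
  using assms ring_hom_ring.hom_nat_pow[of R S h x n] ring_hom_ringI2[of R S h] cring.axioms(1) by metis

lemma psum_hom:
  assumes "h \<in> ring_hom R S" "cring R" "cring S" "w \<in> carrier R" "\<And>j. j < n \<Longrightarrow> d j \<in> carrier R"
  shows "h (psum R w d n) = psum S (h w) (h \<circ> d) n"
proof -
  interpret R: cring R by fact
  interpret S: cring S by fact
  interpret h: ring_hom_cring R S h using assms by (intro ring_hom_cringI) auto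
  show ?thesis using assms(5)
    by (induction n) (auto simp: assms ring_hom_pow[OF assms(1-3)])
qed

section \<open>The Frobenius modulo \<open>w\<close> and its lift to higher precision, for
  \<open>p\<close> in the ideal of \<open>w\<close>\<close>

locale unif = cring R for R (structure) + fixes w :: 'a and p :: nat
  assumes w_closed [simp, intro]: "w \<in> carrier R"
    and p_prime: "Factorial_Ring.prime p"
    and p_w: "cg R w 1 ([p] \<cdot> \<one>) \<zero>"
begin

lemma cgt [trans]: "cg R w n x y \<Longrightarrow> cg R w n y z \<Longrightarrow> cg R w n x z"
  using cg_trans by blast

lemma cgs: "cg R w n x y \<Longrightarrow> cg R w n y x"
  using cg_sym by blast

lemma p_gt_1: "p > 1" using p_prime prime_gt_1_nat by blast

lemma p_mult: assumes "z \<in> carrier R" shows "cg R w 1 ([p] \<cdot> z) \<zero>"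
proof -
  have "[p] \<cdot> z = ([p] \<cdot> \<one>) \<otimes> z" using assms by (simp add: add_pow_ldistr)
  then show ?thesis using cg_shift_zero(1)[OF p_w assms] by simp
qed

lemma frob_add:
  assumes "x \<in> carrier R" "y \<in> carrier R"
  shows "cg R w 1 ((x \<oplus> y) [^] p) (x [^] p \<oplus> y [^] p)"
proof -
  obtain q where q: "q \<in> carrier R" "(x \<oplus> y) [^] p = x [^] p \<oplus> y [^] p \<oplus> [p] \<cdot> q"
    using add_power_prime[OF assms p_prime] by blast
  have "cg R w 1 ((x [^] p \<oplus> y [^] p) \<oplus> [p] \<cdot> q) ((x [^] p \<oplus> y [^] p) \<oplus> \<zero>)"
    using assms q by (intro cg_add cg_refl p_mult) auto
  then show ?thesis using q assms by simp
qed

lemma frob_add_n: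
  assumes "x \<in> carrier R" "y \<in> carrier R"
  shows "cg R w 1 ((x \<oplus> y) [^] (p ^ n)) (x [^] (p ^ n) \<oplus> y [^] (p ^ n))"
proof (induction n)
  case 0
  then show ?case using assms by (simp add: cg_refl)
next
  case (Suc n)
  have *: "z [^] (p ^ Suc n) = (z [^] (p ^ n)) [^] p" if "z \<in> carrier R" for z
    using that by (simp add: nat_pow_pow mult.commute)
  have "cg R w 1 (((x \<oplus> y) [^] (p ^ n)) [^] p) ((x [^] (p ^ n) \<oplus> y [^] (p ^ n)) [^] p)"
    using Suc by (rule cg_pow) auto
  moreover have "cg R w 1 ((x [^] (p ^ n) \<oplus> y [^] (p ^ n)) [^] p) ((x [^] (p ^ n)) [^] p \<oplus> (y [^] (p ^ n)) [^] p)"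
    using assms by (intro frob_add) auto
  ultimately show ?case unfolding *[OF assms(1)] *[OF assms(2)] *[OF a_closed[OF assms]] by (rule cgt)
qed

text \<open>Obtained from additivity applied to \<ominus> x \<oplus> x, which treats odd and even
  \<open>p\<close> alike.\<close>

lemma frob_neg_n:
  assumes "x \<in> carrier R"
  shows "cg R w 1 ((\<ominus> x) [^] (p ^ n)) (\<ominus> (x [^] (p ^ n)))"
proof -
  have "cg R w 1 ((\<ominus> x \<oplus> x) [^] (p ^ n)) ((\<ominus> x) [^] (p ^ n) \<oplus> x [^] (p ^ n))"
    using assms by (intro frob_add_n) auto
  moreover have "(\<ominus> x \<oplus> x) [^] (p ^ n) = \<zero>"
    using assms p_gt_1 by (simp add: l_neg nat_pow_zero)
  ultimately have "cg R w 1 (\<zero> \<oplus> \<ominus> (x [^] (p ^ n))) ((\<ominus> x) [^] (p ^ n) \<oplus> x [^] (p ^ n) \<oplus> \<ominus> (x [^] (p ^ n)))"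
    using assms by (intro cg_add cg_refl) auto
  moreover have "(\<ominus> x) [^] (p ^ n) \<oplus> x [^] (p ^ n) \<oplus> \<ominus> (x [^] (p ^ n)) = (\<ominus> x) [^] (p ^ n)"
    using assms by (simp add: a_assoc r_neg)
  ultimately have "cg R w 1 (\<ominus> (x [^] (p ^ n))) ((\<ominus> x) [^] (p ^ n))" using assms by simp
  then show ?thesis by (rule cgs)
qed

lemma frob_minus_n:
  assumes "x \<in> carrier R" "y \<in> carrier R"
  shows "cg R w 1 ((x \<ominus> y) [^] (p ^ n)) (x [^] (p ^ n) \<ominus> y [^] (p ^ n))"
proof -
  have "cg R w 1 ((x \<oplus> \<ominus> y) [^] (p ^ n)) (x [^] (p ^ n) \<oplus> (\<ominus> y) [^] (p ^ n))"
    using assms by (intro frob_add_n) auto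
  moreover have "cg R w 1 (x [^] (p ^ n) \<oplus> (\<ominus> y) [^] (p ^ n)) (x [^] (p ^ n) \<oplus> \<ominus> (y [^] (p ^ n)))"
    using assms by (intro cg_add frob_neg_n cg_refl) auto
  ultimately show ?thesis unfolding a_minus_def by (rule cgt)
qed

text \<open>Taylor expansion to first order, with a multiple of the square of \<open>v\<close> as
  remainder. The linear coefficient is an integer multiple, which becomes divisible by
  \<open>w\<close> when the exponent is \<open>p\<close>.\<close>

lemma power_expand:
  assumes "y \<in> carrier R" "v \<in> carrier R"
  shows "\<exists>q\<in>carrier R. (y \<oplus> v) [^] (Suc m) = y [^] (Suc m) \<oplus> [Suc m] \<cdot> (y [^] m \<otimes> v) \<oplus> v \<otimes> v \<otimes> q"
proof (induction m)
  case 0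
  then show ?case using assms by (intro bexI[of _ \<zero>]) auto
next
  case (Suc m)
  then obtain q where q: "q \<in> carrier R"
    "(y \<oplus> v) [^] (Suc m) = y [^] (Suc m) \<oplus> [Suc m] \<cdot> (y [^] m \<otimes> v) \<oplus> v \<otimes> v \<otimes> q" by blast
  define a k where "a = y [^] m" and "k = [Suc m] \<cdot> \<one>"
  have c: "a \<in> carrier R" "k \<in> carrier R" using assms by (auto simp: a_def k_def)
  have e: "[Suc m] \<cdot> z = k \<otimes> z" if "z \<in> carrier R" for z
    using that by (simp add: k_def add_pow_ldistr del: add.nat_pow_Suc)
  have e1: "[Suc (Suc m)] \<cdot> z = k \<otimes> z \<oplus> z" if "z \<in> carrier R" for z
    using e[OF that] by (simp)
  have "(y \<oplus> v) [^] (Suc (Suc m)) = (a \<otimes> y \<oplus> k \<otimes> (a \<otimes> v) \<oplus> v \<otimes> v \<otimes> q) \<otimes> (y \<oplus> v)"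
    using q c assms e[of "a \<otimes> v"] unfolding nat_pow_Suc[of _ "Suc m"] by (simp add: a_def)
  also have "\<dots> = a \<otimes> y \<otimes> y \<oplus> (k \<otimes> (a \<otimes> y \<otimes> v) \<oplus> a \<otimes> y \<otimes> v) \<oplus> v \<otimes> v \<otimes> (k \<otimes> a \<oplus> q \<otimes> y \<oplus> q \<otimes> v)"
    by (use q c assms in \<open>simp add: ring_nf\<close>)
  also have "\<dots> = y [^] (Suc (Suc m)) \<oplus> [Suc (Suc m)] \<cdot> (y [^] (Suc m) \<otimes> v) \<oplus> v \<otimes> v \<otimes> (k \<otimes> a \<oplus> q \<otimes> y \<oplus> q \<otimes> v)"
    using e1[of "a \<otimes> y \<otimes> v"] c assms by (simp add: a_def)
  finally show ?case using q c assms by blast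
qed

text \<open>Write x = y + w^n z. In \<open>power_expand\<close> the linear term gains a factor
  \<open>w\<close> from \<open>p\<close>, and the remainder is divisible by w^(2n); n \<ge> 1 gives
  2n \<ge> n + 1.\<close>

lemma frob_lift:
  assumes "cg R w n x y" "n \<ge> 1"
  shows "cg R w (Suc n) (x [^] p) (y [^] p)"
proof -
  from assms obtain z where z: "z \<in> carrier R" "x = y \<oplus> (w [^] n) \<otimes> z" by (auto simp: cg_def)
  have y: "y \<in> carrier R" using assms by (auto simp: cg_def)
  obtain m where m: "p = Suc m" using p_gt_1 by (cases p) auto
  define v where "v = (w [^] n) \<otimes> z"
  have v: "v \<in> carrier R" using z by (simp add: v_def)
  obtain q where q: "q \<in> carrier R" "(y \<oplus> v) [^] p = y [^] p \<oplus> [p] \<cdot> (y [^] m \<otimes> v) \<oplus> v \<otimes> v \<otimes> q"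
    using power_expand[OF y v, of m] unfolding m by blast
  have 1: "cg R w (Suc n) ([p] \<cdot> (y [^] m \<otimes> v)) \<zero>"
  proof -
    have "y [^] m \<otimes> v = w [^] n \<otimes> (y [^] m \<otimes> z)" using y z by (simp add: v_def m_lcomm)
    then have "[p] \<cdot> (y [^] m \<otimes> v) = w [^] n \<otimes> ([p] \<cdot> (y [^] m \<otimes> z))"
      using y z by (simp add: add_pow_rdistr)
    moreover have "cg R w (n + 1) (w [^] n \<otimes> ([p] \<cdot> (y [^] m \<otimes> z))) (w [^] n \<otimes> \<zero>)"
      using y z by (intro cg_mult_pow p_mult) auto
    ultimately show ?thesis by simp
  qed
  have 2: "cg R w (Suc n) (v \<otimes> v \<otimes> q) \<zero>"
  proof -
    have "cg R w (n + n) (w [^] n \<otimes> (w [^] n \<otimes> (z \<otimes> z \<otimes> q))) (w [^] n \<otimes> \<zero>)"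
      using z q by (intro cg_mult_pow cg_multiple) auto
    moreover have "v \<otimes> v \<otimes> q = w [^] n \<otimes> (w [^] n \<otimes> (z \<otimes> z \<otimes> q))"
    proof -
      define r where "r = w [^] n"
      have r: "r \<in> carrier R" by (simp add: r_def)
      have "r \<otimes> z \<otimes> (r \<otimes> z) \<otimes> q = r \<otimes> (r \<otimes> (z \<otimes> z \<otimes> q))"
        by (use r z q in \<open>simp add: ring_nf\<close>)
      then show ?thesis by (simp add: v_def r_def)
    qed
    ultimately show ?thesis using assms(2) by (auto intro: cg_mono)
  qed
  have "cg R w (Suc n) (y [^] p \<oplus> [p] \<cdot> (y [^] m \<otimes> v) \<oplus> v \<otimes> v \<otimes> q) (y [^] p \<oplus> \<zero> \<oplus> \<zero>)"
    using 1 2 y by (intro cg_add cg_refl) auto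
  then show ?thesis using y q z by (simp add: v_def)
qed

lemma frob_lift_n:
  assumes "cg R w m x y" "m \<ge> 1"
  shows "cg R w (m + n) (x [^] (p ^ n)) (y [^] (p ^ n))"
proof (induction n)
  case 0
  then show ?case using assms by (auto simp: cg_def)
next
  case (Suc n)
  have "x \<in> carrier R" "y \<in> carrier R" using assms by (auto simp: cg_def)
  then have *: "z [^] (p ^ Suc n) = (z [^] (p ^ n)) [^] p" if "z \<in> {x, y}" for z
    using that by (auto simp add: nat_pow_pow mult.commute)
  show ?case using frob_lift[OF Suc] assms * by simp
qed

end

locale nunif = unif +
  assumes nzd: "x \<in> carrier R \<Longrightarrow> w \<otimes> x = \<zero> \<Longrightarrow> x = \<zero>"
begin

lemma cancel_w:
  assumes "x \<in> carrier R" "y \<in> carrier R" "w \<otimes> x = w \<otimes> y"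
  shows "x = y"
proof -
  have c: "w \<in> carrier R" by simp
  have "w \<otimes> (x \<ominus> y) = w \<otimes> x \<ominus> w \<otimes> y"
    by (use assms in \<open>simp add: ring_nf\<close>)
  then have "w \<otimes> (x \<ominus> y) = \<zero>" using assms by simp
  then show ?thesis using nzd[of "x \<ominus> y"] assms by simp
qed

lemma cancel_w_pow:
  assumes "x \<in> carrier R" "y \<in> carrier R" "w [^] (n::nat) \<otimes> x = w [^] n \<otimes> y"
  shows "x = y"
  using assms(3)
proof (induction n)
  case (Suc n)
  have "w \<otimes> (w [^] n \<otimes> x) = w \<otimes> (w [^] n \<otimes> y)"
    using Suc.prems assms(1,2) unfolding nat_pow_Suc2[OF w_closed] by (simp add: m_assoc)
  then have "w [^] n \<otimes> x = w [^] n \<otimes> y" by (rule cancel_w[rotated 2]) (use assms in auto)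
  then show ?case by (rule Suc.IH)
qed (use assms in simp)

lemma cg_cancel:
  assumes "cg R w (m + n) (w [^] m \<otimes> x) (w [^] m \<otimes> y)" "x \<in> carrier R" "y \<in> carrier R"
  shows "cg R w n x y"
proof -
  from assms obtain z where z: "z \<in> carrier R" "w [^] m \<otimes> x = w [^] m \<otimes> y \<oplus> w [^] (m + n) \<otimes> z"
    by (auto simp: cg_def)
  have "w [^] m \<otimes> x = w [^] m \<otimes> (y \<oplus> w [^] n \<otimes> z)"
    using z assms by (simp add: nat_pow_mult[symmetric] r_distr m_assoc)
  then have "x = y \<oplus> w [^] n \<otimes> z" by (rule cancel_w_pow[rotated 2]) (use z assms in auto)
  then show ?thesis by (rule cgI[rotated 3]) (use z assms in auto)
qed

lemma cg_cancel1:
  assumes "cg R w (Suc n) (w \<otimes> x) (w \<otimes> y)" "x \<in> carrier R" "y \<in> carrier R"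
  shows "cg R w n x y"
  using cg_cancel[of 1 n x y] assms by simp

end

locale cunif = nunif +
  assumes complete: "(\<And>n. cg R w n (f (Suc n)) (f n)) \<Longrightarrow> \<exists>y. \<forall>n. cg R w n y (f n)"
    and sep: "(\<And>n. cg R w n x \<zero>) \<Longrightarrow> x = \<zero>"
begin

lemma eq_if_cg_all:
  assumes "\<And>n. cg R w n x y" shows "x = y"
proof -
  have xy: "x \<in> carrier R" "y \<in> carrier R" using assms[of 0] by (auto simp: cg_def)
  then have "x \<ominus> y = \<zero>" using assms by (intro sep) (simp add: cg_diff_iff)
  then show ?thesis using xy by simp
qed

lemma psum_limit:
  assumes "\<And>n. d n \<in> carrier R" shows "\<exists>y. \<forall>n. cg R w n y (psum R w d n)"
  proof (rule complete)
  fix n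
  show "cg R w n (psum R w d (Suc n)) (psum R w d n)"
    by (rule cgI[of _ _ "d n"]) (use assms in auto)
qed

text \<open>Geometric series: for x = 1 + w z the inverse is the sum of the terms (- z)^n w^n, whose
  partial sums telescope when multiplied by \<open>x\<close>.\<close>

lemma one_plus_inverse:
  assumes "cg R w 1 x \<one>" shows "\<exists>y\<in>carrier R. x \<otimes> y = \<one>"
proof -
  obtain z where z: "z \<in> carrier R" "x = \<one> \<oplus> w \<otimes> z" using assms by (auto simp: cg_def)
  define d where "d = (\<lambda>n::nat. (\<ominus> z) [^] n)"
  obtain y where y: "\<And>n. cg R w n y (psum R w d n)"
    using psum_limit[of d] z by (auto simp: d_def)
  have yc: "y \<in> carrier R" using y[of 0] by (auto simp: cg_def)
  have dc: "d n \<in> carrier R" for n using z by (simp add: d_def)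
  have *: "x \<otimes> psum R w d n = \<one> \<ominus> w [^] n \<otimes> d n" for n
  proof (induction n)
    case 0
    then show ?case using z by (simp add: d_def r_neg a_minus_def)
  next
    case (Suc n)
    define q a e where "q = w [^] n" and "a = psum R w d n" and "e = d n"
    have c: "q \<in> carrier R" "a \<in> carrier R" "e \<in> carrier R" "w \<in> carrier R"
      using dc by (auto simp: q_def a_def e_def)
    have "x \<otimes> (a \<oplus> q \<otimes> e) = x \<otimes> a \<oplus> x \<otimes> (q \<otimes> e)" using c z by (simp add: r_distr)
    also have "x \<otimes> a = \<one> \<ominus> q \<otimes> e" using Suc by (simp add: q_def a_def e_def)
    also have "(\<one> \<ominus> q \<otimes> e) \<oplus> x \<otimes> (q \<otimes> e) = \<one> \<ominus> (q \<otimes> w) \<otimes> (e \<otimes> \<ominus> z)"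
      unfolding z(2) by (use c z in \<open>simp add: ring_nf\<close>)
    finally show ?case by (simp add: q_def a_def e_def d_def)
  qed
  have "x \<otimes> y = \<one>"
  proof (rule eq_if_cg_all)
    fix n
    have "cg R w n (x \<otimes> y) (x \<otimes> psum R w d n)" using y[of n] z by (intro cg_mult cg_refl) auto
    moreover have "cg R w n (\<one> \<ominus> w [^] n \<otimes> d n) (\<one> \<ominus> \<zero>)"
      using dc by (intro cg_minus cg_refl cg_multiple) auto
    ultimately have "cg R w n (x \<otimes> y) (\<one> \<ominus> \<zero>)" unfolding * by (rule cgt)
    then show "cg R w n (x \<otimes> y) \<one>" by (simp add: a_minus_def)
  qed
  then show ?thesis using yc by blast
qed

end

text \<open>The objects of the category, with \<open>w\<close> the image of a uniformizer: perfectness of the residue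
  ring is the pair \<open>surj\<close>, \<open>red\<close>, and flatness is \<open>nzd\<close> (see \<open>CRP_iff\<close>).\<close>

locale pcr = cunif +
  assumes surj: "x \<in> carrier R \<Longrightarrow> \<exists>y\<in>carrier R. cg R w 1 x (y [^] p)"
    and red: "x \<in> carrier R \<Longrightarrow> cg R w 1 (x [^] p) \<zero> \<Longrightarrow> cg R w 1 x \<zero>"
begin

lemma red_n:
  assumes "x \<in> carrier R" "cg R w 1 (x [^] (p ^ n)) \<zero>" shows "cg R w 1 x \<zero>"
  using assms(2)
proof (induction n)
  case (Suc n)
  have "x [^] (p ^ Suc n) = (x [^] (p ^ n)) [^] p" using assms by (simp add: nat_pow_pow mult.commute)
  with Suc.prems have "cg R w 1 ((x [^] (p ^ n)) [^] p) \<zero>" by simp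
  then have "cg R w 1 (x [^] (p ^ n)) \<zero>" by (rule red[rotated]) (use assms in auto)
  then show ?case by (rule Suc.IH)
qed (use assms in simp)

lemma frob_inj_n:
  assumes "x \<in> carrier R" "y \<in> carrier R" "cg R w 1 (x [^] (p ^ n)) (y [^] (p ^ n))"
  shows "cg R w 1 x y"
proof -
  have "cg R w 1 (x [^] (p ^ n) \<ominus> y [^] (p ^ n)) \<zero>" using assms by (simp add: cg_diff_iff)
  then have "cg R w 1 ((x \<ominus> y) [^] (p ^ n)) \<zero>"
    using frob_minus_n[OF assms(1,2)] cgt by blast
  then show ?thesis using red_n[of "x \<ominus> y"] assms by (simp add: cg_diff_iff)
qed

lemma surj_n:
  assumes "x \<in> carrier R" shows "\<exists>y\<in>carrier R. cg R w 1 x (y [^] (p ^ n))"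
proof (induction n)
  case 0
  then show ?case using assms cg_refl[OF assms w_closed] by (intro bexI[of _ x]) auto
next
  case (Suc n)
  then obtain y where y: "y \<in> carrier R" "cg R w 1 x (y [^] (p ^ n))" by blast
  obtain z where z: "z \<in> carrier R" "cg R w 1 y (z [^] p)" using surj y by blast
  have "cg R w 1 (y [^] (p ^ n)) ((z [^] p) [^] (p ^ n))" using z by (intro cg_pow) auto
  then show ?case using y z cg_trans[OF y(2)] by (intro bexI[of _ z]) (auto simp: nat_pow_pow)
qed

text \<open>In a \<open>w\<close>-adically complete ring, having a \<open>p ^ n\<close>-th root for every \<open>n\<close> characterizes the
  Teichmueller representatives.\<close>

definition tm :: "'a \<Rightarrow> bool" where
  "tm x \<longleftrightarrow> (\<forall>n. \<exists>y\<in>carrier R. x = y [^] (p ^ n))"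

lemma tm_closed: "tm x \<Longrightarrow> x \<in> carrier R"
  unfolding tm_def by (metis nat_pow_closed)

text \<open>Injectivity of the Frobenius modulo \<open>w\<close> makes the p^n-th roots of
  \<open>x\<close> and \<open>y\<close> congruent modulo \<open>w\<close>; raising them back to the
  p^n-th power improves this to a congruence modulo w^(n+1), for every n.\<close>

lemma tm_unique:
  assumes "tm x" "tm y" "cg R w 1 x y" shows "x = y"
proof (rule eq_if_cg_all)
  fix n
  obtain a b where ab: "a \<in> carrier R" "x = a [^] (p ^ n)" "b \<in> carrier R" "y = b [^] (p ^ n)"
    using assms(1,2) unfolding tm_def by metis
  then have "cg R w 1 a b" using frob_inj_n assms(3) by simp
  then have "cg R w (1 + n) x y" using frob_lift_n[of 1 a b n] ab by simp
  then show "cg R w n x y" by (rule cg_mono) auto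
qed

text \<open>Lift p^n-th roots of the residue of \<open>x\<close> arbitrarily and raise them to the
  p^n-th power: another lift of the same root changes the result only modulo w^(n+1), so these
  powers converge.\<close>

lemma tm_exists:
  assumes x: "x \<in> carrier R" shows "\<exists>t. tm t \<and> cg R w 1 t x"
proof -
  have "\<exists>y. \<forall>n. y n \<in> carrier R \<and> cg R w 1 x (y n [^] (p ^ n))"
    using surj_n[OF x] by metis
  then obtain y where y: "\<And>n. y n \<in> carrier R" "\<And>n. cg R w 1 x (y n [^] (p ^ n))" by blast
  have step: "cg R w 1 (y (Suc n) [^] p) (y n)" for n
  proof (rule frob_inj_n[where n = n])
    have "cg R w 1 (y (Suc n) [^] (p ^ Suc n)) (y n [^] (p ^ n))"
      by (rule cgt[OF cgs[OF y(2)] y(2)])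
    then show "cg R w 1 ((y (Suc n) [^] p) [^] (p ^ n)) (y n [^] (p ^ n))"
      using y by (simp add: nat_pow_pow)
  qed (use y in auto)
  \<comment> \<open>Convergence is shown for all shifted sequences at once: the limit
    \<open>z m\<close> of the sequence shifted by m is the p^m-th root of \<open>z 0\<close>
    required by \<open>tm\<close>.\<close>
  have lim: "\<exists>z. \<forall>n. cg R w n z (y (n + m) [^] (p ^ n))" for m
  proof (rule complete)
    fix n
    have "cg R w (1 + n) ((y (Suc (n + m)) [^] p) [^] (p ^ n)) (y (n + m) [^] (p ^ n))"
      by (rule frob_lift_n[OF step]) simp
    then have "cg R w n ((y (Suc (n + m)) [^] p) [^] (p ^ n)) (y (n + m) [^] (p ^ n))"
      by (rule cg_mono) auto
    then show "cg R w n (y (Suc n + m) [^] (p ^ Suc n)) (y (n + m) [^] (p ^ n))"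
      using y by (simp add: nat_pow_pow)
  qed
  obtain z where z: "\<And>m n. cg R w n (z m) (y (n + m) [^] (p ^ n))" using lim by metis
  have zc: "z m \<in> carrier R" for m using z[of 0 m] by (auto simp: cg_def)
  have "z 0 = z m [^] (p ^ m)" for m
  proof (rule eq_if_cg_all)
    fix n
    have "cg R w n (z m [^] (p ^ m)) ((y (n + m) [^] (p ^ n)) [^] (p ^ m))"
      by (rule cg_pow[OF z]) auto
    then have 1: "cg R w n (z m [^] (p ^ m)) (y (n + m) [^] (p ^ (n + m)))"
      using y by (simp add: nat_pow_pow power_add)
    have "cg R w (n + m) (z 0) (y (n + m) [^] (p ^ (n + m)))" using z[of "n + m" 0] by simp
    then have "cg R w n (z 0) (y (n + m) [^] (p ^ (n + m)))" by (rule cg_mono) auto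
    then show "cg R w n (z 0) (z m [^] (p ^ m))" using cgs[OF 1] by (rule cgt)
  qed
  then have "tm (z 0)" unfolding tm_def using zc by blast
  moreover have "cg R w 1 (z 0) x"
    using cgt[OF z[of 1 0] cgs] y(2)[of 1] by simp
  ultimately show ?thesis by blast
qed

definition tau :: "'a \<Rightarrow> 'a" where
  "tau x = (SOME t. tm t \<and> cg R w 1 t x)"

lemma tau: assumes "x \<in> carrier R" shows "tm (tau x)" "cg R w 1 (tau x) x"
  using someI_ex[OF tm_exists[OF assms]] by (auto simp: tau_def)

lemma tau_closed [simp, intro]: "x \<in> carrier R \<Longrightarrow> tau x \<in> carrier R"
  using tau tm_closed by blast

lemma tau_eqI:
  assumes "tm t" "cg R w 1 t x" shows "tau x = t"
proof -
  have x: "x \<in> carrier R" using assms by (auto simp: cg_def)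
  show ?thesis by (rule tm_unique[OF tau(1)[OF x] assms(1) cgt[OF tau(2)[OF x] cgs[OF assms(2)]]])
qed

lemma tau_cong: assumes "cg R w 1 x y" shows "tau x = tau y"
proof (rule tau_eqI)
  have y: "y \<in> carrier R" using assms by (auto simp: cg_def)
  show "tm (tau y)" "cg R w 1 (tau y) x" using tau[OF y] cgt[OF _ cgs[OF assms]] by auto
qed

lemma tm_pow: assumes "tm x" shows "tm (x [^] (k::nat))"
  unfolding tm_def
proof
  fix n
  obtain y where "y \<in> carrier R" "x = y [^] (p ^ n)" using assms unfolding tm_def by blast
  then show "\<exists>y\<in>carrier R. x [^] k = y [^] (p ^ n)"
    by (intro bexI[of _ "y [^] k"]) (auto simp: nat_pow_pow mult.commute)
qed

lemma tau_pow: "x \<in> carrier R \<Longrightarrow> tau (x [^] (k::nat)) = tau x [^] k"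
  by (intro tau_eqI tm_pow tau cg_pow) auto

text \<open>What remains of \<open>x\<close> after removing the first n digits and dividing by w^n.
  The value picked by \<open>SOME\<close> is the only one, because \<open>w\<close> is not a zero
  divisor.\<close>

primrec rem :: "'a \<Rightarrow> nat \<Rightarrow> 'a" where
  "rem x 0 = x"
| "rem x (Suc n) = (SOME y. y \<in> carrier R \<and> rem x n = tau (rem x n) \<oplus> w \<otimes> y)"

definition dig :: "'a \<Rightarrow> nat \<Rightarrow> 'a" where "dig x n = tau (rem x n)"

lemma rem:
  assumes "x \<in> carrier R"
  shows "rem x n \<in> carrier R" "rem x n = dig x n \<oplus> w \<otimes> rem x (Suc n)"
proof -
  have *: "rem x (Suc n) \<in> carrier R \<and> rem x n = tau (rem x n) \<oplus> w \<otimes> rem x (Suc n)"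
    if "rem x n \<in> carrier R" for n
  proof -
    have "cg R w 1 (rem x n) (tau (rem x n))" using tau[OF that] cgs by blast
    then have "\<exists>y. y \<in> carrier R \<and> rem x n = tau (rem x n) \<oplus> w \<otimes> y" by (auto simp: cg_def)
    from someI_ex[OF this] show ?thesis by simp
  qed
  show "rem x n \<in> carrier R" by (induction n) (use assms * in auto)
  then show "rem x n = dig x n \<oplus> w \<otimes> rem x (Suc n)" using * by (simp add: dig_def)
qed

lemma dig_tm: "x \<in> carrier R \<Longrightarrow> tm (dig x n)"
  unfolding dig_def using rem tau by blast

lemma dig_closed [simp, intro]: "x \<in> carrier R \<Longrightarrow> dig x n \<in> carrier R"
  using dig_tm tm_closed by blast

lemma expansion:
  assumes "x \<in> carrier R" shows "x = psum R w (dig x) n \<oplus> w [^] n \<otimes> rem x n"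
proof (induction n)
  case 0
  then show ?case using assms by simp
next
  case (Suc n)
  define q a d r where "q = w [^] n" and "a = psum R w (dig x) n" and "d = dig x n" and "r = rem x (Suc n)"
  have c: "q \<in> carrier R" "a \<in> carrier R" "d \<in> carrier R" "r \<in> carrier R" "w \<in> carrier R"
    using assms rem[OF assms, of "Suc n"] by (auto simp: q_def a_def d_def r_def simp del: rem.simps)
  have "x = a \<oplus> q \<otimes> (d \<oplus> w \<otimes> r)"
    using Suc rem(2)[OF assms, of n] by (simp add: q_def a_def d_def r_def del: rem.simps)
  also have "\<dots> = (a \<oplus> q \<otimes> d) \<oplus> (q \<otimes> w) \<otimes> r"
    by (use c in \<open>simp add: ring_nf\<close>)
  finally show ?case by (simp add: q_def a_def d_def r_def del: rem.simps)
qed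

lemma cg_expansion:
  assumes "x \<in> carrier R" shows "cg R w n x (psum R w (dig x) n)"
  by (rule cgI[OF _ _ _ expansion[OF assms]]) (use rem(1) assms in auto)

text \<open>For precision N, digits that are p^M-th powers with N \<le> M + 1 are as good as
  Teichmueller elements, since congruent bases have p^M-th powers congruent modulo w^(M+1). This
  matters because the test objects prescribe only roots of bounded height. The terms of index 0 are
  subtracted and the rest is divided by \<open>w\<close>.\<close>

lemma digits_unique:
  assumes "\<And>j. j < N \<Longrightarrow> x j \<in> carrier R" "\<And>j. j < N \<Longrightarrow> y j \<in> carrier R"
    and "N \<le> Suc M"
    and "cg R w N (psum R w (\<lambda>j. x j [^] (p ^ M)) N) (psum R w (\<lambda>j. y j [^] (p ^ M)) N)"
    and "j < N"
  shows "cg R w 1 (x j) (y j)"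
  using assms
proof (induction N arbitrary: x y j)
  case 0
  then show ?case by simp
next
  case (Suc n)
  let ?x = "\<lambda>j. x j [^] (p ^ M)" and ?y = "\<lambda>j. y j [^] (p ^ M)"
  define a b where "a = psum R w (?x \<circ> Suc) n" and "b = psum R w (?y \<circ> Suc) n"
  have ab: "a \<in> carrier R" "b \<in> carrier R" using Suc.prems by (auto simp: a_def b_def)
  have x0: "x 0 \<in> carrier R" "y 0 \<in> carrier R" using Suc.prems by auto
  have e: "psum R w ?x (Suc n) = ?x 0 \<oplus> w \<otimes> a" "psum R w ?y (Suc n) = ?y 0 \<oplus> w \<otimes> b"
    unfolding a_def b_def using Suc.prems by (intro psum_shift; force)+
  have c: "cg R w (Suc n) (?x 0 \<oplus> w \<otimes> a) (?y 0 \<oplus> w \<otimes> b)" using Suc.prems(4) unfolding e .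
  then have "cg R w 1 (?x 0 \<oplus> w \<otimes> a) (?y 0 \<oplus> w \<otimes> b)" by (rule cg_mono) auto
  moreover have *: "cg R w 1 (u \<oplus> w \<otimes> v) u" if "u \<in> carrier R" "v \<in> carrier R" for u v
    by (rule cgI[of _ _ v]) (use that in auto)
  ultimately have "cg R w 1 (?x 0 \<oplus> w \<otimes> a) (?y 0)"
    using cgt *[of "?y 0" b] ab x0 by blast
  then have "cg R w 1 (?x 0) (?y 0)"
    using cgt[OF cgs[OF *[of "?x 0" a]]] ab x0 by blast
  then have c0: "cg R w 1 (x 0) (y 0)" using frob_inj_n x0 by simp
  then have "cg R w (1 + M) (?x 0) (?y 0)" by (intro frob_lift_n) auto
  then have "cg R w (Suc n) (?x 0) (?y 0)" by (rule cg_mono) (use Suc.prems in auto)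
  then have "cg R w (Suc n) ((?x 0 \<oplus> w \<otimes> a) \<ominus> ?x 0) ((?y 0 \<oplus> w \<otimes> b) \<ominus> ?y 0)"
    using c by (intro cg_minus) auto
  moreover have c: "w \<in> carrier R" by simp
  have "(u \<oplus> w \<otimes> v) \<ominus> u = w \<otimes> v" if "u \<in> carrier R" "v \<in> carrier R" for u v
    by (use that in \<open>simp add: ring_nf\<close>)
  ultimately have "cg R w (Suc n) (w \<otimes> a) (w \<otimes> b)" using ab x0 by simp
  then have d: "cg R w n a b" using ab by (rule cg_cancel1)
  show ?case
  proof (cases j)
    case 0
    then show ?thesis using c0 by simp
  next
    case (Suc i)
    have "cg R w 1 ((x \<circ> Suc) i) ((y \<circ> Suc) i)"
      by (rule Suc.IH) (use Suc.prems Suc d in \<open>auto simp: a_def b_def comp_def\<close>)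
    then show ?thesis using Suc by simp
  qed
qed

end

text \<open>Describes a complete discrete valuation ring with uniformizer \<open>w\<close> by
  elements alone: every nonzero element is a power of \<open>w\<close> times a unit, so integrality
  is implied.\<close>

locale cdv = cunif +
  assumes unit: "x \<in> carrier R \<Longrightarrow> \<not> cg R w 1 x \<zero> \<Longrightarrow> \<exists>y\<in>carrier R. x \<otimes> y = \<one>"
    and nontriv: "\<not> cg R w 1 \<one> \<zero>"
begin

lemma prime_w:
  assumes "x \<in> carrier R" "y \<in> carrier R" "cg R w 1 (x \<otimes> y) \<zero>" "\<not> cg R w 1 x \<zero>"
  shows "cg R w 1 y \<zero>"
proof -
  obtain z where z: "z \<in> carrier R" "x \<otimes> z = \<one>" using unit assms by blast
  have "cg R w 1 (z \<otimes> (x \<otimes> y)) \<zero>" by (rule cg_shift_zero) (use assms z in auto)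
  moreover have "z \<otimes> (x \<otimes> y) = (x \<otimes> z) \<otimes> y"
    by (use assms(1,2) z(1) in \<open>simp add: m_ac\<close>)
  ultimately show ?thesis using z assms by simp
qed

lemma pow_w:
  assumes "x \<in> carrier R" "cg R w 1 (x [^] (n::nat)) \<zero>" shows "cg R w 1 x \<zero>"
  using assms(2)
proof (induction n)
  case 0
  then show ?case using nontriv by simp
next
  case (Suc n)
  then show ?case using prime_w[of "x [^] n" x] assms(1) by auto
qed

text \<open>Takes the largest power of \<open>w\<close> dividing all of the finitely many elements.
  It exists because the nonzero one is not divisible by every power; after division some cofactor is
  no longer divisible by \<open>w\<close>, hence a unit.\<close>

lemma common_factor:
  assumes "finite E" "a \<in> E \<rightarrow> carrier R" "e0 \<in> E" "a e0 \<noteq> \<zero>"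
  obtains n b e1 where "b \<in> E \<rightarrow> carrier R" "\<And>e. e \<in> E \<Longrightarrow> a e = w [^] (n::nat) \<otimes> b e"
    "e1 \<in> E" "\<not> cg R w 1 (b e1) \<zero>"
proof -
  define P where "P = (\<lambda>n. \<forall>e\<in>E. cg R w n (a e) \<zero>)"
  obtain N where N: "\<not> cg R w N (a e0) \<zero>" using sep[of "a e0"] assms by auto
  then have "\<not> P N" using assms by (auto simp: P_def)
  moreover have P0: "P 0" using assms by (auto simp: P_def intro!: cg_0)
  ultimately obtain n where n: "P n" "\<not> P (Suc n)"
    by (metis nat_induct)
  have "\<exists>b. \<forall>e\<in>E. b e \<in> carrier R \<and> a e = w [^] n \<otimes> b e"
  proof (rule bchoice, rule)
    fix e assume "e \<in> E"
    then have "cg R w n (a e) \<zero>" using n by (auto simp: P_def)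
    then show "\<exists>y. y \<in> carrier R \<and> a e = w [^] n \<otimes> y" using cg_zeroE w_closed by metis
  qed
  then obtain b where b: "\<And>e. e \<in> E \<Longrightarrow> b e \<in> carrier R \<and> a e = w [^] n \<otimes> b e" by blast
  from n obtain e1 where e1: "e1 \<in> E" "\<not> cg R w (Suc n) (a e1) \<zero>" by (auto simp: P_def)
  have "\<not> cg R w 1 (b e1) \<zero>"
  proof
    assume "cg R w 1 (b e1) \<zero>"
    then have "cg R w (n + 1) (w [^] n \<otimes> b e1) (w [^] n \<otimes> \<zero>)" by (rule cg_mult_pow) auto
    then show False using e1 b by simp
  qed
  then show ?thesis using that[of b n e1] b e1 by auto
qed

end

section \<open>Flatness over a discrete valuation ring\<close>

text \<open>Spans are formed in the type of all formal sums, without reference to a carrier.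
  Relations for a submodule and for the whole module can thus be compared directly in
  \<open>torsion_free_core\<close>.\<close>

inductive_set addspan :: "('a \<Rightarrow>\<^sub>0 int) set \<Rightarrow> ('a \<Rightarrow>\<^sub>0 int) set" for H where
  zero: "0 \<in> addspan H"
| add: "x \<in> addspan H \<Longrightarrow> h \<in> H \<Longrightarrow> x + h \<in> addspan H"
| diff: "x \<in> addspan H \<Longrightarrow> h \<in> H \<Longrightarrow> x - h \<in> addspan H"

lemma addspan_add: "y \<in> addspan H \<Longrightarrow> x \<in> addspan H \<Longrightarrow> x + y \<in> addspan H"
proof (induction rule: addspan.induct)
  case (add y h)
  then show ?case using addspan.add[of "x + y" H h] by (simp add: algebra_simps)
next
  case (diff y h)
  then show ?case using addspan.diff[of "x + y" H h] by (simp add: algebra_simps)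
qed simp

lemma addspan_minus: "y \<in> addspan H \<Longrightarrow> - y \<in> addspan H"
proof (induction rule: addspan.induct)
  case (add y h)
  then show ?case using addspan.diff[of "- y" H h]
    by (simp only: minus_add_distrib diff_conv_add_uminus)
next
  case (diff y h)
  then show ?case using addspan.add[of "- y" H h] by (simp add: algebra_simps)
qed (simp add: addspan.zero)

lemma addspan_diff: "x \<in> addspan H \<Longrightarrow> y \<in> addspan H \<Longrightarrow> x - y \<in> addspan H"
  using addspan_add[OF addspan_minus] by fastforce

lemma addspan_incl: "h \<in> H \<Longrightarrow> h \<in> addspan H"
  using addspan.add[OF addspan.zero] by fastforce

abbreviation supp :: "('a \<Rightarrow>\<^sub>0 int) \<Rightarrow> 'a set" where
  "supp \<equiv> Poly_Mapping.keys"

lemma addspan_keys: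
  assumes "\<And>h. h \<in> H \<Longrightarrow> supp h \<subseteq> S" "x \<in> addspan H"
  shows "supp x \<subseteq> S"
  using assms(2)
proof (induction rule: addspan.induct)
  case (add x h)
  then show ?case using assms(1) keys_add[of x h] by blast
next
  case (diff x h)
  then show ?case using assms(1) keys_diff[of x h] by blast
qed simp

lemma generate_free_Abelian_group:
  assumes "\<And>h. h \<in> H \<Longrightarrow> supp h \<subseteq> S"
  shows "generate (free_Abelian_group S) H = addspan H"
proof
  show "generate (free_Abelian_group S) H \<subseteq> addspan H"
  proof
    fix x assume "x \<in> generate (free_Abelian_group S) H"
    then show "x \<in> addspan H"
    proof (induction rule: generate.induct)
      case one
      then show ?case by (simp add: addspan.zero)
    next
      case (incl h)
      then show ?case by (rule addspan_incl)
    next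
      case (inv h)
      then show ?case using assms by (simp add: addspan_minus addspan_incl)
    next
      case (eng h1 h2)
      then show ?case by (simp add: addspan_add)
    qed
  qed
  show "addspan H \<subseteq> generate (free_Abelian_group S) H"
  proof
    fix x assume "x \<in> addspan H"
    then show "x \<in> generate (free_Abelian_group S) H"
    proof (induction rule: addspan.induct)
      case zero
      then show ?case using generate.one[of "free_Abelian_group S" H] by simp
    next
      case (add x h)
      then show ?case using generate.eng[OF add(3) generate.incl[OF add(2)]] by simp
    next
      case (diff x h)
      then show ?case using generate.eng[OF diff(3) generate.inv[OF diff(2)]] assms by simp
    qed
  qed
qed

definition tgen :: "('a, 'm) ring_scheme \<Rightarrow> ('a, 'b, 'n) module_scheme \<Rightarrow> ('a, 'c, 'k) module_scheme \<Rightarrow> ('b \<times> 'c \<Rightarrow>\<^sub>0 int) set" where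
  "tgen R M P =
     {frag_of (x \<oplus>\<^bsub>M\<^esub> y, z) - frag_of (x, z) - frag_of (y, z) | x y z.
         x \<in> carrier M \<and> y \<in> carrier M \<and> z \<in> carrier P} \<union>
     {frag_of (x, y \<oplus>\<^bsub>P\<^esub> z) - frag_of (x, y) - frag_of (x, z) | x y z.
         x \<in> carrier M \<and> y \<in> carrier P \<and> z \<in> carrier P} \<union>
     {frag_of (a \<odot>\<^bsub>M\<^esub> x, z) - frag_of (x, a \<odot>\<^bsub>P\<^esub> z) | a x z.
         a \<in> carrier R \<and> x \<in> carrier M \<and> z \<in> carrier P}"

lemma tgen_cases:
  assumes "h \<in> tgen R M P"
  obtains (l) x y z where "x \<in> carrier M" "y \<in> carrier M" "z \<in> carrier P"
      "h = frag_of (x \<oplus>\<^bsub>M\<^esub> y, z) - frag_of (x, z) - frag_of (y, z)"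
    | (r) x y z where "x \<in> carrier M" "y \<in> carrier P" "z \<in> carrier P"
      "h = frag_of (x, y \<oplus>\<^bsub>P\<^esub> z) - frag_of (x, y) - frag_of (x, z)"
    | (b) a x z where "a \<in> carrier R" "x \<in> carrier M" "z \<in> carrier P"
      "h = frag_of (a \<odot>\<^bsub>M\<^esub> x, z) - frag_of (x, a \<odot>\<^bsub>P\<^esub> z)"
  using assms unfolding tgen_def by blast

lemma tgenI:
  "x \<in> carrier M \<Longrightarrow> y \<in> carrier M \<Longrightarrow> z \<in> carrier P \<Longrightarrow>
     frag_of (x \<oplus>\<^bsub>M\<^esub> y, z) - frag_of (x, z) - frag_of (y, z) \<in> tgen R M P"
  "x \<in> carrier M \<Longrightarrow> y' \<in> carrier P \<Longrightarrow> z \<in> carrier P \<Longrightarrow>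
     frag_of (x, y' \<oplus>\<^bsub>P\<^esub> z) - frag_of (x, y') - frag_of (x, z) \<in> tgen R M P"
  "a \<in> carrier R \<Longrightarrow> x \<in> carrier M \<Longrightarrow> z \<in> carrier P \<Longrightarrow>
     frag_of (a \<odot>\<^bsub>M\<^esub> x, z) - frag_of (x, a \<odot>\<^bsub>P\<^esub> z) \<in> tgen R M P"
  unfolding tgen_def by blast+

text \<open>Closure under the operations is what computations with relations rest on; it is easily
  checked for a record whose carrier is cut down to a submodule.\<close>

definition clo :: "('a, 'm) ring_scheme \<Rightarrow> ('a, 'b, 'n) module_scheme \<Rightarrow> bool" where
  "clo R M \<longleftrightarrow> (\<forall>x\<in>carrier M. \<forall>y\<in>carrier M. x \<oplus>\<^bsub>M\<^esub> y \<in> carrier M) \<and>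
     (\<forall>a\<in>carrier R. \<forall>x\<in>carrier M. a \<odot>\<^bsub>M\<^esub> x \<in> carrier M)"

lemma module_clo: "module R M \<Longrightarrow> clo R M"
  unfolding clo_def by (metis abelian_groupE(1) module.axioms(2) module.smult_closed)

lemma tgen_keys:
  assumes "clo R M" "clo R P" "h \<in> tgen R M P"
  shows "supp h \<subseteq> carrier M \<times> carrier P"
  using assms(3)
proof (cases rule: tgen_cases)
  case (l x y z)
  have "supp h \<subseteq> {(x \<oplus>\<^bsub>M\<^esub> y, z), (x, z), (y, z)}"
    unfolding l(4) using keys_diff[of "frag_of (x \<oplus>\<^bsub>M\<^esub> y, z) - frag_of (x, z)" "frag_of (y, z)"]
      keys_diff[of "frag_of (x \<oplus>\<^bsub>M\<^esub> y, z)" "frag_of (x, z)"] by auto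
  then show ?thesis using l assms(1) unfolding clo_def by auto
next
  case (r x y z)
  have "supp h \<subseteq> {(x, y \<oplus>\<^bsub>P\<^esub> z), (x, y), (x, z)}"
    unfolding r(4) using keys_diff[of "frag_of (x, y \<oplus>\<^bsub>P\<^esub> z) - frag_of (x, y)" "frag_of (x, z)"]
      keys_diff[of "frag_of (x, y \<oplus>\<^bsub>P\<^esub> z)" "frag_of (x, y)"] by auto
  then show ?thesis using r assms(2) unfolding clo_def by auto
next
  case (b a x z)
  have "supp h \<subseteq> {(a \<odot>\<^bsub>M\<^esub> x, z), (x, a \<odot>\<^bsub>P\<^esub> z)}"
    unfolding b(4) using keys_diff[of "frag_of (a \<odot>\<^bsub>M\<^esub> x, z)" "frag_of (x, a \<odot>\<^bsub>P\<^esub> z)"] by auto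
  then show ?thesis using b assms(1,2) unfolding clo_def by auto
qed

lemma tensor_relations_eq:
  assumes "clo R M" "clo R P"
  shows "tensor_relations R M P = addspan (tgen R M P)"
  unfolding tensor_relations_def tgen_def[symmetric]
  by (rule generate_free_Abelian_group) (rule tgen_keys[OF assms])

lemma free_coset:
  "H #>\<^bsub>free_Abelian_group S\<^esub> a = (\<lambda>h. h + a) ` H"
  by (auto simp: r_coset_def)

lemma addspan_coset_eq:
  "(\<lambda>h. h + a) ` addspan H = (\<lambda>h. h + b) ` addspan H \<longleftrightarrow> a - b \<in> addspan H"
proof
  assume "(\<lambda>h. h + a) ` addspan H = (\<lambda>h. h + b) ` addspan H"
  moreover have "a \<in> (\<lambda>h. h + a) ` addspan H" using addspan.zero by force
  ultimately obtain h where "h \<in> addspan H" "a = h + b" by auto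
  then show "a - b \<in> addspan H" by simp
next
  have *: "(\<lambda>h. h + a) ` addspan H \<subseteq> (\<lambda>h. h + b) ` addspan H" if "a - b \<in> addspan H" for a b
  proof
    fix y assume "y \<in> (\<lambda>h. h + a) ` addspan H"
    then obtain h where "h \<in> addspan H" "y = h + a" by auto
    then have "h + (a - b) \<in> addspan H" "y = (h + (a - b)) + b" using that addspan_add by auto
    then show "y \<in> (\<lambda>h. h + b) ` addspan H" by blast
  qed
  assume "a - b \<in> addspan H"
  moreover from this have "b - a \<in> addspan H" using addspan_minus by fastforce
  ultimately show "(\<lambda>h. h + a) ` addspan H = (\<lambda>h. h + b) ` addspan H" using * by blast
qed

lemma tensor_carrier:
  assumes "clo R M" "clo R P"
  shows "carrier (tensor_product R M P) =
    (\<lambda>z. (\<lambda>h. h + z) ` addspan (tgen R M P)) ` {z. supp z \<subseteq> carrier M \<times> carrier P}"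
  unfolding tensor_product_def FactGroup_def tensor_relations_eq[OF assms]
  by (auto simp: RCOSETS_def free_coset)

abbreviation tpush :: "('b \<Rightarrow> 'c) \<Rightarrow> ('b \<times> 'd \<Rightarrow>\<^sub>0 int) \<Rightarrow> ('c \<times> 'd \<Rightarrow>\<^sub>0 int)" where
  "tpush f \<equiv> frag_extend (\<lambda>(x, y). frag_of (f x, y))"

lemma tpush_addspan:
  assumes "f \<in> linear_maps R M N" "u \<in> addspan (tgen R M P)"
  shows "tpush f u \<in> addspan (tgen R N P)"
  using assms(2)
proof (induction rule: addspan.induct)
  case zero
  then show ?case by (simp add: addspan.zero)
next
  have *: "tpush f h \<in> tgen R N P" if "h \<in> tgen R M P" for h
    using that
  proof (cases rule: tgen_cases)
    case (l x y z)
    have "tpush f h = frag_of (f x \<oplus>\<^bsub>N\<^esub> f y, z) - frag_of (f x, z) - frag_of (f y, z)"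
      using assms(1) l by (simp add: frag_extend_diff linear_maps_def)
    then show ?thesis using assms(1) l by (simp add: linear_maps_def tgenI Pi_iff)
  next
    case (r x y z)
    have "tpush f h = frag_of (f x, y \<oplus>\<^bsub>P\<^esub> z) - frag_of (f x, y) - frag_of (f x, z)"
      using assms(1) r by (simp add: frag_extend_diff linear_maps_def)
    then show ?thesis using assms(1) r by (simp add: linear_maps_def tgenI Pi_iff)
  next
    case (b a x z)
    have "tpush f h = frag_of (a \<odot>\<^bsub>N\<^esub> f x, z) - frag_of (f x, a \<odot>\<^bsub>P\<^esub> z)"
      using assms(1) b by (simp add: frag_extend_diff linear_maps_def)
    then show ?thesis using assms(1) b by (simp add: linear_maps_def tgenI Pi_iff)
  qed
  {
    case (add x h)
    then show ?case using * by (simp add: frag_extend_add addspan.add)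
  next
    case (diff x h)
    then show ?case using * by (simp add: frag_extend_diff addspan.diff)
  }
qed

lemma tensor_map_coset:
  assumes "clo R M" "clo R P" "clo R N" "f \<in> linear_maps R M N"
  shows "tensor_map R M N f P ((\<lambda>h. h + z) ` addspan (tgen R M P)) =
    (\<lambda>h. h + tpush f z) ` addspan (tgen R N P)"
proof -
  have "(\<lambda>h. h + tpush f (u + z)) ` addspan (tgen R N P) = (\<lambda>h. h + tpush f z) ` addspan (tgen R N P)"
    if "u \<in> addspan (tgen R M P)" for u
    unfolding addspan_coset_eq using tpush_addspan[OF assms(4) that] by (simp add: frag_extend_add)
  then show ?thesis
    unfolding tensor_map_def free_coset tensor_relations_eq[OF assms(3,2)]
    using addspan.zero[of "tgen R M P"] by fastforce
qed

lemma flat_iff: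
  "flat R P \<longleftrightarrow> module R P \<and>
     (\<forall>(M :: ('a, 'a) module) (N :: ('a, 'a) module). \<forall>f \<in> linear_maps R M N.
        module R M \<and> module R N \<and> inj_on f (carrier M) \<longrightarrow>
        (\<forall>z. supp z \<subseteq> carrier M \<times> carrier P \<longrightarrow>
           tpush f z \<in> addspan (tgen R N P) \<longrightarrow> z \<in> addspan (tgen R M P)))"
  for R :: "('a, 'm) ring_scheme"
proof -
  have "inj_on (tensor_map R M N f P) (carrier (tensor_product R M P)) \<longleftrightarrow>
     (\<forall>z. supp z \<subseteq> carrier M \<times> carrier P \<longrightarrow>
           tpush f z \<in> addspan (tgen R N P) \<longrightarrow> z \<in> addspan (tgen R M P))" (is "?l \<longleftrightarrow> ?r")
    if c: "clo R P" "clo R M" "clo R N" "f \<in> linear_maps R M N"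
    for M N :: "('a, 'a) module" and f
  proof
    assume l: ?l
    show ?r
    proof (intro allI impI)
      fix z assume z: "supp z \<subseteq> carrier M \<times> carrier P" "tpush f z \<in> addspan (tgen R N P)"
      let ?c = "\<lambda>z. (\<lambda>h. h + z) ` addspan (tgen R M P)"
      have "?c z \<in> carrier (tensor_product R M P)" "?c 0 \<in> carrier (tensor_product R M P)"
        unfolding tensor_carrier[OF c(2,1)] using z(1) keys_zero
        by (blast, intro image_eqI[of _ _ 0]) auto
      moreover have "tensor_map R M N f P (?c z) = tensor_map R M N f P (?c 0)"
        unfolding tensor_map_coset[OF c(2,1,3,4)] addspan_coset_eq using z by simp
      ultimately have "?c z = ?c 0" using l unfolding inj_on_def by blast
      then show "z \<in> addspan (tgen R M P)" unfolding addspan_coset_eq by simp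
    qed
  next
    assume r: ?r
    show ?l
    proof (rule inj_onI)
      fix Z1 Z2 assume ZZ: "Z1 \<in> carrier (tensor_product R M P)" "Z2 \<in> carrier (tensor_product R M P)"
        "tensor_map R M N f P Z1 = tensor_map R M N f P Z2"
      then obtain x y where xy: "Z1 = (\<lambda>h. h + x) ` addspan (tgen R M P)" "Z2 = (\<lambda>h. h + y) ` addspan (tgen R M P)"
        "supp x \<subseteq> carrier M \<times> carrier P" "supp y \<subseteq> carrier M \<times> carrier P"
        unfolding tensor_carrier[OF c(2,1)] by blast
      have "tpush f (x - y) \<in> addspan (tgen R N P)"
        using ZZ(3) unfolding xy(1,2) tensor_map_coset[OF c(2,1,3,4)] addspan_coset_eq
        by (simp add: frag_extend_diff)
      moreover have "supp (x - y) \<subseteq> carrier M \<times> carrier P"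
        using keys_diff[of x y] xy by blast
      ultimately have "x - y \<in> addspan (tgen R M P)" using r by blast
      then show "Z1 = Z2" unfolding xy addspan_coset_eq .
    qed
  qed
  then show ?thesis unfolding flat_def using module_clo by (metis (no_types, lifting))
qed

text \<open>The universal property of the tensor product, read on formal sums. It serves to extract
  information, such as vanishing coordinates, from membership among the relations.\<close>

lemma tensor_eval:
  fixes Q :: "('q, 'z) ring_scheme"
  assumes "clo R M" "clo R P" "abelian_group Q"
    and "\<And>m x. m \<in> carrier M \<Longrightarrow> x \<in> carrier P \<Longrightarrow> \<beta> m x \<in> carrier Q"
    and "\<And>m m' x. m \<in> carrier M \<Longrightarrow> m' \<in> carrier M \<Longrightarrow> x \<in> carrier P \<Longrightarrow> \<beta> (m \<oplus>\<^bsub>M\<^esub> m') x = \<beta> m x \<oplus>\<^bsub>Q\<^esub> \<beta> m' x"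
    and "\<And>m x y. m \<in> carrier M \<Longrightarrow> x \<in> carrier P \<Longrightarrow> y \<in> carrier P \<Longrightarrow> \<beta> m (x \<oplus>\<^bsub>P\<^esub> y) = \<beta> m x \<oplus>\<^bsub>Q\<^esub> \<beta> m y"
    and "\<And>a m x. a \<in> carrier R \<Longrightarrow> m \<in> carrier M \<Longrightarrow> x \<in> carrier P \<Longrightarrow> \<beta> (a \<odot>\<^bsub>M\<^esub> m) x = \<beta> m (a \<odot>\<^bsub>P\<^esub> x)"
  obtains h where
    "\<And>u. supp u \<subseteq> carrier M \<times> carrier P \<Longrightarrow> h u \<in> carrier Q"
    "h 0 = \<zero>\<^bsub>Q\<^esub>"
    "\<And>m x. m \<in> carrier M \<Longrightarrow> x \<in> carrier P \<Longrightarrow> h (frag_of (m, x)) = \<beta> m x"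
    "\<And>u v. supp u \<subseteq> carrier M \<times> carrier P \<Longrightarrow> supp v \<subseteq> carrier M \<times> carrier P \<Longrightarrow> h (u - v) = h u \<ominus>\<^bsub>Q\<^esub> h v"
    "\<And>u. u \<in> addspan (tgen R M P) \<Longrightarrow> h u = \<zero>\<^bsub>Q\<^esub>"
proof -
  interpret Q: abelian_group Q by fact
  let ?S = "carrier M \<times> carrier P"
  have "(\<lambda>(m, x). \<beta> m x) ` ?S \<subseteq> carrier (add_monoid Q)" using assms(4) by auto
  then obtain h where h: "h \<in> hom (free_Abelian_group ?S) (add_monoid Q)"
    "\<And>x. x \<in> ?S \<Longrightarrow> h (frag_of x) = (case x of (m, x) \<Rightarrow> \<beta> m x)"
    using comm_group.free_Abelian_group_universal[OF Q.a_comm_group] by blast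
  interpret h: group_hom "free_Abelian_group ?S" "add_monoid Q" h
    using h(1) Q.a_group by (simp add: group_hom_def group_hom_axioms_def)
  have 1: "h u \<in> carrier Q" if "supp u \<subseteq> ?S" for u
    using h.hom_closed[of u] that by simp
  have 2: "h (frag_of (m, x)) = \<beta> m x" if "m \<in> carrier M" "x \<in> carrier P" for m x
    using h(2)[of "(m, x)"] that by simp
  have 3: "h (u - v) = h u \<ominus>\<^bsub>Q\<^esub> h v" if "supp u \<subseteq> ?S" "supp v \<subseteq> ?S" for u v
  proof -
    have "h (u \<otimes>\<^bsub>free_Abelian_group ?S\<^esub> inv\<^bsub>free_Abelian_group ?S\<^esub> v) = h u \<oplus>\<^bsub>Q\<^esub> h (inv\<^bsub>free_Abelian_group ?S\<^esub> v)"
      using that by (subst h.hom_mult) auto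
    also have "h (inv\<^bsub>free_Abelian_group ?S\<^esub> v) = \<ominus>\<^bsub>Q\<^esub> h v"
      using that by (subst h.hom_inv) (auto simp: a_inv_def)
    finally show ?thesis using that by (simp add: a_minus_def)
  qed
  have cancel: "(u \<oplus>\<^bsub>Q\<^esub> v) \<ominus>\<^bsub>Q\<^esub> u \<ominus>\<^bsub>Q\<^esub> v = \<zero>\<^bsub>Q\<^esub>" if "u \<in> carrier Q" "v \<in> carrier Q" for u v
  proof -
    have "(u \<oplus>\<^bsub>Q\<^esub> v) \<ominus>\<^bsub>Q\<^esub> u \<ominus>\<^bsub>Q\<^esub> v = (u \<oplus>\<^bsub>Q\<^esub> v) \<oplus>\<^bsub>Q\<^esub> (\<ominus>\<^bsub>Q\<^esub> u \<oplus>\<^bsub>Q\<^esub> \<ominus>\<^bsub>Q\<^esub> v)"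
      using that by (simp add: a_minus_def Q.a_assoc)
    then show ?thesis using that by (simp add: Q.minus_add[symmetric] Q.r_neg)
  qed
  have 0: "h 0 = \<zero>\<^bsub>Q\<^esub>" using h.hom_one by simp
  have 4: "h u = \<zero>\<^bsub>Q\<^esub>" if "u \<in> addspan (tgen R M P)" for u
  proof -
    have g: "h t = \<zero>\<^bsub>Q\<^esub>" if "t \<in> tgen R M P" for t
      using that
    proof (cases rule: tgen_cases)
      case (l x y z)
      have k: "supp (frag_of (x \<oplus>\<^bsub>M\<^esub> y, z)) \<subseteq> ?S" "supp (frag_of (x, z)) \<subseteq> ?S" "supp (frag_of (y, z)) \<subseteq> ?S"
        using l assms(1) unfolding clo_def by auto
      have k': "supp (frag_of (x \<oplus>\<^bsub>M\<^esub> y, z) - frag_of (x, z)) \<subseteq> ?S"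
        using keys_diff[of "frag_of (x \<oplus>\<^bsub>M\<^esub> y, z)" "frag_of (x, z)"] k by blast
      have "h t = (\<beta> x z \<oplus>\<^bsub>Q\<^esub> \<beta> y z) \<ominus>\<^bsub>Q\<^esub> \<beta> x z \<ominus>\<^bsub>Q\<^esub> \<beta> y z"
        unfolding l(4) 3[OF k' k(3)] 3[OF k(1,2)] using l assms(1,5) 2 unfolding clo_def by simp
      then show ?thesis using assms(4)[of x z] assms(4)[of y z] l cancel by simp
    next
      case (r x y z)
      have k: "supp (frag_of (x, y \<oplus>\<^bsub>P\<^esub> z)) \<subseteq> ?S" "supp (frag_of (x, y)) \<subseteq> ?S" "supp (frag_of (x, z)) \<subseteq> ?S"
        using r assms(2) unfolding clo_def by auto
      have k': "supp (frag_of (x, y \<oplus>\<^bsub>P\<^esub> z) - frag_of (x, y)) \<subseteq> ?S"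
        using keys_diff[of "frag_of (x, y \<oplus>\<^bsub>P\<^esub> z)" "frag_of (x, y)"] k by blast
      have "h t = (\<beta> x y \<oplus>\<^bsub>Q\<^esub> \<beta> x z) \<ominus>\<^bsub>Q\<^esub> \<beta> x y \<ominus>\<^bsub>Q\<^esub> \<beta> x z"
        unfolding r(4) 3[OF k' k(3)] 3[OF k(1,2)] using r assms(2,6) 2 unfolding clo_def by simp
      then show ?thesis using assms(4)[of x y] assms(4)[of x z] r cancel by simp
    next
      case (b a x z)
      have k: "supp (frag_of (a \<odot>\<^bsub>M\<^esub> x, z)) \<subseteq> ?S" "supp (frag_of (x, a \<odot>\<^bsub>P\<^esub> z)) \<subseteq> ?S"
        using b assms(1,2) unfolding clo_def by auto
      have "h t = \<beta> x (a \<odot>\<^bsub>P\<^esub> z) \<ominus>\<^bsub>Q\<^esub> \<beta> x (a \<odot>\<^bsub>P\<^esub> z)"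
        unfolding b(4) 3[OF k] using b assms(1,2,7) 2 unfolding clo_def by simp
      then show ?thesis using assms(2,4) b unfolding clo_def by (simp add: a_minus_def Q.r_neg)
    qed
    have kt: "supp t \<subseteq> ?S" if "t \<in> addspan (tgen R M P)" for t
      using that addspan_keys tgen_keys[OF assms(1,2)] by blast
    show ?thesis using that
    proof (induction rule: addspan.induct)
      case zero
      then show ?case by (rule 0)
    next
      case (add u t)
      have kk: "supp (0 - t) \<subseteq> ?S" using kt[OF addspan_minus[OF addspan_incl[OF add(2)]]] by simp
      have "h (0 - t) = h 0 \<ominus>\<^bsub>Q\<^esub> h t" by (rule 3) (use tgen_keys[OF assms(1,2) add(2)] in auto)
      then have "h (0 - t) = \<zero>\<^bsub>Q\<^esub>" using g[OF add(2)] 0 by (simp add: a_minus_def)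
      moreover have "h (u - (0 - t)) = h u \<ominus>\<^bsub>Q\<^esub> h (0 - t)" by (rule 3[OF kt[OF add(1)] kk])
      ultimately show ?case using add by (simp add: a_minus_def)
    next
      case (diff u t)
      have "h (u - t) = h u \<ominus>\<^bsub>Q\<^esub> h t"
        by (rule 3[OF kt[OF diff(1)] tgen_keys[OF assms(1,2) diff(2)]])
      then show ?case using g[OF diff(2)] diff(3) by (simp add: a_minus_def)
    qed
  qed
  show thesis by (rule that[of h]) (use 0 1 2 3 4 in auto)
qed

lemma free_hull:
  fixes P (structure)
  assumes "module A P" "cdv A w p" "\<And>x. x \<in> carrier P \<Longrightarrow> w \<odot> x = \<zero> \<Longrightarrow> x = \<zero>"
    and "finite F" "F \<subseteq> carrier P"
  obtains E where "finite E" "E \<subseteq> carrier P"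
    "\<And>x. x \<in> F \<Longrightarrow> \<exists>a\<in>E \<rightarrow> carrier A. x = (\<Oplus>e\<in>E. a e \<odot> e)"
    "\<And>a e. a \<in> E \<rightarrow> carrier A \<Longrightarrow> (\<Oplus>e\<in>E. a e \<odot> e) = \<zero> \<Longrightarrow> e \<in> E \<Longrightarrow> a e = \<zero>\<^bsub>A\<^esub>"
proof -
  interpret A: cdv A w p by fact
  interpret P: module A P by fact
  define G where "G = (\<lambda>E. finite E \<and> E \<subseteq> carrier P \<and>
     (\<forall>x\<in>F. \<exists>a\<in>E \<rightarrow> carrier A. x = (\<Oplus>e\<in>E. a e \<odot> e)))"
  have "G F"
    unfolding G_def
  proof (intro conjI ballI)
    fix x assume x: "x \<in> F"
    let ?a = "\<lambda>e. if x = e then \<one>\<^bsub>A\<^esub> else \<zero>\<^bsub>A\<^esub>"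
    have "(\<Oplus>e\<in>F. ?a e \<odot> e) = (\<Oplus>e\<in>F. if x = e then e else \<zero>)"
      using assms(5) by (intro P.M.finsum_cong') auto
    also have "\<dots> = x" using assms(4,5) x by (intro P.M.add.finprod_singleton) auto
    finally show "\<exists>a\<in>F \<rightarrow> carrier A. x = (\<Oplus>e\<in>F. a e \<odot> e)"
      by (intro bexI[of _ ?a]) auto
  qed (use assms in auto)
  then obtain E where E: "G E" "\<And>E'. G E' \<Longrightarrow> card E \<le> card E'"
    using ex_has_least_nat[of G F card] by blast
  have fin: "finite E" "E \<subseteq> carrier P" using E(1) by (auto simp: G_def)
  have indep: "a e = \<zero>\<^bsub>A\<^esub>" if a: "a \<in> E \<rightarrow> carrier A" "(\<Oplus>e\<in>E. a e \<odot> e) = \<zero>" "e \<in> E" for a e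
  proof (rule ccontr)
    assume "a e \<noteq> \<zero>\<^bsub>A\<^esub>"
    then obtain n b e1 where b: "b \<in> E \<rightarrow> carrier A" "\<And>e. e \<in> E \<Longrightarrow> a e = w [^]\<^bsub>A\<^esub> (n::nat) \<otimes>\<^bsub>A\<^esub> b e"
      "e1 \<in> E" "\<not> cg A w 1 (b e1) \<zero>\<^bsub>A\<^esub>"
      using A.common_factor[OF fin(1) a(1) a(3)] by metis
    define S where "S = (\<Oplus>e\<in>E. b e \<odot> e)"
    have Sc: "S \<in> carrier P" unfolding S_def using b fin by (intro P.M.finsum_closed) auto
    have "w [^]\<^bsub>A\<^esub> n \<odot> S = (\<Oplus>e\<in>E. w [^]\<^bsub>A\<^esub> n \<odot> (b e \<odot> e))"
      unfolding S_def using b fin by (intro P.finsum_smult_ldistr) auto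
    also have "\<dots> = (\<Oplus>e\<in>E. a e \<odot> e)"
      proof (rule P.M.finsum_cong')
      fix i assume i: "i \<in> E"
      then have "b i \<in> carrier A" "i \<in> carrier P" using b(1) fin by auto
      then show "w [^]\<^bsub>A\<^esub> n \<odot> (b i \<odot> i) = a i \<odot> i"
        using b(2)[OF i] by (simp add: P.smult_assoc1)
    qed (use fin a(1) in auto)
    finally have wS: "w [^]\<^bsub>A\<^esub> n \<odot> S = \<zero>" using a(2) by simp
    have "w [^]\<^bsub>A\<^esub> k \<odot> S = \<zero> \<Longrightarrow> S = \<zero>" for k :: nat
    proof (induction k)
      case (Suc k)
      have "w \<odot> (w [^]\<^bsub>A\<^esub> k \<odot> S) = \<zero>"
        using Suc.prems Sc unfolding A.nat_pow_Suc2[OF A.w_closed] by (simp add: P.smult_assoc1)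
      then have "w [^]\<^bsub>A\<^esub> k \<odot> S = \<zero>" by (rule assms(3)[rotated]) (use Sc in auto)
      then show ?case by (rule Suc.IH)
    qed (use Sc in simp)
    then have S0: "S = \<zero>" using wS by blast
    obtain c where c: "c \<in> carrier A" "b e1 \<otimes>\<^bsub>A\<^esub> c = \<one>\<^bsub>A\<^esub>" using A.unit b by (metis Pi_mem)
    let ?E = "E - {e1}"
    have ins: "E = insert e1 ?E" using b by auto
    have split: "(\<Oplus>e\<in>E. f e) = f e1 \<oplus> (\<Oplus>e\<in>?E. f e)" if "f \<in> E \<rightarrow> carrier P" for f
      using that b fin by (subst ins, subst P.M.finsum_insert) auto
    define T where "T = (\<Oplus>e\<in>?E. b e \<odot> e)"
    have Tc: "T \<in> carrier P" unfolding T_def using b fin by (intro P.M.finsum_closed) auto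
    have e1c: "e1 \<in> carrier P" "b e1 \<in> carrier A" using b fin by auto
    have "b e1 \<odot> e1 \<oplus> T = \<zero>"
      using S0 b fin unfolding S_def T_def by (subst (asm) split) auto
    then have "b e1 \<odot> e1 = \<ominus> T" using e1c Tc P.M.minus_equality by (metis P.M.minus_minus P.smult_closed)
    then have "c \<odot> (b e1 \<odot> e1) = c \<odot> (\<ominus> T)" by simp
    moreover have "c \<odot> (b e1 \<odot> e1) = (b e1 \<otimes>\<^bsub>A\<^esub> c) \<odot> e1"
      using c e1c A.m_comm by (simp add: P.smult_assoc1[symmetric])
    moreover have "c \<odot> (\<ominus> T) = (\<ominus>\<^bsub>A\<^esub> c) \<odot> T"
      using c Tc by (simp add: P.smult_l_minus P.smult_r_minus)
    ultimately have e1: "e1 = (\<ominus>\<^bsub>A\<^esub> c) \<odot> T" using c e1c by simp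
    have "G ?E"
      unfolding G_def
    proof (intro conjI ballI)
      fix x assume "x \<in> F"
      then obtain d where d: "d \<in> E \<rightarrow> carrier A" "x = (\<Oplus>e\<in>E. d e \<odot> e)" using E(1) by (auto simp: G_def)
      have d1: "d e1 \<in> carrier A" using d b by auto
      have kc: "d e1 \<otimes>\<^bsub>A\<^esub> \<ominus>\<^bsub>A\<^esub> c \<in> carrier A" using d1 c by simp
      have bP: "b e \<odot> e \<in> carrier P" and dP: "d e \<odot> e \<in> carrier P" if "e \<in> E" for e
        using that b(1) d(1) fin by auto
      \<comment> \<open>The coefficients after replacing \<open>e1\<close> by - c times the
        combination \<open>T\<close> of the other generators.\<close>
      let ?d = "\<lambda>e. (d e1 \<otimes>\<^bsub>A\<^esub> \<ominus>\<^bsub>A\<^esub> c) \<otimes>\<^bsub>A\<^esub> b e \<oplus>\<^bsub>A\<^esub> d e"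
      have "x = d e1 \<odot> e1 \<oplus> (\<Oplus>e\<in>?E. d e \<odot> e)"
        unfolding d(2) using d fin by (intro split) auto
      also have "d e1 \<odot> e1 = (d e1 \<otimes>\<^bsub>A\<^esub> \<ominus>\<^bsub>A\<^esub> c) \<odot> T"
        using d1 c Tc by (subst e1) (simp add: P.smult_assoc1[symmetric])
      also have "\<dots> = (\<Oplus>e\<in>?E. (d e1 \<otimes>\<^bsub>A\<^esub> \<ominus>\<^bsub>A\<^esub> c) \<odot> (b e \<odot> e))"
        unfolding T_def using b fin d1 c by (intro P.finsum_smult_ldistr) auto
      also have "\<dots> \<oplus> (\<Oplus>e\<in>?E. d e \<odot> e) =
          (\<Oplus>e\<in>?E. (d e1 \<otimes>\<^bsub>A\<^esub> \<ominus>\<^bsub>A\<^esub> c) \<odot> (b e \<odot> e) \<oplus> d e \<odot> e)"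
        using kc bP dP by (intro P.M.finsum_addf[symmetric]) auto
      also have "\<dots> = (\<Oplus>e\<in>?E. ?d e \<odot> e)"
      proof (rule P.M.finsum_cong')
        fix e assume "e \<in> ?E"
        then have "e \<in> carrier P" "b e \<in> carrier A" "d e \<in> carrier A" using fin b d by auto
        then show "(d e1 \<otimes>\<^bsub>A\<^esub> \<ominus>\<^bsub>A\<^esub> c) \<odot> (b e \<odot> e) \<oplus> d e \<odot> e = ?d e \<odot> e"
          using d1 c by (simp add: P.smult_l_distr P.smult_assoc1)
      qed (use kc b(1) d(1) fin in blast)+
      finally show "\<exists>a\<in>?E \<rightarrow> carrier A. x = (\<Oplus>e\<in>?E. a e \<odot> e)"
      proof (intro bexI[of _ ?d])
        show "?d \<in> ?E \<rightarrow> carrier A"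
        proof
          fix e assume "e \<in> ?E"
          then have "b e \<in> carrier A" "d e \<in> carrier A" using b(1) d(1) by auto
          then show "?d e \<in> carrier A" using kc by simp
        qed
      qed
    qed (use fin in auto)
    then have "card E \<le> card ?E" by (rule E(2))
    then show False using b(3) fin(1) by (metis card_Diff1_less not_le)
  qed
  show thesis
  proof (rule that[OF fin])
    show "\<exists>a\<in>E \<rightarrow> carrier A. x = (\<Oplus>e\<in>E. a e \<odot> e)" if "x \<in> F" for x
      using E(1) that by (auto simp: G_def)
  qed (rule indep)
qed

lemma addspan_finite_support:
  assumes "clo R P" "u \<in> addspan (tgen R M P)"
  obtains F where "finite F" "F \<subseteq> carrier P"
    "\<And>P0. F \<subseteq> P0 \<Longrightarrow> P0 \<subseteq> carrier P \<Longrightarrow> u \<in> addspan (tgen R M (P\<lparr>carrier := P0\<rparr>))"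
proof -
  let ?Q = "\<lambda>u F. finite F \<and> F \<subseteq> carrier P \<and>
    (\<forall>P0. F \<subseteq> P0 \<longrightarrow> P0 \<subseteq> carrier P \<longrightarrow> u \<in> addspan (tgen R M (P\<lparr>carrier := P0\<rparr>)))"
  have g: "\<exists>F. finite F \<and> F \<subseteq> carrier P \<and> (\<forall>P0. F \<subseteq> P0 \<longrightarrow> P0 \<subseteq> carrier P \<longrightarrow> h \<in> tgen R M (P\<lparr>carrier := P0\<rparr>))"
    if "h \<in> tgen R M P" for h
    using that
  proof (cases rule: tgen_cases)
    case (l x y z)
    then show ?thesis using tgenI(1)[of x M y z "P\<lparr>carrier := _\<rparr>" R] by (intro exI[of _ "{z}"]) auto
  next
    case (r x y z)
    then show ?thesis using tgenI(2)[of x M y "P\<lparr>carrier := _\<rparr>" z R] by (intro exI[of _ "{y, z}"]) auto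
  next
    case (b a x z)
    then show ?thesis using tgenI(3)[of a R x M z "P\<lparr>carrier := _\<rparr>"] by (intro exI[of _ "{z}"]) auto
  qed
  have "\<exists>F. ?Q u F" using assms(2)
  proof (induction rule: addspan.induct)
    case zero
    then show ?case by (intro exI[of _ "{}"]) (auto intro: addspan.zero)
  next
    case (add x h)
    from add(3) obtain F where F: "?Q x F" ..
    from g[OF add(2)] obtain F' where F': "finite F' \<and> F' \<subseteq> carrier P \<and> (\<forall>P0. F' \<subseteq> P0 \<longrightarrow> P0 \<subseteq> carrier P \<longrightarrow> h \<in> tgen R M (P\<lparr>carrier := P0\<rparr>))" ..
    show ?case using F F' by (intro exI[of _ "F \<union> F'"]) (auto intro!: addspan.add)
  next
    case (diff x h)
    from diff(3) obtain F where F: "?Q x F" ..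
    from g[OF diff(2)] obtain F' where F': "finite F' \<and> F' \<subseteq> carrier P \<and> (\<forall>P0. F' \<subseteq> P0 \<longrightarrow> P0 \<subseteq> carrier P \<longrightarrow> h \<in> tgen R M (P\<lparr>carrier := P0\<rparr>))" ..
    show ?case using F F' by (intro exI[of _ "F \<union> F'"]) (auto intro!: addspan.diff)
  qed
  then show thesis using that by blast
qed

text \<open>A relation in a tensor product involves only finitely many elements of the torsion-free
  module, and these lie in a finitely generated free submodule.\<close>

lemma torsion_free_core:
  fixes P (structure)
  assumes "module A P" "cdv A w p" "\<And>x. x \<in> carrier P \<Longrightarrow> w \<odot> x = \<zero> \<Longrightarrow> x = \<zero>"
    and "module A M" "module A N" "f \<in> linear_maps A M N" "inj_on f (carrier M)"
    and z: "supp z \<subseteq> carrier M \<times> carrier P" "tpush f z \<in> addspan (tgen A N P)"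
  shows "z \<in> addspan (tgen A M P)"
proof -
  interpret A: cdv A w p by fact
  interpret P: module A P by fact
  interpret M: module A M by fact
  interpret N: module A N by fact
  \<comment> \<open>A derivation of the relation \<open>tpush f z\<close> uses finitely many
    elements of \<open>P\<close>. Together with the second components of \<open>z\<close> they lie
    in a free submodule \<open>P0\<close>, over which both the relation and \<open>z\<close> can be
    written.\<close>
  obtain F where F: "finite F" "F \<subseteq> carrier P"
    "\<And>P0. F \<subseteq> P0 \<Longrightarrow> P0 \<subseteq> carrier P \<Longrightarrow> tpush f z \<in> addspan (tgen A N (P\<lparr>carrier := P0\<rparr>))"
    by (rule addspan_finite_support[OF module_clo[OF assms(1)] z(2)]) (rule that)
  let ?F = "F \<union> snd ` supp z"
  have fF: "finite ?F" "?F \<subseteq> carrier P" using F z(1) by auto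
  obtain E where E: "finite E" "E \<subseteq> carrier P"
    "\<And>x. x \<in> ?F \<Longrightarrow> \<exists>a\<in>E \<rightarrow> carrier A. x = (\<Oplus>e\<in>E. a e \<odot> e)"
    "\<And>a e. a \<in> E \<rightarrow> carrier A \<Longrightarrow> (\<Oplus>e\<in>E. a e \<odot> e) = \<zero> \<Longrightarrow> e \<in> E \<Longrightarrow> a e = \<zero>\<^bsub>A\<^esub>"
    by (rule free_hull[OF assms(1,2) _ fF], erule assms(3), assumption, rule that)
  define lc where "lc = (\<lambda>a. \<Oplus>e\<in>E. a e \<odot> e)"
  define P0 where "P0 = lc ` (E \<rightarrow> carrier A)"
  let ?P0 = "P\<lparr>carrier := P0\<rparr>"
  have lcc: "lc a \<in> carrier P" if "a \<in> E \<rightarrow> carrier A" for a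
    unfolding lc_def using that E by (intro P.M.finsum_closed) auto
  then have P0: "P0 \<subseteq> carrier P" by (auto simp: P0_def)
  have F0: "?F \<subseteq> P0" using E(3) by (auto simp: P0_def lc_def)
  have lc_add: "lc a \<oplus> lc b = lc (\<lambda>e. a e \<oplus>\<^bsub>A\<^esub> b e)" if "a \<in> E \<rightarrow> carrier A" "b \<in> E \<rightarrow> carrier A" for a b
  proof -
    have "lc a \<oplus> lc b = (\<Oplus>e\<in>E. a e \<odot> e \<oplus> b e \<odot> e)"
      unfolding lc_def using that E by (intro P.M.finsum_addf[symmetric]) auto
    also have "\<dots> = lc (\<lambda>e. a e \<oplus>\<^bsub>A\<^esub> b e)" unfolding lc_def
    proof (rule P.M.finsum_cong')
      fix i assume "i \<in> E"
      then have "a i \<in> carrier A" "b i \<in> carrier A" "i \<in> carrier P" using that E by auto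
      then show "a i \<odot> i \<oplus> b i \<odot> i = (a i \<oplus>\<^bsub>A\<^esub> b i) \<odot> i" by (simp add: P.smult_l_distr)
    qed (use that E in auto)
    finally show ?thesis .
  qed
  have lc_smult: "c \<odot> lc a = lc (\<lambda>e. c \<otimes>\<^bsub>A\<^esub> a e)" if "a \<in> E \<rightarrow> carrier A" "c \<in> carrier A" for a c
  proof -
    have "c \<odot> lc a = (\<Oplus>e\<in>E. c \<odot> (a e \<odot> e))"
      unfolding lc_def using that E by (intro P.finsum_smult_ldistr) auto
    also have "\<dots> = lc (\<lambda>e. c \<otimes>\<^bsub>A\<^esub> a e)" unfolding lc_def
    proof (rule P.M.finsum_cong')
      fix i assume "i \<in> E"
      then have "a i \<in> carrier A" "i \<in> carrier P" using that E by auto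
      then show "c \<odot> (a i \<odot> i) = (c \<otimes>\<^bsub>A\<^esub> a i) \<odot> i" using that by (simp add: P.smult_assoc1)
    qed (use that E in auto)
    finally show ?thesis .
  qed
  have lc_inj: "a e = b e" if "a \<in> E \<rightarrow> carrier A" "b \<in> E \<rightarrow> carrier A" "lc a = lc b" "e \<in> E" for a b e
  proof -
    have m: "(\<lambda>e. \<ominus>\<^bsub>A\<^esub> \<one>\<^bsub>A\<^esub> \<otimes>\<^bsub>A\<^esub> b e) \<in> E \<rightarrow> carrier A" using that by auto
    have "lc (\<lambda>e. a e \<oplus>\<^bsub>A\<^esub> \<ominus>\<^bsub>A\<^esub> \<one>\<^bsub>A\<^esub> \<otimes>\<^bsub>A\<^esub> b e) = lc a \<oplus> (\<ominus>\<^bsub>A\<^esub> \<one>\<^bsub>A\<^esub>) \<odot> lc b"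
      using that lc_add[OF that(1) m] lc_smult[OF that(2)] by simp
    also have "\<dots> = \<zero>" using lcc[OF that(1)] that(3) by (simp add: P.smult_l_minus P.M.r_neg)
    finally have "a e \<oplus>\<^bsub>A\<^esub> \<ominus>\<^bsub>A\<^esub> \<one>\<^bsub>A\<^esub> \<otimes>\<^bsub>A\<^esub> b e = \<zero>\<^bsub>A\<^esub>"
      unfolding lc_def by (rule E(4)[rotated]) (use that in auto)
    moreover have "a e \<in> carrier A" "b e \<in> carrier A" using that by auto
    ultimately have "a e \<ominus>\<^bsub>A\<^esub> b e = \<zero>\<^bsub>A\<^esub>" "a e \<in> carrier A" "b e \<in> carrier A"
      by (simp_all add: a_minus_def A.l_minus)
    then show ?thesis by simp
  qed
  define co where "co = (\<lambda>x. SOME a. a \<in> E \<rightarrow> carrier A \<and> lc a = x)"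
  have co: "co x \<in> E \<rightarrow> carrier A" "lc (co x) = x" if "x \<in> P0" for x
    using someI_ex[of "\<lambda>a. a \<in> E \<rightarrow> carrier A \<and> lc a = x"] that by (auto simp: co_def P0_def)
  have coc: "co x e \<in> carrier A" if "x \<in> P0" "e \<in> E" for x e using co(1)[OF that(1)] that(2) by auto
  have clo0: "clo A ?P0"
    unfolding clo_def
  proof (intro conjI ballI)
    fix x y assume "x \<in> carrier ?P0" "y \<in> carrier ?P0"
    then obtain a b where "a \<in> E \<rightarrow> carrier A" "b \<in> E \<rightarrow> carrier A" "x = lc a" "y = lc b" by (auto simp: P0_def)
    then show "x \<oplus>\<^bsub>?P0\<^esub> y \<in> carrier ?P0" using lc_add by (auto simp: P0_def intro!: image_eqI)
  next
    fix c x assume "c \<in> carrier A" "x \<in> carrier ?P0"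
    moreover from this obtain a where "a \<in> E \<rightarrow> carrier A" "x = lc a" by (auto simp: P0_def)
    ultimately show "c \<odot>\<^bsub>?P0\<^esub> x \<in> carrier ?P0" using lc_smult by (auto simp: P0_def intro!: image_eqI)
  qed
  have add0: "x \<oplus> y \<in> P0" "co (x \<oplus> y) e = co x e \<oplus>\<^bsub>A\<^esub> co y e" if "x \<in> P0" "y \<in> P0" "e \<in> E" for x y e
  proof -
    show 1: "x \<oplus> y \<in> P0" using clo0 that unfolding clo_def by simp
    show "co (x \<oplus> y) e = co x e \<oplus>\<^bsub>A\<^esub> co y e"
      by (rule lc_inj) (use co[OF 1] co[OF that(1)] co[OF that(2)] lc_add[of "co x" "co y"] that in auto)
  qed
  have smult0: "c \<odot> x \<in> P0" "co (c \<odot> x) e = c \<otimes>\<^bsub>A\<^esub> co x e" if "c \<in> carrier A" "x \<in> P0" "e \<in> E" for c x e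
  proof -
    show 1: "c \<odot> x \<in> P0" using clo0 that unfolding clo_def by simp
    show "co (c \<odot> x) e = c \<otimes>\<^bsub>A\<^esub> co x e"
      by (rule lc_inj) (use co[OF 1] co[OF that(2)] lc_smult[of "co x" c] that in auto)
  qed
  \<comment> \<open>For a basis element e, the map sending m \<otimes> x to the e-th coordinate of x
    times m is well defined over \<open>P0\<close>. It is required for \<open>M\<close> and for
    \<open>N\<close>, whence the variable module \<open>L\<close>.\<close>
  have hom: "\<exists>h. (\<forall>u. supp u \<subseteq> carrier L \<times> P0 \<longrightarrow> h u \<in> carrier L) \<and> h 0 = \<zero>\<^bsub>L\<^esub> \<and>
     (\<forall>m x. m \<in> carrier L \<longrightarrow> x \<in> P0 \<longrightarrow> h (frag_of (m, x)) = co x e \<odot>\<^bsub>L\<^esub> m) \<and>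
     (\<forall>u v. supp u \<subseteq> carrier L \<times> P0 \<longrightarrow> supp v \<subseteq> carrier L \<times> P0 \<longrightarrow> h (u - v) = h u \<ominus>\<^bsub>L\<^esub> h v) \<and>
     (\<forall>u. u \<in> addspan (tgen A L ?P0) \<longrightarrow> h u = \<zero>\<^bsub>L\<^esub>)" if "module A L" "e \<in> E" for L :: "('a, 'z, 'y) module_scheme" and e
  proof -
    interpret L: module A L by fact
    have s: "carrier ?P0 = P0" by simp
    have 1: "co x e \<odot>\<^bsub>L\<^esub> m \<in> carrier L" if "m \<in> carrier L" "x \<in> P0" for m x
      using that coc \<open>e \<in> E\<close> by auto
    have 2: "co x e \<odot>\<^bsub>L\<^esub> (m \<oplus>\<^bsub>L\<^esub> m') = co x e \<odot>\<^bsub>L\<^esub> m \<oplus>\<^bsub>L\<^esub> co x e \<odot>\<^bsub>L\<^esub> m'" if "m \<in> carrier L" "m' \<in> carrier L" "x \<in> P0" for m m' x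
      using that coc \<open>e \<in> E\<close> by (auto simp: L.smult_r_distr)
    have 3: "co (x \<oplus>\<^bsub>?P0\<^esub> y) e \<odot>\<^bsub>L\<^esub> m = co x e \<odot>\<^bsub>L\<^esub> m \<oplus>\<^bsub>L\<^esub> co y e \<odot>\<^bsub>L\<^esub> m" if "m \<in> carrier L" "x \<in> P0" "y \<in> P0" for m x y
      using that coc add0 \<open>e \<in> E\<close> by (auto simp: L.smult_l_distr)
    have 4: "co x e \<odot>\<^bsub>L\<^esub> (a \<odot>\<^bsub>L\<^esub> m) = co (a \<odot>\<^bsub>?P0\<^esub> x) e \<odot>\<^bsub>L\<^esub> m" if "a \<in> carrier A" "m \<in> carrier L" "x \<in> P0" for a m x
    proof -
      have "co x e \<in> carrier A" using that coc \<open>e \<in> E\<close> by auto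
      then show ?thesis using that smult0 \<open>e \<in> E\<close> A.m_comm by (simp add: L.smult_assoc1[symmetric])
    qed
    show ?thesis
      by (rule tensor_eval[OF module_clo[OF that(1)] clo0 L.M.abelian_group_axioms, of "\<lambda>m x. co x e \<odot>\<^bsub>L\<^esub> m", unfolded s, OF 1 2 3 4];
          (assumption | (elim that; fail))?) blast
  qed
  have "\<exists>h. \<forall>e\<in>E. (\<forall>u. supp u \<subseteq> carrier M \<times> P0 \<longrightarrow> h e u \<in> carrier M) \<and> h e 0 = \<zero>\<^bsub>M\<^esub> \<and>
     (\<forall>m x. m \<in> carrier M \<longrightarrow> x \<in> P0 \<longrightarrow> h e (frag_of (m, x)) = co x e \<odot>\<^bsub>M\<^esub> m) \<and>
     (\<forall>u v. supp u \<subseteq> carrier M \<times> P0 \<longrightarrow> supp v \<subseteq> carrier M \<times> P0 \<longrightarrow> h e (u - v) = h e u \<ominus>\<^bsub>M\<^esub> h e v)"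
  proof (rule bchoice, rule ballI)
    fix e assume "e \<in> E"
    from hom[OF assms(4) this] show "\<exists>h. (\<forall>u. supp u \<subseteq> carrier M \<times> P0 \<longrightarrow> h u \<in> carrier M) \<and> h 0 = \<zero>\<^bsub>M\<^esub> \<and>
     (\<forall>m x. m \<in> carrier M \<longrightarrow> x \<in> P0 \<longrightarrow> h (frag_of (m, x)) = co x e \<odot>\<^bsub>M\<^esub> m) \<and>
     (\<forall>u v. supp u \<subseteq> carrier M \<times> P0 \<longrightarrow> supp v \<subseteq> carrier M \<times> P0 \<longrightarrow> h (u - v) = h u \<ominus>\<^bsub>M\<^esub> h v)"
      by (elim exE conjE) (intro exI conjI; assumption)
  qed
  then obtain h where hh: "\<forall>e\<in>E. (\<forall>u. supp u \<subseteq> carrier M \<times> P0 \<longrightarrow> h e u \<in> carrier M) \<and> h e 0 = \<zero>\<^bsub>M\<^esub> \<and>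
     (\<forall>m x. m \<in> carrier M \<longrightarrow> x \<in> P0 \<longrightarrow> h e (frag_of (m, x)) = co x e \<odot>\<^bsub>M\<^esub> m) \<and>
     (\<forall>u v. supp u \<subseteq> carrier M \<times> P0 \<longrightarrow> supp v \<subseteq> carrier M \<times> P0 \<longrightarrow> h e (u - v) = h e u \<ominus>\<^bsub>M\<^esub> h e v)" ..
  have h: "\<And>e u. e \<in> E \<Longrightarrow> supp u \<subseteq> carrier M \<times> P0 \<Longrightarrow> h e u \<in> carrier M"
    "\<And>e. e \<in> E \<Longrightarrow> h e 0 = \<zero>\<^bsub>M\<^esub>"
    "\<And>e m x. e \<in> E \<Longrightarrow> m \<in> carrier M \<Longrightarrow> x \<in> P0 \<Longrightarrow> h e (frag_of (m, x)) = co x e \<odot>\<^bsub>M\<^esub> m"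
    "\<And>e u v. e \<in> E \<Longrightarrow> supp u \<subseteq> carrier M \<times> P0 \<Longrightarrow> supp v \<subseteq> carrier M \<times> P0 \<Longrightarrow> h e (u - v) = h e u \<ominus>\<^bsub>M\<^esub> h e v"
    using hh by simp_all
  have z0: "supp z \<subseteq> carrier M \<times> P0" using z(1) F0 by fastforce
  have fM: "f m \<in> carrier N" if "m \<in> carrier M" for m using assms(6) that by (auto simp: linear_maps_def)
  have f_add: "f (x \<oplus>\<^bsub>M\<^esub> y) = f x \<oplus>\<^bsub>N\<^esub> f y" if "x \<in> carrier M" "y \<in> carrier M" for x y
    using assms(6) that by (auto simp: linear_maps_def)
  have f_smult: "f (a \<odot>\<^bsub>M\<^esub> x) = a \<odot>\<^bsub>N\<^esub> f x" if "x \<in> carrier M" "a \<in> carrier A" for x a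
    using assms(6) that by (auto simp: linear_maps_def)
  have f0: "f \<zero>\<^bsub>M\<^esub> = \<zero>\<^bsub>N\<^esub>" using f_smult[of "\<zero>\<^bsub>M\<^esub>" "\<zero>\<^bsub>A\<^esub>"] fM by simp
  have f_minus: "f (x \<ominus>\<^bsub>M\<^esub> y) = f x \<ominus>\<^bsub>N\<^esub> f y" if "x \<in> carrier M" "y \<in> carrier M" for x y
  proof -
    have "f (\<ominus>\<^bsub>M\<^esub> y) = f ((\<ominus>\<^bsub>A\<^esub> \<one>\<^bsub>A\<^esub>) \<odot>\<^bsub>M\<^esub> y)" using that by (simp add: M.smult_l_minus)
    also have "\<dots> = \<ominus>\<^bsub>N\<^esub> f y" using that fM by (subst f_smult) (auto simp: N.smult_l_minus)
    finally show ?thesis using that f_add by (simp add: a_minus_def)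
  qed
  \<comment> \<open>The coordinate maps commute with \<open>f\<close>. Those of
    \<open>tpush f z\<close> vanish because it is a relation over \<open>P0\<close>, so injectivity
    of \<open>f\<close> makes those of \<open>z\<close> vanish.\<close>
  have hz: "h e z = \<zero>\<^bsub>M\<^esub>" if e: "e \<in> E" for e
  proof -
    from hom[OF assms(5) e] obtain k where kk: "(\<forall>u. supp u \<subseteq> carrier N \<times> P0 \<longrightarrow> k u \<in> carrier N) \<and> k 0 = \<zero>\<^bsub>N\<^esub> \<and>
     (\<forall>m x. m \<in> carrier N \<longrightarrow> x \<in> P0 \<longrightarrow> k (frag_of (m, x)) = co x e \<odot>\<^bsub>N\<^esub> m) \<and>
     (\<forall>u v. supp u \<subseteq> carrier N \<times> P0 \<longrightarrow> supp v \<subseteq> carrier N \<times> P0 \<longrightarrow> k (u - v) = k u \<ominus>\<^bsub>N\<^esub> k v) \<and>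
     (\<forall>u. u \<in> addspan (tgen A N ?P0) \<longrightarrow> k u = \<zero>\<^bsub>N\<^esub>)" ..
    have k: "\<And>u. supp u \<subseteq> carrier N \<times> P0 \<Longrightarrow> k u \<in> carrier N"
      "k 0 = \<zero>\<^bsub>N\<^esub>"
      "\<And>m x. m \<in> carrier N \<Longrightarrow> x \<in> P0 \<Longrightarrow> k (frag_of (m, x)) = co x e \<odot>\<^bsub>N\<^esub> m"
      "\<And>u v. supp u \<subseteq> carrier N \<times> P0 \<Longrightarrow> supp v \<subseteq> carrier N \<times> P0 \<Longrightarrow> k (u - v) = k u \<ominus>\<^bsub>N\<^esub> k v"
      "\<And>u. u \<in> addspan (tgen A N ?P0) \<Longrightarrow> k u = \<zero>\<^bsub>N\<^esub>" using kk by simp_all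
    have "supp z \<subseteq> carrier M \<times> P0 \<and> supp (tpush f z) \<subseteq> carrier N \<times> P0 \<and> k (tpush f z) = f (h e z)"
      using z0
    proof (induction z rule: frag_induction)
      case zero
      then show ?case using k h e f0 by simp
    next
      case (one x)
      obtain m y where x: "x = (m, y)" by (cases x)
      then show ?case using k h e one fM f_smult coc by auto
    next
      case (diff a b)
      show ?case using keys_diff[of a b] keys_diff[of "tpush f a" "tpush f b"] diff k(4) h(4)[OF e] h(1)[OF e] f_minus
        by (auto simp: frag_extend_diff)
    qed
    moreover have "k (tpush f z) = \<zero>\<^bsub>N\<^esub>" using F(3)[of P0] F0 P0 by (intro k(5)) auto
    ultimately have "f (h e z) = f \<zero>\<^bsub>M\<^esub>" using f0 by simp
    then show ?thesis using assms(7) h(1)[OF e z0] by (auto dest: inj_onD)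
  qed
  \<comment> \<open>Modulo relations, a formal sum equals its expansion in the basis, with its
    coordinates as left components.\<close>
  have cong: "supp u \<subseteq> carrier M \<times> P0 \<Longrightarrow> supp u \<subseteq> carrier M \<times> P0 \<and> u - (\<Sum>e\<in>E. frag_of (h e u, e)) \<in> addspan (tgen A M P)" for u
  proof (induction u rule: frag_induction)
    case zero
    have "frag_of (\<zero>\<^bsub>M\<^esub>, e) \<in> addspan (tgen A M P)" if "e \<in> E" for e
    proof -
      have "frag_of (\<zero>\<^bsub>M\<^esub> \<oplus>\<^bsub>M\<^esub> \<zero>\<^bsub>M\<^esub>, e) - frag_of (\<zero>\<^bsub>M\<^esub>, e) - frag_of (\<zero>\<^bsub>M\<^esub>, e) \<in> addspan (tgen A M P)"
        using that E(2) by (intro addspan_incl tgenI) auto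
      then show ?thesis using addspan_minus by fastforce
    qed
    then have "(\<Sum>e\<in>E. frag_of (h e 0, e)) \<in> addspan (tgen A M P)"
      using E(1) h(2)
    proof -
      assume a: "\<And>e. e \<in> E \<Longrightarrow> frag_of (\<zero>\<^bsub>M\<^esub>, e) \<in> addspan (tgen A M P)"
      have "E' \<subseteq> E \<Longrightarrow> (\<Sum>e\<in>E'. frag_of (h e 0, e)) \<in> addspan (tgen A M P)" if "finite E'" for E'
        using that by (induction E') (auto intro!: addspan.zero addspan_add simp: h(2) a)
      then show ?thesis using E(1) by blast
    qed
    then show ?case using addspan_minus by fastforce
  next
    case (one x)
    then obtain m y where x: "x = (m, y)" "m \<in> carrier M" "y \<in> P0" by auto
    have he: "h e (frag_of x) = co y e \<odot>\<^bsub>M\<^esub> m" if "e \<in> E" for e using h(3) that x by simp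
    have "frag_of (m, \<Oplus>e\<in>E'. co y e \<odot> e) - (\<Sum>e\<in>E'. frag_of (co y e \<odot>\<^bsub>M\<^esub> m, e)) \<in> addspan (tgen A M P)"
      if "finite E'" "E' \<subseteq> E" for E'
      using that
    proof (induction E')
      case empty
      have "frag_of (m, \<zero> \<oplus> \<zero>) - frag_of (m, \<zero>) - frag_of (m, \<zero>) \<in> addspan (tgen A M P)"
        using x by (intro addspan_incl tgenI) auto
      then show ?case using addspan_minus by fastforce
    next
      case (insert e E')
      let ?S = "\<Oplus>e\<in>E'. co y e \<odot> e"
      have cE: "co y e \<odot> e \<in> carrier P" if "e \<in> E" for e using coc[OF x(3) that] that E(2) by auto
      have ce: "co y e \<in> carrier A" "e \<in> carrier P" using insert E(2) coc x by auto
      have S: "?S \<in> carrier P" using insert.prems cE by (intro P.M.finsum_closed) auto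
      have 1: "(\<Oplus>e\<in>insert e E'. co y e \<odot> e) = co y e \<odot> e \<oplus> ?S"
        using insert cE by (intro P.M.finsum_insert) auto
      have 2: "frag_of (m, co y e \<odot> e \<oplus> ?S) - frag_of (m, co y e \<odot> e) - frag_of (m, ?S) \<in> addspan (tgen A M P)"
        using x S ce by (intro addspan_incl tgenI) auto
      have 3: "frag_of (co y e \<odot>\<^bsub>M\<^esub> m, e) - frag_of (m, co y e \<odot> e) \<in> addspan (tgen A M P)"
        using x ce by (intro addspan_incl tgenI) auto
      have 4: "frag_of (m, ?S) - (\<Sum>e\<in>E'. frag_of (co y e \<odot>\<^bsub>M\<^esub> m, e)) \<in> addspan (tgen A M P)"
        using insert by auto
      from addspan_add[OF addspan_diff[OF 2 3] 4] show ?case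
        using insert by (simp add: 1 algebra_simps)
    qed
    from this[OF E(1)] have "frag_of (m, lc (co y)) - (\<Sum>e\<in>E. frag_of (co y e \<odot>\<^bsub>M\<^esub> m, e)) \<in> addspan (tgen A M P)"
      by (simp add: lc_def)
    then show ?case using co(2)[OF x(3)] he x by simp
  next
    case (diff a b)
    have ab: "h e a \<in> carrier M" "h e b \<in> carrier M" "h e (a - b) = h e a \<ominus>\<^bsub>M\<^esub> h e b" if "e \<in> E" for e
      using diff h(1)[OF that] h(4)[OF that] by auto
    have "(\<Sum>e\<in>E'. frag_of (h e a, e)) - (\<Sum>e\<in>E'. frag_of (h e b, e)) - (\<Sum>e\<in>E'. frag_of (h e (a - b), e)) \<in> addspan (tgen A M P)"
      if "finite E'" "E' \<subseteq> E" for E'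
      using that
    proof (induction E')
      case empty
      then show ?case by (simp add: addspan.zero)
    next
      case (insert e E')
      have e: "e \<in> E" "e \<in> carrier P" using insert E(2) by auto
      have "frag_of (h e (a - b) \<oplus>\<^bsub>M\<^esub> h e b, e) - frag_of (h e (a - b), e) - frag_of (h e b, e) \<in> addspan (tgen A M P)"
        using ab e by (intro addspan_incl tgenI) auto
      moreover have "h e (a - b) \<oplus>\<^bsub>M\<^esub> h e b = h e a"
        using ab[OF e(1)] by (simp add: a_minus_def M.M.a_assoc M.M.l_neg)
      ultimately have "frag_of (h e a, e) - frag_of (h e (a - b), e) - frag_of (h e b, e) \<in> addspan (tgen A M P)" by simp
      from addspan_add[OF this insert.IH] show ?case using insert by (simp add: algebra_simps)
    qed
    from this[OF E(1) order_refl] have "(\<Sum>e\<in>E. frag_of (h e a, e)) - (\<Sum>e\<in>E. frag_of (h e b, e)) - (\<Sum>e\<in>E. frag_of (h e (a - b), e)) \<in> addspan (tgen A M P)" .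
    moreover have "a - (\<Sum>e\<in>E. frag_of (h e a, e)) - (b - (\<Sum>e\<in>E. frag_of (h e b, e))) \<in> addspan (tgen A M P)"
      by (rule addspan_diff) (use diff in blast)+
    ultimately have "(a - (\<Sum>e\<in>E. frag_of (h e a, e)) - (b - (\<Sum>e\<in>E. frag_of (h e b, e)))) +
      ((\<Sum>e\<in>E. frag_of (h e a, e)) - (\<Sum>e\<in>E. frag_of (h e b, e)) - (\<Sum>e\<in>E. frag_of (h e (a - b), e))) \<in> addspan (tgen A M P)"
      using addspan_add by blast
    then show ?case using diff keys_diff[of a b] by (auto simp add: algebra_simps)
  qed
  \<comment> \<open>Both \<open>z\<close> and 0 have zero coordinates, hence the same expansion;
    subtracting the two congruences leaves \<open>z\<close>.\<close>
  have "0 - (\<Sum>e\<in>E. frag_of (h e 0, e)) \<in> addspan (tgen A M P)" using cong[of 0] by simp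
  moreover have "(\<Sum>e\<in>E. frag_of (h e z, e)) = (\<Sum>e\<in>E. frag_of (h e 0, e))" using hz h(2) by simp
  ultimately have "z - (\<Sum>e\<in>E. frag_of (h e z, e)) - (0 - (\<Sum>e\<in>E. frag_of (h e z, e))) \<in> addspan (tgen A M P)"
    using cong[OF z0] by - (rule addspan_diff; simp)
  then show ?thesis by simp
qed

lemma torsion_free_imp_flat:
  assumes "module A P" "cdv A w p" "\<And>x. x \<in> carrier P \<Longrightarrow> w \<odot>\<^bsub>P\<^esub> x = \<zero>\<^bsub>P\<^esub> \<Longrightarrow> x = \<zero>\<^bsub>P\<^esub>"
  shows "flat A P"
  unfolding flat_iff using assms torsion_free_core[OF assms] by blast

text \<open>Flatness is tested on multiplication by \<open>w\<close> from \<open>A\<close> to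
  itself. It sends 1 \<otimes> x to w \<otimes> x = 1 \<otimes> w x = 0, so 1 \<otimes> x vanishes,
  and scalar multiplication carries this to \<open>x\<close>.\<close>

lemma flat_imp_torsion_free:
  assumes "flat A P" "cdv A w p" "x \<in> carrier P" "w \<odot>\<^bsub>P\<^esub> x = \<zero>\<^bsub>P\<^esub>"
  shows "x = \<zero>\<^bsub>P\<^esub>"
proof -
  interpret A: cdv A w p by fact
  interpret P: module A P using assms(1) by (simp add: flat_def)
  define M :: "('a, 'a) module" where "M = \<lparr>carrier = carrier A, monoid.mult = (\<otimes>\<^bsub>A\<^esub>), one = \<one>\<^bsub>A\<^esub>,
      ring.zero = \<zero>\<^bsub>A\<^esub>, ring.add = (\<oplus>\<^bsub>A\<^esub>), smult = (\<otimes>\<^bsub>A\<^esub>)\<rparr>"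
  have M_simps: "carrier M = carrier A" "ring.add M = ring.add A" "ring.zero M = ring.zero A" "smult M = monoid.mult A"
    by (simp_all add: M_def)
  have M: "module A M"
  proof (rule moduleI)
    show "abelian_group M"
      by (rule abelian_groupI) (auto simp: M_simps A.a_assoc A.a_comm A.a_lcomm intro: bexI[of _ "\<ominus>\<^bsub>A\<^esub> _"] A.l_neg)
  qed (auto simp: M_simps A.l_distr A.r_distr A.m_assoc A.cring_axioms)
  define f where "f = (\<lambda>a. w \<otimes>\<^bsub>A\<^esub> a)"
  have f: "f \<in> linear_maps A M M"
    by (auto simp: linear_maps_def M_simps f_def A.r_distr A.m_lcomm)
  have inj: "inj_on f (carrier M)" unfolding f_def M_simps by (rule inj_onI) (rule A.cancel_w)
  let ?z = "frag_of (\<one>\<^bsub>A\<^esub>, x)"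
  have "frag_of (w \<odot>\<^bsub>M\<^esub> \<one>\<^bsub>A\<^esub>, x) - frag_of (\<one>\<^bsub>A\<^esub>, w \<odot>\<^bsub>P\<^esub> x) \<in> addspan (tgen A M P)"
    using assms by (intro addspan_incl tgenI) (auto simp: M_simps)
  \<comment> \<open>The generator belonging to a pair with second component zero is not the zero
    formal sum; this relation cancels it.\<close>
  moreover have "frag_of (\<one>\<^bsub>A\<^esub>, \<zero>\<^bsub>P\<^esub> \<oplus>\<^bsub>P\<^esub> \<zero>\<^bsub>P\<^esub>) - frag_of (\<one>\<^bsub>A\<^esub>, \<zero>\<^bsub>P\<^esub>) - frag_of (\<one>\<^bsub>A\<^esub>, \<zero>\<^bsub>P\<^esub>) \<in> addspan (tgen A M P)"
    by (intro addspan_incl tgenI) (auto simp: M_simps)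
  ultimately have "frag_of (w \<odot>\<^bsub>M\<^esub> \<one>\<^bsub>A\<^esub>, x) - frag_of (\<one>\<^bsub>A\<^esub>, w \<odot>\<^bsub>P\<^esub> x) - (frag_of (\<one>\<^bsub>A\<^esub>, \<zero>\<^bsub>P\<^esub> \<oplus>\<^bsub>P\<^esub> \<zero>\<^bsub>P\<^esub>) - frag_of (\<one>\<^bsub>A\<^esub>, \<zero>\<^bsub>P\<^esub>) - frag_of (\<one>\<^bsub>A\<^esub>, \<zero>\<^bsub>P\<^esub>)) \<in> addspan (tgen A M P)"
    by (rule addspan_diff)
  then have "tpush f ?z \<in> addspan (tgen A M P)"
    using assms(4) by (simp add: f_def M_simps)
  moreover have "supp ?z \<subseteq> carrier M \<times> carrier P" using assms(3) by (simp add: M_simps)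
  ultimately have "?z \<in> addspan (tgen A M P)"
    using assms(1) M f inj unfolding flat_iff by blast
  moreover obtain h where "\<And>m x. m \<in> carrier M \<Longrightarrow> x \<in> carrier P \<Longrightarrow> h (frag_of (m, x)) = m \<odot>\<^bsub>P\<^esub> x"
    "\<And>u. u \<in> addspan (tgen A M P) \<Longrightarrow> h u = \<zero>\<^bsub>P\<^esub>"
    by (rule tensor_eval[OF module_clo[OF M] module_clo[OF P.module_axioms] P.M.abelian_group_axioms, of "\<lambda>m x. m \<odot>\<^bsub>P\<^esub> x"])
      (auto simp: M_simps P.smult_r_distr P.smult_l_distr A.m_comm P.smult_assoc1[symmetric])
  ultimately show ?thesis using assms(3) by (metis A.one_closed P.smult_one M_simps(1))
qed

section \<open>Residually perfect algebras in elementary terms\<close>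

lemma (in cring) cg_zero_iff_PIdl:
  assumes "w \<in> carrier R" shows "cg R w 1 x \<zero> \<longleftrightarrow> x \<in> PIdl w"
  using assms by (auto simp: cg_def cgenideal_def m_comm)

lemma (in cring) ideal_power_PIdl:
  assumes w: "w \<in> carrier R" shows "ideal_power R (PIdl w) n = {x. cg R w n x \<zero>}"
proof (induction n)
  case 0
  then show ?case using w cg_0 by (auto dest: cg_carrier)
next
  case (Suc n)
  show ?case
  proof
    show "ideal_power R (PIdl w) (Suc n) \<subseteq> {x. cg R w (Suc n) x \<zero>}"
    proof
      fix x assume "x \<in> ideal_power R (PIdl w) (Suc n)"
      then have "x \<in> ideal_prod R (PIdl w) {x. cg R w n x \<zero>}" using Suc by simp
      then show "x \<in> {x. cg R w (Suc n) x \<zero>}"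
      proof (induction rule: ideal_prod.induct)
        case (prod i j)
        then obtain a where a: "a \<in> carrier R" "i = a \<otimes> w" by (auto simp: cgenideal_def)
        have "cg R w (1 + n) (w [^] (1::nat) \<otimes> (a \<otimes> j)) (w [^] (1::nat) \<otimes> \<zero>)"
          using prod a w by (intro cg_mult_pow cg_shift_zero) auto
        moreover have c: "a \<in> carrier R" "j \<in> carrier R" using a prod by (auto dest: cg_carrier)
        have "w \<otimes> (a \<otimes> j) = a \<otimes> w \<otimes> j" by (use c w in \<open>simp add: ring_nf\<close>)
        then have "w [^] (1::nat) \<otimes> (a \<otimes> j) = i \<otimes> j" using a w by simp
        ultimately show ?case using w by simp
      next
        case (sum s1 s2)
        then show ?case using cg_add[of w "Suc n" s1 \<zero> s2 \<zero>] w by simp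
      qed
    qed
    show "{x. cg R w (Suc n) x \<zero>} \<subseteq> ideal_power R (PIdl w) (Suc n)"
    proof
      fix x assume "x \<in> {x. cg R w (Suc n) x \<zero>}"
      then obtain z where z: "z \<in> carrier R" "x = w [^] (Suc n) \<otimes> z" using cg_zeroE w by blast
      then have "x = w \<otimes> (w [^] n \<otimes> z)" using w unfolding nat_pow_Suc2[OF w] by (simp add: m_assoc)
      moreover have "w \<in> PIdl w" using w by (rule cgenideal_self)
      moreover have "w [^] n \<otimes> z \<in> ideal_power R (PIdl w) n" using Suc z w cg_multiple by auto
      ultimately show "x \<in> ideal_power R (PIdl w) (Suc n)" by (auto intro: ideal_prod.prod)
    qed
  qed
qed

lemma (in cring) complete_separated_iff:
  assumes w: "w \<in> carrier R"
  shows "complete_separated R (PIdl w) \<longleftrightarrow>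
    (\<forall>f. (\<forall>n. cg R w n (f (Suc n)) (f n)) \<longrightarrow> (\<exists>y. \<forall>n. cg R w n y (f n))) \<and>
    (\<forall>x. (\<forall>n. cg R w n x \<zero>) \<longrightarrow> x = \<zero>)" (is "_ \<longleftrightarrow> ?C \<and> ?S")
proof -
  have 1: "(\<forall>n. f n \<in> carrier R \<and> f (Suc n) \<ominus> f n \<in> ideal_power R (PIdl w) n) \<longleftrightarrow> (\<forall>n. cg R w n (f (Suc n)) (f n))" for f
  proof (intro iffI allI conjI)
    fix n
    assume a: "\<forall>n. cg R w n (f (Suc n)) (f n)"
    have "f (Suc n) \<in> carrier R" and c: "f n \<in> carrier R" using a by (auto dest: cg_carrier)
    then show "f (Suc n) \<ominus> f n \<in> ideal_power R (PIdl w) n"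
      unfolding ideal_power_PIdl[OF w] using cg_diff_iff[OF _ _ w] a by simp
    show "f n \<in> carrier R" by (rule c)
  next
    fix n
    assume "\<forall>n. f n \<in> carrier R \<and> f (Suc n) \<ominus> f n \<in> ideal_power R (PIdl w) n"
    then have "f (Suc n) \<in> carrier R" "f n \<in> carrier R" "cg R w n (f (Suc n) \<ominus> f n) \<zero>"
      unfolding ideal_power_PIdl[OF w] by blast+
    then show "cg R w n (f (Suc n)) (f n)" using cg_diff_iff[OF _ _ w] by simp
  qed
  have 2: "y \<in> carrier R \<and> (\<forall>n. y \<ominus> f n \<in> ideal_power R (PIdl w) n) \<longleftrightarrow> (\<forall>n. cg R w n y (f n))"
    if "\<And>n. f n \<in> carrier R" for f y
  proof -
    have "y \<in> carrier R \<Longrightarrow> cg R w n (y \<ominus> f n) \<zero> \<longleftrightarrow> cg R w n y (f n)" for n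
      using cg_diff_iff[OF _ that w] .
    moreover have "cg R w n y (f n) \<Longrightarrow> y \<in> carrier R" for n by (rule cg_carrier)
    ultimately show ?thesis unfolding ideal_power_PIdl[OF w] by blast
  qed
  have "complete_separated R (PIdl w) \<longleftrightarrow>
    (\<forall>f. (\<forall>n. cg R w n (f (Suc n)) (f n)) \<longrightarrow> (\<exists>!y. \<forall>n. cg R w n y (f n)))"
  proof -
    have 3: "(\<exists>!y. y \<in> carrier R \<and> (\<forall>n. y \<ominus> f n \<in> ideal_power R (PIdl w) n)) \<longleftrightarrow> (\<exists>!y. \<forall>n. cg R w n y (f n))"
      if "\<forall>n. cg R w n (f (Suc n)) (f n)" for f
    proof -
      have "f n \<in> carrier R" for n by (rule cg_carrier(2)[OF that[rule_format]])
      then show ?thesis by (simp only: 2)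
    qed
    show ?thesis unfolding complete_separated_def 1
      by (rule all_cong1, rule imp_cong[OF refl], rule 3)
  qed
  also have "\<dots> \<longleftrightarrow> ?C \<and> ?S"
  proof
    assume a: "\<forall>f. (\<forall>n. cg R w n (f (Suc n)) (f n)) \<longrightarrow> (\<exists>!y. \<forall>n. cg R w n y (f n))"
    have ?S
    proof (intro allI impI)
      fix x assume x: "\<forall>n. cg R w n x \<zero>"
      have "\<forall>n. cg R w n \<zero> \<zero>" using w by (simp add: cg_refl)
      then have "\<exists>!y. \<forall>n. cg R w n y \<zero>" using a[rule_format, of "\<lambda>_. \<zero>"] by simp
      then show "x = \<zero>" using x \<open>\<forall>n. cg R w n \<zero> \<zero>\<close> by blast
    qed
    then show "?C \<and> ?S" using a by blast
  next
    assume a: "?C \<and> ?S"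
    show "\<forall>f. (\<forall>n. cg R w n (f (Suc n)) (f n)) \<longrightarrow> (\<exists>!y. \<forall>n. cg R w n y (f n))"
    proof (intro allI impI)
      fix f assume "\<forall>n. cg R w n (f (Suc n)) (f n)"
      then obtain y where y: "\<forall>n. cg R w n y (f n)" using a by blast
      show "\<exists>!y. \<forall>n. cg R w n y (f n)"
      proof (rule ex1I[of _ y], rule y)
        fix z assume z: "\<forall>n. cg R w n z (f n)"
        have c: "z \<in> carrier R" "y \<in> carrier R" using y z by (auto dest: cg_carrier)
        have "cg R w n z y" for n using cg_trans[OF z[rule_format] cg_sym[OF y[rule_format] w] w] .
        then have "z \<ominus> y = \<zero>" using a c w by (simp add: cg_diff_iff)
        then show "z = y" using c by simp
      qed
    qed
  qed
  finally show ?thesis .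
qed

lemma hom_add_pow:
  assumes "h \<in> ring_hom R S" "ring R" "ring S" "x \<in> carrier R"
  shows "h ([(n::nat)] \<cdot>\<^bsub>R\<^esub> x) = [n] \<cdot>\<^bsub>S\<^esub> h x"
proof -
  interpret R: ring R by fact
  interpret S: ring S by fact
  interpret h: ring_hom_ring R S h using assms by (intro ring_hom_ringI2)
  show ?thesis using assms(4) by (induction n) auto
qed

section \<open>Residue rings expressed through congruences\<close>

context cring
begin

lemma Quot_carrier: "carrier (R Quot I) = {I +> x | x. x \<in> carrier R}"
  by (auto simp: FactRing_def A_RCOSETS_def')

lemma Quot_eq_iff:
  assumes "w \<in> carrier R" "x \<in> carrier R" "y \<in> carrier R"
  shows "PIdl w +> x = PIdl w +> y \<longleftrightarrow> cg R w 1 x y"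
  using quotient_eq_iff_same_a_r_cos[OF cgenideal_ideal[OF assms(1)] assms(2,3)]
    cg_zero_iff_PIdl[OF assms(1), of "x \<ominus> y"] cg_diff_iff[OF assms(2,3,1)] by simp

lemma Quot_hom: "w \<in> carrier R \<Longrightarrow> (+>) (PIdl w) \<in> ring_hom R (R Quot PIdl w)"
  using ideal.rcos_ring_hom[OF cgenideal_ideal] .

lemma Quot_cring: "w \<in> carrier R \<Longrightarrow> cring (R Quot PIdl w)"
  using ideal.quotient_is_cring[OF cgenideal_ideal is_cring] .

lemma Quot_zero: "w \<in> carrier R \<Longrightarrow> \<zero>\<^bsub>R Quot PIdl w\<^esub> = PIdl w +> \<zero>"
  using ring_hom_zero[OF Quot_hom ring_axioms cring.axioms(1)[OF Quot_cring]] by simp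

lemma Quot_one: "w \<in> carrier R \<Longrightarrow> \<one>\<^bsub>R Quot PIdl w\<^esub> = PIdl w +> \<one>"
  using ring_hom_one[OF Quot_hom] by simp

lemma Quot_char_iff:
  assumes "w \<in> carrier R"
  shows "[(p::nat)] \<cdot>\<^bsub>R Quot PIdl w\<^esub> \<one>\<^bsub>R Quot PIdl w\<^esub> = \<zero>\<^bsub>R Quot PIdl w\<^esub> \<longleftrightarrow> cg R w 1 ([p] \<cdot> \<one>) \<zero>"
  unfolding Quot_zero[OF assms] Quot_one[OF assms]
    hom_add_pow[OF Quot_hom[OF assms] ring_axioms cring.axioms(1)[OF Quot_cring[OF assms]] one_closed, symmetric]
  using assms by (intro Quot_eq_iff) auto

lemma perfect_algebra_iff:
  assumes w: "w \<in> carrier R"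
  shows "perfect_algebra p (R Quot PIdl w) \<longleftrightarrow> cg R w 1 ([p] \<cdot> \<one>) \<zero> \<and>
    (\<forall>x\<in>carrier R. \<exists>y\<in>carrier R. cg R w 1 x (y [^] p)) \<and>
    (\<forall>x\<in>carrier R. \<forall>y\<in>carrier R. cg R w 1 (x [^] p) (y [^] p) \<longrightarrow> cg R w 1 x y)"
proof -
  let ?Q = "R Quot PIdl w"
  have pow: "(PIdl w +> x) [^]\<^bsub>?Q\<^esub> p = PIdl w +> x [^] p" if "x \<in> carrier R" for x
    using ring_hom_pow[OF Quot_hom[OF w] is_cring Quot_cring[OF w] that] by simp
  have "bij_betw (\<lambda>x. x [^]\<^bsub>?Q\<^esub> p) (carrier ?Q) (carrier ?Q) \<longleftrightarrow>
    inj_on (\<lambda>x. x [^]\<^bsub>?Q\<^esub> p) (carrier ?Q) \<and> carrier ?Q \<subseteq> (\<lambda>x. x [^]\<^bsub>?Q\<^esub> p) ` carrier ?Q"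
    unfolding bij_betw_def using pow by (auto simp: Quot_carrier)
  moreover have "inj_on (\<lambda>x. x [^]\<^bsub>?Q\<^esub> p) (carrier ?Q) \<longleftrightarrow>
     (\<forall>x\<in>carrier R. \<forall>y\<in>carrier R. cg R w 1 (x [^] p) (y [^] p) \<longrightarrow> cg R w 1 x y)"
    unfolding inj_on_def Quot_carrier using pow Quot_eq_iff[OF w]
    by (auto) (smt (verit, best) nat_pow_closed)+
  moreover have "carrier ?Q \<subseteq> (\<lambda>x. x [^]\<^bsub>?Q\<^esub> p) ` carrier ?Q \<longleftrightarrow>
     (\<forall>x\<in>carrier R. \<exists>y\<in>carrier R. cg R w 1 x (y [^] p))"
  proof
    assume a: "carrier ?Q \<subseteq> (\<lambda>x. x [^]\<^bsub>?Q\<^esub> p) ` carrier ?Q"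
    show "\<forall>x\<in>carrier R. \<exists>y\<in>carrier R. cg R w 1 x (y [^] p)"
    proof
      fix x assume x: "x \<in> carrier R"
      then have "PIdl w +> x \<in> carrier ?Q" by (auto simp: Quot_carrier)
      then obtain y where y: "y \<in> carrier R" "PIdl w +> x = (PIdl w +> y) [^]\<^bsub>?Q\<^esub> p"
        using a by (auto simp: Quot_carrier)
      then have "cg R w 1 x (y [^] p)" using pow x Quot_eq_iff[OF w] by simp
      then show "\<exists>y\<in>carrier R. cg R w 1 x (y [^] p)" using y by blast
    qed
  next
    assume a: "\<forall>x\<in>carrier R. \<exists>y\<in>carrier R. cg R w 1 x (y [^] p)"
    show "carrier ?Q \<subseteq> (\<lambda>x. x [^]\<^bsub>?Q\<^esub> p) ` carrier ?Q"
    proof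
      fix Z assume "Z \<in> carrier ?Q"
      then obtain x where x: "x \<in> carrier R" "Z = PIdl w +> x" by (auto simp: Quot_carrier)
      then obtain y where y: "y \<in> carrier R" "cg R w 1 x (y [^] p)" using a by blast
      then have "Z = (PIdl w +> y) [^]\<^bsub>?Q\<^esub> p" using pow x Quot_eq_iff[OF w] by simp
      then show "Z \<in> (\<lambda>x. x [^]\<^bsub>?Q\<^esub> p) ` carrier ?Q" using y by (auto simp: Quot_carrier)
    qed
  qed
  ultimately show ?thesis
    unfolding perfect_algebra_def Quot_char_iff[OF w] using Quot_cring[OF w] by blast
qed

end

text \<open>\<open>w\<close> generates the maximal ideal. An element outside is invertible modulo
  \<open>w\<close> because the residue ring is a field, and completeness turns this into a true
  inverse by the geometric series. That \<open>A\<close> is not a field makes \<open>w\<close>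
  nonzero.\<close>

lemma complete_dvr_uniformizer:
  assumes "complete_dvr A" "has_char (A Quot max_ideal A) p" "Factorial_Ring.prime p"
  obtains w where "cdv A w p" "max_ideal A = PIdl\<^bsub>A\<^esub> w" "domain A"
proof -
  have dvr: "dvr A" and cs: "complete_separated A (max_ideal A)" using assms(1) by (auto simp: complete_dvr_def)
  then interpret A: principal_domain A by (simp add: dvr_def)
  have m: "maximalideal (max_ideal A) A"
    using dvr theI'[of "\<lambda>I. maximalideal I A"] unfolding dvr_def max_ideal_def by blast
  then interpret m: maximalideal "max_ideal A" A .
  obtain w where w: "w \<in> carrier A" "max_ideal A = PIdl\<^bsub>A\<^esub> w" using A.exists_gen[OF m.ideal_axioms] by blast
  have fld: "field (A Quot PIdl\<^bsub>A\<^esub> w)" using m.quotient_is_field A.is_cring w(2) by simp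
  interpret Q: field "A Quot PIdl\<^bsub>A\<^esub> w" by (rule fld)
  have csw: "complete_separated A (PIdl\<^bsub>A\<^esub> w)" using cs w by simp
  have unit1: "\<exists>y\<in>carrier A. cg A w 1 (x \<otimes>\<^bsub>A\<^esub> y) \<one>\<^bsub>A\<^esub>" if "x \<in> carrier A" "\<not> cg A w 1 x \<zero>\<^bsub>A\<^esub>" for x
  proof -
    have "PIdl\<^bsub>A\<^esub> w +>\<^bsub>A\<^esub> x \<noteq> \<zero>\<^bsub>A Quot PIdl\<^bsub>A\<^esub> w\<^esub>"
      unfolding A.Quot_zero[OF w(1)] using A.Quot_eq_iff[OF w(1) that(1), of "\<zero>\<^bsub>A\<^esub>"] that by simp
    moreover have X: "PIdl\<^bsub>A\<^esub> w +>\<^bsub>A\<^esub> x \<in> carrier (A Quot PIdl\<^bsub>A\<^esub> w)" using that by (auto simp: A.Quot_carrier)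
    ultimately have "PIdl\<^bsub>A\<^esub> w +>\<^bsub>A\<^esub> x \<in> Units (A Quot PIdl\<^bsub>A\<^esub> w)" using Q.field_Units by blast
    then obtain Z where "Z \<in> carrier (A Quot PIdl\<^bsub>A\<^esub> w)"
      "(PIdl\<^bsub>A\<^esub> w +>\<^bsub>A\<^esub> x) \<otimes>\<^bsub>A Quot PIdl\<^bsub>A\<^esub> w\<^esub> Z = \<one>\<^bsub>A Quot PIdl\<^bsub>A\<^esub> w\<^esub>"
      by (auto simp: Units_def)
    then obtain y where y: "y \<in> carrier A"
      "(PIdl\<^bsub>A\<^esub> w +>\<^bsub>A\<^esub> x) \<otimes>\<^bsub>A Quot PIdl\<^bsub>A\<^esub> w\<^esub> (PIdl\<^bsub>A\<^esub> w +>\<^bsub>A\<^esub> y) = PIdl\<^bsub>A\<^esub> w +>\<^bsub>A\<^esub> \<one>\<^bsub>A\<^esub>"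
      by (auto simp: A.Quot_carrier A.Quot_one[OF w(1)])
    then have "PIdl\<^bsub>A\<^esub> w +>\<^bsub>A\<^esub> (x \<otimes>\<^bsub>A\<^esub> y) = PIdl\<^bsub>A\<^esub> w +>\<^bsub>A\<^esub> \<one>\<^bsub>A\<^esub>"
      using ring_hom_mult[OF A.Quot_hom[OF w(1)] that(1) y(1)] by simp
    then show ?thesis using A.Quot_eq_iff[OF w(1)] that y by auto
  qed
  have w0: "w \<noteq> \<zero>\<^bsub>A\<^esub>"
  proof
    assume w0: "w = \<zero>\<^bsub>A\<^esub>"
    have "field A"
    proof (rule A.cring_fieldI2[OF A.zero_not_one])
      fix a assume a: "a \<in> carrier A" "a \<noteq> \<zero>\<^bsub>A\<^esub>"
      then have "\<not> cg A w 1 a \<zero>\<^bsub>A\<^esub>" by (auto simp: cg_def w0)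
      then obtain y where "y \<in> carrier A" "cg A w 1 (a \<otimes>\<^bsub>A\<^esub> y) \<one>\<^bsub>A\<^esub>" using unit1 a by blast
      then show "\<exists>b\<in>carrier A. a \<otimes>\<^bsub>A\<^esub> b = \<one>\<^bsub>A\<^esub>" by (auto simp: cg_def w0)
    qed
    then show False using dvr by (simp add: dvr_def)
  qed
  interpret A: cunif A w p
  proof
    show "cg A w 1 ([p] \<cdot>\<^bsub>A\<^esub> \<one>\<^bsub>A\<^esub>) \<zero>\<^bsub>A\<^esub>"
      by (rule iffD1[OF A.Quot_char_iff[OF w(1)]], rule iffD2[OF assms(2)[unfolded has_char_def w(2), THEN spec, of p]]) simp
    show "\<exists>y. \<forall>n. cg A w n y (f n)" if "\<And>n. cg A w n (f (Suc n)) (f n)" for f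
      by (rule conjunct1[OF csw[unfolded A.complete_separated_iff[OF w(1)]], rule_format]) (rule that)
    show "x = \<zero>\<^bsub>A\<^esub>" if "\<And>n. cg A w n x \<zero>\<^bsub>A\<^esub>" for x
      by (rule conjunct2[OF csw[unfolded A.complete_separated_iff[OF w(1)]], rule_format]) (rule that)
    show "x = \<zero>\<^bsub>A\<^esub>" if "x \<in> carrier A" "w \<otimes>\<^bsub>A\<^esub> x = \<zero>\<^bsub>A\<^esub>" for x
      using that w(1) w0 A.integral by blast
  qed (use w assms in auto)
  have "cdv A w p"
  proof
    show "\<not> cg A w 1 \<one>\<^bsub>A\<^esub> \<zero>\<^bsub>A\<^esub>"
      unfolding A.cg_zero_iff_PIdl[OF w(1)] using m.one_imp_carrier m.I_notcarr w(2) by metis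
    show "\<exists>y\<in>carrier A. x \<otimes>\<^bsub>A\<^esub> y = \<one>\<^bsub>A\<^esub>" if x: "x \<in> carrier A" "\<not> cg A w 1 x \<zero>\<^bsub>A\<^esub>" for x
    proof -
      obtain y where y: "y \<in> carrier A" "cg A w 1 (x \<otimes>\<^bsub>A\<^esub> y) \<one>\<^bsub>A\<^esub>" using unit1 x by blast
      then obtain z where "z \<in> carrier A" "x \<otimes>\<^bsub>A\<^esub> y \<otimes>\<^bsub>A\<^esub> z = \<one>\<^bsub>A\<^esub>" using A.one_plus_inverse by blast
      then show ?thesis using x y by (intro bexI[of _ "y \<otimes>\<^bsub>A\<^esub> z"]) (auto simp: A.m_assoc)
    qed
  qed
  then show thesis using that w A.domain_axioms by blast
qed

section \<open>The category over a fixed complete discrete valuation ring, in terms of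
  elements\<close>

locale base = A: cdv A w p for A :: "'a ring" (structure) and w p +
  assumes max_ideal: "max_ideal A = PIdl w"
begin

lemma ext_ideal_eq:
  assumes "cring B" "s \<in> ring_hom A B"
  shows "ext_ideal A B s = PIdl\<^bsub>B\<^esub> (s w)"
proof -
  interpret B: cring B by fact
  interpret s: ring_hom_cring A B s using assms A.is_cring by (intro ring_hom_cringI) auto
  have sw: "s w \<in> carrier B" by simp
  show ?thesis
    unfolding ext_ideal_def max_ideal
  proof
    show "Idl\<^bsub>B\<^esub> (s ` (PIdl w)) \<subseteq> PIdl\<^bsub>B\<^esub> (s w)"
      by (rule B.genideal_minimal[OF B.cgenideal_ideal[OF sw]]) (auto simp: cgenideal_def)
    have "s ` (PIdl w) \<subseteq> carrier B" by (auto simp: cgenideal_def)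
    then have "ideal (Idl\<^bsub>B\<^esub> (s ` (PIdl w))) B" "s w \<in> Idl\<^bsub>B\<^esub> (s ` (PIdl w))"
      using B.genideal_ideal B.genideal_self A.cgenideal_self[OF A.w_closed] by (blast, blast)
    then show "PIdl\<^bsub>B\<^esub> (s w) \<subseteq> Idl\<^bsub>B\<^esub> (s ` (PIdl w))" using B.cgenideal_minimal by blast
  qed
qed

lemma alg_module_module:
  assumes "cring B" "s \<in> ring_hom A B"
  shows "module A (alg_module B s)"
proof -
  interpret B: cring B by fact
  interpret s: ring_hom_cring A B s using assms A.is_cring by (intro ring_hom_cringI) auto
  show ?thesis
  proof (rule moduleI)
    show "abelian_group (alg_module B s)"
      by (rule abelian_groupI) (auto simp: alg_module_def B.a_assoc B.a_comm B.a_lcomm intro: bexI[of _ "\<ominus>\<^bsub>B\<^esub> _"] B.l_neg)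
  qed (auto simp: alg_module_def B.l_distr B.r_distr B.m_assoc A.cring_axioms)
qed

lemma CRP_iff:
  "CRP p A B s \<longleftrightarrow> s \<in> ring_hom A B \<and> pcr B (s w) p" (is "?l \<longleftrightarrow> ?r")
proof
  assume l: ?l
  then have B: "cring B" and s: "s \<in> ring_hom A B" by (auto simp: CRP_def)
  interpret B: cring B by fact
  interpret s: ring_hom_cring A B s using s B A.is_cring by (intro ring_hom_cringI) auto
  have sw: "s w \<in> carrier B" by simp
  have cs: "complete_separated B (PIdl\<^bsub>B\<^esub> (s w))" and pf: "perfect_algebra p (B Quot PIdl\<^bsub>B\<^esub> (s w))"
    and fl: "flat A (alg_module B s)"
    using l unfolding CRP_def residual_ring_def ext_ideal_eq[OF B s] by auto
  have "pcr B (s w) p"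
  proof
    show "cg B (s w) 1 ([p] \<cdot>\<^bsub>B\<^esub> \<one>\<^bsub>B\<^esub>) \<zero>\<^bsub>B\<^esub>" by (rule conjunct1[OF pf[unfolded B.perfect_algebra_iff[OF sw]]])
    show "x = \<zero>\<^bsub>B\<^esub>" if "x \<in> carrier B" "s w \<otimes>\<^bsub>B\<^esub> x = \<zero>\<^bsub>B\<^esub>" for x
      using flat_imp_torsion_free[OF fl A.cdv_axioms, of x] that by (simp add: alg_module_def)
    show "\<exists>y. \<forall>n. cg B (s w) n y (f n)" if "\<And>n. cg B (s w) n (f (Suc n)) (f n)" for f
      by (rule conjunct1[OF cs[unfolded B.complete_separated_iff[OF sw]], rule_format]) (rule that)
    show "x = \<zero>\<^bsub>B\<^esub>" if "\<And>n. cg B (s w) n x \<zero>\<^bsub>B\<^esub>" for x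
      by (rule conjunct2[OF cs[unfolded B.complete_separated_iff[OF sw]], rule_format]) (rule that)
    show "\<exists>y\<in>carrier B. cg B (s w) 1 x (y [^]\<^bsub>B\<^esub> p)" if "x \<in> carrier B" for x
      by (rule conjunct1[OF conjunct2[OF pf[unfolded B.perfect_algebra_iff[OF sw]]], rule_format]) (rule that)
    show "cg B (s w) 1 x \<zero>\<^bsub>B\<^esub>" if "x \<in> carrier B" "cg B (s w) 1 (x [^]\<^bsub>B\<^esub> p) \<zero>\<^bsub>B\<^esub>" for x
    proof -
      have "p \<noteq> 0" using A.p_gt_1 by simp
      then have "\<zero>\<^bsub>B\<^esub> [^]\<^bsub>B\<^esub> p = \<zero>\<^bsub>B\<^esub>" by (simp add: B.nat_pow_zero)
      with that show ?thesis
        by - (rule conjunct2[OF conjunct2[OF pf[unfolded B.perfect_algebra_iff[OF sw]]], rule_format]; simp)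
    qed
  qed (use A.p_prime in auto)
  then show ?r using s by blast
next
  assume r: ?r
  then have s: "s \<in> ring_hom A B" and pc: "pcr B (s w) p" by auto
  interpret B: pcr B "s w" p by (rule pc)
  have B: "cring B" by (rule B.is_cring)
  interpret s: ring_hom_cring A B s using s B A.is_cring by (intro ring_hom_cringI) auto
  have sw: "s w \<in> carrier B" by simp
  have "flat A (alg_module B s)"
    by (rule torsion_free_imp_flat[OF alg_module_module[OF B s] A.cdv_axioms]) (auto simp: alg_module_def intro: B.nzd)
  moreover have "complete_separated B (PIdl\<^bsub>B\<^esub> (s w))"
    unfolding B.complete_separated_iff[OF sw] using B.complete B.sep by blast
  moreover have "perfect_algebra p (B Quot PIdl\<^bsub>B\<^esub> (s w))"
    unfolding B.perfect_algebra_iff[OF sw] using B.p_w B.surj B.frob_inj_n[of _ _ 1] by simp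
  ultimately show ?l using B s unfolding CRP_def residual_ring_def ext_ideal_eq[OF B s] by blast
qed

end

section \<open>Independence of powers over the field of p-th powers\<close>

lemma (in domain) prime_power_factor:
  assumes P: "P \<in> carrier R" "ring_prime P"
  shows "f \<in> carrier R \<Longrightarrow> g \<in> carrier R \<Longrightarrow> f \<otimes> g = P [^] (n::nat) \<Longrightarrow> \<exists>r u. u \<in> Units R \<and> f = u \<otimes> P [^] (r::nat)"
proof (induction n arbitrary: f g)
  case 0
  then have "f \<in> Units R" unfolding Units_def using m_comm[of f g] by auto
  then show ?case using 0 by (intro exI[of _ "0::nat"] exI[of _ f]) auto
next
  case (Suc n)
  have P0: "P \<noteq> \<zero>" using ring_primeE(1)[OF P] .
  have dv: "P divides f \<or> P divides g"
    using ring_primeE(3)[OF P(1,2)] P Suc.prems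
    unfolding prime_def factor_def by (metis m_comm nat_pow_Suc nat_pow_closed dividesI)
  then show ?case
  proof
    assume "P divides f"
    then obtain f' where f': "f' \<in> carrier R" "f = P \<otimes> f'" by (auto simp: factor_def)
    have "P \<otimes> (f' \<otimes> g) = P \<otimes> P [^] n" using Suc.prems f' P m_comm[of "P [^] n" P] by (simp add: m_assoc)
    then have "f' \<otimes> g = P [^] n" using m_lcancel[OF P0 P(1)] f' Suc.prems P by simp
    then obtain r u where ru: "u \<in> Units R" "f' = u \<otimes> P [^] (r::nat)" using Suc.IH[of f' g] f' Suc.prems by blast
    have "P \<otimes> (u \<otimes> P [^] r) = u \<otimes> P [^] (Suc r)" using P Units_closed[OF ru(1)] by (simp add: m_comm[of P] m_assoc)
    then show ?thesis using ru f' by blast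
  next
    assume "P divides g"
    then obtain g' where g': "g' \<in> carrier R" "g = P \<otimes> g'" by (auto simp: factor_def)
    have "P \<otimes> (f \<otimes> g') = P \<otimes> P [^] n" using Suc.prems g' P by (simp add: m_lcomm m_comm)
    then have "f \<otimes> g' = P [^] n" using m_lcancel[OF P0 P(1)] g' Suc.prems P by simp
    then show ?thesis using Suc.IH[of f g'] g' Suc.prems by blast
  qed
qed

lemma (in cring) eval_rev_map:
  assumes "x \<in> carrier R" "\<And>i. i < n \<Longrightarrow> d i \<in> carrier R"
  shows "eval (rev (map d [0..<n])) x = psum R x d n"
  using assms(2) by (induction n) (auto simp: assms(1) a_comm m_comm)

lemma (in cring) freshman:
  assumes "Factorial_Ring.prime (p::nat)" "[p] \<cdot> \<one> = \<zero>" "x \<in> carrier R" "y \<in> carrier R"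
  shows "(x \<oplus> y) [^] p = x [^] p \<oplus> y [^] p"
proof -
  obtain q where q: "q \<in> carrier R" "(x \<oplus> y) [^] p = x [^] p \<oplus> y [^] p \<oplus> [p] \<cdot> q"
    using add_power_prime[OF assms(3,4,1)] by blast
  have "[p] \<cdot> q = ([p] \<cdot> \<one>) \<otimes> q" using q by (simp add: add_pow_ldistr)
  then show ?thesis using q assms by simp
qed

lemma (in field) frobenius_subfield:
  assumes p: "Factorial_Ring.prime (p::nat)" and char: "[p] \<cdot> \<one> = \<zero>"
  shows "subfield ((\<lambda>b. b [^] p) ` carrier R) R"
proof (rule subfieldI'[OF subringI])
  let ?E = "(\<lambda>b. b [^] p) ` carrier R"
  have p0: "p \<noteq> 0" using p by auto
  show "?E \<subseteq> carrier R" by auto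
  show "\<one> \<in> ?E" by (rule image_eqI[of _ _ \<one>]) auto
  show "\<ominus> h \<in> ?E" if hE: "h \<in> ?E" for h
  proof -
    obtain b where b: "b \<in> carrier R" "h = b [^] p" using hE by auto
    have "(\<ominus> b \<oplus> b) [^] p = (\<ominus> b) [^] p \<oplus> b [^] p" using b by - (rule freshman[OF p char]; simp)
    then have "(\<ominus> b) [^] p \<oplus> h = \<zero>" using b p0 by (simp add: l_neg nat_pow_zero)
    then have "(\<ominus> b) [^] p = \<ominus> h" using b minus_equality[of "(\<ominus> b) [^] p" h] by simp
    then show ?thesis using b by (auto intro: image_eqI[of _ _ "\<ominus> b"])
  qed
  show "h1 \<otimes> h2 \<in> ?E" if hE: "h1 \<in> ?E" "h2 \<in> ?E" for h1 h2
  proof -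
    obtain a b where ab: "a \<in> carrier R" "h1 = a [^] p" "b \<in> carrier R" "h2 = b [^] p" using hE by blast
    then have "(a \<otimes> b) [^] p = h1 \<otimes> h2" by (simp add: nat_pow_distrib)
    then show ?thesis using ab by (auto intro: image_eqI[of _ _ "a \<otimes> b"])
  qed
  show "h1 \<oplus> h2 \<in> ?E" if hE: "h1 \<in> ?E" "h2 \<in> ?E" for h1 h2
  proof -
    obtain a b where ab: "a \<in> carrier R" "h1 = a [^] p" "b \<in> carrier R" "h2 = b [^] p" using hE by blast
    then have "(a \<oplus> b) [^] p = h1 \<oplus> h2" using freshman[OF p char] by simp
    then show ?thesis using ab by (auto intro: image_eqI[of _ _ "a \<oplus> b"])
  qed
  show "inv z \<in> ?E" if hE: "z \<in> ?E - {\<zero>}" for z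
  proof -
    obtain b where b: "b \<in> carrier R" "z = b [^] p" "z \<noteq> \<zero>" using hE by blast
    have "b \<noteq> \<zero>" using b p0 by (auto simp: nat_pow_zero)
    then have bu: "b \<in> Units R" using b field_Units by auto
    have "b [^] p \<otimes> (inv b) [^] p = \<one>" using bu b by (simp add: nat_pow_distrib[symmetric])
    then have "inv z = (inv b) [^] p" using b bu comm_inv_char[of "b [^] p" "(inv b) [^] p"] by simp
    then show ?thesis using bu by auto
  qed
qed

text \<open>If \<open>t\<close> is not a \<open>p\<close>-th power, its minimal polynomial over the field of \<open>p\<close>-th powers divides
  \<open>(X - t)^p\<close>, hence is \<open>(X - t)^r\<close>; its constant term shows that \<open>r < p\<close> is impossible.\<close>

lemma (in field) frobenius_independent:
  assumes p: "Factorial_Ring.prime (p::nat)" and char: "[p] \<cdot> \<one> = \<zero>"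
    and t: "t \<in> carrier R" "\<And>b. b \<in> carrier R \<Longrightarrow> t \<noteq> b [^] p"
    and b: "\<And>i. i < p \<Longrightarrow> b i \<in> carrier R" "psum R t (\<lambda>i. b i [^] p) p = \<zero>"
    and i: "i < p"
  shows "b i = \<zero>"
proof (rule ccontr)
  assume ne: "b i \<noteq> \<zero>"
  define E where "E = (\<lambda>b. b [^] p) ` carrier R"
  have E: "subfield E R" unfolding E_def by (rule frobenius_subfield[OF p char])
  note Er = subfieldE(1)[OF E]
  have p0: "p \<noteq> 0" "p > 1" using p prime_gt_1_nat by auto
  have nat_pow_nz: "x [^] (n::nat) \<noteq> \<zero>" if "x \<in> carrier R" "x \<noteq> \<zero>" for x n
    using that by (induction n) (auto dest: integral)
  have pow0: "x = \<zero>" if "x \<in> carrier R" "x [^] p = \<zero>" for x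
    by (rule ccontr) (use that nat_pow_nz in blast)
  \<comment> \<open>A polynomial must have a nonzero leading coefficient, so the relation is cut off
    at the highest nonzero coefficient before it can serve as a polynomial killing
    \<open>t\<close>.\<close>
  define r0 where "r0 = Max {j. j < p \<and> b j \<noteq> \<zero>}"
  have "finite {j. j < p \<and> b j \<noteq> \<zero>}" "{j. j < p \<and> b j \<noteq> \<zero>} \<noteq> {}" using ne i by auto
  then have r0: "r0 < p" "b r0 \<noteq> \<zero>" "\<And>j. j < p \<Longrightarrow> b j \<noteq> \<zero> \<Longrightarrow> j \<le> r0"
    using Max_in[of "{j. j < p \<and> b j \<noteq> \<zero>}"] unfolding r0_def by auto
  have trunc: "psum R t (\<lambda>i. b i [^] p) m = psum R t (\<lambda>i. b i [^] p) (Suc r0)" if "Suc r0 \<le> m" "m \<le> p" for m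
    using that
  proof (induction m rule: dec_induct)
    case (step n)
    then have "b n = \<zero>" using r0(3)[of n] by auto
    then show ?case using step p0 t b by (auto simp: nat_pow_zero)
  qed simp
  define q where "q = rev (map (\<lambda>i. b i [^] p) [0..<Suc r0])"
  have qc: "q \<in> carrier (E[X])"
    unfolding univ_poly_carrier[symmetric]
  proof (rule polynomialI)
    show "set q \<subseteq> E" unfolding q_def E_def using b r0 by auto
    show "lead_coeff q \<noteq> \<zero>" using pow0[of "b r0"] r0 b by (auto simp: q_def)
  qed
  have q0: "q \<noteq> []" "degree q = r0" by (simp_all add: q_def)
  have qe: "eval q t = \<zero>"
    unfolding q_def using trunc[of p] r0 b t by (subst eval_rev_map) auto
  have alg: "(algebraic over E) t" by (rule algebraicI[OF qc q0(1) qe])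
  define f where "f = Irr E t"
  have f: "f \<in> carrier (E[X])" "pirreducible E f" "lead_coeff f = \<one>" "eval f t = \<zero>"
    unfolding f_def using IrrE[OF E t(1) alg] by auto
  have fq: "degree f \<le> r0"
    using pdivides_imp_degree_le[OF Er f(1) qc q0(1)] Irr_minimal[OF E t(1) alg qc qe] q0(2) by (simp add: f_def)
  interpret UP: domain "poly_ring R" using univ_poly_is_domain[OF carrier_is_subring] .
  interpret EP: domain "E[X]" using univ_poly_is_domain[OF Er] .
  have fR: "f \<in> carrier (poly_ring R)" using f(1) carrier_polynomial_shell[OF Er] by blast
  define P where "P = [\<one>, \<ominus> t]"
  have P: "P \<in> carrier (poly_ring R)"
    unfolding P_def univ_poly_carrier[symmetric] using t by (intro polynomialI) auto
  have Pprime: "ring_prime\<^bsub>poly_ring R\<^esub> P"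
    using degree_one_imp_pirreducible[OF carrier_is_subfield P]
      pprime_iff_pirreducible[OF carrier_is_subfield P] by (simp add: P_def)
  have X: "X \<in> carrier (poly_ring R)" "X \<in> carrier (E[X])" using var_closed Er carrier_is_subring by auto
  have tn0: "\<ominus> t \<noteq> \<zero>" using t(2)[of \<zero>] t(1) p0 by (auto simp: nat_pow_zero)
  have tE: "(\<ominus> t) [^] p \<in> E" unfolding E_def using t(1) by blast
  define C where "C = poly_of_const (\<ominus> t)"
  have Ch: "poly_of_const \<in> ring_hom R (poly_ring R)"
    using canonical_embedding_is_hom[OF carrier_is_subring] by simp
  have C: "C \<in> carrier (poly_ring R)" using ring_hom_closed[OF Ch] t by (simp add: C_def)
  have Pe: "P = X \<oplus>\<^bsub>poly_ring R\<^esub> C"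
    using tn0 t by (simp add: P_def C_def poly_of_const_def var_def univ_poly_add)
  have charP: "[p] \<cdot>\<^bsub>poly_ring R\<^esub> \<one>\<^bsub>poly_ring R\<^esub> = \<zero>\<^bsub>poly_ring R\<^esub>"
    using hom_add_pow[OF Ch ring_axioms UP.ring_axioms one_closed, of p] char
      ring_hom_one[OF Ch] ring_hom_zero[OF Ch ring_axioms UP.ring_axioms] by simp
  have powE: "x [^]\<^bsub>E[X]\<^esub> n = x [^]\<^bsub>poly_ring R\<^esub> n" for x and n :: nat
    by (induction n) (simp_all add: univ_poly_mult univ_poly_one nat_pow_def)
  have "P [^]\<^bsub>poly_ring R\<^esub> p = X [^]\<^bsub>poly_ring R\<^esub> p \<oplus>\<^bsub>poly_ring R\<^esub> C [^]\<^bsub>poly_ring R\<^esub> p"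
    unfolding Pe by (rule UP.freshman[OF p charP X(1) C])
  also have "C [^]\<^bsub>poly_ring R\<^esub> p = poly_of_const ((\<ominus> t) [^] p)"
    unfolding C_def by (rule ring_hom_pow[OF Ch is_cring UP.is_cring, symmetric]) (use t in simp)
  \<comment> \<open>In characteristic \<open>p\<close> the polynomial (X - t)^p is X^p + (- t)^p,
    with coefficients in \<open>E\<close>; this is why the minimal polynomial over \<open>E\<close>
    divides it.\<close>
  finally have Pp: "P [^]\<^bsub>poly_ring R\<^esub> p = X [^]\<^bsub>E[X]\<^esub> p \<oplus>\<^bsub>E[X]\<^esub> poly_of_const ((\<ominus> t) [^] p)"
    by (simp add: powE univ_poly_add)
  have "poly_of_const ((\<ominus> t) [^] p) \<in> carrier (E[X])"
    using ring_hom_closed[OF canonical_embedding_is_hom[OF Er]] tE by simp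
  then have PE: "P [^]\<^bsub>poly_ring R\<^esub> p \<in> carrier (E[X])" unfolding Pp using X(2) by simp
  have evh: "(\<lambda>q. eval q x) \<in> ring_hom (poly_ring R) R" if "x \<in> carrier R" for x
    using eval_cring_hom[OF carrier_is_subring that] ring_hom_cring.homh by blast
  have evP: "eval (P [^]\<^bsub>poly_ring R\<^esub> n) x = (x \<ominus> t) [^] n" if "x \<in> carrier R" for x and n :: nat
    using ring_hom_pow[OF evh[OF that] UP.is_cring is_cring P, of n] that t by (simp add: P_def a_minus_def)
  have "eval (P [^]\<^bsub>poly_ring R\<^esub> p) t = \<zero>" using evP[OF t(1)] t p0 by (simp add: a_minus_def r_neg nat_pow_zero)
  then have "f pdivides (P [^]\<^bsub>poly_ring R\<^esub> p)" unfolding f_def by (intro Irr_minimal[OF E t(1) alg PE])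
  then obtain g where g: "g \<in> carrier (poly_ring R)" "f \<otimes>\<^bsub>poly_ring R\<^esub> g = P [^]\<^bsub>poly_ring R\<^esub> p"
    unfolding pdivides_def factor_def by metis
  obtain r u where ru: "u \<in> Units (poly_ring R)" "f = u \<otimes>\<^bsub>poly_ring R\<^esub> P [^]\<^bsub>poly_ring R\<^esub> (r::nat)"
    using UP.prime_power_factor[OF P Pprime fR g] by blast
  obtain k where k: "k \<in> carrier R" "k \<noteq> \<zero>" "u = [k]"
    using univ_poly_units_incl[OF carrier_is_subring] ru(1) by blast
  have uc: "polynomial (carrier R) u" unfolding k(3) using k by (intro polynomialI) auto
  have Pr: "P [^]\<^bsub>poly_ring R\<^esub> n \<noteq> [] \<and> lead_coeff (P [^]\<^bsub>poly_ring R\<^esub> n) = \<one> \<and> degree (P [^]\<^bsub>poly_ring R\<^esub> n) = n" for n :: nat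
  proof (induction n)
    case 0
    then show ?case by (simp add: univ_poly_one)
  next
    case (Suc n)
    have c: "polynomial (carrier R) (P [^]\<^bsub>poly_ring R\<^esub> n)" "polynomial (carrier R) P"
      using P UP.nat_pow_closed[OF P] unfolding univ_poly_carrier by auto
    have e: "P [^]\<^bsub>poly_ring R\<^esub> (Suc n) = poly_mult (P [^]\<^bsub>poly_ring R\<^esub> n) P" by (simp add: univ_poly_mult)
    have n0: "P \<noteq> []" "lead_coeff P = \<one>" "degree P = 1" by (simp_all add: P_def)
    have "degree (poly_mult (P [^]\<^bsub>poly_ring R\<^esub> n) P) = Suc n"
      using poly_mult_degree_eq[OF carrier_is_subring c] Suc n0 by simp
    moreover from this have "poly_mult (P [^]\<^bsub>poly_ring R\<^esub> n) P \<noteq> []" by (metis list.size(3) diff_0_eq_0 nat.distinct(1))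
    moreover have "lead_coeff (poly_mult (P [^]\<^bsub>poly_ring R\<^esub> n) P) = \<one>"
      using poly_mult_lead_coeff[OF carrier_is_subring c] Suc n0 by simp
    ultimately show ?case unfolding e by simp
  qed
  have Prc: "polynomial (carrier R) (P [^]\<^bsub>poly_ring R\<^esub> r)" using UP.nat_pow_closed[OF P] unfolding univ_poly_carrier by auto
  have fm: "f = poly_mult u (P [^]\<^bsub>poly_ring R\<^esub> r)" using ru by (simp add: univ_poly_mult)
  have "lead_coeff f = k \<otimes> \<one>"
    unfolding fm using poly_mult_lead_coeff[OF carrier_is_subring uc Prc] Pr[of r] k by simp
  then have k1: "k = \<one>" using f(3) k by simp
  then have "u = \<one>\<^bsub>poly_ring R\<^esub>" using k by (simp add: univ_poly_one)
  then have fP: "f = P [^]\<^bsub>poly_ring R\<^esub> r" using ru P by simp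
  have r: "r < p" using fP Pr[of r] fq r0 by simp
  have "r \<noteq> 0"
  proof
    assume "r = 0"
    then have "f = [\<one>]" using fP by (simp add: univ_poly_one)
    then show False using f(4) t by simp
  qed
  have "eval f \<zero> \<in> E"
    using const_term_simprules_shell(1)[OF Er f(1)] by (simp add: const_term_def)
  then have sr: "(\<ominus> t) [^] r \<in> E" using evP[of \<zero> r] t unfolding fP by (simp add: a_minus_def)
  define c where "c = \<ominus> t"
  have c: "c \<in> carrier R" "c \<noteq> \<zero>" "c [^] r \<in> E" "c [^] p \<in> E" using t tn0 sr tE by (auto simp: c_def)
  have powc: "x [^] (n::nat) \<in> E" if "x \<in> E" for x n
    using that by (induction n) (use subringE(3,6)[OF Er] in auto)
  \<comment> \<open>Both c^r and c^p lie in \<open>E\<close>, and r is prime to \<open>p\<close>; a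
    Bezout relation puts \<open>c\<close> itself into \<open>E\<close>, contrary to the choice of
    \<open>t\<close>.\<close>
  have "coprime r p"
    using r \<open>r \<noteq> 0\<close> p by (metis coprime_commute nat_dvd_not_less not_gr_zero prime_imp_coprime)
  then obtain a b where ab: "r * a = p * b + 1" using bezout_nat[OF \<open>r \<noteq> 0\<close>, of p] by auto
  have 1: "c [^] (r * a) \<in> E" "c [^] (p * b) \<in> E"
    using powc[OF c(3), of a] powc[OF c(4), of b] c by (simp_all add: nat_pow_pow)
  have nz: "c [^] (p * b) \<noteq> \<zero>" using c nat_pow_nz by blast
  have inv: "inv (c [^] (p * b)) \<in> E" using subfield_m_inv(1)[OF E] 1 nz by auto
  have "c [^] (r * a) = c [^] (p * b) \<otimes> c" using ab c by simp
  then have "inv (c [^] (p * b)) \<otimes> c [^] (r * a) = c"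
    using c nz field_Units by (simp add: m_assoc[symmetric])
  then have "c \<in> E" using subringE(6)[OF Er inv 1(1)] by simp
  then have "\<ominus> c \<in> E" using subringE(5)[OF Er] by blast
  then show False using t unfolding c_def E_def by auto
qed

section \<open>Orders closed under p-th roots\<close>

lemma (in ring) subring_chain_Union:
  assumes "C \<noteq> {}" "\<And>S. S \<in> C \<Longrightarrow> subring S R" "\<And>S T. S \<in> C \<Longrightarrow> T \<in> C \<Longrightarrow> S \<subseteq> T \<or> T \<subseteq> S"
  shows "subring (\<Union>C) R"
proof (rule subringI)
  show "\<Union>C \<subseteq> carrier R" using subringE(1)[OF assms(2)] by blast
  obtain S where "S \<in> C" using assms(1) by blast
  then show "\<one> \<in> \<Union>C" using subringE(3)[OF assms(2)] by blast
  show "\<ominus> h \<in> \<Union>C" if "h \<in> \<Union>C" for h using that subringE(5)[OF assms(2)] by blast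
  have *: "\<exists>S\<in>C. h1 \<in> S \<and> h2 \<in> S" if "h1 \<in> \<Union>C" "h2 \<in> \<Union>C" for h1 h2
    using that assms(3) by blast
  show "h1 \<otimes> h2 \<in> \<Union>C" "h1 \<oplus> h2 \<in> \<Union>C" if "h1 \<in> \<Union>C" "h2 \<in> \<Union>C" for h1 h2
    using *[OF that] subringE(6,7)[OF assms(2)] by (blast, blast)
qed

lemma (in ring) subring_pow_closed:
  "subring S R \<Longrightarrow> x \<in> S \<Longrightarrow> x [^] (n::nat) \<in> S"
  by (induction n) (auto intro: subringE(3,6))

lemma (in ring) subring_psum:
  "subring S R \<Longrightarrow> x \<in> S \<Longrightarrow> (\<And>i. i < n \<Longrightarrow> c i \<in> S) \<Longrightarrow> psum R x c n \<in> S"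
  by (induction n) (auto intro!: subringE(2,6,7) subring_pow_closed)

lemma (in domain) simple_extension_root:
  assumes D: "subring D R" and y: "y \<in> carrier R" "y [^] p \<in> D" "(p::nat) > 0"
  shows "simple_extension D y = {psum R y c p | c. \<forall>i. c i \<in> D}"
proof
  have Dc: "D \<subseteq> carrier R" using subringE(1)[OF D] .
  have sub: "subring (simple_extension D y) R" by (rule simple_extension_is_subring[OF D y(1)])
  have "y \<in> simple_extension D y" "D \<subseteq> simple_extension D y"
    using simple_extension_mem[OF D y(1)] simple_extension_incl[OF Dc y(1)] .
  then show "{psum R y c p | c. \<forall>i. c i \<in> D} \<subseteq> simple_extension D y"
    using subring_psum[OF sub] by blast
  obtain m where m: "p = Suc m" using y(3) by (cases p) auto
  show "simple_extension D y \<subseteq> {psum R y c p | c. \<forall>i. c i \<in> D}"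
  proof
    fix x assume "x \<in> simple_extension D y"
    then show "x \<in> {psum R y c p | c. \<forall>i. c i \<in> D}"
    proof (induction rule: simple_extension.induct)
      case zero
      have "psum R y (\<lambda>_. \<zero>) n = \<zero>" for n by (induction n) (use y in auto)
      then show ?case using subringE(2)[OF D] by (auto intro!: exI[of _ "\<lambda>_. \<zero>"])
    next
      case (lin k1 k2)
      then obtain c where c: "k1 = psum R y c p" "\<And>i. c i \<in> D" by blast
      have cc: "c i \<in> carrier R" for i using c(2) Dc by blast
      have k2: "k2 \<in> carrier R" using lin Dc by blast
      \<comment> \<open>Multiplication by \<open>y\<close> shifts the coefficients by one place; the
        top one returns to degree zero because y^p lies in \<open>D\<close>.\<close>
      define d where "d = (\<lambda>i. if i = 0 then k2 \<oplus> y [^] p \<otimes> c m else c (i - 1))"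
      have d: "d i \<in> D" for i using c(2) lin y subringE(6,7)[OF D] by (auto simp: d_def)
      have dc: "d i \<in> carrier R" for i using d Dc by blast
      define a q u where "a = psum R y c m" and "q = y [^] m" and "u = c m"
      have k: "a \<in> carrier R" "q \<in> carrier R" "u \<in> carrier R" using cc y by (auto simp: a_def q_def u_def)
      have "psum R y d p = d 0 \<oplus> y \<otimes> psum R y (d \<circ> Suc) m"
        unfolding m by (rule psum_shift) (use y dc in auto)
      also have "psum R y (d \<circ> Suc) m = a" by (simp add: comp_def d_def a_def)
      also have "d 0 = k2 \<oplus> (q \<otimes> y) \<otimes> u" by (simp add: d_def m q_def u_def)
      also have "k2 \<oplus> (q \<otimes> y) \<otimes> u \<oplus> y \<otimes> a = (a \<oplus> q \<otimes> u) \<otimes> y \<oplus> k2"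
        by (use k y k2 in \<open>simp add: ring_nf\<close>)
      finally have "psum R y d p = k1 \<otimes> y \<oplus> k2" by (simp add: c(1) m a_def q_def u_def)
      then have "k1 \<otimes> y \<oplus> k2 = psum R y d p \<and> (\<forall>i. d i \<in> D)" using d by simp
      then show ?case unfolding mem_Collect_eq by - (rule exI)
    qed
  qed
qed

text \<open>In the application \<open>L\<close> is an algebraic closure of \<open>K\<close> and
  \<open>A0\<close> the image of \<open>A\<close>. The axioms on \<open>A0\<close> say by elements
  that it is a local ring with maximal ideal generated by \<open>w\<close> and residue
  characteristic \<open>p\<close>.\<close>

locale amb = field L for L (structure) +
  fixes A0 :: "'a set" and w :: 'a and p :: nat
  assumes A0: "subring A0 L" and wA: "w \<in> A0" and p_prime: "Factorial_Ring.prime p"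
    and pw: "\<exists>c\<in>A0. [p] \<cdot> \<one> = w \<otimes> c"
    and A_one: "\<And>a. a \<in> A0 \<Longrightarrow> w \<otimes> a \<noteq> \<one>"
    and A_unit: "\<And>a. a \<in> A0 \<Longrightarrow> (\<exists>b\<in>A0. a = w \<otimes> b) \<or> (\<exists>b\<in>A0. a \<otimes> b = \<one>)"
    and roots: "\<And>x. x \<in> carrier L \<Longrightarrow> \<exists>y\<in>carrier L. y [^] p = x"
begin

lemma w_carrier [simp]: "w \<in> carrier L" using subringE(1)[OF A0] wA by blast

lemma p_pos: "p > 0" using prime_gt_0_nat[OF p_prime] .

text \<open>A maximal subring in which \<open>w\<close> is not invertible is closed under \<open>p\<close>-th roots, by a
  determinant-free form of Nakayama's lemma.\<close>

lemma exists_order: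
  obtains V where "subring V L" "A0 \<subseteq> V" "\<And>v. v \<in> V \<Longrightarrow> w \<otimes> v \<noteq> \<one>"
    "\<And>y. y \<in> carrier L \<Longrightarrow> y [^] p \<in> V \<Longrightarrow> y \<in> V"
proof -
  define F where "F = {S. subring S L \<and> A0 \<subseteq> S \<and> (\<forall>v\<in>S. w \<otimes> v \<noteq> \<one>)}"
  have "\<exists>M\<in>F. \<forall>T\<in>F. M \<subseteq> T \<longrightarrow> T = M"
  proof (rule subset_Zorn_nonempty)
    show "F \<noteq> {}" using A0 A_one by (auto simp: F_def)
    fix C assume C: "C \<noteq> {}" "subset.chain F C"
    then have ch: "\<And>S T. S \<in> C \<Longrightarrow> T \<in> C \<Longrightarrow> S \<subseteq> T \<or> T \<subseteq> S" "\<And>S. S \<in> C \<Longrightarrow> S \<in> F"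
      by (auto simp: subset_chain_def)
    have CF: "subring S L" "A0 \<subseteq> S" "\<And>v. v \<in> S \<Longrightarrow> w \<otimes> v \<noteq> \<one>" if "S \<in> C" for S
      using ch(2)[OF that] by (auto simp: F_def)
    show "\<Union>C \<in> F"
      unfolding F_def
    proof (intro CollectI conjI ballI)
      show "subring (\<Union>C) L" by (rule subring_chain_Union[OF C(1) CF(1) ch(1)])
      show "A0 \<subseteq> \<Union>C" using C(1) CF(2) by blast
    qed (use CF(3) in blast)
  qed
  then obtain V where V: "V \<in> F" "\<And>S. S \<in> F \<Longrightarrow> V \<subseteq> S \<Longrightarrow> S = V" by blast
  then have Vs: "subring V L" "A0 \<subseteq> V" "\<And>v. v \<in> V \<Longrightarrow> w \<otimes> v \<noteq> \<one>" by (auto simp: F_def)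
  note VE = subringE[OF Vs(1)]
  have wV: "w \<in> V" using Vs wA by auto
  have Vc: "v \<in> V \<Longrightarrow> v \<in> carrier L" for v using VE(1) by blast
  \<comment> \<open>Adjoin the inverse \<open>i\<close> of e = 1 - w x. Powers of \<open>e\<close>
    are 1 modulo \<open>w\<close> in \<open>V\<close>, so clearing denominators in w s = 1 would
    make \<open>w\<close> invertible in \<open>V\<close> already; maximality of \<open>V\<close>
    then puts \<open>i\<close> into \<open>V\<close>.\<close>
  have unit: "\<exists>u\<in>V. (\<one> \<ominus> w \<otimes> x) \<otimes> u = \<one>" if x: "x \<in> V" for x
  proof -
    define e where "e = \<one> \<ominus> w \<otimes> x"
    have xc: "x \<in> carrier L" using x Vc by blast
    have e: "e \<in> V" unfolding e_def a_minus_def using VE wV x by auto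
    have ec: "e \<in> carrier L" using e Vc by blast
    have e0: "e \<noteq> \<zero>" using Vs(3)[OF x] xc by (auto simp: e_def)
    define i where "i = inv e"
    have ei: "e \<otimes> i = \<one>" "i \<in> carrier L" using ec e0 field_Units by (auto simp: i_def)
    have en: "\<exists>z\<in>V. e [^] (n::nat) = \<one> \<ominus> w \<otimes> z" for n
    proof (induction n)
      case 0
      then show ?case using VE(2) by (intro bexI[of _ \<zero>]) (auto simp: a_minus_def)
    next
      case (Suc n)
      then obtain z where z: "z \<in> V" "e [^] n = \<one> \<ominus> w \<otimes> z" by blast
      have zc: "z \<in> carrier L" using z Vc by blast
      have wc: "w \<in> carrier L" by simp
      have "(\<one> \<ominus> w \<otimes> z) \<otimes> (\<one> \<ominus> w \<otimes> x) = \<one> \<ominus> w \<otimes> (z \<oplus> x \<oplus> w \<otimes> z \<otimes> (\<ominus> x))"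
        by (use zc xc in \<open>simp add: ring_nf\<close>)
      then have "e [^] (Suc n) = \<one> \<ominus> w \<otimes> (z \<oplus> x \<oplus> w \<otimes> z \<otimes> (\<ominus> x))" using z(2) by (simp add: e_def)
      moreover have "z \<oplus> x \<oplus> w \<otimes> z \<otimes> (\<ominus> x) \<in> V" using VE wV z x by auto
      ultimately show ?case by blast
    qed
    define S where "S = simple_extension V i"
    have S: "subring S L" "V \<subseteq> S" "i \<in> S"
      unfolding S_def using simple_extension_is_subring[OF Vs(1) ei(2)] simple_extension_incl[OF VE(1) ei(2)]
        simple_extension_mem[OF Vs(1) ei(2)] by auto
    have Sform: "\<exists>n. s \<otimes> e [^] (n::nat) \<in> V" if "s \<in> S" for s
      using that unfolding S_def
    proof (induction rule: simple_extension.induct)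
      case zero
      then show ?case using VE(2) ec by auto
    next
      case (lin k1 k2)
      then obtain n where n: "k1 \<otimes> e [^] (n::nat) \<in> V" by blast
      have k1: "k1 \<in> carrier L" using lin(1) S(1) subringE(1) unfolding S_def by blast
      have k2: "k2 \<in> carrier L" using lin Vc by blast
      define q where "q = e [^] n"
      have q: "q \<in> carrier L" using ec by (simp add: q_def)
      have ic: "i \<in> carrier L" by (rule ei)
      have "(k1 \<otimes> i \<oplus> k2) \<otimes> (q \<otimes> e) = (k1 \<otimes> q) \<otimes> (e \<otimes> i) \<oplus> k2 \<otimes> (q \<otimes> e)"
        by (use k1 k2 q ic ec in \<open>simp add: ring_nf\<close>)
      then have "(k1 \<otimes> i \<oplus> k2) \<otimes> e [^] (Suc n) = k1 \<otimes> e [^] n \<oplus> k2 \<otimes> e [^] (Suc n)"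
        using ei k1 ec by (simp add: q_def)
      moreover have "\<dots> \<in> V" using n lin(2) VE(6,7) subring_pow_closed[OF Vs(1) e, of "Suc n"] by blast
      ultimately show ?case by metis
    qed
    have "S \<in> F"
      unfolding F_def
    proof (intro CollectI conjI ballI)
      fix s assume s: "s \<in> S"
      show "w \<otimes> s \<noteq> \<one>"
      proof
        assume ws: "w \<otimes> s = \<one>"
        obtain n where n: "s \<otimes> e [^] (n::nat) \<in> V" using Sform s by blast
        obtain z where z: "z \<in> V" "e [^] n = \<one> \<ominus> w \<otimes> z" using en by blast
        have sc: "s \<in> carrier L" using s S(1) subringE(1) by blast
        have zc: "z \<in> carrier L" using z Vc by blast
        define q where "q = e [^] n"
        have q: "q \<in> carrier L" using ec by (simp add: q_def)
        have wc: "w \<in> carrier L" by simp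
        have "w \<otimes> (s \<otimes> q \<oplus> z) = (w \<otimes> s) \<otimes> q \<oplus> w \<otimes> z"
          by (use sc zc q in \<open>simp add: ring_nf\<close>)
        also have "\<dots> = \<one>" using ws z zc by (simp add: q_def a_minus_def a_assoc l_neg)
        finally have "w \<otimes> (s \<otimes> q \<oplus> z) = \<one>" .
        moreover have "s \<otimes> q \<oplus> z \<in> V" using n z VE(7) by (simp add: q_def)
        ultimately show False using Vs(3) by blast
      qed
    qed (use S Vs in auto)
    then have "S = V" using V(2) S(2) by blast
    then show ?thesis using S(3) ei(1) unfolding e_def[symmetric] by blast
  qed
  \<comment> \<open>Nakayama's lemma for finitely many generators, by elimination: the last equation
    is solved for \<open>g r\<close>, as 1 - w times \<open>c r\<close> is invertible, and the
    result is substituted into the others.\<close>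
  have nak: "(\<And>j. j < r \<Longrightarrow> g j \<in> carrier L) \<Longrightarrow>
     (\<And>j. j < r \<Longrightarrow> \<exists>c. (\<forall>i. c i \<in> V) \<and> g j = w \<otimes> (\<Oplus>i\<in>{..<r}. c i \<otimes> g i)) \<Longrightarrow> (\<And>j. j < r \<Longrightarrow> g j = \<zero>)" for r :: nat and g
  proof (induction r)
    case 0
    then show ?case by simp
  next
    case (Suc r)
    have gc: "\<And>j. j < Suc r \<Longrightarrow> g j \<in> carrier L" using Suc.prems by blast
    have wc: "w \<in> carrier L" by simp
    have fc: "(\<Oplus>i\<in>{..<r}. c i \<otimes> g i) \<in> carrier L" if "\<forall>i. c i \<in> V" for c
      using that Vc gc by (intro finsum_closed) auto
    have split: "(\<Oplus>i\<in>{..<Suc r}. c i \<otimes> g i) = c r \<otimes> g r \<oplus> (\<Oplus>i\<in>{..<r}. c i \<otimes> g i)" if "\<forall>i. c i \<in> V" for c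
      unfolding lessThan_Suc using that Vc gc by (intro finsum_insert) auto
    have lin: "(\<Oplus>i\<in>{..<r}. c i \<otimes> g i) \<oplus> k \<otimes> (\<Oplus>i\<in>{..<r}. d i \<otimes> g i) = (\<Oplus>i\<in>{..<r}. (c i \<oplus> k \<otimes> d i) \<otimes> g i)"
      if "\<forall>i. c i \<in> V" "\<forall>i. d i \<in> V" "k \<in> V" for c d k
    proof -
      have cc: "c i \<in> carrier L" "d i \<in> carrier L" "k \<in> carrier L" for i using that Vc by blast+
      have "k \<otimes> (\<Oplus>i\<in>{..<r}. d i \<otimes> g i) = (\<Oplus>i\<in>{..<r}. k \<otimes> (d i \<otimes> g i))"
        using cc gc by (intro finsum_rdistr) auto
      then have "(\<Oplus>i\<in>{..<r}. c i \<otimes> g i) \<oplus> k \<otimes> (\<Oplus>i\<in>{..<r}. d i \<otimes> g i) = (\<Oplus>i\<in>{..<r}. c i \<otimes> g i \<oplus> k \<otimes> (d i \<otimes> g i))"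
        using cc gc by (subst finsum_addf) auto
      also have "\<dots> = (\<Oplus>i\<in>{..<r}. (c i \<oplus> k \<otimes> d i) \<otimes> g i)"
        using cc gc by (intro finsum_cong') (auto simp: l_distr m_assoc)
      finally show ?thesis .
    qed
    obtain c where c: "\<forall>i. c i \<in> V" "g r = w \<otimes> (\<Oplus>i\<in>{..<Suc r}. c i \<otimes> g i)" using Suc.prems(2)[of r] by blast
    define s where "s = (\<Oplus>i\<in>{..<r}. c i \<otimes> g i)"
    have sc: "s \<in> carrier L" unfolding s_def using fc c by blast
    have crc: "c r \<in> carrier L" "g r \<in> carrier L" using c Vc gc by auto
    obtain u where u: "u \<in> V" "(\<one> \<ominus> w \<otimes> c r) \<otimes> u = \<one>" using unit c by blast
    have uc: "u \<in> carrier L" using u Vc by blast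
    have gr1: "g r = w \<otimes> (c r \<otimes> g r \<oplus> s)" using c split s_def by simp
    define G k where "G = g r" and "k = c r"
    have Gk: "G \<in> carrier L" "k \<in> carrier L" using crc by (auto simp: G_def k_def)
    have "G = ((\<one> \<ominus> w \<otimes> k) \<otimes> u) \<otimes> G" using u Gk by (simp add: k_def)
    also have "\<dots> = u \<otimes> (G \<ominus> w \<otimes> (k \<otimes> G \<oplus> s)) \<oplus> w \<otimes> (u \<otimes> s)"
      by (use Gk uc sc in \<open>simp add: ring_nf\<close>)
    also have "G \<ominus> w \<otimes> (k \<otimes> G \<oplus> s) = \<zero>" using gr1 Gk sc by (simp add: G_def k_def)
    finally have gr: "g r = w \<otimes> (u \<otimes> s)" using uc sc by (simp add: G_def)
    have IH: "g j = \<zero>" if "j < r" for j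
    proof (rule Suc.IH[OF _ _ that])
      fix j assume j: "j < r"
      show "g j \<in> carrier L" using gc j by simp
      obtain d where d: "\<forall>i. d i \<in> V" "g j = w \<otimes> (\<Oplus>i\<in>{..<Suc r}. d i \<otimes> g i)" using Suc.prems(2)[of j] j by auto
      define s' where "s' = (\<Oplus>i\<in>{..<r}. d i \<otimes> g i)"
      have s'c: "s' \<in> carrier L" unfolding s'_def using fc d by blast
      define e where "e = d r"
      have ec: "e \<in> V" "e \<in> carrier L" using d Vc by (auto simp: e_def)
      have "g j = w \<otimes> (e \<otimes> (w \<otimes> (u \<otimes> s)) \<oplus> s')" using d split gr by (simp add: s'_def e_def)
      also have "e \<otimes> (w \<otimes> (u \<otimes> s)) \<oplus> s' = s' \<oplus> (e \<otimes> w \<otimes> u) \<otimes> s"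
        by (use ec uc sc s'c wc in \<open>simp add: ring_nf\<close>)
      also have "\<dots> = (\<Oplus>i\<in>{..<r}. (d i \<oplus> (e \<otimes> w \<otimes> u) \<otimes> c i) \<otimes> g i)"
        unfolding s_def s'_def using lin[OF d(1) c(1)] ec u wV VE(6) by blast
      finally show "\<exists>c. (\<forall>i. c i \<in> V) \<and> g j = w \<otimes> (\<Oplus>i\<in>{..<r}. c i \<otimes> g i)"
        using d c ec u wV VE(6,7) by (intro exI[of _ "\<lambda>i. d i \<oplus> (e \<otimes> w \<otimes> u) \<otimes> c i"]) auto
    qed
    have "s = (\<Oplus>i\<in>{..<r}. \<zero>)" unfolding s_def using IH c(1) Vc by (intro finsum_cong') auto
    then have "s = \<zero>" by simp
    then have "g r = \<zero>" using gr uc by simp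
    then show ?case using IH Suc.prems(3) less_Suc_eq by metis
  qed
  have psum_fin: "psum L y c r = (\<Oplus>i\<in>{..<r}. c i \<otimes> y [^] i)" if "y \<in> carrier L" "\<And>i. c i \<in> carrier L" for y c and r :: nat
  proof (induction r)
    case (Suc r)
    have "(\<Oplus>i\<in>{..<r}. c i \<otimes> y [^] i) \<in> carrier L" using that by (intro finsum_closed) auto
    then show ?case using Suc that unfolding lessThan_Suc by (subst finsum_insert) (auto simp: m_comm a_comm)
  qed simp
  have root: "y \<in> V" if y: "y \<in> carrier L" "y [^] p \<in> V" for y
  proof -
    let ?S = "simple_extension V y"
    have Sf: "?S = {psum L y c p | c. \<forall>i. c i \<in> V}" by (rule simple_extension_root[OF Vs(1) y p_pos])
    have S: "subring ?S L" "V \<subseteq> ?S" "y \<in> ?S"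
      using simple_extension_is_subring[OF Vs(1) y(1)] simple_extension_incl[OF VE(1) y(1)]
        simple_extension_mem[OF Vs(1) y(1)] by auto
    have "w \<otimes> s \<noteq> \<one>" if s: "s \<in> ?S" for s
    proof
      assume ws: "w \<otimes> s = \<one>"
      \<comment> \<open>If w s = 1 with s in V[y], each power y^j = w (s y^j) lies in
        \<open>w\<close> times the span of the powers below \<open>p\<close>; by \<open>nak\<close>
        these powers vanish, including y^0 = 1.\<close>
      have "y [^] j = \<zero>" if "j < p" for j
      proof (rule nak[OF _ _ that])
        fix j :: nat
        show "y [^] j \<in> carrier L" using y by simp
        have "s \<otimes> y [^] j \<in> ?S" using subringE(6)[OF S(1) s subring_pow_closed[OF S(1,3)]] .
        then obtain c where c: "s \<otimes> y [^] j = psum L y c p" "\<forall>i. c i \<in> V" using Sf by auto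
        have sc: "s \<in> carrier L" using s subringE(1)[OF S(1)] by blast
        have "y [^] j = (w \<otimes> s) \<otimes> y [^] j" using ws y by simp
        also have "\<dots> = w \<otimes> (s \<otimes> y [^] j)" using sc y by (simp add: m_assoc)
        finally show "\<exists>c. (\<forall>i. c i \<in> V) \<and> y [^] j = w \<otimes> (\<Oplus>i\<in>{..<p}. c i \<otimes> y [^] i)"
          using c psum_fin[OF y(1), of c] Vc by auto
      qed
      from this[OF p_pos] show False by simp
    qed
    then have "?S \<in> F" using S Vs by (auto simp: F_def)
    then show "y \<in> V" using V(2) S by blast
  qed
  show thesis by (rule that[OF Vs root])
qed

end

locale amb_order = amb +
  fixes V
  assumes V: "subring V L" "A0 \<subseteq> V" and V_one: "\<And>v. v \<in> V \<Longrightarrow> w \<otimes> v \<noteq> \<one>"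
    and V_root: "\<And>y. y \<in> carrier L \<Longrightarrow> y [^] p \<in> V \<Longrightarrow> y \<in> V"
begin

lemma wV: "w \<in> V" using wA V by blast

lemma V_carrier: "v \<in> V \<Longrightarrow> v \<in> carrier L" using subringE(1)[OF V(1)] by blast

lemma V_cring: "cring (L\<lparr>carrier := V\<rparr>)"
  using subring_is_domain[OF V(1)] domain.axioms(1) by blast

lemma V_unif: "unif (L\<lparr>carrier := V\<rparr>) w p"
proof -
  interpret O: cring "L\<lparr>carrier := V\<rparr>" by (rule V_cring)
  have one: "\<one>\<^bsub>L\<lparr>carrier := V\<rparr>\<^esub> \<in> carrier (L\<lparr>carrier := V\<rparr>)" by (rule O.one_closed)
  have e: "[n] \<cdot>\<^bsub>L\<lparr>carrier := V\<rparr>\<^esub> \<one>\<^bsub>L\<lparr>carrier := V\<rparr>\<^esub> = [n] \<cdot> \<one>" for n :: nat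
    by (induction n) (simp_all add: add_pow_def)
  obtain c where c: "c \<in> A0" "[p] \<cdot> \<one> = w \<otimes> c" using pw by blast
  have cc: "c \<in> V" "c \<in> carrier L" using c V V_carrier by auto
  show ?thesis
  proof
    show "cg (L\<lparr>carrier := V\<rparr>) w 1 ([p] \<cdot>\<^bsub>L\<lparr>carrier := V\<rparr>\<^esub> \<one>\<^bsub>L\<lparr>carrier := V\<rparr>\<^esub>) \<zero>\<^bsub>L\<lparr>carrier := V\<rparr>\<^esub>"
      unfolding e by (rule O.cgI[of _ _ c]) (use cc c wV subringE(2)[OF V(1)] O.nat_pow_eone[of w] in auto)
  qed (use wV p_prime in auto)
qed

text \<open>Congruence modulo \<open>w\<close> is formed once, in the largest ring \<open>V\<close>.
  For the intermediate orders it agrees with their own congruence by saturation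
  (\<open>state_cg\<close>), so residues can be compared across extensions.\<close>

definition sim :: "'a \<Rightarrow> 'a \<Rightarrow> bool" (infix \<open>\<doteq>\<close> 50) where
  "x \<doteq> y \<longleftrightarrow> x \<in> V \<and> y \<in> V \<and> (\<exists>z\<in>V. x = y \<oplus> w \<otimes> z)"

lemma sim_cg: "x \<doteq> y \<longleftrightarrow> cg (L\<lparr>carrier := V\<rparr>) w 1 x y"
proof -
  interpret O: unif "L\<lparr>carrier := V\<rparr>" w p by (rule V_unif)
  show ?thesis using O.nat_pow_eone[OF O.w_closed] by (simp add: sim_def cg_def)
qed

lemma sim_refl: "x \<in> V \<Longrightarrow> x \<doteq> x"
  unfolding sim_cg using unif.axioms(1)[OF V_unif] cring.cg_refl[of "L\<lparr>carrier := V\<rparr>" x w 1] wV by simp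

lemma sim_sym: "x \<doteq> y \<Longrightarrow> y \<doteq> x"
  unfolding sim_cg by (rule unif.cgs[OF V_unif])

lemma sim_trans [trans]: "x \<doteq> y \<Longrightarrow> y \<doteq> z \<Longrightarrow> x \<doteq> z"
  unfolding sim_cg by (rule unif.cgt[OF V_unif])

lemma sim_add: "x \<doteq> y \<Longrightarrow> x' \<doteq> y' \<Longrightarrow> x \<oplus> x' \<doteq> y \<oplus> y'"
  unfolding sim_cg using cring.cg_add[OF V_cring, of w 1 x y x' y'] wV by simp

lemma sim_mult: "x \<doteq> y \<Longrightarrow> x' \<doteq> y' \<Longrightarrow> x \<otimes> x' \<doteq> y \<otimes> y'"
  unfolding sim_cg using cring.cg_mult[OF V_cring, of w 1 x y x' y'] wV by simp

lemma sim_V: "x \<doteq> y \<Longrightarrow> x \<in> V" "x \<doteq> y \<Longrightarrow> y \<in> V"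
  by (auto simp: sim_def)

lemma sim_neg: assumes "x \<doteq> y" shows "\<ominus> x \<doteq> \<ominus> y"
proof -
  have "\<ominus> \<one> \<in> V" using subringE(3,5)[OF V(1)] by blast
  then have "\<ominus> \<one> \<otimes> x \<doteq> \<ominus> \<one> \<otimes> y" using assms sim_mult sim_refl by blast
  then show ?thesis using assms sim_V V_carrier by (simp add: l_minus)
qed

lemma sim_pow: "x \<doteq> y \<Longrightarrow> x [^] (n::nat) \<doteq> y [^] n"
  by (induction n) (auto intro: sim_mult sim_refl subringE(3)[OF V(1)])

lemma sim_frob_add: "x \<in> V \<Longrightarrow> y \<in> V \<Longrightarrow> (x \<oplus> y) [^] p \<doteq> x [^] p \<oplus> y [^] p"
  unfolding sim_cg using unif.frob_add[OF V_unif, of x y] by (simp add: nat_pow_consistent[symmetric])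

lemma sim_frob_neg: "x \<in> V \<Longrightarrow> (\<ominus> x) [^] p \<doteq> \<ominus> (x [^] p)"
proof -
  assume x: "x \<in> V"
  have V0: "\<zero> \<in> V" "\<ominus> x \<in> V" "x [^] p \<in> V" "\<ominus> (x [^] p) \<in> V" "(\<ominus> x) [^] p \<in> V"
    using x V subringE(2,5)[OF V(1)] subring_pow_closed[OF V(1)] by auto
  have xc: "x \<in> carrier L" using x V_carrier by blast
  have "(\<ominus> x \<oplus> x) [^] p \<doteq> (\<ominus> x) [^] p \<oplus> x [^] p" by (rule sim_frob_add) (use x V0 in auto)
  then have "\<zero> \<doteq> (\<ominus> x) [^] p \<oplus> x [^] p" using xc p_pos by (simp add: l_neg nat_pow_zero)
  then have "\<zero> \<oplus> \<ominus> (x [^] p) \<doteq> (\<ominus> x) [^] p \<oplus> x [^] p \<oplus> \<ominus> (x [^] p)"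
    by (rule sim_add) (use V0 sim_refl in auto)
  then have "\<ominus> (x [^] p) \<doteq> (\<ominus> x) [^] p" using xc by (simp add: a_assoc r_neg)
  then show ?thesis by (rule sim_sym)
qed

lemma sim_psum_frob:
  assumes "y \<in> V" "\<And>i. c i \<in> V"
  shows "psum L y c n [^] p \<doteq> psum L (y [^] p) (\<lambda>i. c i [^] p) n"
proof (induction n)
  case 0
  then show ?case using p_pos subringE(2)[OF V(1)] by (auto simp: nat_pow_zero intro: sim_refl)
next
  case (Suc n)
  have P: "psum L y c n \<in> V" "y [^] n \<in> V" using subring_psum[OF V(1)] subring_pow_closed[OF V(1)] assms by auto
  have "(psum L y c n \<oplus> y [^] n \<otimes> c n) [^] p \<doteq> psum L y c n [^] p \<oplus> (y [^] n \<otimes> c n) [^] p"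
    by (rule sim_frob_add) (use P assms subringE(6)[OF V(1)] in auto)
  also have "\<dots> \<doteq> psum L (y [^] p) (\<lambda>i. c i [^] p) n \<oplus> (y [^] n \<otimes> c n) [^] p"
    by (rule sim_add[OF Suc sim_refl]) (use P assms subringE(6)[OF V(1)] subring_pow_closed[OF V(1)] in auto)
  also have "(y [^] n \<otimes> c n) [^] p = (y [^] p) [^] n \<otimes> c n [^] p"
    using assms V_carrier by (simp add: nat_pow_distrib nat_pow_pow mult.commute)
  finally show ?case by simp
qed

lemma sim_psum:
  assumes "x \<in> V" "\<And>i. c i \<doteq> d i" shows "psum L x c n \<doteq> psum L x d n"
proof (induction n)
  case 0
  then show ?case using subringE(2)[OF V(1)] by (auto intro: sim_refl)
next
  case (Suc n)
  have "x [^] n \<in> V" using subring_pow_closed[OF V(1)] assms by auto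
  then show ?case using Suc assms by (auto intro!: sim_add sim_mult sim_refl)
qed

text \<open>Intermediate orders with residue ring reduced and purely inseparable over that of \<open>A0\<close>; the last
  condition also says that \<open>D\<close> is saturated, so that reduction modulo \<open>w\<close> may be tested in \<open>V\<close>.\<close>

definition state :: "'a set \<Rightarrow> bool" where
  "state D \<longleftrightarrow> subring D L \<and> A0 \<subseteq> D \<and> D \<subseteq> V \<and> (\<forall>d\<in>D. \<exists>n. \<exists>a\<in>A0. d [^] (p ^ n) \<doteq> a) \<and>
     (\<forall>d\<in>D. d [^] p \<doteq> \<zero> \<longrightarrow> (\<exists>e\<in>D. d = w \<otimes> e))"

lemma stateD:
  assumes "state D"
  shows "subring D L" "A0 \<subseteq> D" "D \<subseteq> V" "d \<in> D \<Longrightarrow> \<exists>n. \<exists>a\<in>A0. d [^] (p ^ n) \<doteq> a"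
    "d \<in> D \<Longrightarrow> d [^] p \<doteq> \<zero> \<Longrightarrow> \<exists>e\<in>D. d = w \<otimes> e"
  using assms by (auto simp: state_def)

lemma zero_pow_p: "\<zero> [^] p = \<zero>" using p_pos by (simp add: nat_pow_zero)

lemma state_zero: "state D \<Longrightarrow> d \<in> D \<Longrightarrow> d \<doteq> \<zero> \<Longrightarrow> \<exists>e\<in>D. d = w \<otimes> e"
  using stateD(5) sim_pow[of d \<zero> p] zero_pow_p by simp

lemma sim_zeroI: "e \<in> V \<Longrightarrow> w \<otimes> e \<doteq> \<zero>"
  using wV V_carrier subringE(2,6)[OF V(1)] by (auto simp: sim_def)

lemma not_sim_one: "\<not> \<one> \<doteq> \<zero>"
  using V_one V_carrier by (fastforce simp: sim_def)

lemma A0_state: "state A0"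
  unfolding state_def
proof (intro conjI ballI impI)
  show "\<exists>n. \<exists>a\<in>A0. d [^] (p ^ n) \<doteq> a" if "d \<in> A0" for d
  proof -
    have "d \<in> V" "d \<in> carrier L" using that V(2) V_carrier by auto
    then have "d [^] (p ^ 0) \<doteq> d" using sim_refl by simp
    then show ?thesis using that by blast
  qed
  show "\<exists>e\<in>A0. d = w \<otimes> e" if d: "d \<in> A0" "d [^] p \<doteq> \<zero>" for d
  proof (rule ccontr)
    assume "\<not> (\<exists>e\<in>A0. d = w \<otimes> e)"
    then obtain b where b: "b \<in> A0" "d \<otimes> b = \<one>" using A_unit d by blast
    have bd: "b \<in> V" "d \<in> V" "b \<in> carrier L" "d \<in> carrier L" using b d V V_carrier by auto
    have "d [^] p \<otimes> b [^] p \<doteq> \<zero> \<otimes> b [^] p"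
      by (rule sim_mult[OF d(2) sim_refl]) (use bd subring_pow_closed[OF V(1)] in auto)
    then have "\<one> \<doteq> \<zero>" using b bd by (simp add: nat_pow_distrib[symmetric])
    then show False using not_sim_one by blast
  qed
qed (use A0 V in auto)

text \<open>The residue ring of \<open>D\<close> is a field: a p-power of \<open>d\<close> is
  congruent to an element of \<open>A0\<close>, which is a unit there, since otherwise reducedness
  would force d \<doteq> 0.\<close>

lemma state_inverse:
  assumes D: "state D" and d: "d \<in> D" "\<not> d \<doteq> \<zero>"
  shows "\<exists>e\<in>D. d \<otimes> e \<doteq> \<one>"
proof -
  note s = stateD(1-3)[OF D]
  have dV: "d \<in> V" "d \<in> carrier L" using d s V_carrier by auto
  obtain n a where a: "a \<in> A0" "d [^] (p ^ n) \<doteq> a" using stateD(4)[OF D d(1)] by blast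
  have nz: "\<not> d [^] (p ^ m) \<doteq> \<zero>" for m
  proof (induction m)
    case 0
    then show ?case using d dV by simp
  next
    case (Suc m)
    show ?case
    proof
      assume "d [^] (p ^ Suc m) \<doteq> \<zero>"
      then have "(d [^] (p ^ m)) [^] p \<doteq> \<zero>" using dV by (simp add: nat_pow_pow mult.commute)
      then obtain e where "e \<in> D" "d [^] (p ^ m) = w \<otimes> e" using stateD(5)[OF D] subring_pow_closed[OF s(1) d(1)] by blast
      then show False using Suc sim_zeroI s by auto
    qed
  qed
  have "\<not> (\<exists>b\<in>A0. a = w \<otimes> b)"
  proof
    assume "\<exists>b\<in>A0. a = w \<otimes> b"
    then have "a \<doteq> \<zero>" using sim_zeroI V by auto
    then show False using a nz sim_trans by blast
  qed
  then obtain b where b: "b \<in> A0" "a \<otimes> b = \<one>" using A_unit a by blast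
  obtain m where m: "p ^ n = Suc m" using p_pos by (metis gr0_implies_Suc zero_less_power)
  have bc: "b \<in> D" "b \<in> V" "b \<in> carrier L" using b s V V_carrier by auto
  have "d [^] (p ^ n) \<otimes> b \<doteq> a \<otimes> b" by (rule sim_mult[OF a(2) sim_refl[OF bc(2)]])
  moreover have "d [^] (p ^ n) \<otimes> b = d \<otimes> (d [^] m \<otimes> b)" unfolding m nat_pow_Suc2[OF dV(2)] using dV bc by (simp add: m_assoc)
  ultimately have "d \<otimes> (d [^] m \<otimes> b) \<doteq> \<one>" using b by simp
  moreover have "d [^] m \<otimes> b \<in> D" using subringE(6)[OF s(1) subring_pow_closed[OF s(1) d(1)] bc(1)] .
  ultimately show ?thesis by blast
qed

end

section \<open>Adjunction of \<open>p\<close>-th roots to the intermediate orders\<close>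

context amb_order
begin

lemma state_ring: assumes "state D" shows "cring (L\<lparr>carrier := D\<rparr>)" "w \<in> carrier (L\<lparr>carrier := D\<rparr>)"
  using subring_is_domain[OF stateD(1)[OF assms]] domain.axioms(1) stateD(2)[OF assms] wA by auto

lemma state_cg:
  assumes D: "state D" and "x \<in> D" "y \<in> D"
  shows "cg (L\<lparr>carrier := D\<rparr>) w 1 x y \<longleftrightarrow> x \<doteq> y"
proof -
  interpret DR: cring "L\<lparr>carrier := D\<rparr>" by (rule state_ring[OF D])
  have wD: "w \<in> carrier (L\<lparr>carrier := D\<rparr>)" by (rule state_ring[OF D])
  have e: "w [^]\<^bsub>L\<lparr>carrier := D\<rparr>\<^esub> (1::nat) = w" using DR.nat_pow_eone[OF wD] by simp
  show ?thesis
  proof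
    assume "cg (L\<lparr>carrier := D\<rparr>) w 1 x y"
    then show "x \<doteq> y" using stateD(3)[OF D] unfolding cg_def e sim_def by auto
  next
    assume s: "x \<doteq> y"
    have yV: "y \<in> V" "\<ominus> y \<in> V" "x \<in> V" "x \<in> carrier L" "y \<in> carrier L"
      using assms stateD(3)[OF D] subringE(5)[OF V(1)] V_carrier by auto
    have "x \<oplus> \<ominus> y \<doteq> y \<oplus> \<ominus> y" by (rule sim_add[OF s sim_refl]) (use yV in auto)
    then have "x \<oplus> \<ominus> y \<doteq> \<zero>" using yV by (simp add: r_neg)
    moreover have "x \<oplus> \<ominus> y \<in> D" using assms subringE(5,7)[OF stateD(1)[OF D]] by blast
    ultimately obtain z where z: "z \<in> D" "x \<oplus> \<ominus> y = w \<otimes> z" using state_zero[OF D] by blast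
    have "x = y \<oplus> (x \<oplus> \<ominus> y)" using yV by (simp add: a_lcomm r_neg)
    then show "cg (L\<lparr>carrier := D\<rparr>) w 1 x y" using z assms unfolding cg_def e by auto
  qed
qed

text \<open>This is \<open>frobenius_independent\<close> in the residue field of \<open>D\<close>,
  translated back to congruences.\<close>

lemma state_independent:
  assumes D: "state D" and t: "t \<in> D" "\<And>b. b \<in> D \<Longrightarrow> \<not> t \<doteq> b [^] p"
    and c: "\<And>i. c i \<in> D" "psum L t (\<lambda>i. c i [^] p) p \<doteq> \<zero>" and i: "i < p"
  shows "c i \<doteq> \<zero>"
proof -
  let ?D = "L\<lparr>carrier := D\<rparr>"
  let ?I = "PIdl\<^bsub>?D\<^esub> w"
  let ?Q = "?D Quot ?I"
  interpret DR: cring ?D by (rule state_ring[OF D])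
  have wD: "w \<in> carrier ?D" by (rule state_ring[OF D])
  have D0: "\<zero> \<in> D" "\<one> \<in> D" using subringE(2,3)[OF stateD(1)[OF D]] by auto
  interpret Q: cring ?Q by (rule DR.Quot_cring[OF wD])
  note hom = DR.Quot_hom[OF wD]
  have eqQ: "?I +>\<^bsub>?D\<^esub> x = ?I +>\<^bsub>?D\<^esub> y \<longleftrightarrow> x \<doteq> y" if "x \<in> D" "y \<in> D" for x y
    using DR.Quot_eq_iff[OF wD, of x y] state_cg[OF D that] that by simp
  have zQ: "\<zero>\<^bsub>?Q\<^esub> = ?I +>\<^bsub>?D\<^esub> \<zero>" and oQ: "\<one>\<^bsub>?Q\<^esub> = ?I +>\<^bsub>?D\<^esub> \<one>"
    using DR.Quot_zero[OF wD] DR.Quot_one[OF wD] by auto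
  have "field ?Q"
  proof (rule Q.cring_fieldI2)
    show "\<zero>\<^bsub>?Q\<^esub> \<noteq> \<one>\<^bsub>?Q\<^esub>" unfolding zQ oQ using eqQ[OF D0] not_sim_one sim_sym by blast
    fix a assume a: "a \<in> carrier ?Q" "a \<noteq> \<zero>\<^bsub>?Q\<^esub>"
    then obtain x where x: "x \<in> D" "a = ?I +>\<^bsub>?D\<^esub> x" by (auto simp: DR.Quot_carrier)
    then have "\<not> x \<doteq> \<zero>" using a eqQ D0 zQ by auto
    then obtain e where e: "e \<in> D" "x \<otimes> e \<doteq> \<one>" using state_inverse[OF D] x by blast
    have "a \<otimes>\<^bsub>?Q\<^esub> (?I +>\<^bsub>?D\<^esub> e) = ?I +>\<^bsub>?D\<^esub> (x \<otimes> e)"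
      using ring_hom_mult[OF hom, of x e] x e by simp
    also have "\<dots> = \<one>\<^bsub>?Q\<^esub>" unfolding oQ using eqQ e x D0 subringE(6)[OF stateD(1)[OF D]] by blast
    finally show "\<exists>b\<in>carrier ?Q. a \<otimes>\<^bsub>?Q\<^esub> b = \<one>\<^bsub>?Q\<^esub>" using e by (auto simp: DR.Quot_carrier)
  qed
  then interpret Q: field ?Q .
  have powQ: "(?I +>\<^bsub>?D\<^esub> x) [^]\<^bsub>?Q\<^esub> n = ?I +>\<^bsub>?D\<^esub> (x [^] n)" if "x \<in> D" for x and n :: nat
    using ring_hom_pow[OF hom DR.is_cring Q.is_cring, of x n] that by (simp add: nat_pow_consistent[symmetric])
  have psD: "psum ?D x d n = psum L x d n" for x d n
    by (induction n) (simp_all add: nat_pow_consistent[symmetric])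
  have e: "[n] \<cdot>\<^bsub>?D\<^esub> \<one>\<^bsub>?D\<^esub> = [n] \<cdot> \<one>" for n :: nat
    by (induction n) (simp_all add: add_pow_def)
  have "?I +>\<^bsub>?D\<^esub> c i = \<zero>\<^bsub>?Q\<^esub>"
  proof (rule Q.frobenius_independent[OF p_prime, where t = "?I +>\<^bsub>?D\<^esub> t" and b = "\<lambda>i. ?I +>\<^bsub>?D\<^esub> c i"])
    obtain k where k: "k \<in> A0" "[p] \<cdot> \<one> = w \<otimes> k" using pw by blast
    have "[p] \<cdot>\<^bsub>?Q\<^esub> \<one>\<^bsub>?Q\<^esub> = ?I +>\<^bsub>?D\<^esub> ([p] \<cdot> \<one>)"
      using hom_add_pow[OF hom DR.ring_axioms Q.ring_axioms DR.one_closed, of p] ring_hom_one[OF hom] e[of p] by simp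
    also have "\<dots> = \<zero>\<^bsub>?Q\<^esub>" unfolding zQ
    proof (subst eqQ)
      show "[p] \<cdot> \<one> \<in> D" unfolding k using k wA stateD(2)[OF D] subringE(6)[OF stateD(1)[OF D]] by blast
      show "[p] \<cdot> \<one> \<doteq> \<zero>" unfolding k using sim_zeroI k V by auto
    qed (use D0 in auto)
    finally show "[p] \<cdot>\<^bsub>?Q\<^esub> \<one>\<^bsub>?Q\<^esub> = \<zero>\<^bsub>?Q\<^esub>" .
    show "?I +>\<^bsub>?D\<^esub> t \<in> carrier ?Q" using t by (auto simp: DR.Quot_carrier)
    show "?I +>\<^bsub>?D\<^esub> t \<noteq> b [^]\<^bsub>?Q\<^esub> p" if "b \<in> carrier ?Q" for b
    proof -
      from that have "\<exists>x\<in>D. b = ?I +>\<^bsub>?D\<^esub> x" by (auto simp: DR.Quot_carrier)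
      then obtain x where x: "x \<in> D" "b = ?I +>\<^bsub>?D\<^esub> x" by blast
      then show ?thesis using powQ t eqQ[OF t(1) subring_pow_closed[OF stateD(1)[OF D] x(1)]] by auto
    qed
    show "?I +>\<^bsub>?D\<^esub> c i \<in> carrier ?Q" for i using c by (auto simp: DR.Quot_carrier)
    have "psum ?Q (?I +>\<^bsub>?D\<^esub> t) (\<lambda>i. (?I +>\<^bsub>?D\<^esub> c i) [^]\<^bsub>?Q\<^esub> p) p = ?I +>\<^bsub>?D\<^esub> psum L t (\<lambda>i. c i [^] p) p"
      using psum_hom[OF hom DR.is_cring Q.is_cring, of t p "\<lambda>i. c i [^] p"] t(1) c(1)
        subring_pow_closed[OF stateD(1)[OF D] c(1)] powQ
      by (simp add: psD comp_def)
    also have "\<dots> = \<zero>\<^bsub>?Q\<^esub>" unfolding zQ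
      by (subst eqQ) (use c D0 subring_psum[OF stateD(1)[OF D] t(1)] subring_pow_closed[OF stateD(1)[OF D] c(1)] in auto)
    finally show "psum ?Q (?I +>\<^bsub>?D\<^esub> t) (\<lambda>i. (?I +>\<^bsub>?D\<^esub> c i) [^]\<^bsub>?Q\<^esub> p) p = \<zero>\<^bsub>?Q\<^esub>" .
  qed (rule i)
  then show ?thesis unfolding zQ using eqQ c D0 by blast
qed

text \<open>If the p-th power of a combination of the y^i is congruent to zero, so is the sum of the
  c_i^p t^i, and independence makes every c_i divisible by \<open>w\<close>; hence D[y] stays
  reduced and saturated. The last conclusion records where p-th powers go, by which
  \<open>state_step\<close> keeps track of independence.\<close>

lemma state_extend:
  assumes D: "state D" and t: "t \<in> D" "\<And>b. b \<in> D \<Longrightarrow> \<not> t \<doteq> b [^] p"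
    and y: "y \<in> carrier L" "y [^] p = t"
  obtains D' where "state D'" "D \<subseteq> D'" "y \<in> D'"
    "\<And>x. x \<in> D' \<Longrightarrow> \<exists>c. (\<forall>i. c i \<in> D) \<and> x [^] p \<doteq> psum L t (\<lambda>i. c i [^] p) p"
proof -
  let ?D = "simple_extension D y"
  note s = stateD(1-3)[OF D]
  have yV: "y \<in> V" using V_root y t s by auto
  have Df: "?D = {psum L y c p | c. \<forall>i. c i \<in> D}"
    by (rule simple_extension_root[OF s(1) y(1)]) (use y t p_pos in auto)
  have sub: "subring ?D L" "D \<subseteq> ?D" "y \<in> ?D"
    using simple_extension_is_subring[OF s(1) y(1)] simple_extension_incl[OF subringE(1)[OF s(1)] y(1)]
      simple_extension_mem[OF s(1) y(1)] by auto
  have inV: "?D \<subseteq> V" by (rule simple_extension_subring_incl[OF V(1) s(3) yV])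
  have frob: "psum L y c p [^] p \<doteq> psum L t (\<lambda>i. c i [^] p) p" if "\<forall>i. c i \<in> D" for c
    using sim_psum_frob[OF yV, of c p] that s(3) y(2) by blast
  have psD: "psum L t (\<lambda>i. c i [^] p) p \<in> D" if "\<forall>i. c i \<in> D" for c
    by (rule subring_psum[OF s(1) t(1)]) (use that subring_pow_closed[OF s(1)] in blast)
  have st: "state ?D"
    unfolding state_def
  proof (intro conjI ballI impI)
    fix d assume "d \<in> ?D"
    then obtain c where c: "d = psum L y c p" "\<forall>i. c i \<in> D" unfolding Df by blast
    define f where "f = psum L t (\<lambda>i. c i [^] p) p"
    have f: "f \<in> D" "d [^] p \<doteq> f" using psD frob c by (auto simp: f_def)
    have dc: "d \<in> carrier L" using \<open>d \<in> ?D\<close> inV V_carrier by blast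
    show "\<exists>n. \<exists>a\<in>A0. d [^] (p ^ n) \<doteq> a"
    proof -
      obtain n a where na: "a \<in> A0" "f [^] (p ^ n) \<doteq> a" using stateD(4)[OF D f(1)] by blast
      have "(d [^] p) [^] (p ^ n) \<doteq> f [^] (p ^ n)" by (rule sim_pow[OF f(2)])
      then have "d [^] (p ^ Suc n) \<doteq> a" using na(2) sim_trans dc by (simp add: nat_pow_pow)
      then show ?thesis using na(1) by blast
    qed
    show "\<exists>e\<in>?D. d = w \<otimes> e" if "d [^] p \<doteq> \<zero>"
    proof -
      have "f \<doteq> \<zero>" using sim_trans[OF sim_sym[OF f(2)] that] .
      then have "c i \<doteq> \<zero>" if "i < p" for i
        using state_independent[OF D t, of c i] c(2) that by (simp add: f_def)
      then have "\<exists>e\<in>D. c i = w \<otimes> e" if "i < p" for i using state_zero[OF D] c that by blast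
      then obtain e where e: "\<And>i. i < p \<Longrightarrow> e i \<in> D" "\<And>i. i < p \<Longrightarrow> c i = w \<otimes> e i" by metis
      have ec: "i < p \<Longrightarrow> e i \<in> carrier L" for i using e(1) subringE(1)[OF s(1)] by blast
      have "psum L y c n = psum L y (\<lambda>i. w \<otimes> e i) n" if "n \<le> p" for n
        using that by (induction n) (use e in auto)
      then have "d = w \<otimes> psum L y e p" using psum_smult[OF y(1), of p e w] ec c by simp
      moreover have "psum L y e p \<in> ?D" by (rule subring_psum[OF sub(1,3)]) (use e sub in blast)
      ultimately show ?thesis by blast
    qed
  qed (use sub inV s in auto)
  show thesis
  proof (rule that[OF st sub(2,3)])
    fix x assume "x \<in> ?D"
    then obtain c where c: "x = psum L y c p" "\<forall>i. c i \<in> D" unfolding Df by blast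
    then show "\<exists>c. (\<forall>i. c i \<in> D) \<and> x [^] p \<doteq> psum L t (\<lambda>i. c i [^] p) p" using frob by blast
  qed
qed

text \<open>Modulo \<open>w\<close> this is k_D^p[T] for the residue field k_D of \<open>D\<close>.
  In general the p-th powers are closed under addition only modulo \<open>w\<close>, hence the
  generated ring.\<close>

definition gen :: "'a set \<Rightarrow> 'a set \<Rightarrow> 'a set" where
  "gen D T = generate_ring L ((\<lambda>d. d [^] p) ` D \<union> T)"

text \<open>Ordered \<open>p\<close>-independence modulo \<open>w\<close>: each \<open>y i\<close> avoids the ring generated by all \<open>p\<close>-th powers and
  the preceding \<open>y j\<close>.\<close>

definition ind :: "'a set \<Rightarrow> (nat \<Rightarrow> 'a) \<Rightarrow> nat \<Rightarrow> bool" where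
  "ind D y r \<longleftrightarrow> (\<forall>i<r. y i \<in> D \<and> (\<forall>e\<in>gen D (y ` {..<i}). \<not> y i \<doteq> e))"

lemma gen_subring: "D \<subseteq> carrier L \<Longrightarrow> T \<subseteq> carrier L \<Longrightarrow> subring (gen D T) L"
  unfolding gen_def by (rule generate_ring_is_subring) auto

lemma gen_pow: "d \<in> D \<Longrightarrow> d [^] p \<in> gen D T"
  unfolding gen_def by (auto intro: generate_ring.incl)

lemma gen_incl: "d \<in> T \<Longrightarrow> d \<in> gen D T"
  unfolding gen_def by (auto intro: generate_ring.incl)

lemma gen_mono: "T \<subseteq> T' \<Longrightarrow> D \<subseteq> carrier L \<Longrightarrow> T' \<subseteq> carrier L \<Longrightarrow> gen D T \<subseteq> gen D T'"
  unfolding gen_def by (rule mono_generate_ring) auto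

lemma gen_subset: "subring D L \<Longrightarrow> T \<subseteq> D \<Longrightarrow> gen D T \<subseteq> D"
  unfolding gen_def using subring_pow_closed[of D] subringE(1)[of D L]
  by (intro generate_ring_min_subring1) auto

text \<open>The roots are adjoined one after the other. After k of them, all p-th powers lie modulo
  \<open>w\<close> in the ring generated by the p-th powers of \<open>D\<close> and the first k
  elements, so the next element is still not a p-th power and \<open>state_extend\<close>
  applies.\<close>

lemma state_step:
  assumes D: "state D" and t: "ind D t r"
  shows "\<exists>D' y. state D' \<and> D \<subseteq> D' \<and> (\<forall>i<r. y i [^] p = t i) \<and> ind D' y r"
proof -
  note s = stateD(1-3)[OF D]
  have Dc: "D \<subseteq> carrier L" using subringE(1)[OF s(1)] .
  have tD: "t i \<in> D" if "i < r" for i using t that by (auto simp: ind_def)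
  have "\<exists>y. \<forall>i\<in>{..<r}. y i \<in> carrier L \<and> y i [^] p = t i"
    using roots tD Dc by (intro bchoice) blast
  then obtain y where y: "\<And>i. i < r \<Longrightarrow> y i \<in> carrier L" "\<And>i. i < r \<Longrightarrow> y i [^] p = t i" by auto
  have Tc: "t ` {..<k} \<subseteq> D" "t ` {..<k} \<subseteq> carrier L" if "k \<le> r" for k
    using tD Dc that by auto
  have "k \<le> r \<Longrightarrow> \<exists>E. state E \<and> D \<subseteq> E \<and> (\<forall>i<k. y i \<in> E) \<and> (\<forall>x\<in>E. \<exists>e\<in>gen D (t ` {..<k}). x [^] p \<doteq> e)" for k
  proof (induction k)
    case 0
    have "\<exists>e\<in>gen D (t ` {..<0}). x [^] p \<doteq> e" if "x \<in> D" for x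
      using gen_pow[OF that] sim_refl subring_pow_closed[OF s(1) that] s(3) by blast
    then show ?case using D by blast
  next
    case (Suc k)
    then obtain E where E: "state E" "D \<subseteq> E" "\<forall>i<k. y i \<in> E" "\<forall>x\<in>E. \<exists>e\<in>gen D (t ` {..<k}). x [^] p \<doteq> e" by auto
    have k: "k < r" using Suc by simp
    have nt: "\<not> t k \<doteq> b [^] p" if b: "b \<in> E" for b
    proof
      assume "t k \<doteq> b [^] p"
      moreover obtain e where "e \<in> gen D (t ` {..<k})" "b [^] p \<doteq> e" using E(4) b by blast
      ultimately have "e \<in> gen D (t ` {..<k})" "t k \<doteq> e" using sim_trans by blast+
      then show False using t k by (auto simp: ind_def)
    qed
    have tE: "t k \<in> E" using tD[OF k] E(2) by blast
    obtain E' where E': "state E'" "E \<subseteq> E'" "y k \<in> E'"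
      "\<And>x. x \<in> E' \<Longrightarrow> \<exists>c. (\<forall>i. c i \<in> E) \<and> x [^] p \<doteq> psum L (t k) (\<lambda>i. c i [^] p) p"
      by (rule state_extend[OF E(1) tE nt y(1)[OF k] y(2)[OF k]]) (assumption, rule that)
    have G1: "subring (gen D (t ` {..<Suc k})) L" by (rule gen_subring[OF Dc Tc(2)[OF Suc.prems]])
    have "t ` {..<k} \<subseteq> t ` {..<Suc k}" by auto
    then have "gen D (t ` {..<k}) \<subseteq> gen D (t ` {..<Suc k})" by (rule gen_mono[OF _ Dc Tc(2)[OF Suc.prems]])
    note G = G1 this
    have tG: "t k \<in> gen D (t ` {..<Suc k})" by (rule gen_incl) auto
    have "\<exists>e\<in>gen D (t ` {..<Suc k}). x [^] p \<doteq> e" if x: "x \<in> E'" for x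
    proof -
      obtain c where c: "\<forall>i. c i \<in> E" "x [^] p \<doteq> psum L (t k) (\<lambda>i. c i [^] p) p" using E'(4)[OF x] by blast
      have "\<forall>i. \<exists>e. e \<in> gen D (t ` {..<k}) \<and> c i [^] p \<doteq> e" using E(4) c(1) by blast
      then obtain e where e: "\<And>i. e i \<in> gen D (t ` {..<k})" "\<And>i. c i [^] p \<doteq> e i" by metis
      have "psum L (t k) (\<lambda>i. c i [^] p) p \<doteq> psum L (t k) e p"
        by (rule sim_psum) (use e tE stateD(3)[OF E(1)] in auto)
      then have "x [^] p \<doteq> psum L (t k) e p" using c(2) sim_trans by blast
      moreover have "psum L (t k) e p \<in> gen D (t ` {..<Suc k})"
        by (rule subring_psum[OF G(1) tG]) (use e(1) G(2) in blast)
      ultimately show ?thesis by blast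
    qed
    then show ?case using E' E(2,3) by (intro exI[of _ E']) (auto simp: less_Suc_eq)
  qed
  from this[OF order_refl] obtain E where E: "state E" "D \<subseteq> E" "\<forall>i<r. y i \<in> E"
    "\<forall>x\<in>E. \<exists>e\<in>gen D (t ` {..<r}). x [^] p \<doteq> e" by blast
  \<comment> \<open>The Frobenius carries a dependence of \<open>y i\<close> on the preceding roots
    over \<open>E\<close> to one of \<open>t i\<close> over \<open>D\<close>. The new sequence is
    therefore independent again, and the step can be iterated.\<close>
  have key: "\<exists>e'\<in>gen D (t ` {..<i}). e [^] p \<doteq> e'" if i: "i < r" and e: "e \<in> gen E (y ` {..<i})" for e i
  proof -
    have G: "subring (gen D (t ` {..<i})) L" using gen_subring[OF Dc Tc(2)] i by simp
    have GD: "gen D (t ` {..<r}) \<subseteq> D" using gen_subset[OF s(1) Tc(1)] by simp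
    have *: "e \<in> V \<and> (\<exists>e'\<in>gen D (t ` {..<i}). e [^] p \<doteq> e')"
      using e unfolding gen_def[of E]
    proof (induction rule: generate_ring.induct)
      case one
      have "\<one> \<in> V" "\<one> \<in> gen D (t ` {..<i})" using subringE(3) G V by auto
      then show ?case using sim_refl by (auto intro!: bexI[of _ \<one>])
    next
      case (incl h)
      then show ?case
      proof
        assume "h \<in> (\<lambda>d. d [^] p) ` E"
        then obtain d where d: "d \<in> E" "h = d [^] p" by blast
        obtain f where f: "f \<in> gen D (t ` {..<r})" "d [^] p \<doteq> f" using E(4) d by blast
        then have "h [^] p \<doteq> f [^] p" using sim_pow d by simp
        moreover have "f [^] p \<in> gen D (t ` {..<i})" using gen_pow f GD by blast
        moreover have "h \<in> V" using sim_V(1)[OF f(2)] d by simp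
        ultimately show ?thesis by blast
      next
        assume "h \<in> y ` {..<i}"
        then obtain j where j: "j < i" "h = y j" by blast
        have "t j \<in> V" "h \<in> V" using tD[of j] i j s(3) E(3) stateD(3)[OF E(1)] by auto
        then show ?thesis using y(2)[of j] j i sim_refl by (auto intro!: bexI[of _ "t j"] gen_incl)
      qed
    next
      case (a_inv h)
      then obtain e' where e': "e' \<in> gen D (t ` {..<i})" "h [^] p \<doteq> e'" "h \<in> V" by blast
      have "(\<ominus> h) [^] p \<doteq> \<ominus> e'" using sim_trans[OF sim_frob_neg[OF e'(3)] sim_neg[OF e'(2)]] .
      then show ?case using subringE(5)[OF G e'(1)] subringE(5)[OF V(1) e'(3)] by blast
    next
      case (eng_add h1 h2)
      then obtain e1 e2 where e': "e1 \<in> gen D (t ` {..<i})" "h1 [^] p \<doteq> e1" "h1 \<in> V"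
        "e2 \<in> gen D (t ` {..<i})" "h2 [^] p \<doteq> e2" "h2 \<in> V" by blast
      have "(h1 \<oplus> h2) [^] p \<doteq> e1 \<oplus> e2" using sim_trans[OF sim_frob_add[OF e'(3,6)] sim_add[OF e'(2,5)]] .
      then show ?case using subringE(7)[OF G e'(1,4)] subringE(7)[OF V(1) e'(3,6)] by blast
    next
      case (eng_mult h1 h2)
      then obtain e1 e2 where e': "e1 \<in> gen D (t ` {..<i})" "h1 [^] p \<doteq> e1" "h1 \<in> V"
        "e2 \<in> gen D (t ` {..<i})" "h2 [^] p \<doteq> e2" "h2 \<in> V" by blast
      have "(h1 \<otimes> h2) [^] p \<doteq> e1 \<otimes> e2" using sim_mult[OF e'(2,5)] e'(3,6) V_carrier by (simp add: nat_pow_distrib)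
      then show ?case using subringE(6)[OF G e'(1,4)] subringE(6)[OF V(1) e'(3,6)] by blast
    qed
    then show ?thesis by blast
  qed
  have "ind E y r"
    unfolding ind_def
  proof (intro allI impI conjI ballI)
    fix i assume i: "i < r"
    show "y i \<in> E" using E i by blast
    fix e assume e: "e \<in> gen E (y ` {..<i})"
    show "\<not> y i \<doteq> e"
    proof
      assume "y i \<doteq> e"
      then have "t i \<doteq> e [^] p" using sim_pow[of "y i" e p] y(2)[OF i] by simp
      moreover obtain e' where e': "e' \<in> gen D (t ` {..<i})" "e [^] p \<doteq> e'" using key[OF i e] by blast
      ultimately have "t i \<doteq> e'" using sim_trans by blast
      then show False using t i e' by (auto simp: ind_def)
    qed
  qed
  then show ?thesis using E y by blast
qed

lemma state_steps:
  assumes D: "state D" and t: "ind D t r"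
  shows "\<exists>D' y. state D' \<and> D \<subseteq> D' \<and> (\<forall>i<r. y i [^] (p ^ M) = t i) \<and> ind D' y r"
proof (induction M)
  case 0
  have "t i \<in> carrier L" if "i < r" for i using t that stateD(3)[OF D] V_carrier by (auto simp: ind_def)
  then show ?case using D t by (intro exI[of _ D] exI[of _ t]) auto
next
  case (Suc M)
  then obtain D1 y1 where 1: "state D1" "D \<subseteq> D1" "\<forall>i<r. y1 i [^] (p ^ M) = t i" "ind D1 y1 r" by blast
  obtain D2 y2 where 2: "state D2" "D1 \<subseteq> D2" "\<forall>i<r. y2 i [^] p = y1 i" "ind D2 y2 r" using state_step[OF 1(1,4)] by blast
  have "y2 i [^] (p ^ Suc M) = t i" if "i < r" for i
  proof -
    have "y2 i \<in> carrier L" using 2(4) that stateD(3)[OF 2(1)] V_carrier by (auto simp: ind_def)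
    then have "y2 i [^] (p ^ Suc M) = (y2 i [^] p) [^] (p ^ M)" by (simp add: nat_pow_pow)
    then show ?thesis using 1 2 that by simp
  qed
  then show ?case using 1 2 by blast
qed

text \<open>A maximal \<open>state\<close> above \<open>D\<close> is residually perfect: an element
  that is not a p-th power modulo \<open>w\<close> would allow a further extension by
  \<open>state_extend\<close>.\<close>

lemma state_hull:
  assumes D: "state D"
  shows "\<exists>H. state H \<and> D \<subseteq> H \<and> (\<forall>d\<in>H. \<exists>b\<in>H. d \<doteq> b [^] p)"
proof -
  define F where "F = {H. state H \<and> D \<subseteq> H}"
  have "\<exists>M\<in>F. \<forall>T\<in>F. M \<subseteq> T \<longrightarrow> T = M"
  proof (rule subset_Zorn_nonempty)
    show "F \<noteq> {}" using D by (auto simp: F_def)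
    fix C assume C: "C \<noteq> {}" "subset.chain F C"
    then have ch: "\<And>S T. S \<in> C \<Longrightarrow> T \<in> C \<Longrightarrow> S \<subseteq> T \<or> T \<subseteq> S" "\<And>S. S \<in> C \<Longrightarrow> S \<in> F"
      by (auto simp: subset_chain_def)
    have CF: "state S" "D \<subseteq> S" if "S \<in> C" for S using ch(2)[OF that] by (auto simp: F_def)
    have "state (\<Union>C)"
      unfolding state_def
    proof (intro conjI ballI impI)
      show "subring (\<Union>C) L" by (rule subring_chain_Union[OF C(1) stateD(1)[OF CF(1)] ch(1)])
      show "A0 \<subseteq> \<Union>C" using C(1) stateD(2)[OF CF(1)] by blast
      show "\<Union>C \<subseteq> V" using stateD(3)[OF CF(1)] by blast
      show "\<exists>n. \<exists>a\<in>A0. d [^] (p ^ n) \<doteq> a" if "d \<in> \<Union>C" for d using that stateD(4)[OF CF(1)] by blast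
      show "\<exists>e\<in>\<Union>C. d = w \<otimes> e" if "d \<in> \<Union>C" "d [^] p \<doteq> \<zero>" for d using that stateD(5)[OF CF(1)] by blast
    qed
    then show "\<Union>C \<in> F" using C(1) CF(2) by (auto simp: F_def)
  qed
  then obtain H where H: "state H" "D \<subseteq> H" "\<And>T. state T \<Longrightarrow> D \<subseteq> T \<Longrightarrow> H \<subseteq> T \<Longrightarrow> T = H" by (auto simp: F_def)
  have "\<exists>b\<in>H. d \<doteq> b [^] p" if d: "d \<in> H" for d
  proof (rule ccontr)
    assume n: "\<not> (\<exists>b\<in>H. d \<doteq> b [^] p)"
    have "d \<in> carrier L" using d stateD(3)[OF H(1)] V_carrier by blast
    then obtain y where y: "y \<in> carrier L" "y [^] p = d" using roots by blast
    have n': "\<And>b. b \<in> H \<Longrightarrow> \<not> d \<doteq> b [^] p" using n by blast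
    obtain T where T: "state T" "H \<subseteq> T" "y \<in> T"
      by (rule state_extend[OF H(1) d n' y]) (assumption, rule that)
    then have "T = H" using H by blast
    then have "y \<in> H" "d \<doteq> y [^] p" using T y sim_refl d stateD(3)[OF H(1)] by auto
    then show False using n by blast
  qed
  then show ?thesis using H by blast
qed

end

section \<open>Completion and transport of structure\<close>

locale precomplete = nunif +
  assumes surj': "x \<in> carrier R \<Longrightarrow> \<exists>y\<in>carrier R. cg R w 1 x (y [^] p)"
    and red': "x \<in> carrier R \<Longrightarrow> cg R w 1 (x [^] p) \<zero> \<Longrightarrow> cg R w 1 x \<zero>"
begin

text \<open>The rate of convergence is fixed: the n-th term is already correct modulo w^n.
  Congruences in the completion can thus be read off a single term (\<open>cg_CR\<close>).\<close>

definition Cau :: "(nat \<Rightarrow> 'a) set" where "Cau = {x. \<forall>n. cg R w n (x (Suc n)) (x n)}"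

definition SR :: "(nat \<Rightarrow> 'a) ring" where
  "SR = \<lparr>carrier = Cau, monoid.mult = (\<lambda>x y n. x n \<otimes> y n), one = (\<lambda>_. \<one>),
     ring.zero = (\<lambda>_. \<zero>), ring.add = (\<lambda>x y n. x n \<oplus> y n)\<rparr>"

definition Nul :: "(nat \<Rightarrow> 'a) set" where "Nul = {x. \<forall>n. cg R w n (x n) \<zero>}"

definition CR :: "(nat \<Rightarrow> 'a) set ring" where "CR = SR Quot Nul"

definition cl :: "(nat \<Rightarrow> 'a) \<Rightarrow> (nat \<Rightarrow> 'a) set" where "cl x = Nul +>\<^bsub>SR\<^esub> x"

lemma SR_simps [simp]: "carrier SR = Cau" "x \<otimes>\<^bsub>SR\<^esub> y = (\<lambda>n. x n \<otimes> y n)" "\<one>\<^bsub>SR\<^esub> = (\<lambda>_. \<one>)"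
  "\<zero>\<^bsub>SR\<^esub> = (\<lambda>_. \<zero>)" "x \<oplus>\<^bsub>SR\<^esub> y = (\<lambda>n. x n \<oplus> y n)"
  by (simp_all add: SR_def)

lemma Cau_closed: "x \<in> Cau \<Longrightarrow> x n \<in> carrier R"
  unfolding Cau_def by (auto dest: cg_carrier(2))

lemma Cau_step: "x \<in> Cau \<Longrightarrow> cg R w n (x (Suc n)) (x n)"
  by (simp add: Cau_def)

lemma Cau_le: assumes "x \<in> Cau" "m \<le> n" shows "cg R w m (x n) (x m)"
  using assms(2)
proof (induction n rule: dec_induct)
  case base
  then show ?case using Cau_closed[OF assms(1)] cg_refl by blast
next
  case (step n)
  have "cg R w m (x (Suc n)) (x n)" by (rule cg_mono[OF Cau_step[OF assms(1)]]) (use step in auto)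
  then show ?case using step.IH by (rule cgt)
qed

lemma const_Cau: "a \<in> carrier R \<Longrightarrow> (\<lambda>_. a) \<in> Cau"
  by (simp add: Cau_def cg_refl)

lemma add_Cau: "x \<in> Cau \<Longrightarrow> y \<in> Cau \<Longrightarrow> (\<lambda>n. x n \<oplus> y n) \<in> Cau"
  by (simp add: Cau_def cg_add)

lemma mult_Cau: "x \<in> Cau \<Longrightarrow> y \<in> Cau \<Longrightarrow> (\<lambda>n. x n \<otimes> y n) \<in> Cau"
  by (simp add: Cau_def cg_mult)

lemma neg_Cau: "x \<in> Cau \<Longrightarrow> (\<lambda>n. \<ominus> x n) \<in> Cau"
  by (simp add: Cau_def cg_neg)

lemma SR_cring: "cring SR"
proof (rule cringI)
  show "abelian_group SR"
  proof (rule abelian_groupI)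
    show "\<exists>y\<in>carrier SR. y \<oplus>\<^bsub>SR\<^esub> x = \<zero>\<^bsub>SR\<^esub>" if "x \<in> carrier SR" for x
      using that neg_Cau[of x] Cau_closed[of x] by (intro bexI[of _ "\<lambda>n. \<ominus> x n"]) (auto simp: l_neg)
  qed (auto simp: add_Cau const_Cau Cau_closed a_ac)
  show "Group.comm_monoid SR"
    by (rule comm_monoidI) (auto simp: mult_Cau const_Cau Cau_closed m_ac)
qed (auto simp: Cau_closed l_distr)

lemma Nul_Cau: "x \<in> Nul \<Longrightarrow> x \<in> Cau"
proof -
  assume x: "x \<in> Nul"
  then have 0: "cg R w n (x n) \<zero>" for n by (simp add: Nul_def)
  have "cg R w n (x (Suc n)) (x n)" for n
    using cgt[OF cg_mono[OF 0[of "Suc n"]] cgs[OF 0[of n]]] by simp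
  then show ?thesis by (simp add: Cau_def)
qed

lemma SR_neg: "x \<in> Cau \<Longrightarrow> \<ominus>\<^bsub>SR\<^esub> x = (\<lambda>n. \<ominus> x n)"
proof -
  interpret S: cring SR by (rule SR_cring)
  assume x: "x \<in> Cau"
  show ?thesis
    by (rule S.minus_equality) (use x neg_Cau Cau_closed in \<open>auto simp: l_neg\<close>)
qed

lemma Nul_ideal: "ideal Nul SR"
proof (rule idealI)
  interpret S: cring SR by (rule SR_cring)
  show "ring SR" by (rule S.ring_axioms)
  show "subgroup Nul (add_monoid SR)"
  proof (rule S.add.subgroupI)
    show "Nul \<subseteq> carrier SR" using Nul_Cau by auto
    have "(\<lambda>_. \<zero>) \<in> Nul" by (simp add: Nul_def cg_refl)
    then show "Nul \<noteq> {}" by blast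
    show "\<ominus>\<^bsub>SR\<^esub> x \<in> Nul" if "x \<in> Nul" for x
      unfolding SR_neg[OF Nul_Cau[OF that]] using that cg_neg[of w _ _ \<zero>] by (simp add: Nul_def)
    show "x \<oplus>\<^bsub>SR\<^esub> y \<in> Nul" if "x \<in> Nul" "y \<in> Nul" for x y
      using that cg_add[of w _ _ \<zero> _ \<zero>] by (simp add: Nul_def)
  qed
  show "x \<otimes>\<^bsub>SR\<^esub> a \<in> Nul" "a \<otimes>\<^bsub>SR\<^esub> x \<in> Nul" if "a \<in> Nul" "x \<in> carrier SR" for a x
    using that cg_shift_zero[of w] Cau_closed[of x] by (auto simp: Nul_def)
qed

lemma CR_cring: "cring CR"
  unfolding CR_def by (rule ideal.quotient_is_cring[OF Nul_ideal SR_cring])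

lemma cl_hom: "cl \<in> ring_hom SR CR"
  unfolding CR_def using ideal.rcos_ring_hom[OF Nul_ideal] by (simp add: cl_def[abs_def])

lemma CR_carrier: "carrier CR = cl ` Cau"
  by (auto simp: CR_def cl_def FactRing_def A_RCOSETS_def')

lemma cl_eq_iff:
  assumes "x \<in> Cau" "y \<in> Cau" shows "cl x = cl y \<longleftrightarrow> (\<forall>n. cg R w n (x n) (y n))"
proof -
  interpret S: cring SR by (rule SR_cring)
  have "cl x = cl y \<longleftrightarrow> x \<ominus>\<^bsub>SR\<^esub> y \<in> Nul"
    unfolding cl_def using S.quotient_eq_iff_same_a_r_cos[OF Nul_ideal, of x y] assms by simp
  also have "x \<ominus>\<^bsub>SR\<^esub> y = (\<lambda>n. x n \<ominus> y n)" using SR_neg[OF assms(2)] by (simp add: a_minus_def)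
  finally show ?thesis using assms by (simp add: Nul_def cg_diff_iff Cau_closed)
qed

lemma cl_pow: "x \<in> Cau \<Longrightarrow> cl x [^]\<^bsub>CR\<^esub> (k::nat) = cl (\<lambda>n. x n [^] k)"
proof -
  assume x: "x \<in> Cau"
  have "x [^]\<^bsub>SR\<^esub> k = (\<lambda>n. x n [^] k)" by (induction k) auto
  then show ?thesis using ring_hom_pow[OF cl_hom SR_cring CR_cring, of x k] x by simp
qed

lemma pow_Cau: "x \<in> Cau \<Longrightarrow> (\<lambda>n. x n [^] (k::nat)) \<in> Cau"
  by (simp add: Cau_def cg_pow)

lemma cl_add: "x \<in> Cau \<Longrightarrow> y \<in> Cau \<Longrightarrow> cl x \<oplus>\<^bsub>CR\<^esub> cl y = cl (\<lambda>n. x n \<oplus> y n)"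
  using ring_hom_add[OF cl_hom, of x y] by simp

lemma cl_mult: "x \<in> Cau \<Longrightarrow> y \<in> Cau \<Longrightarrow> cl x \<otimes>\<^bsub>CR\<^esub> cl y = cl (\<lambda>n. x n \<otimes> y n)"
  using ring_hom_mult[OF cl_hom, of x y] by simp

lemma cl_zero: "\<zero>\<^bsub>CR\<^esub> = cl (\<lambda>_. \<zero>)"
  using ring_hom_zero[OF cl_hom cring.axioms(1)[OF SR_cring] cring.axioms(1)[OF CR_cring]] by simp

abbreviation "W \<equiv> cl (\<lambda>_. w)"

lemma W: "W \<in> carrier CR" using const_Cau[of w] by (auto simp: CR_carrier)

lemma cg_CR:
  assumes x: "x \<in> Cau" and y: "y \<in> Cau"
  shows "cg CR W m (cl x) (cl y) \<longleftrightarrow> cg R w m (x m) (y m)"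
proof
  have wc: "(\<lambda>_. w [^] m) \<in> Cau" by (rule const_Cau) simp
  have Wm: "W [^]\<^bsub>CR\<^esub> m = cl (\<lambda>_. w [^] m)" using cl_pow[OF const_Cau[of w]] by simp
  {
    assume "cg CR W m (cl x) (cl y)"
    then obtain z where z: "z \<in> Cau" "cl x = cl y \<oplus>\<^bsub>CR\<^esub> W [^]\<^bsub>CR\<^esub> m \<otimes>\<^bsub>CR\<^esub> cl z"
      by (auto simp: cg_def CR_carrier)
    then have "cl x = cl (\<lambda>n. y n \<oplus> w [^] m \<otimes> z n)"
      using y wc mult_Cau[OF wc z(1)] by (simp add: Wm cl_mult cl_add)
    then have "cg R w m (x m) (y m \<oplus> w [^] m \<otimes> z m)"
      using cl_eq_iff[OF x add_Cau[OF y mult_Cau[OF wc z(1)]]] by blast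
    also have "cg R w m \<dots> (y m)" by (rule cgI[of _ _ "z m"]) (use Cau_closed z y in auto)
    finally show "cg R w m (x m) (y m)" .
  next
    assume m: "cg R w m (x m) (y m)"
    \<comment> \<open>Division by w^m loses m places of precision; the index n + m compensates, so
      that the quotients \<open>z\<close> converge at the fixed rate again.\<close>
    have "cg R w m (x (n + m)) (y (n + m))" for n
      using cgt[OF cgt[OF Cau_le[OF x, of m "n + m"] m] cgs[OF Cau_le[OF y, of m "n + m"]]] by simp
    then have "\<forall>n. \<exists>z. z \<in> carrier R \<and> x (n + m) = y (n + m) \<oplus> w [^] m \<otimes> z" by (auto simp: cg_def)
    then obtain z where z: "\<And>n. z n \<in> carrier R" "\<And>n. x (n + m) = y (n + m) \<oplus> w [^] m \<otimes> z n" by metis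
    have xc: "x n \<in> carrier R" and yc: "y n \<in> carrier R" for n using x y Cau_closed by auto
    have wz: "w [^] m \<otimes> z n = x (n + m) \<ominus> y (n + m)" for n
    proof -
      define a b where "a = y (n + m)" and "b = w [^] m \<otimes> z n"
      have ab: "a \<in> carrier R" "b \<in> carrier R" using z yc by (auto simp: a_def b_def)
      have "b = (a \<oplus> b) \<ominus> a \<oplus> \<zero>" by (use ab in \<open>simp add: ring_nf\<close>)
      then show ?thesis using z(2)[of n] ab by (simp add: a_def b_def)
    qed
    have zC: "z \<in> Cau"
      unfolding Cau_def
    proof (intro CollectI allI)
      fix n
      have "cg R w (m + n) (w [^] m \<otimes> z (Suc n)) (w [^] m \<otimes> z n)"
        unfolding wz using cg_minus[OF Cau_step[OF x, of "n + m"] Cau_step[OF y, of "n + m"]] by (simp add: add.commute)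
      then show "cg R w n (z (Suc n)) (z n)" by (rule cg_cancel) (use z in auto)
    qed
    have "cl x = cl (\<lambda>n. y n \<oplus> w [^] m \<otimes> z n)"
      unfolding cl_eq_iff[OF x add_Cau[OF y mult_Cau[OF wc zC]]]
    proof
      fix n
      have "cg R w n (x n) (x (n + m))" using cgs[OF Cau_le[OF x, of n "n + m"]] by simp
      also have "cg R w n (x (n + m)) (y n \<oplus> w [^] m \<otimes> z n)"
        unfolding z(2) by (rule cg_add[OF Cau_le[OF y] cg_refl]) (use z in auto)
      finally show "cg R w n (x n) (y n \<oplus> w [^] m \<otimes> z n)" .
    qed
    then have "cl x = cl y \<oplus>\<^bsub>CR\<^esub> W [^]\<^bsub>CR\<^esub> m \<otimes>\<^bsub>CR\<^esub> cl z"
      using y wc zC mult_Cau[OF wc zC] by (simp add: Wm cl_mult cl_add)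
    then show "cg CR W m (cl x) (cl y)" using x y zC by (auto simp: cg_def CR_carrier)
  }
qed

definition \<iota> :: "'a \<Rightarrow> (nat \<Rightarrow> 'a) set" where "\<iota> a = cl (\<lambda>_. a)"

lemma iota_hom: "\<iota> \<in> ring_hom R CR"
proof -
  have "\<one>\<^bsub>CR\<^esub> = cl (\<lambda>_. \<one>)" using ring_hom_one[OF cl_hom] by simp
  then show ?thesis
    by (intro ring_hom_memI) (auto simp: \<iota>_def CR_carrier const_Cau cl_mult cl_add)
qed

lemma cg_iota: "a \<in> carrier R \<Longrightarrow> b \<in> carrier R \<Longrightarrow> cg CR (\<iota> w) m (\<iota> a) (\<iota> b) \<longleftrightarrow> cg R w m a b"
  using cg_CR[OF const_Cau const_Cau, of a b m] by (simp add: \<iota>_def)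

lemma iota_approx: assumes "c \<in> carrier CR" shows "\<exists>x\<in>carrier R. cg CR (\<iota> w) 1 c (\<iota> x)"
proof -
  obtain x where x: "x \<in> Cau" "c = cl x" using assms by (auto simp: CR_carrier)
  then have "cg CR (\<iota> w) 1 c (\<iota> (x 1))"
    using cg_CR[OF x(1) const_Cau[OF Cau_closed[OF x(1)]], of 1 1] cg_refl[OF Cau_closed[OF x(1)]] by (simp add: \<iota>_def)
  then show ?thesis using Cau_closed x by blast
qed

lemma CR_pcr: "pcr CR (\<iota> w) p"
proof -
  interpret C: cring CR by (rule CR_cring)
  interpret h: ring_hom_cring R CR \<iota> using iota_hom CR_cring is_cring by (intro ring_hom_cringI) auto
  show ?thesis
  proof
    have e: "\<iota> ([p] \<cdot> \<one>) = [p] \<cdot>\<^bsub>CR\<^esub> \<one>\<^bsub>CR\<^esub>"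
      using hom_add_pow[OF iota_hom ring_axioms C.ring_axioms one_closed, of p] by simp
    show "cg CR (\<iota> w) 1 ([p] \<cdot>\<^bsub>CR\<^esub> \<one>\<^bsub>CR\<^esub>) \<zero>\<^bsub>CR\<^esub>"
      using cg_hom[OF p_w iota_hom is_cring CR_cring] e by simp
    show "c = \<zero>\<^bsub>CR\<^esub>" if c: "c \<in> carrier CR" "\<iota> w \<otimes>\<^bsub>CR\<^esub> c = \<zero>\<^bsub>CR\<^esub>" for c
    proof -
      obtain x where x: "x \<in> Cau" "c = cl x" using c by (auto simp: CR_carrier)
      have "cl (\<lambda>n. w \<otimes> x n) = cl (\<lambda>_. \<zero>)" using c(2) x cl_mult[OF const_Cau[of w] x(1)] by (simp add: \<iota>_def cl_zero)
      then have 1: "cg R w n (w \<otimes> x n) \<zero>" for n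
        using cl_eq_iff[OF mult_Cau[OF const_Cau[of w] x(1)] const_Cau[of \<zero>]] by simp
      have "cg R w n (x n) \<zero>" for n
      proof -
        have "cg R w (Suc n) (w \<otimes> x (Suc n)) (w \<otimes> \<zero>)" using 1[of "Suc n"] by simp
        then have "cg R w n (x (Suc n)) \<zero>" by (rule cg_cancel1) (use Cau_closed x in auto)
        then show ?thesis using cgt[OF cgs[OF Cau_step[OF x(1)]]] by blast
      qed
      then show ?thesis using cl_eq_iff[OF x(1) const_Cau[of \<zero>]] x by (simp add: cl_zero)
    qed
    show "\<exists>y. \<forall>n. cg CR (\<iota> w) n y (f n)" if f: "\<And>n. cg CR (\<iota> w) n (f (Suc n)) (f n)" for f
    proof -
      have "f n \<in> carrier CR" for n by (rule cg_carrier(2)[OF f])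
      then have "\<forall>n. \<exists>x. x \<in> Cau \<and> f n = cl x" by (auto simp: CR_carrier)
      then obtain x where x: "\<And>n. x n \<in> Cau" "\<And>n. f n = cl (x n)" by metis
      have s: "cg R w n (x (Suc n) n) (x n n)" for n using f[of n] cg_CR[OF x(1) x(1)] by (simp add: x(2) \<iota>_def)
      \<comment> \<open>The diagonal sequence: the n-th element of \<open>f\<close> has to be
        matched only modulo w^n, and for this the n-th term of its representative is enough.\<close>
      have y: "(\<lambda>n. x n n) \<in> Cau"
        unfolding Cau_def using cgt[OF Cau_step[OF x(1)] s] by blast
      have "cg CR (\<iota> w) n (cl (\<lambda>n. x n n)) (f n)" for n
        using cg_CR[OF y x(1), of n n] cg_refl[OF Cau_closed[OF x(1)]] by (simp add: x(2) \<iota>_def)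
      then show ?thesis by blast
    qed
    show "c = \<zero>\<^bsub>CR\<^esub>" if c: "\<And>n. cg CR (\<iota> w) n c \<zero>\<^bsub>CR\<^esub>" for c
    proof -
      obtain x where x: "x \<in> Cau" "c = cl x" using cg_carrier(1)[OF c] by (auto simp: CR_carrier)
      have "cg R w n (x n) \<zero>" for n using c[of n] cg_CR[OF x(1) const_Cau[of \<zero>], of n] by (simp add: x(2) \<iota>_def cl_zero)
      then show ?thesis using cl_eq_iff[OF x(1) const_Cau[of \<zero>]] x by (simp add: cl_zero)
    qed
    show "\<exists>y\<in>carrier CR. cg CR (\<iota> w) 1 c (y [^]\<^bsub>CR\<^esub> p)" if c: "c \<in> carrier CR" for c
    proof -
      obtain x where x: "x \<in> carrier R" "cg CR (\<iota> w) 1 c (\<iota> x)" using iota_approx[OF c] by blast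
      obtain y where y: "y \<in> carrier R" "cg R w 1 x (y [^] p)" using surj'[OF x(1)] by blast
      have "cg CR (\<iota> w) 1 (\<iota> x) (\<iota> (y [^] p))" using cg_iota[of x "y [^] p" 1] x y by simp
      then have "cg CR (\<iota> w) 1 c (\<iota> y [^]\<^bsub>CR\<^esub> p)"
        using C.cg_trans[OF x(2)] ring_hom_pow[OF iota_hom is_cring CR_cring y(1)] by simp
      then show ?thesis using y by blast
    qed
    show "cg CR (\<iota> w) 1 c \<zero>\<^bsub>CR\<^esub>" if c: "c \<in> carrier CR" "cg CR (\<iota> w) 1 (c [^]\<^bsub>CR\<^esub> p) \<zero>\<^bsub>CR\<^esub>" for c
    proof -
      obtain x where x: "x \<in> Cau" "c = cl x" using c by (auto simp: CR_carrier)
      have "cg R w 1 (x 1 [^] p) \<zero>"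
        using c(2) cg_CR[OF pow_Cau[OF x(1)] const_Cau[of \<zero>], of 1 p] cl_pow[OF x(1), of p] by (simp add: x(2) \<iota>_def cl_zero)
      then have "cg R w 1 (x 1) \<zero>" using red'[OF Cau_closed[OF x(1)]] by blast
      then show ?thesis using cg_CR[OF x(1) const_Cau[of \<zero>], of 1] by (simp add: x(2) \<iota>_def cl_zero)
    qed
  qed (use p_prime in auto)
qed

end

text \<open>Moves a ring along an injection. It places completions, which live in a type of sets of
  sequences, into the type of \<open>U\<close>, over which initiality is quantified.\<close>

definition transport :: "('a \<Rightarrow> 'b) \<Rightarrow> 'a ring \<Rightarrow> 'b ring" where
  "transport f C = (let g = inv_into (carrier C) f in
     \<lparr>carrier = f ` carrier C, monoid.mult = (\<lambda>x y. f (g x \<otimes>\<^bsub>C\<^esub> g y)), one = f \<one>\<^bsub>C\<^esub>,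
      ring.zero = f \<zero>\<^bsub>C\<^esub>, ring.add = (\<lambda>x y. f (g x \<oplus>\<^bsub>C\<^esub> g y))\<rparr>)"

lemma transport:
  fixes C :: "'a ring"
  assumes C: "cring C" and f: "inj_on f (carrier C)"
  shows "cring (transport f C)" "f \<in> ring_hom C (transport f C)" "carrier (transport f C) = f ` carrier C"
proof -
  interpret C: cring C by fact
  let ?T = "transport f C"
  note [simp] = inv_into_f_f[OF f]
  have car: "carrier ?T = f ` carrier C" by (simp add: transport_def Let_def)
  have m: "f x \<otimes>\<^bsub>?T\<^esub> f y = f (x \<otimes>\<^bsub>C\<^esub> y)" "f x \<oplus>\<^bsub>?T\<^esub> f y = f (x \<oplus>\<^bsub>C\<^esub> y)" if "x \<in> carrier C" "y \<in> carrier C" for x y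
    using that by (simp_all add: transport_def Let_def)
  have o: "\<one>\<^bsub>?T\<^esub> = f \<one>\<^bsub>C\<^esub>" "\<zero>\<^bsub>?T\<^esub> = f \<zero>\<^bsub>C\<^esub>" by (simp_all add: transport_def Let_def)
  show "carrier ?T = f ` carrier C" by (rule car)
  show "f \<in> ring_hom C ?T" by (rule ring_hom_memI) (auto simp: car m o)
  show "cring ?T"
  proof (rule cringI)
    show "abelian_group ?T"
    proof (rule abelian_groupI)
      show "\<exists>y\<in>carrier ?T. y \<oplus>\<^bsub>?T\<^esub> x = \<zero>\<^bsub>?T\<^esub>" if "x \<in> carrier ?T" for x
      proof -
        from that obtain a where "a \<in> carrier C" "x = f a" by (auto simp: car)
        then show ?thesis by (intro bexI[of _ "f (\<ominus>\<^bsub>C\<^esub> a)"]) (auto simp: m o car C.l_neg)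
      qed
      show "x \<oplus>\<^bsub>?T\<^esub> y = y \<oplus>\<^bsub>?T\<^esub> x" if "x \<in> carrier ?T" "y \<in> carrier ?T" for x y
        using that by (auto simp: car m C.a_comm)
    qed (auto simp: car m o C.a_assoc)
    show "Group.comm_monoid ?T"
    proof (rule comm_monoidI)
      show "x \<otimes>\<^bsub>?T\<^esub> y = y \<otimes>\<^bsub>?T\<^esub> x" if "x \<in> carrier ?T" "y \<in> carrier ?T" for x y
        using that by (auto simp: car m C.m_comm)
    qed (auto simp: car m o C.m_assoc)
  qed (auto simp: car m C.l_distr)
qed

lemma pcr_transport:
  fixes C :: "'a ring"
  assumes C: "pcr C v p" and f: "inj_on f (carrier C)"
  shows "pcr (transport f C) (f v) p"
    "\<And>n x y. x \<in> carrier C \<Longrightarrow> y \<in> carrier C \<Longrightarrow> cg (transport f C) (f v) n (f x) (f y) \<longleftrightarrow> cg C v n x y"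
proof -
  interpret C: pcr C v p by fact
  note t = transport[OF C.is_cring f]
  let ?T = "transport f C"
  interpret T: cring ?T by (rule t)
  interpret h: ring_hom_cring C ?T f using t C.is_cring by (intro ring_hom_cringI) auto
  have powf: "f (x [^]\<^bsub>C\<^esub> n) = f x [^]\<^bsub>?T\<^esub> n" if "x \<in> carrier C" for x and n :: nat
    using ring_hom_pow[OF t(2) C.is_cring t(1) that] .
  have inj: "f x = f y \<longleftrightarrow> x = y" if "x \<in> carrier C" "y \<in> carrier C" for x y
    using f that by (auto dest: inj_onD)
  show cg: "cg ?T (f v) n (f x) (f y) \<longleftrightarrow> cg C v n x y" if xy: "x \<in> carrier C" "y \<in> carrier C" for n x y
  proof
    assume "cg ?T (f v) n (f x) (f y)"
    then obtain z where z: "z \<in> carrier C" "f x = f y \<oplus>\<^bsub>?T\<^esub> f v [^]\<^bsub>?T\<^esub> n \<otimes>\<^bsub>?T\<^esub> f z" by (auto simp: cg_def t(3))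
    then have "f x = f (y \<oplus>\<^bsub>C\<^esub> v [^]\<^bsub>C\<^esub> n \<otimes>\<^bsub>C\<^esub> z)" using xy z(1) powf[of v n] by simp
    then have "x = y \<oplus>\<^bsub>C\<^esub> v [^]\<^bsub>C\<^esub> n \<otimes>\<^bsub>C\<^esub> z" using inj[of x "y \<oplus>\<^bsub>C\<^esub> v [^]\<^bsub>C\<^esub> n \<otimes>\<^bsub>C\<^esub> z"] xy z(1) by simp
    then show "cg C v n x y" using xy z(1) by (auto simp: cg_def)
  next
    assume "cg C v n x y"
    then show "cg ?T (f v) n (f x) (f y)" by (rule cg_hom[OF _ t(2) C.is_cring t(1)]) simp
  qed
  have ex: "\<exists>a\<in>carrier C. x = f a" if "x \<in> carrier ?T" for x using that t(3) by auto
  have e: "f ([p] \<cdot>\<^bsub>C\<^esub> \<one>\<^bsub>C\<^esub>) = [p] \<cdot>\<^bsub>?T\<^esub> \<one>\<^bsub>?T\<^esub>"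
    using hom_add_pow[OF t(2) C.ring_axioms T.ring_axioms C.one_closed, of p] by simp
  show "pcr ?T (f v) p"
  proof
    show "cg ?T (f v) 1 ([p] \<cdot>\<^bsub>?T\<^esub> \<one>\<^bsub>?T\<^esub>) \<zero>\<^bsub>?T\<^esub>"
      using cg_hom[OF C.p_w t(2) C.is_cring t(1)] e by simp
    show "x = \<zero>\<^bsub>?T\<^esub>" if x: "x \<in> carrier ?T" "f v \<otimes>\<^bsub>?T\<^esub> x = \<zero>\<^bsub>?T\<^esub>" for x
    proof -
      obtain a where a: "a \<in> carrier C" "x = f a" using ex x by blast
      then have "f (v \<otimes>\<^bsub>C\<^esub> a) = f \<zero>\<^bsub>C\<^esub>" using x by simp
      then have "v \<otimes>\<^bsub>C\<^esub> a = \<zero>\<^bsub>C\<^esub>" by (rule iffD1[OF inj, rotated 2]) (use a in auto)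
      then have "a = \<zero>\<^bsub>C\<^esub>" by (rule C.nzd[OF a(1)])
      then show ?thesis using a by simp
    qed
    show "\<exists>y. \<forall>n. cg ?T (f v) n y (g n)" if g: "\<And>n. cg ?T (f v) n (g (Suc n)) (g n)" for g
    proof -
      have "\<forall>n. \<exists>a. a \<in> carrier C \<and> g n = f a" using ex cg_carrier(2)[OF g] by blast
      then obtain a where a: "\<And>n. a n \<in> carrier C" "\<And>n. g n = f (a n)" by metis
      have "cg C v n (a (Suc n)) (a n)" for n using g[of n] cg[OF a(1) a(1)] a(2) by simp
      then obtain y where y: "\<And>n. cg C v n y (a n)" using C.complete by blast
      then have "cg ?T (f v) n (f y) (g n)" for n using cg[OF cg_carrier(1)[OF y] a(1)] a(2) by simp
      then show ?thesis by blast
    qed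
    show "x = \<zero>\<^bsub>?T\<^esub>" if x: "\<And>n. cg ?T (f v) n x \<zero>\<^bsub>?T\<^esub>" for x
    proof -
      obtain a where a: "a \<in> carrier C" "x = f a" using ex cg_carrier(1)[OF x] by blast
      have "cg C v n a \<zero>\<^bsub>C\<^esub>" for n using x[of n] cg[OF a(1) C.zero_closed, of n] a(2) by simp
      then have "a = \<zero>\<^bsub>C\<^esub>" by (rule C.sep)
      then show ?thesis using a by simp
    qed
    show "\<exists>y\<in>carrier ?T. cg ?T (f v) 1 x (y [^]\<^bsub>?T\<^esub> p)" if "x \<in> carrier ?T" for x
    proof -
      obtain a where a: "a \<in> carrier C" "x = f a" using ex \<open>x \<in> carrier ?T\<close> by blast
      obtain b where b: "b \<in> carrier C" "cg C v 1 a (b [^]\<^bsub>C\<^esub> p)" using C.surj a by blast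
      then show ?thesis using cg[of a "b [^]\<^bsub>C\<^esub> p" 1] a powf by (intro bexI[of _ "f b"]) auto
    qed
    show "cg ?T (f v) 1 x \<zero>\<^bsub>?T\<^esub>" if "x \<in> carrier ?T" "cg ?T (f v) 1 (x [^]\<^bsub>?T\<^esub> p) \<zero>\<^bsub>?T\<^esub>" for x
    proof -
      obtain a where a: "a \<in> carrier C" "x = f a" using ex \<open>x \<in> carrier ?T\<close> by blast
      have "cg C v 1 (a [^]\<^bsub>C\<^esub> p) \<zero>\<^bsub>C\<^esub>" using \<open>cg ?T (f v) 1 (x [^]\<^bsub>?T\<^esub> p) \<zero>\<^bsub>?T\<^esub>\<close> cg[of "a [^]\<^bsub>C\<^esub> p" "\<zero>\<^bsub>C\<^esub>" 1] a powf by simp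
      then have "cg C v 1 a \<zero>\<^bsub>C\<^esub>" by (rule C.red[OF a(1)])
      then show ?thesis using cg[of a "\<zero>\<^bsub>C\<^esub>" 1] a by simp
    qed
  qed (use C.p_prime in auto)
qed

text \<open>Sends an element to the series whose digits are the Teichmueller representatives of the
  \<open>\<theta>\<close>-images of its digits. By uniqueness of digits this is injective as soon as
  \<open>\<theta>\<close> is injective on residues; an injection of sets is all that is
  claimed.\<close>

lemma pcr_embedding:
  assumes C: "pcr C v p" and U: "pcr U u p"
    and th: "\<And>x. x \<in> carrier C \<Longrightarrow> \<theta> x \<in> carrier U"
      "\<And>x y. x \<in> carrier C \<Longrightarrow> y \<in> carrier C \<Longrightarrow> cg U u 1 (\<theta> x) (\<theta> y) \<Longrightarrow> cg C v 1 x y"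
  obtains \<phi> where "inj_on \<phi> (carrier C)" "\<phi> ` carrier C \<subseteq> carrier U"
proof -
  interpret C: pcr C v p by fact
  interpret U: pcr U u p by fact
  let ?d = "\<lambda>c j. U.tau (\<theta> (C.dig c j))"
  have dc: "?d c j \<in> carrier U" if "c \<in> carrier C" for c j using th that by auto
  have "\<forall>c\<in>carrier C. \<exists>y. \<forall>n. cg U u n y (psum U u (?d c) n)"
    using U.psum_limit[of "?d _"] dc by blast
  then obtain \<phi> where phi: "\<And>c n. c \<in> carrier C \<Longrightarrow> cg U u n (\<phi> c) (psum U u (?d c) n)" by metis
  have "c = c'" if c: "c \<in> carrier C" "c' \<in> carrier C" "\<phi> c = \<phi> c'" for c c'
  proof -
    have "C.dig c j = C.dig c' j" for j
    proof -
      let ?N = "Suc j"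
      have root: "\<exists>r. \<forall>j. r j \<in> carrier U \<and> ?d c j = r j [^]\<^bsub>U\<^esub> (p ^ ?N)" if "c \<in> carrier C" for c
      proof (rule choice, rule allI)
        fix j
        have "U.tm (?d c j)" by (rule U.tau(1)[OF th(1)[OF C.dig_closed[OF that]]])
        then show "\<exists>r. r \<in> carrier U \<and> ?d c j = r [^]\<^bsub>U\<^esub> (p ^ ?N)" unfolding U.tm_def by blast
      qed
      obtain r where r: "\<And>j. r j \<in> carrier U" "\<And>j. ?d c j = r j [^]\<^bsub>U\<^esub> (p ^ ?N)" using root[OF c(1)] by blast
      obtain r' where r': "\<And>j. r' j \<in> carrier U" "\<And>j. ?d c' j = r' j [^]\<^bsub>U\<^esub> (p ^ ?N)" using root[OF c(2)] by blast
      have "cg U u ?N (psum U u (?d c) ?N) (psum U u (?d c') ?N)"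
        using U.cgt[OF U.cgs[OF phi[OF c(1)]]] phi[OF c(2)] c(3) by metis
      then have "cg U u ?N (psum U u (\<lambda>j. r j [^]\<^bsub>U\<^esub> (p ^ ?N)) ?N) (psum U u (\<lambda>j. r' j [^]\<^bsub>U\<^esub> (p ^ ?N)) ?N)"
        by (simp only: r(2) r'(2))
      then have "cg U u 1 (r j) (r' j)"
        by (rule U.digits_unique[where N = ?N and M = ?N, rotated 3]) (use r(1) r'(1) in auto)
      then have "cg U u 1 (?d c j) (?d c' j)" unfolding r(2) r'(2) by (rule U.cg_pow) simp
      moreover have dd: "\<theta> (C.dig c j) \<in> carrier U" "\<theta> (C.dig c' j) \<in> carrier U" using th c by auto
      ultimately have "cg U u 1 (\<theta> (C.dig c j)) (\<theta> (C.dig c' j))"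
        using U.cgt[OF U.cgt[OF U.cgs[OF U.tau(2)[OF dd(1)]]] U.tau(2)[OF dd(2)]] by blast
      then have "cg C v 1 (C.dig c j) (C.dig c' j)" by (intro th(2)) (use c in auto)
      then show ?thesis by (intro C.tm_unique C.dig_tm c)
    qed
    then have e: "C.dig c = C.dig c'" by blast
    have "cg C v n c c'" for n
      using C.cgt[OF C.cg_expansion[OF c(1), of n, unfolded e] C.cgs[OF C.cg_expansion[OF c(2), of n]]] .
    then show ?thesis by (rule C.eq_if_cg_all)
  qed
  then have "inj_on \<phi> (carrier C)" by (rule inj_onI)
  moreover have "\<phi> c \<in> carrier U" if "c \<in> carrier C" for c by (rule cg_carrier(1)[OF phi[OF that, of 0]])
  then have "\<phi> ` carrier C \<subseteq> carrier U" by (rule image_subsetI)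
  ultimately show thesis by (rule that)
qed

section \<open>Algebras with prescribed roots\<close>

lemma (in algebraically_closed) exists_nth_root:
  assumes x: "x \<in> carrier L" and n: "n > 0" shows "\<exists>y\<in>carrier L. y [^] (n::nat) = x"
proof -
  define q where "q = \<one> # replicate (n - 1) \<zero> @ [\<ominus> x]"
  have q: "q \<in> carrier (poly_ring L)"
    unfolding univ_poly_carrier[symmetric] polynomial_def using x by (auto simp: q_def)
  have d: "degree q = n" using n by (simp add: q_def)
  have "size (roots q) = n" using roots_over_carrier[OF q] d by (simp add: splitted_def)
  then obtain y where "y \<in># roots q" using n by (metis multiset_nonemptyE size_empty less_irrefl)
  then have y: "y \<in> carrier L" "eval q y = \<zero>" using roots_mem_iff_is_root[OF q] by (auto simp: is_root_def)
  have "eval (replicate (n - 1) \<zero> @ [\<ominus> x]) y = eval [\<ominus> x] y"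
    by (induction "n - 1" arbitrary: n) (use x y eval_replicate[of "[\<ominus> x]" y] in auto)
  then have "eval q y = y [^] n \<oplus> \<ominus> x" using n x y by (simp add: q_def)
  then have "y [^] n = x" using y x minus_equality[of "y [^] n" "\<ominus> x"] by (simp add: minus_minus)
  then show ?thesis using y by blast
qed

lemma generate_ring_hom:
  assumes h: "h \<in> ring_hom R S" and R: "ring R" and S: "ring S" and T: "T \<subseteq> carrier R"
    and e: "e \<in> generate_ring S (h ` T)"
  shows "e \<in> h ` generate_ring R T"
proof -
  interpret R: ring R by fact
  interpret S: ring S by fact
  interpret h: ring_hom_ring R S h using assms by (intro ring_hom_ringI2)
  note c = R.generate_ring_in_carrier[OF T]
  show ?thesis
    using e
  proof (induction rule: generate_ring.induct)
    case one
    show ?case by (rule image_eqI[where x = "\<one>\<^bsub>R\<^esub>"]) (auto intro: generate_ring.one)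
  next
    case (incl z)
    then show ?case by (auto intro: generate_ring.incl)
  next
    case (a_inv e)
    then obtain x where "e = h x" "x \<in> generate_ring R T" by blast
    then show ?case by (intro image_eqI[where x = "\<ominus>\<^bsub>R\<^esub> x"]) (auto simp: c intro: generate_ring.a_inv)
  next
    case (eng_add e1 e2)
    then obtain x y where "e1 = h x" "x \<in> generate_ring R T" "e2 = h y" "y \<in> generate_ring R T" by blast
    then show ?case by (intro image_eqI[where x = "x \<oplus>\<^bsub>R\<^esub> y"]) (auto simp: c intro: generate_ring.eng_add)
  next
    case (eng_mult e1 e2)
    then obtain x y where "e1 = h x" "x \<in> generate_ring R T" "e2 = h y" "y \<in> generate_ring R T" by blast
    then show ?case by (intro image_eqI[where x = "x \<otimes>\<^bsub>R\<^esub> y"]) (auto simp: c intro: generate_ring.eng_mult)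
  qed
qed

lemma (in cring) prime_pow_pow:
  fixes p m n :: nat
  assumes "y \<in> carrier R"
  shows "(y [^] (p ^ m)) [^] (p ^ n) = y [^] (p ^ (m + n))" "(y [^] (p ^ n)) [^] (p ^ m) = y [^] (p ^ (m + n))"
  using assms by (simp_all add: nat_pow_pow power_add mult.commute)

text \<open>The residue field of \<open>A\<close> injects into every nonzero residue ring: if a - b
  were not divisible by \<open>w\<close>, it would be a unit, and its image would be a unit
  congruent to zero.\<close>

lemma (in base) cg_of_hom:
  assumes B: "cring B" and s: "s \<in> ring_hom A B" and nt: "\<not> cg B (s w) 1 \<one>\<^bsub>B\<^esub> \<zero>\<^bsub>B\<^esub>"
    and ab: "a \<in> carrier A" "b \<in> carrier A" and c: "cg B (s w) 1 (s a) (s b)"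
  shows "cg A w 1 a b"
proof (rule ccontr)
  interpret B: cring B by fact
  interpret s: ring_hom_cring A B s using assms A.is_cring by (intro ring_hom_cringI) auto
  assume "\<not> cg A w 1 a b"
  then have "\<not> cg A w 1 (a \<ominus> b) \<zero>" using ab by (simp add: A.cg_diff_iff)
  then obtain y where y: "y \<in> carrier A" "(a \<ominus> b) \<otimes> y = \<one>" using A.unit[of "a \<ominus> b"] ab by auto
  have "cg B (s w) 1 (s a \<ominus>\<^bsub>B\<^esub> s b) \<zero>\<^bsub>B\<^esub>" using c ab B.cg_diff_iff[of "s a" "s b" "s w" 1] by simp
  then have "cg B (s w) 1 (s (a \<ominus> b)) \<zero>\<^bsub>B\<^esub>" using ab by (simp add: a_minus_def)
  then have "cg B (s w) 1 (s (a \<ominus> b) \<otimes>\<^bsub>B\<^esub> s y) \<zero>\<^bsub>B\<^esub>" by (rule B.cg_shift_zero(1)) (use y in auto)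
  moreover have "s (a \<ominus> b) \<otimes>\<^bsub>B\<^esub> s y = \<one>\<^bsub>B\<^esub>"
    using y(2) s.hom_mult[of "a \<ominus> b" y] ab y(1) A.minus_closed by simp
  ultimately show False using nt by simp
qed

text \<open>\<open>U\<close> acts as a reservoir of elements: its residue ring contains p-power
  roots of all residues of \<open>A\<close>, so its carrier can receive an injection of the
  completion. The roots of height \<open>M\<close> are adjoined before the residually perfect hull
  is taken, because afterwards every element is a p-th power modulo \<open>w\<close> and
  \<open>state_extend\<close> no longer applies.\<close>

theorem (in base) exists_CRP:
  fixes U :: "'b ring" and K :: "'k ring"
  assumes K: "fraction_field A K i"
    and U: "u \<in> ring_hom A U" "pcr U (u w) p" "\<not> cg U (u w) 1 \<one>\<^bsub>U\<^esub> \<zero>\<^bsub>U\<^esub>"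
    and t: "\<And>i. i < (r::nat) \<Longrightarrow> t i \<in> carrier A"
      "\<And>i e. i < r \<Longrightarrow> e \<in> generate_ring A ((\<lambda>d. d [^] p) ` carrier A \<union> t ` {..<i}) \<Longrightarrow> \<not> cg A w 1 (t i) e"
  obtains C :: "'b ring" and s where "CRP p A C s" "\<And>i. i < r \<Longrightarrow> \<exists>y\<in>carrier C. s (t i) = y [^]\<^bsub>C\<^esub> (p ^ M)"
    "\<And>x. x \<in> carrier C \<Longrightarrow> \<exists>n. \<exists>a\<in>carrier A. cg C (s w) 1 (x [^]\<^bsub>C\<^esub> (p ^ n)) (s a)"
    "\<not> cg C (s w) 1 \<one>\<^bsub>C\<^esub> \<zero>\<^bsub>C\<^esub>"
proof -
  interpret K: field K using K by (simp add: fraction_field_def)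
  interpret AD: domain A using K by (simp add: fraction_field_def)
  obtain L :: "((('k list \<times> nat) multiset) \<Rightarrow> 'k) ring"
    where L: "algebraic_closure L (K.indexed_const ` carrier K)" "K.indexed_const \<in> ring_hom K L"
    by (rule K.exists_closure)
  interpret L: algebraic_closure L "K.indexed_const ` carrier K" by (rule L(1))
  define j :: "'a \<Rightarrow> ('k list \<times> nat) multiset \<Rightarrow> 'k" where "j = K.indexed_const \<circ> i"
  have j: "j \<in> ring_hom A L" unfolding j_def by (rule ring_hom_trans[OF _ L(2)]) (use K in \<open>simp add: fraction_field_def\<close>)
  interpret j: ring_hom_cring A L j using j A.is_cring L.is_cring by (intro ring_hom_cringI) auto
  have "inj_on j (carrier A)"
    unfolding j_def by (rule comp_inj_on) (use K K.indexed_const_is_inj in \<open>auto simp: fraction_field_def intro: inj_on_subset\<close>)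
  then have jinj: "j a = j b \<longleftrightarrow> a = b" if "a \<in> carrier A" "b \<in> carrier A" for a b using that by (auto dest: inj_onD)
  have p0: "p > 0" using A.p_gt_1 by simp
  have wcA: "w \<in> carrier A" by simp
  have sub: "subring (j ` carrier A) L" by (rule ring_hom_ring.img_is_subring[OF ring_hom_ringI2[OF A.ring_axioms L.ring_axioms j] A.carrier_is_subring])
  have one: "w \<otimes> a \<noteq> \<one>" if a: "a \<in> carrier A" for a
    using A.nontriv A.cg_multiple[OF a wcA, of 1] by auto
  interpret amb L "j ` carrier A" "j w" p
  proof (rule amb.intro[OF L.field_axioms], rule amb_axioms.intro)
    show "subring (j ` carrier A) L" by (rule sub)
    show "j w \<in> j ` carrier A" by simp
    show "Factorial_Ring.prime p" by (rule A.p_prime)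
    obtain c where c: "c \<in> carrier A" "[p] \<cdot> \<one> = w \<otimes> c" using A.cg_zeroE[OF A.p_w wcA] by auto
    have "[p] \<cdot>\<^bsub>L\<^esub> \<one>\<^bsub>L\<^esub> = j w \<otimes>\<^bsub>L\<^esub> j c"
      using hom_add_pow[OF j A.ring_axioms L.ring_axioms A.one_closed, of p] c by simp
    then show "\<exists>c\<in>j ` carrier A. [p] \<cdot>\<^bsub>L\<^esub> \<one>\<^bsub>L\<^esub> = j w \<otimes>\<^bsub>L\<^esub> c" using c by blast
    show "j w \<otimes>\<^bsub>L\<^esub> a \<noteq> \<one>\<^bsub>L\<^esub>" if a: "a \<in> j ` carrier A" for a
    proof
      obtain a' where a': "a' \<in> carrier A" "a = j a'" using a by blast
      assume "j w \<otimes>\<^bsub>L\<^esub> a = \<one>\<^bsub>L\<^esub>"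
      then have "j (w \<otimes> a') = j \<one>" using a' by simp
      then have "w \<otimes> a' = \<one>" by (rule iffD1[OF jinj, rotated 2]) (use a' in auto)
      then show False using one[OF a'(1)] by blast
    qed
    show "(\<exists>b\<in>j ` carrier A. a = j w \<otimes>\<^bsub>L\<^esub> b) \<or> (\<exists>b\<in>j ` carrier A. a \<otimes>\<^bsub>L\<^esub> b = \<one>\<^bsub>L\<^esub>)" if a: "a \<in> j ` carrier A" for a
    proof -
      obtain a' where a': "a' \<in> carrier A" "a = j a'" using a by blast
      show ?thesis
      proof (cases "cg A w 1 a' \<zero>")
        case True
        then obtain z where "z \<in> carrier A" "a' = w \<otimes> z" using A.cg_zeroE[OF True wcA] by auto
        then show ?thesis using a' by auto
      next
        case False
        then obtain z where z: "z \<in> carrier A" "a' \<otimes> z = \<one>" using A.unit a' by blast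
        then have "a \<otimes>\<^bsub>L\<^esub> j z = \<one>\<^bsub>L\<^esub>" using a' j.hom_mult[of a' z] by simp
        then show ?thesis using z by blast
      qed
    qed
    show "\<exists>y\<in>carrier L. y [^]\<^bsub>L\<^esub> p = x" if "x \<in> carrier L" for x
      by (rule L.exists_nth_root[OF that p0])
  qed
  obtain V where V: "subring V L" "j ` carrier A \<subseteq> V" "\<And>v. v \<in> V \<Longrightarrow> j w \<otimes>\<^bsub>L\<^esub> v \<noteq> \<one>\<^bsub>L\<^esub>"
    "\<And>y. y \<in> carrier L \<Longrightarrow> y [^]\<^bsub>L\<^esub> p \<in> V \<Longrightarrow> y \<in> V"
  proof (rule exists_order)
    fix V
    assume V: "subring V L" "j ` carrier A \<subseteq> V" "\<And>v. v \<in> V \<Longrightarrow> j w \<otimes>\<^bsub>L\<^esub> v \<noteq> \<one>\<^bsub>L\<^esub>"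
      "\<And>y. y \<in> carrier L \<Longrightarrow> y [^]\<^bsub>L\<^esub> p \<in> V \<Longrightarrow> y \<in> V"
    show thesis by (rule that[OF V])
  qed
  interpret amb_order L "j ` carrier A" "j w" p V
  proof (rule amb_order.intro[OF amb_axioms], rule amb_order_axioms.intro)
    show "v \<in> V \<Longrightarrow> j w \<otimes>\<^bsub>L\<^esub> v \<noteq> \<one>\<^bsub>L\<^esub>" for v by (rule V(3))
    show "y \<in> carrier L \<Longrightarrow> y [^]\<^bsub>L\<^esub> p \<in> V \<Longrightarrow> y \<in> V" for y by (rule V(4))
  qed (rule V(1), rule V(2))
  have simE: "cg A w 1 a b" if ab: "a \<in> carrier A" "b \<in> carrier A" "sim (j a) (j b)" for a b
  proof -
    have 1: "j b \<in> V" "\<ominus>\<^bsub>L\<^esub> (j b) \<in> V" using ab V subringE(5)[OF V(1)] by auto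
    have "sim (j a \<oplus>\<^bsub>L\<^esub> \<ominus>\<^bsub>L\<^esub> j b) (j b \<oplus>\<^bsub>L\<^esub> \<ominus>\<^bsub>L\<^esub> j b)" by (rule sim_add[OF ab(3) sim_refl[OF 1(2)]])
    then have "sim (j (a \<ominus> b)) (\<zero>\<^bsub>L\<^esub>)" using ab by (simp add: L.r_neg a_minus_def)
    moreover have "j (a \<ominus> b) \<in> j ` carrier A" using ab by (intro imageI) simp
    ultimately obtain e where "e \<in> j ` carrier A" "j (a \<ominus> b) = j w \<otimes>\<^bsub>L\<^esub> e" using state_zero[OF A0_state] by blast
    then obtain z where z: "z \<in> carrier A" "j (a \<ominus> b) = j (w \<otimes> z)" by auto
    have "a \<ominus> b = w \<otimes> z" by (rule iffD1[OF jinj z(2)]) (use ab z(1) in auto)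
    then have "cg A w 1 (a \<ominus> b) \<zero>" using A.cg_multiple[OF z(1) wcA, of 1] by simp
    then show ?thesis using ab by (simp add: A.cg_diff_iff)
  qed
  have "ind (j ` carrier A) (\<lambda>i. j (t i)) r"
    unfolding ind_def
  proof (intro allI impI conjI ballI)
    fix k assume k: "k < r"
    show "j (t k) \<in> j ` carrier A" using t k by auto
    fix e assume e: "e \<in> gen (j ` carrier A) ((\<lambda>i. j (t i)) ` {..<k})"
    let ?X = "(\<lambda>d. d [^] p) ` carrier A \<union> t ` {..<k}"
    have X: "?X \<subseteq> carrier A" using t(1) k by auto
    have "(\<lambda>d. d [^]\<^bsub>L\<^esub> p) ` j ` carrier A \<union> (\<lambda>i. j (t i)) ` {..<k} = j ` ?X"
      using ring_hom_pow[OF j A.is_cring L.is_cring] by (auto simp: image_Un image_image)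
    then have "e \<in> j ` generate_ring A ?X"
      using generate_ring_hom[OF j A.ring_axioms L.ring_axioms X] e by (simp add: gen_def)
    then obtain e' where e': "e' \<in> generate_ring A ?X" "e = j e'" by blast
    show "\<not> sim (j (t k)) (e)"
      using t(2)[OF k e'(1)] simE[OF t(1)[OF k] A.generate_ring_in_carrier[OF X e'(1)]] e'(2) by blast
  qed
  then obtain D y where D: "state D" "\<And>i. i < r \<Longrightarrow> y i [^]\<^bsub>L\<^esub> (p ^ M) = j (t i)" "ind D y r"
    using state_steps[OF A0_state, of "\<lambda>i. j (t i)" r M] by blast
  obtain H where H: "state H" "D \<subseteq> H" "\<And>d. d \<in> H \<Longrightarrow> \<exists>b\<in>H. sim (d) (b [^]\<^bsub>L\<^esub> p)" using state_hull[OF D(1)] by blast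
  have yH: "y i \<in> H" if "i < r" for i using D(3) H(2) that by (auto simp: ind_def)
  let ?H = "L\<lparr>carrier := H\<rparr>"
  note sH = stateD(1-3)[OF H(1)]
  have HL: "x \<in> carrier L" if "x \<in> H" for x using sH(3) that V_carrier by auto
  have powH: "x [^]\<^bsub>?H\<^esub> k = x [^]\<^bsub>L\<^esub> k" for x and k :: nat by (simp add: nat_pow_def)
  have powHc: "x [^]\<^bsub>L\<^esub> k \<in> H" if "x \<in> H" for x and k :: nat by (rule L.subring_pow_closed[OF sH(1) that])
  interpret H: cring ?H by (rule state_ring[OF H(1)])
  have jH: "j \<in> ring_hom A ?H" by (rule ring_hom_memI) (use sH(2) in auto)
  have cgH: "cg ?H (j w) 1 x x' \<longleftrightarrow> sim (x) (x')" if "x \<in> H" "x' \<in> H" for x x' by (rule state_cg[OF H(1) that])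
  interpret P: precomplete ?H "j w" p
  proof
    show "j w \<in> carrier ?H" using sH(2) by auto
    show "Factorial_Ring.prime p" by (rule A.p_prime)
    have "j ([p] \<cdot> \<one>) = [p] \<cdot>\<^bsub>?H\<^esub> \<one>\<^bsub>?H\<^esub>"
      using hom_add_pow[OF jH A.ring_axioms H.ring_axioms A.one_closed, of p] by simp
    then show "cg ?H (j w) 1 ([p] \<cdot>\<^bsub>?H\<^esub> \<one>\<^bsub>?H\<^esub>) \<zero>\<^bsub>?H\<^esub>"
      using cg_hom[OF A.p_w jH A.is_cring H.is_cring wcA] by simp
    show "x = \<zero>\<^bsub>?H\<^esub>" if "x \<in> carrier ?H" "j w \<otimes>\<^bsub>?H\<^esub> x = \<zero>\<^bsub>?H\<^esub>" for x
    proof -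
      have "j w \<noteq> \<zero>\<^bsub>L\<^esub>"
      proof
        assume "j w = \<zero>\<^bsub>L\<^esub>"
        then have "w = \<zero>" using jinj[of w "\<zero>"] by simp
        then have "\<one> = \<zero>" using A.nzd[of "\<one>"] by simp
        then show False by simp
      qed
      then show ?thesis using that L.integral[of "j w" x] HL by auto
    qed
    show "\<exists>b\<in>carrier ?H. cg ?H (j w) 1 x (b [^]\<^bsub>?H\<^esub> p)" if x: "x \<in> carrier ?H" for x
    proof -
      obtain b where b: "b \<in> H" "sim (x) (b [^]\<^bsub>L\<^esub> p)" using H(3) x by auto
      then show ?thesis using cgH[of x "b [^]\<^bsub>L\<^esub> p"] x powHc[OF b(1), of p] by (auto simp: powH)
    qed
    show "cg ?H (j w) 1 x \<zero>\<^bsub>?H\<^esub>" if x: "x \<in> carrier ?H" "cg ?H (j w) 1 (x [^]\<^bsub>?H\<^esub> p) \<zero>\<^bsub>?H\<^esub>" for x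
    proof -
      have xH: "x \<in> H" using x by simp
      have "sim (x [^]\<^bsub>L\<^esub> p) (\<zero>\<^bsub>L\<^esub>)" using x(2) cgH[OF powHc[OF xH, of p] subringE(2)[OF sH(1)]] by (simp add: powH)
      then obtain e where e: "e \<in> H" "x = j w \<otimes>\<^bsub>L\<^esub> e" using stateD(5)[OF H(1) xH] by blast
      then have "sim (x) (\<zero>\<^bsub>L\<^esub>)" using sim_zeroI sH(3) by blast
      then show ?thesis using cgH[OF xH subringE(2)[OF sH(1)]] by simp
    qed
  qed
  interpret C: pcr P.CR "P.\<iota> (j w)" p by (rule P.CR_pcr)
  interpret U: pcr U "u w" p by (rule U(2))
  interpret u: ring_hom_cring A U u using U(1) A.is_cring U.is_cring by (intro ring_hom_cringI) auto
  define s0 where "s0 = P.\<iota> \<circ> j"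
  have s0: "s0 \<in> ring_hom A P.CR" unfolding s0_def by (rule ring_hom_trans[OF jH P.iota_hom])
  interpret s0: ring_hom_cring A P.CR s0 using s0 A.is_cring C.is_cring by (intro ring_hom_cringI) auto
  have s0w: "P.\<iota> (j w) = s0 w" by (simp add: s0_def)
  note cgC = P.cg_iota[unfolded s0w]
  have iota_pow: "P.\<iota> (x [^]\<^bsub>L\<^esub> (k::nat)) = P.\<iota> x [^]\<^bsub>P.CR\<^esub> k" if "x \<in> H" for x k
    using ring_hom_pow[OF P.iota_hom H.is_cring C.is_cring, of x k] that by (simp add: powH)
  have jc: "j a \<in> H" if "a \<in> carrier A" for a using that sH(2) by auto
  have alg: "\<exists>n. \<exists>a\<in>carrier A. cg P.CR (s0 w) 1 (c [^]\<^bsub>P.CR\<^esub> (p ^ n)) (s0 a)" if c: "c \<in> carrier P.CR" for c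
  proof -
    obtain x where x: "x \<in> H" "cg P.CR (s0 w) 1 c (P.\<iota> x)" using P.iota_approx[OF c] by (auto simp: s0w)
    obtain n a where a: "a \<in> carrier A" "sim (x [^]\<^bsub>L\<^esub> (p ^ n)) (j a)" using stateD(4)[OF H(1) x(1)] by blast
    have "cg P.CR (s0 w) 1 (P.\<iota> (x [^]\<^bsub>L\<^esub> (p ^ n))) (s0 a)"
      using cgC[of "x [^]\<^bsub>L\<^esub> (p ^ n)" "j a" 1] cgH[OF powHc[OF x(1)] jc[OF a(1)]] a powHc[OF x(1)] jc[OF a(1)]
      by (simp add: s0_def)
    then have "cg P.CR (s0 w) 1 (P.\<iota> x [^]\<^bsub>P.CR\<^esub> (p ^ n)) (s0 a)" using iota_pow[OF x(1)] by simp
    then show ?thesis using C.cg_trans[OF C.cg_pow[OF x(2)]] a s0.hom_closed wcA by blast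
  qed
  have nt0: "\<not> cg P.CR (s0 w) 1 \<one>\<^bsub>P.CR\<^esub> \<zero>\<^bsub>P.CR\<^esub>"
  proof
    assume "cg P.CR (s0 w) 1 \<one>\<^bsub>P.CR\<^esub> \<zero>\<^bsub>P.CR\<^esub>"
    moreover have "P.\<iota> \<one>\<^bsub>L\<^esub> = \<one>\<^bsub>P.CR\<^esub>" "P.\<iota> \<zero>\<^bsub>L\<^esub> = \<zero>\<^bsub>P.CR\<^esub>"
      using ring_hom_one[OF P.iota_hom] ring_hom_zero[OF P.iota_hom H.ring_axioms C.ring_axioms] by auto
    ultimately have "sim (\<one>\<^bsub>L\<^esub>) (\<zero>\<^bsub>L\<^esub>)"
      using cgC[of "\<one>\<^bsub>L\<^esub>" "\<zero>\<^bsub>L\<^esub>" 1] cgH[OF subringE(3,2)[OF sH(1)]] subringE(3,2)[OF sH(1)] by simp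
    then show False using not_sim_one by blast
  qed
  \<comment> \<open>Assigns to \<open>c\<close> a residue of \<open>U\<close> satisfying the same
    equation: if c^(p^n) has the residue of \<open>a\<close>, take a p^n-th root of the residue of
    \<open>a\<close> in \<open>U\<close>.\<close>
  have ex: "\<exists>v n a. v \<in> carrier U \<and> a \<in> carrier A \<and> cg P.CR (s0 w) 1 (c [^]\<^bsub>P.CR\<^esub> (p ^ n)) (s0 a) \<and>
      cg U (u w) 1 (u a) (v [^]\<^bsub>U\<^esub> (p ^ n))" if c: "c \<in> carrier P.CR" for c
  proof -
    obtain n a where a: "a \<in> carrier A" "cg P.CR (s0 w) 1 (c [^]\<^bsub>P.CR\<^esub> (p ^ n)) (s0 a)" using alg[OF c] by blast
    obtain v where "v \<in> carrier U" "cg U (u w) 1 (u a) (v [^]\<^bsub>U\<^esub> (p ^ n))" using U.surj_n[of "u a" n] a by auto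
    then show ?thesis using a by blast
  qed
  obtain \<theta> \<nu> \<alpha> where th: "\<And>c. c \<in> carrier P.CR \<Longrightarrow> \<theta> c \<in> carrier U" "\<And>c. c \<in> carrier P.CR \<Longrightarrow> \<alpha> c \<in> carrier A"
    "\<And>c. c \<in> carrier P.CR \<Longrightarrow> cg P.CR (s0 w) 1 (c [^]\<^bsub>P.CR\<^esub> (p ^ \<nu> c)) (s0 (\<alpha> c))"
    "\<And>c. c \<in> carrier P.CR \<Longrightarrow> cg U (u w) 1 (u (\<alpha> c)) (\<theta> c [^]\<^bsub>U\<^esub> (p ^ \<nu> c))"
    using ex by metis
  \<comment> \<open>The exponents belonging to \<open>c\<close> and \<open>d\<close> may differ;
    everything is raised to the power p^(m+n), with m and n the two exponents, before residues in
    \<open>A\<close> are compared.\<close>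
  have th_inj: "cg P.CR (s0 w) 1 c d" if c: "c \<in> carrier P.CR" and d: "d \<in> carrier P.CR"
      and e: "cg U (u w) 1 (\<theta> c) (\<theta> d)" for c d
  proof -
    let ?m = "\<nu> c" and ?n = "\<nu> d"
    have ac: "\<alpha> c \<in> carrier A" "\<alpha> d \<in> carrier A" "\<theta> c \<in> carrier U" "\<theta> d \<in> carrier U" using th c d by auto
    have 1: "cg U (u w) 1 (u (\<alpha> c [^] (p ^ ?n))) (\<theta> c [^]\<^bsub>U\<^esub> (p ^ (?m + ?n)))"
      using U.cg_pow[OF th(4)[OF c] U.w_closed, of "p ^ ?n"] ac U.prime_pow_pow(1)[OF ac(3)] by simp
    have 2: "cg U (u w) 1 (u (\<alpha> d [^] (p ^ ?m))) (\<theta> d [^]\<^bsub>U\<^esub> (p ^ (?m + ?n)))"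
      using U.cg_pow[OF th(4)[OF d] U.w_closed, of "p ^ ?m"] ac U.prime_pow_pow(2)[OF ac(4)] by simp
    have "cg U (u w) 1 (u (\<alpha> c [^] (p ^ ?n))) (u (\<alpha> d [^] (p ^ ?m)))"
      using U.cgt[OF U.cgt[OF 1 U.cg_pow[OF e U.w_closed]] U.cgs[OF 2]] .
    then have 3: "cg A w 1 (\<alpha> c [^] (p ^ ?n)) (\<alpha> d [^] (p ^ ?m))"
      by (rule cg_of_hom[OF U.is_cring U(1,3), rotated 2]) (use ac in auto)
    have 4: "cg P.CR (s0 w) 1 (c [^]\<^bsub>P.CR\<^esub> (p ^ (?m + ?n))) (s0 (\<alpha> c [^] (p ^ ?n)))"
      using C.cg_pow[OF th(3)[OF c], of "p ^ ?n"] ac C.prime_pow_pow(1)[OF c] by simp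
    have 5: "cg P.CR (s0 w) 1 (d [^]\<^bsub>P.CR\<^esub> (p ^ (?m + ?n))) (s0 (\<alpha> d [^] (p ^ ?m)))"
      using C.cg_pow[OF th(3)[OF d], of "p ^ ?m"] ac C.prime_pow_pow(2)[OF d] by simp
    have 6: "cg P.CR (s0 w) 1 (s0 (\<alpha> c [^] (p ^ ?n))) (s0 (\<alpha> d [^] (p ^ ?m)))"
      by (rule cg_hom[OF 3 s0 A.is_cring C.is_cring wcA])
    have "cg P.CR (s0 w) 1 (c [^]\<^bsub>P.CR\<^esub> (p ^ (?m + ?n))) (d [^]\<^bsub>P.CR\<^esub> (p ^ (?m + ?n)))"
      using C.cgt[OF C.cgt[OF 4[folded s0w] 6[folded s0w]] C.cgs[OF 5[folded s0w]]] by (simp add: s0w)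
    then show ?thesis using C.frob_inj_n[OF c d] by (simp add: s0w)
  qed
  obtain \<phi> where phi: "inj_on \<phi> (carrier P.CR)" "\<phi> ` carrier P.CR \<subseteq> carrier U"
  proof (rule pcr_embedding[OF C.pcr_axioms U(2), of \<theta>])
    show "cg P.CR (P.\<iota> (j w)) 1 c d" if "c \<in> carrier P.CR" "d \<in> carrier P.CR" "cg U (u w) 1 (\<theta> c) (\<theta> d)" for c d
      unfolding s0w by (rule th_inj[OF that])
  qed (rule th(1), assumption, rule that)
  let ?T = "transport \<phi> P.CR"
  note T = transport[OF C.is_cring phi(1)]
  note TP = pcr_transport[OF C.pcr_axioms phi(1), unfolded s0w]
  let ?s = "\<phi> \<circ> s0"
  have s: "?s \<in> ring_hom A ?T" by (rule ring_hom_trans[OF s0 T(2)])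
  have powT: "\<phi> (x [^]\<^bsub>P.CR\<^esub> (k::nat)) = \<phi> x [^]\<^bsub>?T\<^esub> k" if "x \<in> carrier P.CR" for x k
    by (rule ring_hom_pow[OF T(2) C.is_cring T(1) that])
  show thesis
  proof (rule that[of ?T ?s])
    show "CRP p A ?T ?s" unfolding CRP_iff using s TP(1) by simp
    show "\<exists>x\<in>carrier ?T. ?s (t k) = x [^]\<^bsub>?T\<^esub> (p ^ M)" if k: "k < r" for k
    proof -
      have c: "P.\<iota> (y k) \<in> carrier P.CR" using ring_hom_closed[OF P.iota_hom] yH[OF k] by simp
      have "?s (t k) = \<phi> (P.\<iota> (y k [^]\<^bsub>L\<^esub> (p ^ M)))" using D(2)[OF k] by (simp add: s0_def)
      also have "\<dots> = \<phi> (P.\<iota> (y k)) [^]\<^bsub>?T\<^esub> (p ^ M)" using iota_pow[OF yH[OF k]] powT[OF c] by simp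
      finally show ?thesis using c T(3) by blast
    qed
    show "\<exists>n. \<exists>a\<in>carrier A. cg ?T (?s w) 1 (x [^]\<^bsub>?T\<^esub> (p ^ n)) (?s a)" if "x \<in> carrier ?T" for x
    proof -
      obtain c where c: "c \<in> carrier P.CR" "x = \<phi> c" using \<open>x \<in> carrier ?T\<close> T(3) by auto
      obtain n a where a: "a \<in> carrier A" "cg P.CR (s0 w) 1 (c [^]\<^bsub>P.CR\<^esub> (p ^ n)) (s0 a)" using alg[OF c(1)] by blast
      have "cg ?T (?s w) 1 (\<phi> (c [^]\<^bsub>P.CR\<^esub> (p ^ n))) (\<phi> (s0 a))" using TP(2)[of "c [^]\<^bsub>P.CR\<^esub> (p ^ n)" "s0 a" 1] a c by simp
      then have "cg ?T (?s w) 1 (x [^]\<^bsub>?T\<^esub> (p ^ n)) (?s a)" using powT[OF c(1)] c(2) by simp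
      then show ?thesis using a by blast
    qed
    show "\<not> cg ?T (?s w) 1 \<one>\<^bsub>?T\<^esub> \<zero>\<^bsub>?T\<^esub>"
      using TP(2)[OF C.one_closed C.zero_closed, of 1] nt0 ring_hom_one[OF T(2)]
        ring_hom_zero[OF T(2) C.ring_axioms cring.axioms(1)[OF T(1)]] by simp
  qed
qed

section \<open>Polynomials and p-independent elements\<close>

text \<open>Polynomials in Horner form: only products with a variable, so that extracting the
  coefficients with respect to one variable needs no convolution.\<close>

datatype (vars: 'v, coefs: 'a) pol = PConst 'a | PAdd "('v, 'a) pol" "('v, 'a) pol" | PTimes 'v "('v, 'a) pol"

primrec ev :: "('b, 'm) ring_scheme \<Rightarrow> ('a \<Rightarrow> 'b) \<Rightarrow> ('v \<Rightarrow> 'b) \<Rightarrow> ('v, 'a) pol \<Rightarrow> 'b" where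
  "ev R s d (PConst a) = s a"
| "ev R s d (PAdd P Q) = ev R s d P \<oplus>\<^bsub>R\<^esub> ev R s d Q"
| "ev R s d (PTimes v P) = d v \<otimes>\<^bsub>R\<^esub> ev R s d P"

text \<open>The coefficient of the k-th power of the variable \<open>i\<close>, a polynomial in the
  remaining variables. The parameter \<open>z\<close> supplies the zero constant, as the datatype
  knows no ring.\<close>

primrec cf :: "'a \<Rightarrow> 'v \<Rightarrow> ('v, 'a) pol \<Rightarrow> nat \<Rightarrow> ('v, 'a) pol" where
  "cf z i (PConst a) k = (if k = 0 then PConst a else PConst z)"
| "cf z i (PAdd P Q) k = PAdd (cf z i P k) (cf z i Q k)"
| "cf z i (PTimes v P) k =
    (if v = i then (case k of 0 \<Rightarrow> PConst z | Suc l \<Rightarrow> cf z i P l) else PTimes v (cf z i P k))"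

text \<open>Strictly larger than the degree in each single variable, so it bounds the number of
  coefficients; adding the bounds of summands is crude but sufficient.\<close>

primrec degree_bound :: "('v, 'a) pol \<Rightarrow> nat" where
  "degree_bound (PConst a) = 1"
| "degree_bound (PAdd P Q) = degree_bound P + degree_bound Q"
| "degree_bound (PTimes v P) = Suc (degree_bound P)"

lemma vars_cf: "vars (cf z i P k) \<subseteq> vars P - {i}"
  by (induction P arbitrary: k) (auto split: nat.split)

lemma coefs_cf: "coefs (cf z i P k) \<subseteq> insert z (coefs P)"
proof (induction P arbitrary: k)
  case (PTimes v P)
  then show ?case by (cases k) auto
qed auto

lemma finite_vars: "finite (vars P)"
  by (induction P) auto

lemma ev_cong: "(\<And>v. v \<in> vars P \<Longrightarrow> d v = d' v) \<Longrightarrow> ev R s d P = ev R s d' P"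
  by (induction P) auto

context cring
begin

lemma ev_closed:
  "(\<And>a. a \<in> coefs P \<Longrightarrow> s a \<in> carrier R) \<Longrightarrow> (\<And>v. v \<in> vars P \<Longrightarrow> d v \<in> carrier R) \<Longrightarrow> ev R s d P \<in> carrier R"
  by (induction P) auto

lemma ev_cg:
  assumes "w \<in> carrier R"
  shows "(\<And>a. a \<in> coefs P \<Longrightarrow> s a \<in> carrier R) \<Longrightarrow> (\<And>v. v \<in> vars P \<Longrightarrow> cg R w n (d v) (d' v)) \<Longrightarrow>
    cg R w n (ev R s d P) (ev R s d' P)"
  by (induction P) (auto intro!: cg_add cg_mult cg_refl assms)

lemma ev_cf:
  assumes z: "s z = \<zero>" and "\<And>a. a \<in> coefs P \<Longrightarrow> s a \<in> carrier R"
    "\<And>v. v \<in> vars P \<Longrightarrow> d v \<in> carrier R" "d i \<in> carrier R" "degree_bound P \<le> n"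
  shows "ev R s d P = psum R (d i) (\<lambda>k. ev R s d (cf z i P k)) n"
  using assms(2-)
proof (induction P arbitrary: n)
  case (PConst a)
  have "psum R (d i) (\<lambda>k. ev R s d (cf z i (PConst a) k)) (Suc m) = s a" for m
    using PConst by (induction m) (auto simp: z)
  moreover obtain m where "n = Suc m" using PConst by (cases n) auto
  ultimately show ?case by simp
next
  case (PAdd P Q)
  have c: "ev R s d (cf z i P k) \<in> carrier R" "ev R s d (cf z i Q k) \<in> carrier R" for k
    using PAdd.prems coefs_cf[of z i P k] vars_cf[of z i P k] coefs_cf[of z i Q k] vars_cf[of z i Q k]
    by (auto intro!: ev_closed simp: z subset_iff)
  have 1: "ev R s d P = psum R (d i) (\<lambda>k. ev R s d (cf z i P k)) n" by (rule PAdd.IH(1)) (use PAdd.prems in auto)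
  have 2: "ev R s d Q = psum R (d i) (\<lambda>k. ev R s d (cf z i Q k)) n" by (rule PAdd.IH(2)) (use PAdd.prems in auto)
  show ?case
    unfolding ev.simps cf.simps by (subst 1, subst 2, rule psum_add) (use PAdd.prems(3) c in auto)
next
  case (PTimes v P)
  have c: "ev R s d (cf z i P k) \<in> carrier R" for k
    using PTimes.prems coefs_cf[of z i P k] vars_cf[of z i P k] by (auto intro!: ev_closed simp: z subset_iff)
  obtain m where m: "n = Suc m" "degree_bound P \<le> m" using PTimes.prems by (cases n) auto
  show ?case
  proof (cases "v = i")
    case True
    have e: "ev R s d (cf z i (PTimes i P) k) = (case k of 0 \<Rightarrow> \<zero> | Suc l \<Rightarrow> ev R s d (cf z i P l))" for k
      by (auto simp: z split: nat.split)
    have "psum R (d i) (\<lambda>k. ev R s d (cf z i (PTimes i P) k)) n =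
        \<zero> \<oplus> d i \<otimes> psum R (d i) (\<lambda>k. ev R s d (cf z i P k)) m"
      unfolding e m(1) using c PTimes.prems(3)
      by (subst psum_shift) (auto simp: comp_def split: nat.split)
    also have "psum R (d i) (\<lambda>k. ev R s d (cf z i P k)) m = ev R s d P"
      by (rule PTimes.IH[symmetric]) (use PTimes.prems m in auto)
    finally show ?thesis using True PTimes.prems(3) ev_closed[of P s d] PTimes.prems(1,2) by simp
  next
    case False
    have 1: "ev R s d P = psum R (d i) (\<lambda>k. ev R s d (cf z i P k)) n" by (rule PTimes.IH) (use PTimes.prems in auto)
    have dv: "d v \<in> carrier R" using PTimes.prems by simp
    have "ev R s d (PTimes v P) = d v \<otimes> psum R (d i) (\<lambda>k. ev R s d (cf z i P k)) n" by (simp add: 1[symmetric])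
    also have "\<dots> = psum R (d i) (\<lambda>k. d v \<otimes> ev R s d (cf z i P k)) n"
      by (rule psum_smult) (use PTimes.prems(3) c dv in auto)
    finally show ?thesis using False by simp
  qed
qed

end

lemma ev_hom:
  assumes h: "h \<in> ring_hom R S"
  shows "cring R \<Longrightarrow> (\<And>a. a \<in> coefs P \<Longrightarrow> s a \<in> carrier R) \<Longrightarrow> (\<And>v. v \<in> vars P \<Longrightarrow> d v \<in> carrier R) \<Longrightarrow>
    h (ev R s d P) = ev S (h \<circ> s) (h \<circ> d) P"
  by (induction P) (auto simp: ring_hom_add[OF h] ring_hom_mult[OF h] cring.ev_closed)

text \<open>Polynomials have no product constructor, so a polynomial with the required value is
  built by recursion on the left factor; multiplication by a scalar (\<open>k\<close>) is the base
  case.\<close>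

lemma ev_mult:
  assumes u: "u \<in> ring_hom A U" and A: "cring A" and U: "cring U" and d: "\<And>v. d v \<in> carrier U"
    and "coefs P \<subseteq> carrier A" "vars P \<subseteq> I" "coefs Q \<subseteq> carrier A" "vars Q \<subseteq> I"
  shows "\<exists>R. coefs R \<subseteq> carrier A \<and> vars R \<subseteq> I \<and> ev U u d R = ev U u d P \<otimes>\<^bsub>U\<^esub> ev U u d Q"
proof -
  interpret A: cring A by fact
  interpret U: cring U by fact
  note uc = ring_hom_closed[OF u]
  have c: "ev U u d P \<in> carrier U" if "coefs P \<subseteq> carrier A" for P
    using that uc d by (intro U.ev_closed) auto
  have k: "\<exists>R. coefs R \<subseteq> carrier A \<and> vars R \<subseteq> I \<and> ev U u d R = u a \<otimes>\<^bsub>U\<^esub> ev U u d Q"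
    if "coefs Q \<subseteq> carrier A" "vars Q \<subseteq> I" "a \<in> carrier A" for a Q
    using that(1,2)
  proof (induction Q)
    case (PConst b)
    then show ?case using that(3) ring_hom_mult[OF u, of a b] by (intro exI[of _ "PConst (a \<otimes>\<^bsub>A\<^esub> b)"]) auto
  next
    case (PAdd Q Q')
    then obtain R R' where "coefs R \<subseteq> carrier A" "vars R \<subseteq> I" "ev U u d R = u a \<otimes>\<^bsub>U\<^esub> ev U u d Q"
      "coefs R' \<subseteq> carrier A" "vars R' \<subseteq> I" "ev U u d R' = u a \<otimes>\<^bsub>U\<^esub> ev U u d Q'" by auto
    then show ?case using PAdd.prems that(3) uc c[of Q] c[of Q'] by (intro exI[of _ "PAdd R R'"]) (auto simp: U.r_distr)
  next
    case (PTimes v Q)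
    then obtain R where "coefs R \<subseteq> carrier A" "vars R \<subseteq> I" "ev U u d R = u a \<otimes>\<^bsub>U\<^esub> ev U u d Q" by auto
    then show ?case using PTimes.prems that(3) uc c[of Q] d by (intro exI[of _ "PTimes v R"]) (auto simp: U.m_lcomm)
  qed
  show ?thesis
    using assms(5,6)
  proof (induction P)
    case (PConst a)
    then show ?case using k[of Q a] assms by auto
  next
    case (PAdd P P')
    then obtain R R' where "coefs R \<subseteq> carrier A" "vars R \<subseteq> I" "ev U u d R = ev U u d P \<otimes>\<^bsub>U\<^esub> ev U u d Q"
      "coefs R' \<subseteq> carrier A" "vars R' \<subseteq> I" "ev U u d R' = ev U u d P' \<otimes>\<^bsub>U\<^esub> ev U u d Q" by auto
    then show ?case using PAdd.prems assms(7) c[of P] c[of P'] c[of Q] by (intro exI[of _ "PAdd R R'"]) (auto simp: U.l_distr)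
  next
    case (PTimes v P)
    then obtain R where "coefs R \<subseteq> carrier A" "vars R \<subseteq> I" "ev U u d R = ev U u d P \<otimes>\<^bsub>U\<^esub> ev U u d Q" by auto
    then show ?case using PTimes.prems assms(7) c[of P] c[of Q] d by (intro exI[of _ "PTimes v R"]) (auto simp: U.m_assoc)
  qed
qed

lemma generate_ring_ev:
  assumes u: "u \<in> ring_hom A U" and A: "cring A" and U: "cring U" and d: "\<And>v. d v \<in> carrier U"
    and e: "e \<in> generate_ring U (u ` carrier A \<union> d ` I)"
  shows "\<exists>P. coefs P \<subseteq> carrier A \<and> vars P \<subseteq> I \<and> e = ev U u d P"
proof -
  interpret A: cring A by fact
  interpret U: cring U by fact
  note uc = ring_hom_closed[OF u]
  have c: "ev U u d P \<in> carrier U" if "coefs P \<subseteq> carrier A" for P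
    using that uc d by (intro U.ev_closed) auto
  show ?thesis
    using e
  proof (induction rule: generate_ring.induct)
    case one
    show ?case using ring_hom_one[OF u] by (intro exI[of _ "PConst \<one>\<^bsub>A\<^esub>"]) auto
  next
    case (incl x)
    then show ?case
    proof
      assume "x \<in> u ` carrier A"
      then obtain a where "a \<in> carrier A" "x = u a" by blast
      then show ?thesis by (intro exI[of _ "PConst a"]) auto
    next
      assume "x \<in> d ` I"
      then obtain i where "i \<in> I" "x = d i" by blast
      then show ?thesis using ring_hom_one[OF u] d by (intro exI[of _ "PTimes i (PConst \<one>\<^bsub>A\<^esub>)"]) auto
    qed
  next
    case (a_inv x)
    then obtain P where P: "coefs P \<subseteq> carrier A" "vars P \<subseteq> I" "x = ev U u d P" by blast
    obtain R where R: "coefs R \<subseteq> carrier A" "vars R \<subseteq> I" "ev U u d R = ev U u d (PConst (\<ominus>\<^bsub>A\<^esub> \<one>\<^bsub>A\<^esub>)) \<otimes>\<^bsub>U\<^esub> ev U u d P"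
      using ev_mult[where P = "PConst (\<ominus>\<^bsub>A\<^esub> \<one>\<^bsub>A\<^esub>)" and Q = P and d = d and I = I, OF u A U d] P by auto
    interpret u: ring_hom_cring A U u using u A U by (intro ring_hom_cringI) auto
    have "ev U u d (PConst (\<ominus>\<^bsub>A\<^esub> \<one>\<^bsub>A\<^esub>)) = \<ominus>\<^bsub>U\<^esub> \<one>\<^bsub>U\<^esub>" by simp
    then have "ev U u d R = \<ominus>\<^bsub>U\<^esub> x" using R(3) P c[OF P(1)] by (simp add: U.l_minus)
    then show ?case using R by metis
  next
    case (eng_add x y)
    then obtain P Q where "coefs P \<subseteq> carrier A" "vars P \<subseteq> I" "x = ev U u d P"
      "coefs Q \<subseteq> carrier A" "vars Q \<subseteq> I" "y = ev U u d Q" by blast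
    then show ?case by (intro exI[of _ "PAdd P Q"]) auto
  next
    case (eng_mult x y)
    then obtain P Q where PQ: "coefs P \<subseteq> carrier A" "vars P \<subseteq> I" "x = ev U u d P"
      "coefs Q \<subseteq> carrier A" "vars Q \<subseteq> I" "y = ev U u d Q" by blast
    show ?case using ev_mult[where d = d, OF u A U d PQ(1,2,4,5)] PQ(3,6) by metis
  qed
qed

section \<open>Polynomials that vanish residually on a multiplicative set\<close>

lemma (in cring) psum_scale:
  assumes "x \<in> carrier R" "y \<in> carrier R" "\<And>k. c k \<in> carrier R"
  shows "psum R (x \<otimes> y) c n = psum R x (\<lambda>k. y [^] k \<otimes> c k) n"
  using assms by (induction n) (auto simp: nat_pow_distrib m_assoc)

context cdv
begin

text \<open>Comparing \<open>g (x \<otimes> y)\<close> with \<open>y [^] n \<otimes> g x\<close> eliminates the leading coefficient of a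
  polynomial \<open>g\<close> of degree \<open>n\<close>.\<close>

lemma vanishing_polynomial:
  assumes G: "G \<subseteq> carrier R" "\<And>x y. x \<in> G \<Longrightarrow> y \<in> G \<Longrightarrow> x \<otimes> y \<in> G"
    and y: "y \<in> G" "\<not> cg R w 1 y \<zero>" "\<And>m. m > 0 \<Longrightarrow> \<not> cg R w 1 (y [^] (m::nat)) \<one>"
    and "\<And>k. c k \<in> carrier R" "\<And>x. x \<in> G \<Longrightarrow> cg R w 1 (psum R x c n) \<zero>" "k < n"
  shows "cg R w 1 (c k) \<zero>"
  using assms(6-8)
proof (induction n arbitrary: c k)
  case 0
  then show ?case by simp
next
  case (Suc n)
  have wc: "w \<in> carrier R" by simp
  have yc: "y \<in> carrier R" using G y by blast
  have ynz: "\<not> cg R w 1 (y [^] m) \<zero>" for m :: nat using pow_w[OF yc] y(2) by blast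
  \<comment> \<open>The coefficients of the difference; the one of degree n is zero. For j < n the
    factor y^j - y^n is y^j times 1 - y^(n-j), which is not divisible by \<open>w\<close> because
    \<open>y\<close> has infinite order modulo \<open>w\<close>.\<close>
  define g where "g = (\<lambda>k. (y [^] k \<ominus> y [^] n) \<otimes> c k)"
  have gc: "g k \<in> carrier R" for k using yc Suc.prems by (simp add: g_def)
  have "cg R w 1 (psum R x g n) \<zero>" if x: "x \<in> G" for x
  proof -
    have xc: "x \<in> carrier R" using x G by blast
    define m where "m = \<ominus> (y [^] n)"
    have mc: "m \<in> carrier R" using yc by (simp add: m_def)
    have "psum R (x \<otimes> y) c (Suc n) \<oplus> m \<otimes> psum R x c (Suc n) =
      psum R x (\<lambda>k. y [^] k \<otimes> c k) (Suc n) \<oplus> psum R x (\<lambda>k. m \<otimes> c k) (Suc n)"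
      unfolding psum_scale[OF xc yc Suc.prems(1)] using psum_smult[OF xc Suc.prems(1) mc] by (simp only:)
    also have "\<dots> = psum R x (\<lambda>k. y [^] k \<otimes> c k \<oplus> m \<otimes> c k) (Suc n)"
      by (rule psum_add[OF xc]) (use yc mc Suc.prems in auto)
    also have "(\<lambda>k. y [^] k \<otimes> c k \<oplus> m \<otimes> c k) = g"
      using yc mc Suc.prems(1) by (simp add: g_def a_minus_def l_distr m_def)
    also have "psum R x g (Suc n) = psum R x g n"
      using xc gc yc Suc.prems(1) by (simp add: g_def[THEN fun_cong, of n] r_neg a_minus_def)
    finally have e: "psum R (x \<otimes> y) c (Suc n) \<oplus> m \<otimes> psum R x c (Suc n) = psum R x g n" .
    have "cg R w 1 (psum R (x \<otimes> y) c (Suc n) \<oplus> m \<otimes> psum R x c (Suc n)) (\<zero> \<oplus> \<zero>)"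
      by (rule cg_add[OF Suc.prems(2)[OF G(2)[OF x y(1)]] cg_shift_zero(2)[OF Suc.prems(2)[OF x] mc wc] wc])
    then show ?thesis unfolding e by simp
  qed
  then have gk: "cg R w 1 (g j) \<zero>" if "j < n" for j using Suc.IH[of g j, OF gc] that by blast
  have low: "cg R w 1 (c j) \<zero>" if j: "j < n" for j
  proof (rule prime_w[of "y [^] j \<ominus> y [^] n"])
    show "cg R w 1 ((y [^] j \<ominus> y [^] n) \<otimes> c j) \<zero>" using gk[OF j] by (simp add: g_def)
    show "\<not> cg R w 1 (y [^] j \<ominus> y [^] n) \<zero>"
    proof
      assume a: "cg R w 1 (y [^] j \<ominus> y [^] n) \<zero>"
      have "y [^] n = y [^] j \<otimes> y [^] (n - j)" using j yc by (simp add: nat_pow_mult)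
      then have "y [^] j \<ominus> y [^] n = y [^] j \<otimes> (\<one> \<ominus> y [^] (n - j))"
        using yc by (simp add: a_minus_def r_distr r_minus)
      then have "cg R w 1 (y [^] j \<otimes> (\<one> \<ominus> y [^] (n - j))) \<zero>" using a by simp
      then have "cg R w 1 (\<one> \<ominus> y [^] (n - j)) \<zero>" by (rule prime_w[rotated 2]) (use yc ynz in auto)
      then have "cg R w 1 \<one> (y [^] (n - j))" using yc cg_diff_iff[of \<one> "y [^] (n - j)" w 1] by simp
      then have "cg R w 1 (y [^] (n - j)) \<one>" by (rule cgs)
      then show False using y(3)[of "n - j"] j by simp
    qed
  qed (use yc Suc.prems in auto)
  show ?case
  proof (cases "k < n")
    case True
    then show ?thesis by (rule low)
  next
    case False
    then have k: "k = n" using Suc.prems by simp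
    \<comment> \<open>Once the lower coefficients vanish modulo \<open>w\<close>, evaluation at
      \<open>y\<close>, which is invertible modulo \<open>w\<close>, isolates the leading
      one.\<close>
    have z0: "psum R y (\<lambda>_. \<zero>) m = \<zero>" for m using yc by (induction m) auto
    have "cg R w 1 (psum R y c n) (psum R y (\<lambda>_. \<zero>) n)"
    proof -
      have "cg R w 1 (psum R y c m) \<zero>" if "m \<le> n" for m
        using that
      proof (induction m)
        case (Suc m)
        have "cg R w 1 (psum R y c m \<oplus> y [^] m \<otimes> c m) (\<zero> \<oplus> \<zero>)"
          by (rule cg_add[OF Suc.IH cg_shift_zero(2)[OF low] wc]) (use Suc.prems yc in auto)
        then show ?case by simp
      qed (simp add: cg_refl)
      then show ?thesis by (simp add: z0)
    qed
    then have 1: "cg R w 1 (psum R y c n) \<zero>" by (simp add: z0)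
    have pc: "psum R y c n \<in> carrier R" using yc Suc.prems(1) by simp
    have "cg R w 1 (psum R y c (Suc n) \<ominus> psum R y c n) (\<zero> \<ominus> \<zero>)" by (rule cg_minus[OF Suc.prems(2)[OF y(1)] 1 wc])
    moreover have "psum R y c (Suc n) \<ominus> psum R y c n = y [^] n \<otimes> c n"
    proof -
      define a b where "a = psum R y c n" and "b = y [^] n \<otimes> c n"
      have ab: "a \<in> carrier R" "b \<in> carrier R" using pc yc Suc.prems(1) by (auto simp: a_def b_def)
      have "(a \<oplus> b) \<ominus> a = b \<oplus> \<zero>" by (use ab in \<open>simp add: ring_nf\<close>)
      then show ?thesis using ab by (simp add: a_def b_def)
    qed
    ultimately have "cg R w 1 (y [^] n \<otimes> c n) \<zero>" by (simp add: a_minus_def)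
    then have "cg R w 1 (c n) \<zero>" by (rule prime_w[rotated 2]) (use ynz yc Suc.prems in auto)
    then show ?thesis using k by simp
  qed
qed

text \<open>If \<open>p\<close> divides m, a congruence t^m = 1 passes to t^(m/p), as the residue
  field is reduced of characteristic \<open>p\<close>. Otherwise a Bezout relation a p = b m + 1
  gives t = (t^a)^p modulo \<open>w\<close>, contrary to the hypothesis. So an imperfect residue
  field comes with explicit elements of infinite order.\<close>

lemma not_root_of_unity:
  assumes t: "t \<in> carrier R" "\<And>b. b \<in> carrier R \<Longrightarrow> \<not> cg R w 1 t (b [^] p)"
  shows "m > 0 \<Longrightarrow> \<not> cg R w 1 (t [^] (m::nat)) \<one>"
proof (induction m rule: less_induct)
  case (less m)
  show ?case
  proof (cases "p dvd m")
    case True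
    then obtain l where "m = p * l" by (elim dvdE)
    then have l: "m = l * p" by simp
    then have l0: "l > 0" "l < m" using less.prems p_gt_1 by auto
    show ?thesis
    proof
      assume "cg R w 1 (t [^] m) \<one>"
      then have "cg R w 1 ((t [^] l) [^] (p ^ 1)) \<one>" using t l by (simp add: nat_pow_pow)
      then have "cg R w 1 ((t [^] l) [^] (p ^ 1) \<ominus> \<one> [^] (p ^ 1)) \<zero>" using t cg_diff_iff[of "(t [^] l) [^] (p ^ 1)" \<one> w 1] by simp
      then have "cg R w 1 ((t [^] l \<ominus> \<one>) [^] (p ^ 1)) \<zero>" using cgt[OF frob_minus_n[of "t [^] l" \<one> 1]] t by simp
      then have "cg R w 1 (t [^] l \<ominus> \<one>) \<zero>" by (rule pow_w[rotated]) (use t in auto)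
      then have "cg R w 1 (t [^] l) \<one>" using t cg_diff_iff[of "t [^] l" \<one> w 1] by simp
      then show False using less.IH[OF l0(2,1)] by blast
    qed
  next
    case False
    then have "coprime p m" using p_prime prime_imp_coprime by blast
    then obtain a b where ab: "a * p = b * m + 1"
      using bezout_nat[of p m] p_gt_1 by (metis coprime_imp_gcd_eq_1 mult.commute not_one_less_zero)
    show ?thesis
    proof
      assume "cg R w 1 (t [^] m) \<one>"
      then have "cg R w 1 ((t [^] m) [^] b) (\<one> [^] b)" by (rule cg_pow) simp
      then have "cg R w 1 ((t [^] m) [^] b \<otimes> t) (\<one> [^] b \<otimes> t)" by (rule cg_mult) (use t cg_refl in auto)
      moreover have "(t [^] m) [^] b \<otimes> t = t [^] (a * p)" unfolding ab using t by (simp add: nat_pow_pow mult.commute)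
      ultimately have "cg R w 1 ((t [^] a) [^] p) t" using t by (simp add: nat_pow_pow)
      then have "cg R w 1 t ((t [^] a) [^] p)" by (rule cgs)
      then show False using t(2)[of "t [^] a"] t(1) by simp
    qed
  qed
qed

end

text \<open>Used in contrapositive form. A polynomial over \<open>A\<close> vanishing modulo
  \<open>w\<close> at all points of \<open>G\<close> has, by induction on the variables,
  coefficients that vanish modulo \<open>w\<close>, and then so does its value at any point
  \<open>d\<close> of \<open>U\<close>. An element of infinite order is demanded only when variables
  are present, because a perfect residue field may have none.\<close>

lemma (in base) nonvanishing_point:
  fixes P :: "('v, 'a) pol"
  assumes U: "cring U" "u \<in> ring_hom A U" and I: "finite I" and d: "\<And>v. d v \<in> carrier U"
    and G: "G \<subseteq> carrier A" "\<one> \<in> G" "\<And>x y. x \<in> G \<Longrightarrow> y \<in> G \<Longrightarrow> x \<otimes> y \<in> G"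
    and y: "I \<noteq> {} \<Longrightarrow> \<exists>y\<in>G. \<not> cg A w 1 y \<zero> \<and> (\<forall>m>0. \<not> cg A w 1 (y [^] (m::nat)) \<one>)"
    and "vars P \<subseteq> I" "coefs P \<subseteq> carrier A"
      "\<And>\<beta>. (\<And>v. \<beta> v \<in> G) \<Longrightarrow> cg A w 1 (ev A (\<lambda>a. a) \<beta> P) \<zero>"
  shows "cg U (u w) 1 (ev U u d P) \<zero>\<^bsub>U\<^esub>"
  using I y assms(9-)
proof (induction I arbitrary: P rule: finite_induct)
  case empty
  interpret U: cring U by fact
  let ?b = "\<lambda>_. \<one>"
  have "u (ev A (\<lambda>a. a) ?b P) = ev U u d P"
    using ev_hom[OF U(2) A.is_cring, of P "\<lambda>a. a" ?b] empty ev_cong[of P "u \<circ> ?b" d U u] by (auto simp: comp_def)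
  moreover have "cg U (u w) 1 (u (ev A (\<lambda>a. a) ?b P)) (u \<zero>)"
    by (rule cg_hom[OF empty(4) U(2) A.is_cring U(1)]) (use G in auto)
  ultimately show ?case using ring_hom_zero[OF U(2) A.ring_axioms U.ring_axioms] by simp
next
  case (insert i I)
  interpret U: cring U by fact
  interpret u: ring_hom_cring A U u using U A.is_cring by (intro ring_hom_cringI) auto
  obtain y where y: "y \<in> G" "\<not> cg A w 1 y \<zero>" "\<And>m. m > 0 \<Longrightarrow> \<not> cg A w 1 (y [^] (m::nat)) \<one>"
    using insert.prems(1) by blast
  have uw: "u w \<in> carrier U" by simp
  define n where "n = degree_bound P"
  define Q where "Q = cf \<zero> i P"
  have Q: "vars (Q k) \<subseteq> I" "i \<notin> vars (Q k)" "coefs (Q k) \<subseteq> carrier A" for k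
    using insert.prems(2,3) vars_cf[of "\<zero>" i P k] coefs_cf[of "\<zero>" i P k] by (auto simp: Q_def)
  have evc: "ev A (\<lambda>a. a) \<beta> (Q k) \<in> carrier A" if "\<And>v. \<beta> v \<in> G" for \<beta> k
  proof (rule A.ev_closed)
    show "a \<in> carrier A" if "a \<in> coefs (Q k)" for a using Q(3)[of k] that by blast
    show "\<beta> v \<in> carrier A" for v using \<open>\<And>v. \<beta> v \<in> G\<close> G(1) by blast
  qed
  have "cg A w 1 (ev A (\<lambda>a. a) \<beta> (Q k)) \<zero>" if b: "\<And>v. \<beta> v \<in> G" and k: "k < n" for \<beta> k
  proof (rule A.vanishing_polynomial[where c = "\<lambda>k. ev A (\<lambda>a. a) \<beta> (Q k)", OF G(1,3) y evc _ k])
    fix x assume x: "x \<in> G"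
    let ?b = "\<beta>(i := x)"
    have bG: "?b v \<in> G" for v using b x by simp
    then have bc: "?b v \<in> carrier A" for v using G(1) by blast
    have "cg A w 1 (ev A (\<lambda>a. a) ?b P) \<zero>" by (rule insert.prems(4)) (rule bG)
    also have "ev A (\<lambda>a. a) ?b P = psum A (?b i) (\<lambda>k. ev A (\<lambda>a. a) ?b (Q k)) n"
      unfolding Q_def by (rule A.ev_cf) (use insert.prems(3) bc n_def in \<open>auto simp del: fun_upd_apply\<close>)
    also have "(\<lambda>k. ev A (\<lambda>a. a) ?b (Q k)) = (\<lambda>k. ev A (\<lambda>a. a) \<beta> (Q k))"
      using Q(2) by (intro ext ev_cong) auto
    finally show "cg A w 1 (psum A x (\<lambda>k. ev A (\<lambda>a. a) \<beta> (Q k)) n) \<zero>" by simp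
  qed (use b in auto)
  then have Qk: "cg U (u w) 1 (ev U u d (Q k)) \<zero>\<^bsub>U\<^esub>" if "k < n" for k
    by (intro insert.IH) (use Q y that in blast)+
  have "ev U u d P = psum U (d i) (\<lambda>k. ev U u d (Q k)) n"
    unfolding Q_def by (rule U.ev_cf) (use insert.prems(3) d n_def in auto)
  moreover have "cg U (u w) 1 (psum U (d i) (\<lambda>k. ev U u d (Q k)) m) \<zero>\<^bsub>U\<^esub>" if "m \<le> n" for m
    using that
  proof (induction m)
    case (Suc m)
    have "cg U (u w) 1 (psum U (d i) (\<lambda>k. ev U u d (Q k)) m \<oplus>\<^bsub>U\<^esub> d i [^]\<^bsub>U\<^esub> m \<otimes>\<^bsub>U\<^esub> ev U u d (Q m)) (\<zero>\<^bsub>U\<^esub> \<oplus>\<^bsub>U\<^esub> \<zero>\<^bsub>U\<^esub>)"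
      by (rule U.cg_add[OF Suc.IH U.cg_shift_zero(2)[OF Qk] uw]) (use Suc.prems d in auto)
    then show ?case by simp
  qed (simp add: U.cg_refl)
  ultimately show ?case by simp
qed

section \<open>A \<open>p\<close>-basis of the residue field of \<open>A\<close>\<close>

lemma (in cring) generate_ring_cg:
  assumes w: "w \<in> carrier R" and T: "S \<subseteq> carrier R" "T \<subseteq> carrier R"
    and st: "\<And>x. x \<in> S \<Longrightarrow> \<exists>y\<in>generate_ring R T. cg R w n x y" and e: "e \<in> generate_ring R S"
  shows "\<exists>y\<in>generate_ring R T. cg R w n e y"
  using e
proof (induction rule: generate_ring.induct)
  case one
  then show ?case using w by (intro bexI[of _ \<one>] cg_refl generate_ring.one) auto
next
  case (incl h)
  then show ?case using st by blast
next
  case (a_inv h)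
  then obtain y where "y \<in> generate_ring R T" "cg R w n h y" by blast
  then show ?case using cg_neg w by (intro bexI[of _ "\<ominus> y"] generate_ring.a_inv) auto
next
  case (eng_add h1 h2)
  then obtain y z where "y \<in> generate_ring R T" "cg R w n h1 y" "z \<in> generate_ring R T" "cg R w n h2 z" by blast
  then show ?case using cg_add w by (intro bexI[of _ "y \<oplus> z"] generate_ring.eng_add) auto
next
  case (eng_mult h1 h2)
  then obtain y z where "y \<in> generate_ring R T" "cg R w n h1 y" "z \<in> generate_ring R T" "cg R w n h2 z" by blast
  then show ?case using cg_mult w by (intro bexI[of _ "y \<otimes> z"] generate_ring.eng_mult) auto
qed

definition wo :: "'a rel" where
  "wo = (SOME r. Well_order r \<and> Field r = UNIV) - Id"

lemma wo:
  fixes x y :: 'a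
  shows "wf (wo :: 'a rel)" "trans (wo :: 'a rel)" "x \<noteq> y \<Longrightarrow> (x, y) \<in> wo \<or> (y, x) \<in> wo"
proof -
  define r :: "'a rel" where "r = (SOME r. Well_order r \<and> Field r = UNIV)"
  have r: "Well_order r" "Field r = UNIV" using someI_ex[OF well_ordering] by (auto simp: r_def)
  then show "wf (wo :: 'a rel)" unfolding wo_def r_def[symmetric] by (simp add: well_order_on_def)
  have "trans r" "antisym r" using r by (auto simp: order_on_defs)
  then show "trans (wo :: 'a rel)" unfolding wo_def r_def[symmetric] by (simp add: trans_diff_Id)
  assume "x \<noteq> y"
  then show "(x, y) \<in> wo \<or> (y, x) \<in> wo" using r unfolding wo_def r_def[symmetric] by (auto simp: order_on_defs total_on_def)
qed

lemma sorted_enumeration: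
  assumes "finite F"
  shows "\<exists>t r. t ` {..<(r::nat)} = F \<and> (\<forall>i<r. \<forall>j<i. (t j, t i) \<in> wo)"
  using assms
proof (induction "card F" arbitrary: F)
  case 0
  then show ?case by (intro exI[of _ undefined] exI[of _ 0]) auto
next
  case (Suc n)
  have "\<exists>m\<in>F. \<forall>s\<in>F. s \<noteq> m \<longrightarrow> (s, m) \<in> wo" if "finite F" "F \<noteq> {}" for F :: "'a set"
    using that
  proof (induction F rule: finite_ne_induct)
    case (insert x F)
    then obtain m where m: "m \<in> F" "\<forall>s\<in>F. s \<noteq> m \<longrightarrow> (s, m) \<in> wo" by blast
    then show ?case using wo(3)[of x m] transD[OF wo(2)] insert(3) by (metis insert_iff)
  qed auto
  then obtain m where m: "m \<in> F" "\<forall>s\<in>F. s \<noteq> m \<longrightarrow> (s, m) \<in> wo" using Suc by (metis card.empty nat.distinct(1))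
  have "n = card (F - {m})" "finite (F - {m})" using Suc m by auto
  then obtain t r where t: "t ` {..<(r::nat)} = F - {m}" "\<forall>i<r. \<forall>j<i. (t j, t i) \<in> wo" using Suc.hyps(1) by blast
  have "(t(r := m)) ` {..<Suc r} = F" using t(1) m(1) by (auto simp: lessThan_Suc)
  moreover have "\<forall>i<Suc r. \<forall>j<i. ((t(r := m)) j, (t(r := m)) i) \<in> wo"
    using t m(2) by (auto simp: less_Suc_eq)
  ultimately show ?case by blast
qed

context base
begin

text \<open>Lifts of a \<open>p\<close>-basis of the residue field, selected greedily along a well-ordering.\<close>

definition T0 :: "'a set" where
  "T0 = {t \<in> carrier A. \<forall>e\<in>generate_ring A ((\<lambda>d. d [^] p) ` carrier A \<union> {s \<in> carrier A. (s, t) \<in> wo}). \<not> cg A w 1 t e}"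

lemma T0_carrier: "t \<in> T0 \<Longrightarrow> t \<in> carrier A" by (simp add: T0_def)

lemma T0_not_power: "t \<in> T0 \<Longrightarrow> b \<in> carrier A \<Longrightarrow> \<not> cg A w 1 t (b [^] p)"
  by (auto simp: T0_def intro: generate_ring.incl)

text \<open>Well-founded induction: an element outside \<open>T0\<close> is congruent to an
  expression in p-th powers and smaller elements, and the latter are replaced by expressions in p-th
  powers and \<open>T0\<close>.\<close>

lemma T0_generate:
  "a \<in> carrier A \<Longrightarrow> \<exists>e\<in>generate_ring A ((\<lambda>d. d [^] p) ` carrier A \<union> T0). cg A w 1 a e"
proof (induction a rule: wf_induct_rule[OF wo(1)])
  case (1 a)
  let ?P = "(\<lambda>d. d [^] p) ` carrier A"
  show ?case
  proof (cases "a \<in> T0")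
    case True
    then show ?thesis using 1(2) by (intro bexI[of _ a] A.cg_refl generate_ring.incl) auto
  next
    case False
    then obtain e where e: "e \<in> generate_ring A (?P \<union> {s \<in> carrier A. (s, a) \<in> wo})" "cg A w 1 a e"
      using 1(2) by (auto simp: T0_def)
    have "\<exists>y\<in>generate_ring A (?P \<union> T0). cg A w 1 e y"
    proof (rule A.generate_ring_cg[OF A.w_closed _ _ _ e(1)])
      fix x assume "x \<in> ?P \<union> {s \<in> carrier A. (s, a) \<in> wo}"
      then show "\<exists>y\<in>generate_ring A (?P \<union> T0). cg A w 1 x y"
      proof
        assume "x \<in> ?P"
        then show ?thesis by (intro bexI[of _ x] A.cg_refl generate_ring.incl) auto
      next
        assume "x \<in> {s \<in> carrier A. (s, a) \<in> wo}"
        then show ?thesis using 1(1) by blast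
      qed
    qed (auto simp: T0_carrier)
    then show ?thesis using A.cgt[OF e(2)] by blast
  qed
qed

text \<open>Enumerated increasingly, a finite part of \<open>T0\<close> is independent, since a
  relation would express an element by smaller ones. The lifts may be altered by multiples of
  \<open>w\<close>; through this freedom digits are prescribed later.\<close>

lemma T0_independent:
  assumes F: "finite F" "F \<subseteq> T0" and t': "\<And>t. t \<in> F \<Longrightarrow> cg A w 1 (t' t) t"
  shows "\<exists>t r. t ` {..<(r::nat)} = F \<and> (\<forall>i<r. \<forall>e\<in>generate_ring A ((\<lambda>d. d [^] p) ` carrier A \<union> (\<lambda>i. t' (t i)) ` {..<i}).
    \<not> cg A w 1 (t' (t i)) e)"
proof -
  let ?P = "(\<lambda>d. d [^] p) ` carrier A"
  obtain t and r :: nat where t: "t ` {..<r} = F" "\<And>i j. i < r \<Longrightarrow> j < i \<Longrightarrow> (t j, t i) \<in> wo"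
    using sorted_enumeration[OF F(1)] by blast
  have tF: "t i \<in> F" if "i < r" for i using t(1) that by blast
  have "\<not> cg A w 1 (t' (t i)) e" if i: "i < r" and e: "e \<in> generate_ring A (?P \<union> (\<lambda>i. t' (t i)) ` {..<i})" for i e
  proof
    assume a: "cg A w 1 (t' (t i)) e"
    have "\<exists>y\<in>generate_ring A (?P \<union> {s \<in> carrier A. (s, t i) \<in> wo}). cg A w 1 e y"
    proof (rule A.generate_ring_cg[OF A.w_closed _ _ _ e])
      fix x assume "x \<in> ?P \<union> (\<lambda>i. t' (t i)) ` {..<i}"
      then show "\<exists>y\<in>generate_ring A (?P \<union> {s \<in> carrier A. (s, t i) \<in> wo}). cg A w 1 x y"
      proof
        assume "x \<in> ?P"
        then show ?thesis by (intro bexI[of _ x] A.cg_refl generate_ring.incl) auto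
      next
        assume "x \<in> (\<lambda>i. t' (t i)) ` {..<i}"
        then obtain j where j: "j < i" "x = t' (t j)" by blast
        then have "t j \<in> carrier A" "(t j, t i) \<in> wo" "cg A w 1 x (t j)"
          using t(2)[OF i] tF[of j] i T0_carrier F(2) t' by auto
        then show ?thesis by (intro bexI[of _ "t j"] generate_ring.incl) auto
      qed
    next
      have "t' (t j) \<in> carrier A" if "j < i" for j using cg_carrier(1)[OF t'[OF tF]] that i by simp
      then show "?P \<union> (\<lambda>i. t' (t i)) ` {..<i} \<subseteq> carrier A" by auto
    qed auto
    then obtain y where y: "y \<in> generate_ring A (?P \<union> {s \<in> carrier A. (s, t i) \<in> wo})" "cg A w 1 e y" by blast
    have "cg A w 1 (t i) y" using A.cgt[OF A.cgt[OF A.cgs[OF t'[OF tF[OF i]]] a] y(2)] .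
    then show False using tF[OF i] F(2) y(1) by (auto simp: T0_def)
  qed
  then show ?thesis using t(1) by blast
qed

end

section \<open>The residue ring of the initial object\<close>

locale initial = base A w p for A :: "'a ring" and w p +
  fixes U :: "'b ring" (structure) and u :: "'a \<Rightarrow> 'b" and K :: "'k ring" and i :: "'a \<Rightarrow> 'k"
  assumes init: "CRP_initial p A U u" and K: "fraction_field A K i"
    and U_nontriv: "\<not> cg U (u w) 1 \<one> \<zero>"
begin

lemma u_hom: "u \<in> ring_hom A U" using init by (simp add: CRP_initial_def CRP_iff)

lemma U_pcr: "pcr U (u w) p" using init by (simp add: CRP_initial_def CRP_iff)

end

sublocale initial \<subseteq> U: pcr U "u w" p by (rule U_pcr)

context initial
begin

text \<open>\<open>Wp\<close> turns out to be all of \<open>U\<close>: the \<open>w\<close>-adic closure \<open>U'\<close> of \<open>S\<close> is again an object, and the initial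
  object has no proper subobject.\<close>

definition E :: "'b set" where
  "E = generate_ring U (u ` carrier A \<union> (\<lambda>(t, j). U.dig (u t) j) ` (T0 \<times> {1..}))"

text \<open>Modulo \<open>w\<close>, the elements purely inseparable over the residues of
  \<open>E\<close>. The digits in \<open>E\<close> start at index 1 because the digit of index 0 has
  the residue of \<open>u t\<close>, which \<open>E\<close> contains anyway.\<close>

definition Wp :: "'b set" where
  "Wp = {x \<in> carrier U. \<exists>n. \<exists>e\<in>E. cg U (u w) 1 (x [^] (p ^ n)) e}"

definition S :: "'b set" where "S = generate_ring U (U.tau ` Wp \<union> {u w})"

definition U' :: "'b set" where "U' = {x \<in> carrier U. \<forall>N. \<exists>s\<in>S. cg U (u w) N x s}"

lemma u_closed: "a \<in> carrier A \<Longrightarrow> u a \<in> carrier U" by (rule ring_hom_closed[OF u_hom])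

lemma E_subring: "subring E U"
  unfolding E_def by (rule U.generate_ring_is_subring) (auto simp: u_closed T0_carrier)

lemma E_carrier: "e \<in> E \<Longrightarrow> e \<in> carrier U" using subringE(1)[OF E_subring] by blast

lemma u_E: "a \<in> carrier A \<Longrightarrow> u a \<in> E" unfolding E_def by (intro generate_ring.incl) auto

lemma Wp_carrier: "x \<in> Wp \<Longrightarrow> x \<in> carrier U" by (simp add: Wp_def)

lemma Wp_power:
  assumes "x \<in> Wp" shows "\<exists>n0. \<forall>n\<ge>n0. \<exists>e\<in>E. cg U (u w) 1 (x [^] (p ^ n)) e"
proof -
  obtain n0 e where e: "e \<in> E" "cg U (u w) 1 (x [^] (p ^ n0)) e" using assms by (auto simp: Wp_def)
  have "\<exists>e\<in>E. cg U (u w) 1 (x [^] (p ^ n)) e" if "n \<ge> n0" for n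
  proof -
    have "cg U (u w) 1 ((x [^] (p ^ n0)) [^] (p ^ (n - n0))) (e [^] (p ^ (n - n0)))"
      by (rule U.cg_pow[OF e(2) U.w_closed])
    then have "cg U (u w) 1 (x [^] (p ^ n)) (e [^] (p ^ (n - n0)))"
      using U.prime_pow_pow(1)[OF Wp_carrier[OF assms], of p n0 "n - n0"] that by simp
    then show ?thesis using U.subring_pow_closed[OF E_subring e(1)] by blast
  qed
  then show ?thesis by blast
qed

lemma E_Wp: "e \<in> E \<Longrightarrow> e \<in> Wp"
proof -
  assume e: "e \<in> E"
  then have "cg U (u w) 1 (e [^] (p ^ 0)) e" using U.cg_refl[OF E_carrier[OF e] U.w_closed] E_carrier[OF e] by simp
  then show ?thesis unfolding Wp_def using e E_carrier[OF e] by blast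
qed

lemma Wp_cong: assumes "cg U (u w) 1 x y" "y \<in> Wp" shows "x \<in> Wp"
proof -
  obtain n e where e: "e \<in> E" "cg U (u w) 1 (y [^] (p ^ n)) e" using assms by (auto simp: Wp_def)
  then have "cg U (u w) 1 (x [^] (p ^ n)) e" using U.cgt[OF U.cg_pow[OF assms(1) U.w_closed]] by blast
  then show ?thesis unfolding Wp_def using e cg_carrier(1)[OF assms(1)] by blast
qed

lemma Wp_root: assumes "y \<in> carrier U" "y [^] (p ^ M) \<in> Wp" shows "y \<in> Wp"
proof -
  obtain n e where e: "e \<in> E" "cg U (u w) 1 ((y [^] (p ^ M)) [^] (p ^ n)) e" using assms by (auto simp: Wp_def)
  then have "cg U (u w) 1 (y [^] (p ^ (M + n))) e" using U.prime_pow_pow(1)[OF assms(1), of p M n] by simp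
  then show ?thesis unfolding Wp_def using e assms by blast
qed

lemma Wp_ops:
  assumes x: "x \<in> Wp" and y: "y \<in> Wp"
  shows "x \<oplus> y \<in> Wp" "x \<otimes> y \<in> Wp" "\<ominus> x \<in> Wp"
proof -
  note c = Wp_carrier[OF x] Wp_carrier[OF y]
  obtain n where n: "\<forall>m\<ge>n. \<exists>e\<in>E. cg U (u w) 1 (x [^] (p ^ m)) e" using Wp_power[OF x] by blast
  obtain k where k: "\<forall>m\<ge>k. \<exists>e\<in>E. cg U (u w) 1 (y [^] (p ^ m)) e" using Wp_power[OF y] by blast
  obtain e where e: "e \<in> E" "cg U (u w) 1 (x [^] (p ^ (n + k))) e" using n by (meson le_add1)
  obtain f where f: "f \<in> E" "cg U (u w) 1 (y [^] (p ^ (n + k))) f" using k by (meson le_add2)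
  have "cg U (u w) 1 ((x \<oplus> y) [^] (p ^ (n + k))) (e \<oplus> f)"
    by (rule U.cgt[OF U.frob_add_n[OF c] U.cg_add[OF e(2) f(2) U.w_closed]])
  then show "x \<oplus> y \<in> Wp" unfolding Wp_def using c subringE(7)[OF E_subring e(1) f(1)] by blast
  have "cg U (u w) 1 ((x \<otimes> y) [^] (p ^ (n + k))) (e \<otimes> f)"
    using U.cg_mult[OF e(2) f(2) U.w_closed] c by (simp add: U.nat_pow_distrib)
  then show "x \<otimes> y \<in> Wp" unfolding Wp_def using c subringE(6)[OF E_subring e(1) f(1)] by blast
  have "cg U (u w) 1 ((\<ominus> x) [^] (p ^ (n + k))) (\<ominus> e)"
    by (rule U.cgt[OF U.frob_neg_n[OF c(1)] U.cg_neg[OF e(2) U.w_closed]])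
  then show "\<ominus> x \<in> Wp" unfolding Wp_def using c subringE(5)[OF E_subring e(1)] by blast
qed

lemma S_subring: "subring S U"
  unfolding S_def by (rule U.generate_ring_is_subring) (auto simp: Wp_carrier)

lemma S_carrier: "s \<in> S \<Longrightarrow> s \<in> carrier U" using subringE(1)[OF S_subring] by blast

lemma tau_S: "x \<in> Wp \<Longrightarrow> U.tau x \<in> S" unfolding S_def by (intro generate_ring.incl) auto

lemma w_S: "u w \<in> S" unfolding S_def by (intro generate_ring.incl) auto

lemma S_Wp: "s \<in> S \<Longrightarrow> s \<in> Wp"
  unfolding S_def
proof (induction rule: generate_ring.induct)
  case one
  show ?case by (rule E_Wp[OF subringE(3)[OF E_subring]])
next
  case (incl x)
  then show ?case using Wp_cong[OF U.tau(2)[OF Wp_carrier]] E_Wp[OF u_E[OF A.w_closed]] by auto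
qed (auto intro: Wp_ops)

lemma S_cring: "cring (U\<lparr>carrier := S\<rparr>)"
  by (rule U.subcring_iff[THEN iffD1, OF subringE(1)[OF S_subring] U.subcringI'[OF S_subring]])

text \<open>The Frobenius on \<open>S\<close> is considered modulo \<open>p\<close> and not modulo
  \<open>u w\<close>: to write \<open>p\<close> as a multiple of \<open>u w\<close> inside
  \<open>S\<close>, the cofactor would have to lie in \<open>S\<close>, but \<open>S\<close> only
  approximates the image of \<open>A\<close>.\<close>

lemma S_unif: "unif (U\<lparr>carrier := S\<rparr>) ([p] \<cdot> \<one>) p"
proof -
  interpret S: cring "U\<lparr>carrier := S\<rparr>" by (rule S_cring)
  have e: "[n] \<cdot>\<^bsub>U\<lparr>carrier := S\<rparr>\<^esub> \<one>\<^bsub>U\<lparr>carrier := S\<rparr>\<^esub> = [n] \<cdot> \<one>" for n :: nat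
    by (induction n) (simp_all add: add_pow_def)
  have c: "[p] \<cdot> \<one> \<in> carrier (U\<lparr>carrier := S\<rparr>)"
    using S.add.nat_pow_closed[OF S.one_closed, of p] unfolding e .
  show ?thesis
  proof
    show "cg (U\<lparr>carrier := S\<rparr>) ([p] \<cdot> \<one>) 1 ([p] \<cdot>\<^bsub>U\<lparr>carrier := S\<rparr>\<^esub> \<one>\<^bsub>U\<lparr>carrier := S\<rparr>\<^esub>) \<zero>\<^bsub>U\<lparr>carrier := S\<rparr>\<^esub>"
      unfolding e using S.cg_multiple[OF S.one_closed c, of 1] S.nat_pow_eone[OF c] S.r_one[OF c] by simp
  qed (use c A.p_prime in auto)
qed

text \<open>The generators other than \<open>u w\<close> are Teichmueller elements with p^M-th roots
  in \<open>S\<close>; sums are handled by additivity of the Frobenius modulo \<open>p\<close>. The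
  errors divisible by \<open>u w\<close> and by \<open>p\<close> are kept apart, as no relation
  between the two is available inside \<open>S\<close>.\<close>

lemma S_decomposition:
  assumes "s \<in> S"
  shows "\<exists>b\<in>S. \<exists>s1\<in>S. \<exists>s2\<in>S. s = b [^] (p ^ M) \<oplus> (u w \<otimes> s1 \<oplus> [p] \<cdot> \<one> \<otimes> s2)"
proof -
  interpret S: unif "U\<lparr>carrier := S\<rparr>" "[p] \<cdot> \<one>" p by (rule S_unif)
  define P v where "P = [p] \<cdot> \<one>" and "v = u w"
  have PS: "P \<in> S" using S.w_closed by (simp add: P_def)
  have Pc: "P \<in> carrier U" "v \<in> carrier U" using PS S_carrier by (auto simp: v_def)
  have pw: "x [^]\<^bsub>U\<lparr>carrier := S\<rparr>\<^esub> (k::nat) = x [^] k" for x k by (simp add: nat_pow_def)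
  have P1: "P [^] (1::nat) = P" using Pc by simp
  note Sops = subringE(5-7)[OF S_subring] subringE(2,3)[OF S_subring]
  have add: "\<exists>z\<in>S. x [^] (p ^ M) \<oplus> y [^] (p ^ M) = (x \<oplus> y) [^] (p ^ M) \<oplus> P \<otimes> z"
    if "x \<in> S" "y \<in> S" for x y
  proof -
    have "cg (U\<lparr>carrier := S\<rparr>) P 1 (x [^] (p ^ M) \<oplus> y [^] (p ^ M)) ((x \<oplus> y) [^] (p ^ M))"
      using S.cgs[OF S.frob_add_n[of x y M]] that by (simp add: pw P_def)
    then show ?thesis unfolding cg_def pw P1 by auto
  qed
  have neg: "\<exists>z\<in>S. \<ominus> (x [^] (p ^ M)) = (\<ominus> x) [^] (p ^ M) \<oplus> P \<otimes> z" if x: "x \<in> S" for x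
  proof -
    have z0: "\<zero> [^] (p ^ M) = \<zero>" using A.p_gt_1 by (simp add: U.nat_pow_zero)
    define a b where "a = x [^] (p ^ M)" and "b = (\<ominus> x) [^] (p ^ M)"
    have ab: "a \<in> carrier U" "b \<in> carrier U" using S_carrier[OF x] by (auto simp: a_def b_def)
    obtain z where z: "z \<in> S" "a \<oplus> b = \<zero> \<oplus> P \<otimes> z"
      using add[OF x Sops(1)[OF x]] S_carrier[OF x] z0 unfolding a_def b_def by (auto simp: U.r_neg)
    have zc: "z \<in> carrier U" using z S_carrier by blast
    have "\<ominus> a = b \<oplus> \<ominus> (a \<oplus> b)" by (use ab in \<open>simp add: U.ring_nf\<close>)
    also have "\<dots> = b \<oplus> P \<otimes> \<ominus> z" unfolding z(2) using Pc zc by (simp add: U.r_minus)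
    finally show ?thesis using Sops(1)[OF z(1)] unfolding a_def b_def by blast
  qed
  let ?D = "\<lambda>s. \<exists>b\<in>S. \<exists>s1\<in>S. \<exists>s2\<in>S. s = b [^] (p ^ M) \<oplus> (v \<otimes> s1 \<oplus> P \<otimes> s2)"
  have "s \<in> generate_ring U (U.tau ` Wp \<union> {u w})" using assms by (simp add: S_def)
  then have "?D s"
  proof (induction rule: generate_ring.induct)
    case one
    have "\<one> = \<one> [^] (p ^ M) \<oplus> (v \<otimes> \<zero> \<oplus> P \<otimes> \<zero>)" using Pc by simp
    then show ?case using Sops(4,5) by blast
  next
    case (incl x)
    then consider y where "y \<in> Wp" "x = U.tau y" | "x = v" by (auto simp: v_def)
    then show ?case
    proof cases
      case 1
      obtain z where z: "z \<in> carrier U" "cg U (u w) 1 y (z [^] (p ^ M))" using U.surj_n[OF Wp_carrier[OF 1(1)]] by blast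
      have zW: "z \<in> Wp" by (rule Wp_root[OF z(1) Wp_cong[OF U.cgs[OF z(2)] 1(1)]])
      have "x = U.tau z [^] (p ^ M)" using U.tau_cong[OF z(2)] U.tau_pow[OF z(1)] 1(2) by simp
      then have "x = U.tau z [^] (p ^ M) \<oplus> (v \<otimes> \<zero> \<oplus> P \<otimes> \<zero>)" using z(1) Pc by simp
      then show ?thesis using tau_S[OF zW] Sops(4) by blast
    next
      case 2
      have "x = \<zero> [^] (p ^ M) \<oplus> (v \<otimes> \<one> \<oplus> P \<otimes> \<zero>)"
        using 2 Pc A.p_gt_1 by (simp add: U.nat_pow_zero)
      then show ?thesis using Sops(4,5) by blast
    qed
  next
    case (a_inv s)
    then obtain b s1 s2 where s: "b \<in> S" "s1 \<in> S" "s2 \<in> S" "s = b [^] (p ^ M) \<oplus> (v \<otimes> s1 \<oplus> P \<otimes> s2)" by blast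
    obtain z where z: "z \<in> S" "\<ominus> (b [^] (p ^ M)) = (\<ominus> b) [^] (p ^ M) \<oplus> P \<otimes> z" using neg[OF s(1)] by blast
    define B B' where "B = b [^] (p ^ M)" and "B' = (\<ominus> b) [^] (p ^ M)"
    have c: "B \<in> carrier U" "B' \<in> carrier U" "s1 \<in> carrier U" "s2 \<in> carrier U" "z \<in> carrier U"
      using s z S_carrier by (auto simp: B_def B'_def)
    have "\<ominus> s = \<ominus> B \<oplus> (v \<otimes> \<ominus> s1 \<oplus> P \<otimes> \<ominus> s2)"
      unfolding s(4) B_def[symmetric] by (use c Pc in \<open>simp add: U.ring_nf\<close>)
    also have "\<ominus> B = B' \<oplus> P \<otimes> z" using z(2) by (simp add: B_def B'_def)
    also have "B' \<oplus> P \<otimes> z \<oplus> (v \<otimes> \<ominus> s1 \<oplus> P \<otimes> \<ominus> s2) =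
      B' \<oplus> (v \<otimes> \<ominus> s1 \<oplus> P \<otimes> (z \<oplus> \<ominus> s2))"
      by (use c Pc in \<open>simp add: U.ring_nf\<close>)
    finally have "\<ominus> s = (\<ominus> b) [^] (p ^ M) \<oplus> (v \<otimes> \<ominus> s1 \<oplus> P \<otimes> (z \<oplus> \<ominus> s2))"
      unfolding B'_def .
    then show ?case using Sops(1)[OF s(1)] Sops(1)[OF s(2)] Sops(3)[OF z(1) Sops(1)[OF s(3)]] by blast
  next
    case (eng_add s t)
    then obtain b s1 s2 where s: "b \<in> S" "s1 \<in> S" "s2 \<in> S" "s = b [^] (p ^ M) \<oplus> (v \<otimes> s1 \<oplus> P \<otimes> s2)" by blast
    obtain c t1 t2 where t: "c \<in> S" "t1 \<in> S" "t2 \<in> S" "t = c [^] (p ^ M) \<oplus> (v \<otimes> t1 \<oplus> P \<otimes> t2)" using eng_add by blast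
    obtain z where z: "z \<in> S" "b [^] (p ^ M) \<oplus> c [^] (p ^ M) = (b \<oplus> c) [^] (p ^ M) \<oplus> P \<otimes> z" using add[OF s(1) t(1)] by blast
    define B C B' where "B = b [^] (p ^ M)" and "C = c [^] (p ^ M)" and "B' = (b \<oplus> c) [^] (p ^ M)"
    have c: "B \<in> carrier U" "C \<in> carrier U" "B' \<in> carrier U" "s1 \<in> carrier U" "s2 \<in> carrier U" "t1 \<in> carrier U" "t2 \<in> carrier U" "z \<in> carrier U"
      using s t z S_carrier by (auto simp: B_def B'_def C_def)
    have "s \<oplus> t = (B \<oplus> C) \<oplus> (v \<otimes> (s1 \<oplus> t1) \<oplus> P \<otimes> (s2 \<oplus> t2))"
      unfolding s(4) t(4) B_def[symmetric] C_def[symmetric] by (use c Pc in \<open>simp add: U.ring_nf\<close>)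
    also have "B \<oplus> C = B' \<oplus> P \<otimes> z" using z(2) by (simp add: B_def B'_def C_def)
    also have "B' \<oplus> P \<otimes> z \<oplus> (v \<otimes> (s1 \<oplus> t1) \<oplus> P \<otimes> (s2 \<oplus> t2)) =
      B' \<oplus> (v \<otimes> (s1 \<oplus> t1) \<oplus> P \<otimes> (z \<oplus> (s2 \<oplus> t2)))"
      by (use c Pc in \<open>simp add: U.ring_nf\<close>)
    finally have "s \<oplus> t = (b \<oplus> c) [^] (p ^ M) \<oplus> (v \<otimes> (s1 \<oplus> t1) \<oplus> P \<otimes> (z \<oplus> (s2 \<oplus> t2)))"
      unfolding B'_def .
    then show ?case using Sops(3)[OF s(1) t(1)] Sops(3)[OF s(2) t(2)] Sops(3)[OF z(1) Sops(3)[OF s(3) t(3)]] by blast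
  next
    case (eng_mult s t)
    then obtain b s1 s2 where s: "b \<in> S" "s1 \<in> S" "s2 \<in> S" "s = b [^] (p ^ M) \<oplus> (v \<otimes> s1 \<oplus> P \<otimes> s2)" by blast
    obtain c t1 t2 where t: "c \<in> S" "t1 \<in> S" "t2 \<in> S" "t = c [^] (p ^ M) \<oplus> (v \<otimes> t1 \<oplus> P \<otimes> t2)" using eng_mult by blast
    define B C where "B = b [^] (p ^ M)" and "C = c [^] (p ^ M)"
    have BS: "B \<in> S" "C \<in> S" using U.subring_pow_closed[OF S_subring] s t by (auto simp: B_def C_def)
    have cc: "B \<in> carrier U" "C \<in> carrier U" "s1 \<in> carrier U" "s2 \<in> carrier U" "t1 \<in> carrier U" "t2 \<in> carrier U"
      using s t BS S_carrier by auto
    \<comment> \<open>All cross terms containing a factor \<open>v\<close> go to \<open>q1\<close>,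
      including those that also contain \<open>P\<close>; \<open>q2\<close> collects the
      others.\<close>
    define q1 where "q1 = s1 \<otimes> C \<oplus> B \<otimes> t1 \<oplus> v \<otimes> s1 \<otimes> t1 \<oplus> s1 \<otimes> P \<otimes> t2 \<oplus> P \<otimes> s2 \<otimes> t1"
    define q2 where "q2 = s2 \<otimes> C \<oplus> B \<otimes> t2 \<oplus> P \<otimes> s2 \<otimes> t2"
    have q: "q1 \<in> S" "q2 \<in> S" unfolding q1_def q2_def v_def using s t BS PS w_S by (auto intro!: Sops(2,3))
    have "s \<otimes> t = B \<otimes> C \<oplus> (v \<otimes> q1 \<oplus> P \<otimes> q2)"
      unfolding s(4) t(4) B_def[symmetric] C_def[symmetric] q1_def q2_def by (use cc Pc in \<open>simp add: U.ring_nf\<close>)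
    then have "s \<otimes> t = (b \<otimes> c) [^] (p ^ M) \<oplus> (v \<otimes> q1 \<oplus> P \<otimes> q2)"
      using S_carrier[OF s(1)] S_carrier[OF t(1)] by (simp add: B_def C_def U.nat_pow_distrib)
    then show ?case using Sops(2)[OF s(1) t(1)] q by blast
  qed
  then show ?thesis unfolding P_def v_def .
qed

text \<open>The digit of index 0 has the residue of \<open>u t\<close>, the others are generators of
  \<open>E\<close>; being Teichmueller elements, all of them equal their own representative under
  \<open>U.tau\<close>.\<close>

lemma dig_S: assumes t: "t \<in> T0" shows "U.dig (u t) j \<in> S"
proof -
  have ut: "u t \<in> carrier U" using t T0_carrier u_closed by blast
  have "U.dig (u t) j \<in> Wp"
  proof (cases j)
    case 0
    have "cg U (u w) 1 (u t) (U.dig (u t) 0)" using U.cg_expansion[OF ut, of 1] ut by simp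
    then have "cg U (u w) 1 (U.dig (u t) 0) (u t)" by (rule U.cgs)
    then show ?thesis unfolding 0 by (rule Wp_cong) (rule E_Wp[OF u_E[OF T0_carrier[OF t]]])
  next
    case (Suc k)
    then have "U.dig (u t) j \<in> E" using t unfolding E_def by (intro generate_ring.incl) auto
    then show ?thesis by (rule E_Wp)
  qed
  moreover have "U.tau (U.dig (u t) j) = U.dig (u t) j"
    by (rule U.tau_eqI[OF U.dig_tm[OF ut] U.cg_refl]) (use ut in auto)
  ultimately show ?thesis using tau_S by metis
qed

text \<open>Induction on the precision. Modulo \<open>w\<close>, \<open>a\<close> is an expression
  in p-th powers and elements of \<open>T0\<close>: p-th powers gain one place by
  \<open>frob_lift\<close>, elements of \<open>T0\<close> have all digits in \<open>S\<close>, and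
  the remaining multiple of \<open>w\<close> is covered by the induction hypothesis.\<close>

lemma A_approx: "a \<in> carrier A \<Longrightarrow> \<exists>s\<in>S. cg U (u w) N (u a) s"
proof (induction N arbitrary: a)
  case 0
  then show ?case using U.cg_0[OF u_closed U.one_closed U.w_closed] subringE(3)[OF S_subring] by blast
next
  case (Suc N)
  show ?case
  \<comment> \<open>\<open>frob_lift\<close> gains a place only from precision 1 on; the first place
    is supplied by the Teichmueller representative.\<close>
  proof (cases "N = 0")
    case True
    have "cg U (u w) 1 (u a) (U.tau (u a))" by (rule U.cgs[OF U.tau(2)[OF u_closed[OF Suc.prems]]])
    then show ?thesis using tau_S[OF E_Wp[OF u_E[OF Suc.prems]]] True by auto
  next
    case False
    let ?X = "(\<lambda>d. d [^]\<^bsub>A\<^esub> p) ` carrier A \<union> T0"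
    have X: "?X \<subseteq> carrier A" using T0_carrier by auto
    have wc: "w \<in> carrier A" by simp
    interpret u: ring_hom_cring A U u using u_hom A.is_cring U.is_cring by (intro ring_hom_cringI) auto
    obtain e where e: "e \<in> generate_ring A ?X" "cg A w 1 a e" using T0_generate[OF Suc.prems] by blast
    obtain c where c: "c \<in> carrier A" "a = e \<oplus>\<^bsub>A\<^esub> w \<otimes>\<^bsub>A\<^esub> c" using e(2) by (auto simp: cg_def)
    have "\<exists>s\<in>S. cg U (u w) (Suc N) (u e) s"
      using e(1)
    proof (induction rule: generate_ring.induct)
      case one
      then show ?case using U.cg_refl[OF U.one_closed U.w_closed] subringE(3)[OF S_subring] by auto
    next
      case (incl x)
      then show ?case
      proof
        assume "x \<in> (\<lambda>d. d [^]\<^bsub>A\<^esub> p) ` carrier A"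
        then obtain b where b: "b \<in> carrier A" "x = b [^]\<^bsub>A\<^esub> p" by blast
        obtain s where s: "s \<in> S" "cg U (u w) N (u b) s" using Suc.IH[OF b(1)] by blast
        have "cg U (u w) (Suc N) (u b [^] p) (s [^] p)" by (rule U.frob_lift[OF s(2)]) (use False in auto)
        then have "cg U (u w) (Suc N) (u x) (s [^] p)" using b ring_hom_pow[OF u_hom A.is_cring U.is_cring b(1), of p] by simp
        then show ?thesis using U.subring_pow_closed[OF S_subring s(1)] by blast
      next
        assume x: "x \<in> T0"
        have "psum U (u w) (U.dig (u x)) (Suc N) \<in> S" by (rule U.subring_psum[OF S_subring w_S dig_S[OF x]])
        then show ?thesis using U.cg_expansion[OF u_closed[OF T0_carrier[OF x]], of "Suc N"] by blast
      qed
    next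
      case (a_inv h)
      then obtain s where s: "s \<in> S" "cg U (u w) (Suc N) (u h) s" by blast
      have hc: "h \<in> carrier A" using A.generate_ring_in_carrier[OF X a_inv.hyps] .
      have "cg U (u w) (Suc N) (u (\<ominus>\<^bsub>A\<^esub> h)) (\<ominus> s)" using U.cg_neg[OF s(2) U.w_closed] hc by simp
      then show ?case using subringE(5)[OF S_subring s(1)] by blast
    next
      case (eng_add h k)
      then obtain s t where s: "s \<in> S" "cg U (u w) (Suc N) (u h) s" "t \<in> S" "cg U (u w) (Suc N) (u k) t" by blast
      have hc: "h \<in> carrier A" "k \<in> carrier A" using A.generate_ring_in_carrier[OF X] eng_add.hyps by auto
      have "cg U (u w) (Suc N) (u (h \<oplus>\<^bsub>A\<^esub> k)) (s \<oplus> t)" using U.cg_add[OF s(2,4) U.w_closed] hc by simp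
      then show ?case using subringE(7)[OF S_subring s(1,3)] by blast
    next
      case (eng_mult h k)
      then obtain s t where s: "s \<in> S" "cg U (u w) (Suc N) (u h) s" "t \<in> S" "cg U (u w) (Suc N) (u k) t" by blast
      have hc: "h \<in> carrier A" "k \<in> carrier A" using A.generate_ring_in_carrier[OF X] eng_mult.hyps by auto
      have "cg U (u w) (Suc N) (u (h \<otimes>\<^bsub>A\<^esub> k)) (s \<otimes> t)" using U.cg_mult[OF s(2,4) U.w_closed] hc by simp
      then show ?case using subringE(6)[OF S_subring s(1,3)] by blast
    qed
    then obtain s where s: "s \<in> S" "cg U (u w) (Suc N) (u e) s" by blast
    obtain t where t: "t \<in> S" "cg U (u w) N (u c) t" using Suc.IH[OF c(1)] by blast
    have ec: "e \<in> carrier A" using A.generate_ring_in_carrier[OF X e(1)] .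
    have "cg U (u w) (Suc N) (u w \<otimes> u c) (u w \<otimes> t)"
      using U.cg_mult_pow[OF t(2) U.w_closed, of 1] by simp
    then have "cg U (u w) (Suc N) (u e \<oplus> u w \<otimes> u c) (s \<oplus> u w \<otimes> t)" by (rule U.cg_add[OF s(2) _ U.w_closed])
    moreover have "u a = u e \<oplus> u w \<otimes> u c" using c ec wc by simp
    moreover have "s \<oplus> u w \<otimes> t \<in> S" using s t w_S subringE(6,7)[OF S_subring] by blast
    ultimately show ?thesis by auto
  qed
qed

text \<open>Decompose w x with a p^N-th power. The other terms are divisible by \<open>w\<close>, so
  \<open>w\<close> divides b by reducedness, and then b^(p^N) is divisible by w^(N+1): it disappears
  modulo w^N after division by \<open>w\<close>. The cofactor \<open>u c\<close> of \<open>p\<close>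
  is replaced by an approximation in \<open>S\<close>.\<close>

lemma S_divide:
  assumes s: "u w \<otimes> x \<in> S" and x: "x \<in> carrier U" shows "\<exists>s'\<in>S. cg U (u w) N x s'"
proof -
  obtain b s1 s2 where d: "b \<in> S" "s1 \<in> S" "s2 \<in> S"
    "u w \<otimes> x = b [^] (p ^ N) \<oplus> (u w \<otimes> s1 \<oplus> [p] \<cdot> \<one> \<otimes> s2)"
    using S_decomposition[OF s, of N] by blast
  obtain c where c: "c \<in> carrier A" "[p] \<cdot>\<^bsub>A\<^esub> \<one>\<^bsub>A\<^esub> = w \<otimes>\<^bsub>A\<^esub> c" using A.cg_zeroE[OF A.p_w A.w_closed] by auto
  have P: "[p] \<cdot> \<one> = u w \<otimes> u c"
    using hom_add_pow[OF u_hom A.ring_axioms U.ring_axioms A.one_closed, of p] c ring_hom_mult[OF u_hom A.w_closed c(1)] ring_hom_one[OF u_hom] by simp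
  obtain s3 where s3: "s3 \<in> S" "cg U (u w) N (u c) s3" using A_approx[OF c(1)] by blast
  define v B q where "v = u w" and "B = b [^] (p ^ N)" and "q = s1 \<oplus> u c \<otimes> s2"
  have cc: "v \<in> carrier U" "B \<in> carrier U" "s1 \<in> carrier U" "s2 \<in> carrier U" "u c \<in> carrier U" "q \<in> carrier U" "b \<in> carrier U"
    using d S_carrier u_closed c by (auto simp: v_def B_def q_def)
  define d' where "d' = u c"
  have dc: "d' \<in> carrier U" using cc by (simp add: d'_def)
  have e: "v \<otimes> x = B \<oplus> v \<otimes> q"
  proof -
    have "v \<otimes> s1 \<oplus> v \<otimes> d' \<otimes> s2 = v \<otimes> (s1 \<oplus> d' \<otimes> s2)"
      by (use cc dc in \<open>simp add: U.ring_nf\<close>)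
    then show ?thesis using d(4) P by (simp add: v_def B_def q_def d'_def)
  qed
  have "B = v \<otimes> (x \<ominus> q)"
  proof -
    have "B = (B \<oplus> v \<otimes> q) \<ominus> v \<otimes> q \<oplus> \<zero>"
      using cc by (simp add: a_minus_def U.a_assoc U.r_neg)
    also have "\<dots> = v \<otimes> (x \<ominus> q)" unfolding e[symmetric]
      by (use cc x in \<open>simp add: U.ring_nf\<close>)
    finally show ?thesis .
  qed
  note B = this
  have "cg U (u w) 1 B \<zero>" unfolding B v_def using U.cg_multiple[of "x \<ominus> q" "u w" 1] x cc by simp
  then have "cg U (u w) 1 b \<zero>" unfolding B_def by (rule U.red_n[OF cc(7)])
  then have "cg U (u w) (1 + N) B (\<zero> [^] (p ^ N))" unfolding B_def by (rule U.frob_lift_n) simp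
  then have "cg U (u w) (Suc N) (u w \<otimes> (x \<ominus> q)) (u w \<otimes> \<zero>)"
    using A.p_gt_1 by (simp add: U.nat_pow_zero B v_def)
  then have "cg U (u w) N (x \<ominus> q) \<zero>" by (rule U.cg_cancel1) (use x cc in auto)
  then have "cg U (u w) N x q" using x cc by (simp add: U.cg_diff_iff)
  also have "cg U (u w) N q (s1 \<oplus> s3 \<otimes> s2)"
    unfolding q_def by (intro U.cg_add U.cg_mult U.cg_refl s3(2)) (use cc in auto)
  finally show ?thesis using d(2,3) s3(1) subringE(6,7)[OF S_subring] by blast
qed

lemma U'_carrier: "x \<in> U' \<Longrightarrow> x \<in> carrier U" by (simp add: U'_def)

lemma U'_subring: "subring U' U"
proof (rule U.subringI)
  show "U' \<subseteq> carrier U" using U'_carrier by blast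
  show "\<one> \<in> U'" unfolding U'_def using U.cg_refl[OF U.one_closed U.w_closed] subringE(3)[OF S_subring] by blast
  show "\<ominus> h \<in> U'" if h: "h \<in> U'" for h
  proof -
    have "\<exists>s\<in>S. cg U (u w) N (\<ominus> h) s" for N
    proof -
      obtain s where "s \<in> S" "cg U (u w) N h s" using h by (auto simp: U'_def)
      then show ?thesis using subringE(5)[OF S_subring] U.cg_neg[OF _ U.w_closed] by blast
    qed
    then show ?thesis using U'_carrier[OF h] by (simp add: U'_def)
  qed
  show "h \<otimes> k \<in> U'" if h: "h \<in> U'" "k \<in> U'" for h k
  proof -
    have "\<exists>s\<in>S. cg U (u w) N (h \<otimes> k) s" for N
    proof -
      obtain s t where "s \<in> S" "cg U (u w) N h s" "t \<in> S" "cg U (u w) N k t" using h unfolding U'_def by blast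
      then show ?thesis using subringE(6)[OF S_subring] U.cg_mult[OF _ _ U.w_closed] by blast
    qed
    then show ?thesis using U'_carrier h by (simp add: U'_def)
  qed
  show "h \<oplus> k \<in> U'" if h: "h \<in> U'" "k \<in> U'" for h k
  proof -
    have "\<exists>s\<in>S. cg U (u w) N (h \<oplus> k) s" for N
    proof -
      obtain s t where "s \<in> S" "cg U (u w) N h s" "t \<in> S" "cg U (u w) N k t" using h unfolding U'_def by blast
      then show ?thesis using subringE(7)[OF S_subring] U.cg_add[OF _ _ U.w_closed] by blast
    qed
    then show ?thesis using U'_carrier h by (simp add: U'_def)
  qed
qed

lemma S_U': "s \<in> S \<Longrightarrow> s \<in> U'"
  unfolding U'_def using S_carrier U.cg_refl[OF S_carrier U.w_closed] by blast

lemma U'_approx: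
  assumes x: "x \<in> carrier U" and a: "\<And>N. \<exists>y\<in>U'. cg U (u w) N x y" shows "x \<in> U'"
proof -
  have "\<exists>s\<in>S. cg U (u w) N x s" for N
  proof -
    obtain y where y: "y \<in> U'" "cg U (u w) N x y" using a by blast
    obtain s where "s \<in> S" "cg U (u w) N y s" using y(1) by (auto simp: U'_def)
    then show ?thesis using U.cgt[OF y(2)] by blast
  qed
  then show ?thesis using x by (simp add: U'_def)
qed

text \<open>Passing to the closure turns the approximate quotients of \<open>S_divide\<close> into
  exact ones. Congruences in \<open>U'\<close> and in \<open>U\<close> then agree, which is what
  makes \<open>U'\<close> an object.\<close>

lemma U'_divide: assumes x: "x \<in> carrier U" and wx: "u w \<otimes> x \<in> U'" shows "x \<in> U'"
proof -
  have "\<exists>s\<in>S. cg U (u w) N x s" for N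
  proof -
    obtain s where s: "s \<in> S" "cg U (u w) (Suc N) (u w \<otimes> x) s" using wx unfolding U'_def by blast
    have "cg U (u w) 1 s (u w \<otimes> x)" by (rule U.cgs[OF U.cg_mono[OF s(2)]]) auto
    also have "cg U (u w) 1 (u w \<otimes> x) \<zero>" using U.cg_multiple[OF x U.w_closed, of 1] by simp
    finally obtain x' where x': "x' \<in> carrier U" "s = u w \<otimes> x'" using U.cg_zeroE[OF _ U.w_closed, of 1 s] by auto
    obtain s' where s': "s' \<in> S" "cg U (u w) N x' s'" using S_divide[of x' N] s(1) x' by blast
    have "cg U (u w) N x x'" using U.cg_cancel1[of N x x'] s(2) x x' by simp
    then show ?thesis using U.cgt s' by blast
  qed
  then show ?thesis using x by (simp add: U'_def)
qed

lemma U'_divide_pow: "x \<in> carrier U \<Longrightarrow> u w [^] (n::nat) \<otimes> x \<in> U' \<Longrightarrow> x \<in> U'"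
proof (induction n arbitrary: x)
  case (Suc n)
  have "u w [^] n \<otimes> (u w \<otimes> x) \<in> U'" using Suc.prems by (simp add: U.m_assoc)
  then have "u w \<otimes> x \<in> U'" using Suc.IH[of "u w \<otimes> x"] Suc.prems(1) by simp
  then show ?case using U'_divide Suc.prems(1) by blast
qed simp

lemma cg_U':
  assumes "x \<in> U'" "y \<in> U'"
  shows "cg (U\<lparr>carrier := U'\<rparr>) (u w) n x y \<longleftrightarrow> cg U (u w) n x y"
proof -
  have pw: "z [^]\<^bsub>U\<lparr>carrier := U'\<rparr>\<^esub> (k::nat) = z [^] k" for z k by (simp add: nat_pow_def)
  have "z \<in> U'" if z: "z \<in> carrier U" "x = y \<oplus> u w [^] n \<otimes> z" for z
  proof (rule U'_divide_pow[OF z(1)])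
    define q where "q = u w [^] n \<otimes> z"
    have qc: "q \<in> carrier U" "y \<in> carrier U" using z U'_carrier assms by (auto simp: q_def)
    have "(y \<oplus> q) \<oplus> \<ominus> y = q \<oplus> \<zero>" by (use qc in \<open>simp add: U.ring_nf\<close>)
    then have "q = x \<oplus> \<ominus> y" unfolding z(2) q_def[symmetric] using qc by simp
    then show "u w [^] n \<otimes> z \<in> U'" using assms subringE(5,7)[OF U'_subring] by (simp add: q_def)
  qed
  then show ?thesis using assms U'_carrier by (auto simp: cg_def pw)
qed

lemma U'_eq: "x \<in> carrier U \<Longrightarrow> x \<in> U'"
proof -
  let ?R = "U\<lparr>carrier := U'\<rparr>"
  interpret R: cring ?R by (rule U.subcring_iff[THEN iffD1, OF subringE(1)[OF U'_subring] U.subcringI'[OF U'_subring]])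
  have pw: "z [^]\<^bsub>?R\<^esub> (k::nat) = z [^] k" for z k by (simp add: nat_pow_def)
  have powc: "z [^] (k::nat) \<in> U'" if "z \<in> U'" for z k by (rule U.subring_pow_closed[OF U'_subring that])
  have uA: "u a \<in> U'" if "a \<in> carrier A" for a using A_approx[OF that] u_closed[OF that] by (simp add: U'_def)
  have uR: "u \<in> ring_hom A ?R"
    by (rule ring_hom_memI) (use uA ring_hom_mult[OF u_hom] ring_hom_add[OF u_hom] ring_hom_one[OF u_hom] in auto)
  have z: "\<zero> \<in> U'" by (rule subringE(2)[OF U'_subring])
  have "pcr ?R (u w) p"
  proof
    show "u w \<in> carrier ?R" using uA by simp
    show "Factorial_Ring.prime p" by (rule A.p_prime)
    have "u ([p] \<cdot>\<^bsub>A\<^esub> \<one>\<^bsub>A\<^esub>) = [p] \<cdot>\<^bsub>?R\<^esub> \<one>\<^bsub>?R\<^esub>"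
      using hom_add_pow[OF uR A.ring_axioms R.ring_axioms A.one_closed, of p] ring_hom_one[OF uR] by simp
    moreover have "u \<zero>\<^bsub>A\<^esub> = \<zero>\<^bsub>?R\<^esub>" using ring_hom_zero[OF uR A.ring_axioms R.ring_axioms] .
    ultimately show "cg ?R (u w) 1 ([p] \<cdot>\<^bsub>?R\<^esub> \<one>\<^bsub>?R\<^esub>) \<zero>\<^bsub>?R\<^esub>"
      using cg_hom[OF A.p_w uR A.is_cring R.is_cring A.w_closed] by simp
    show "x = \<zero>\<^bsub>?R\<^esub>" if "x \<in> carrier ?R" "u w \<otimes>\<^bsub>?R\<^esub> x = \<zero>\<^bsub>?R\<^esub>" for x
      using U.nzd[OF U'_carrier, of x] that by simp
    show "\<exists>y. \<forall>n. cg ?R (u w) n y (f n)" if f: "\<And>n. cg ?R (u w) n (f (Suc n)) (f n)" for f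
    proof -
      have fc: "f n \<in> U'" for n using cg_carrier(2)[OF f[of n]] by simp
      then have "cg U (u w) n (f (Suc n)) (f n)" for n using f[of n] cg_U'[OF fc fc] by simp
      then obtain y where y: "\<And>n. cg U (u w) n y (f n)" using U.complete[of f] by blast
      have yU: "y \<in> U'" using U'_approx[OF cg_carrier(1)[OF y[of 0]]] y fc by blast
      show ?thesis using y cg_U'[OF yU fc] by blast
    qed
    show "x = \<zero>\<^bsub>?R\<^esub>" if x: "\<And>n. cg ?R (u w) n x \<zero>\<^bsub>?R\<^esub>" for x
    proof -
      have "x \<in> U'" using cg_carrier(1)[OF x[of 0]] by simp
      then have "cg U (u w) n x \<zero>" for n using x[of n] cg_U'[OF _ z] by simp
      then show ?thesis using U.sep by simp
    qed
    show "\<exists>y\<in>carrier ?R. cg ?R (u w) 1 x (y [^]\<^bsub>?R\<^esub> p)" if x: "x \<in> carrier ?R" for x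
    proof -
      have xU: "x \<in> U'" using x by simp
      obtain s where s: "s \<in> S" "cg U (u w) 1 x s" using xU unfolding U'_def by blast
      obtain b s1 s2 where d: "b \<in> S" "s1 \<in> S" "s2 \<in> S"
        "s = b [^] (p ^ 1) \<oplus> (u w \<otimes> s1 \<oplus> [p] \<cdot> \<one> \<otimes> s2)"
        using S_decomposition[OF s(1), of 1] by blast
      note c = d(1-3)[THEN S_carrier]
      have "cg U (u w) 1 (u w \<otimes> s1) \<zero>" using U.cg_multiple[OF c(2) U.w_closed, of 1] by simp
      moreover have "cg U (u w) 1 ([p] \<cdot> \<one> \<otimes> s2) \<zero>" by (rule U.cg_shift_zero(1)[OF U.p_w c(3) U.w_closed])
      ultimately have "cg U (u w) 1 s (b [^] p \<oplus> (\<zero> \<oplus> \<zero>))"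
        unfolding d(4) power_one_right by (intro U.cg_add U.cg_refl) (use c in auto)
      then have "cg U (u w) 1 x (b [^] p)" using U.cgt[OF s(2)] c by simp
      then show ?thesis using cg_U'[OF xU powc[OF S_U'[OF d(1)]]] S_U'[OF d(1)] by (intro bexI[of _ b]) (auto simp: pw)
    qed
    show "cg ?R (u w) 1 x \<zero>\<^bsub>?R\<^esub>" if x: "x \<in> carrier ?R" "cg ?R (u w) 1 (x [^]\<^bsub>?R\<^esub> p) \<zero>\<^bsub>?R\<^esub>" for x
    proof -
      have xU: "x \<in> U'" using x by simp
      have "cg U (u w) 1 (x [^] p) \<zero>" using x(2) cg_U'[OF powc[OF xU] z] by (simp add: pw)
      then have "cg U (u w) 1 x \<zero>" by (rule U.red[OF U'_carrier[OF xU]])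
      then show ?thesis using cg_U'[OF xU z] by simp
    qed
  qed
  then have "CRP p A ?R u" using uR CRP_iff by blast
  \<comment> \<open>The initial map into the subobject, followed by the inclusion, is an
    endomorphism of \<open>U\<close>; by uniqueness it is the identity, so \<open>U'\<close>
    contains everything.\<close>
  then obtain h where h: "h \<in> alg_homs A U u ?R u" using init unfolding CRP_initial_def by blast
  have hR: "h \<in> ring_hom U ?R" using h by (simp add: alg_homs_def)
  have hc: "h x \<in> U'" if "x \<in> carrier U" for x using ring_hom_closed[OF hR that] by simp
  have "h \<in> ring_hom U U"
    by (rule ring_hom_memI) (use hc U'_carrier ring_hom_mult[OF hR] ring_hom_add[OF hR] ring_hom_one[OF hR] in auto)
  then have "h \<in> alg_homs A U u U u" using h by (simp add: alg_homs_def)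
  moreover have "restrict (\<lambda>x. x) (carrier U) \<in> alg_homs A U u U u"
    using u_closed by (auto simp: alg_homs_def intro!: ring_hom_memI)
  moreover have "CRP p A U u" using init by (simp add: CRP_initial_def)
  ultimately have "h = restrict (\<lambda>x. x) (carrier U)" using init unfolding CRP_initial_def by blast
  then show "x \<in> U'" if "x \<in> carrier U" using hc[OF that] that by simp
qed

lemma power_in_E:
  assumes "x \<in> carrier U" shows "\<exists>n. \<exists>e\<in>E. cg U (u w) 1 (x [^] (p ^ n)) e"
proof -
  obtain s where s: "s \<in> S" "cg U (u w) 1 x s" using U'_eq[OF assms] unfolding U'_def by blast
  have "x \<in> Wp" by (rule Wp_cong[OF s(2) S_Wp[OF s(1)]])
  then show ?thesis by (simp add: Wp_def)
qed

end

section \<open>Specializations of the initial object\<close>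

lemma ev_cong_coefs: "(\<And>a. a \<in> coefs P \<Longrightarrow> s a = s' a) \<Longrightarrow> ev R s d P = ev R s' d P"
  by (induction P) auto

text \<open>A p-power of \<open>v\<close> is congruent to a polynomial P in the digits. Values
  \<beta> that are p^N-th powers in \<open>A\<close> and at which P is nonzero modulo
  \<open>w\<close> are chosen beforehand; then an object is taken in which each t - w c_t has a
  p^N-th root, with c_t the sum of the \<beta>(t, j+1) w^j. There t has an expansion by p^N-th
  powers whose terms of index j \<ge> 1 are the prescribed \<beta>(t, j).\<close>

lemma (in initial) exists_CRP_avoiding:
  assumes v: "v \<in> carrier U" "\<not> cg U (u w) 1 v \<zero>"
  shows "\<exists>(C :: 'b ring) s h. CRP p A C s \<and> (\<forall>x\<in>carrier C. \<exists>n. \<exists>a\<in>carrier A. cg C (s w) 1 (x [^]\<^bsub>C\<^esub> (p ^ n)) (s a)) \<and>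
    \<not> cg C (s w) 1 \<one>\<^bsub>C\<^esub> \<zero>\<^bsub>C\<^esub> \<and> h \<in> alg_homs A U u C s \<and> \<not> cg C (s w) 1 (h v) \<zero>\<^bsub>C\<^esub>"
proof -
  obtain n e where e: "e \<in> E" "cg U (u w) 1 (v [^] (p ^ n)) e" using power_in_E[OF v(1)] by blast
  have enz: "\<not> cg U (u w) 1 e \<zero>" using U.cgt[OF e(2)] U.red_n[OF v(1)] v(2) by blast
  \<comment> \<open>Zero outside \<open>A\<close>, so that all values lie in \<open>U\<close>; the
    variables of P never meet this default.\<close>
  define d where "d = (\<lambda>(t, j). if t \<in> carrier A then U.dig (u t) j else \<zero>)"
  have dc: "d x \<in> carrier U" for x using u_closed by (cases x) (auto simp: d_def)
  have "(\<lambda>(t, j). U.dig (u t) j) ` (T0 \<times> {1..}) = d ` (T0 \<times> {1..})"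
    by (rule image_cong) (auto simp: d_def T0_carrier)
  then have "e \<in> generate_ring U (u ` carrier A \<union> d ` (T0 \<times> {1..}))" using e(1) by (simp add: E_def)
  then obtain P where P: "coefs P \<subseteq> carrier A" "vars P \<subseteq> T0 \<times> {1..}" "e = ev U u d P"
    using generate_ring_ev[where d = d, OF u_hom A.is_cring U.is_cring dc] by blast
  \<comment> \<open>Bounds all digit indices in P; the inserted 0 covers a polynomial without
    variables. All indices are then below N, and p^N-th powers determine the digits of index below
    N.\<close>
  define N' where "N' = Max (insert 0 (snd ` vars P))"
  define N where "N = Suc N'"
  have jN: "j < N" if "(t, j) \<in> vars P" for t j
  proof -
    have "j \<le> N'" unfolding N'_def by (rule Max_ge) (use that finite_vars[of P] in force)+
    then show ?thesis by (simp add: N_def)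
  qed
  define Gm where "Gm = (\<lambda>b. b [^]\<^bsub>A\<^esub> (p ^ N)) ` carrier A"
  have "\<exists>\<beta>. (\<forall>v. \<beta> v \<in> Gm) \<and> \<not> cg A w 1 (ev A (\<lambda>a. a) \<beta> P) \<zero>\<^bsub>A\<^esub>"
  proof (rule ccontr)
    assume c: "\<not> ?thesis"
    have "cg U (u w) 1 (ev U u d P) \<zero>"
    proof (rule nonvanishing_point[where I = "vars P" and G = Gm])
      show "cg A w 1 (ev A (\<lambda>a. a) \<beta> P) \<zero>\<^bsub>A\<^esub>" if "\<And>v. \<beta> v \<in> Gm" for \<beta> using c that by blast
      show "Gm \<subseteq> carrier A" by (auto simp: Gm_def)
      show "\<one>\<^bsub>A\<^esub> \<in> Gm" unfolding Gm_def by (rule image_eqI[of _ _ "\<one>\<^bsub>A\<^esub>"]) auto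
      show "x \<otimes>\<^bsub>A\<^esub> y \<in> Gm" if "x \<in> Gm" "y \<in> Gm" for x y
      proof -
        obtain b c where "b \<in> carrier A" "x = b [^]\<^bsub>A\<^esub> (p ^ N)" "c \<in> carrier A" "y = c [^]\<^bsub>A\<^esub> (p ^ N)"
          using \<open>x \<in> Gm\<close> \<open>y \<in> Gm\<close> by (auto simp: Gm_def)
        then show ?thesis unfolding Gm_def by (intro image_eqI[of _ _ "b \<otimes>\<^bsub>A\<^esub> c"]) (auto simp: A.nat_pow_distrib)
      qed
      show "\<exists>y\<in>Gm. \<not> cg A w 1 y \<zero>\<^bsub>A\<^esub> \<and> (\<forall>m>0. \<not> cg A w 1 (y [^]\<^bsub>A\<^esub> (m::nat)) \<one>\<^bsub>A\<^esub>)" if ne: "vars P \<noteq> {}"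
      proof -
        obtain t where t: "t \<in> T0" using ne P(2) by auto
        have tc: "t \<in> carrier A" by (rule T0_carrier[OF t])
        have np: "\<not> cg A w 1 t (b [^]\<^bsub>A\<^esub> p)" if "b \<in> carrier A" for b by (rule T0_not_power[OF t that])
        have "\<zero>\<^bsub>A\<^esub> [^]\<^bsub>A\<^esub> p = \<zero>\<^bsub>A\<^esub>" using A.p_gt_1 by (simp add: A.nat_pow_zero)
        then have "\<not> cg A w 1 t \<zero>\<^bsub>A\<^esub>" using np[OF A.zero_closed] by simp
        then have "\<not> cg A w 1 (t [^]\<^bsub>A\<^esub> (p ^ N)) \<zero>\<^bsub>A\<^esub>" using A.pow_w[OF tc] by blast
        moreover have "\<not> cg A w 1 ((t [^]\<^bsub>A\<^esub> (p ^ N)) [^]\<^bsub>A\<^esub> m) \<one>\<^bsub>A\<^esub>" if "m > 0" for m :: nat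
          using A.not_root_of_unity[OF tc np, of "p ^ N * m"] that tc A.p_gt_1 by (simp add: A.nat_pow_pow)
        ultimately show ?thesis using tc by (intro bexI[of _ "t [^]\<^bsub>A\<^esub> (p ^ N)"]) (auto simp: Gm_def)
      qed
    qed (use u_hom U.is_cring finite_vars dc P in auto)
    then show False using enz P(3) by simp
  qed
  then obtain \<beta> where \<beta>: "\<And>v. \<beta> v \<in> Gm" "\<not> cg A w 1 (ev A (\<lambda>a. a) \<beta> P) \<zero>\<^bsub>A\<^esub>" by blast
  have "\<forall>v. \<exists>b. b \<in> carrier A \<and> \<beta> v = b [^]\<^bsub>A\<^esub> (p ^ N)" using \<beta>(1) by (auto simp: Gm_def)
  then obtain b where b: "\<And>v. b v \<in> carrier A" "\<And>v. \<beta> v = b v [^]\<^bsub>A\<^esub> (p ^ N)" by metis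
  have \<beta>c: "\<beta> v \<in> carrier A" for v using b by simp
  define c where "c = (\<lambda>t. psum A w (\<lambda>j. \<beta> (t, Suc j)) N')"
  have cc: "c t \<in> carrier A" for t using \<beta>c by (simp add: c_def)
  define t' where "t' = (\<lambda>t. t \<ominus>\<^bsub>A\<^esub> w \<otimes>\<^bsub>A\<^esub> c t)"
  define F where "F = fst ` vars P"
  have F: "finite F" "F \<subseteq> T0" using finite_vars[of P] P(2) by (auto simp: F_def)
  have t'c: "t' t \<in> carrier A" if "t \<in> F" for t using F T0_carrier that cc by (auto simp: t'_def)
  have t'eq: "t = t' t \<oplus>\<^bsub>A\<^esub> w \<otimes>\<^bsub>A\<^esub> c t" if "t \<in> F" for t
  proof -
    define q where "q = w \<otimes>\<^bsub>A\<^esub> c t"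
    have "t \<in> carrier A" "q \<in> carrier A" using F T0_carrier that cc by (auto simp: q_def)
    then show ?thesis unfolding t'_def q_def[symmetric] by (simp add: a_minus_def A.a_assoc A.l_neg)
  qed
  have t'cg: "cg A w 1 (t' t) t" if "t \<in> F" for t
  proof (rule A.cgs, rule A.cgI)
    show "t = t' t \<oplus>\<^bsub>A\<^esub> w [^]\<^bsub>A\<^esub> (1::nat) \<otimes>\<^bsub>A\<^esub> c t" using t'eq[OF that] by simp
  qed (use t'c that cc in auto)
  obtain \<tau> and r :: nat where \<tau>: "\<tau> ` {..<r} = F" "\<And>i e. i < r \<Longrightarrow>
      e \<in> generate_ring A ((\<lambda>d. d [^]\<^bsub>A\<^esub> p) ` carrier A \<union> (\<lambda>i. t' (\<tau> i)) ` {..<i}) \<Longrightarrow> \<not> cg A w 1 (t' (\<tau> i)) e"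
    using T0_independent[OF F t'cg] by blast
  have \<tau>F: "\<tau> i \<in> F" if "i < r" for i using \<tau>(1) that by blast
  obtain C :: "'b ring" and s where C: "CRP p A C s" "\<And>i. i < r \<Longrightarrow> \<exists>y\<in>carrier C. s (t' (\<tau> i)) = y [^]\<^bsub>C\<^esub> (p ^ N)"
    "\<And>x. x \<in> carrier C \<Longrightarrow> \<exists>n. \<exists>a\<in>carrier A. cg C (s w) 1 (x [^]\<^bsub>C\<^esub> (p ^ n)) (s a)" "\<not> cg C (s w) 1 \<one>\<^bsub>C\<^esub> \<zero>\<^bsub>C\<^esub>"
  proof (rule exists_CRP[OF K u_hom U_pcr U_nontriv, where r = r and t = "\<lambda>i. t' (\<tau> i)" and M = N])
    show "t' (\<tau> i) \<in> carrier A" if "i < r" for i by (rule t'c[OF \<tau>F[OF that]])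
  qed (rule \<tau>(2), assumption, assumption, rule that)
  obtain h where h: "h \<in> alg_homs A U u C s" using init C(1) unfolding CRP_initial_def by blast
  have s: "s \<in> ring_hom A C" and Cp: "pcr C (s w) p" using C(1) by (auto simp: CRP_iff)
  interpret C: pcr C "s w" p by (rule Cp)
  have hh: "h \<in> ring_hom U C" and hu: "\<And>a. a \<in> carrier A \<Longrightarrow> h (u a) = s a" using h by (auto simp: alg_homs_def)
  interpret h: ring_hom_cring U C h using hh U.is_cring C.is_cring by (intro ring_hom_cringI) auto
  interpret s: ring_hom_cring A C s using s A.is_cring C.is_cring by (intro ring_hom_cringI) auto
  have hw: "h (u w) = s w" by (rule hu) simp
  have key: "cg C (s w) 1 (h (d v)) (s (\<beta> v))" if "v \<in> vars P" for v
  proof -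
    obtain t j where v: "v = (t, j)" by (cases v)
    have tj: "t \<in> F" "j \<ge> 1" "j < N" using that P(2) jN v by (force simp: F_def)+
    have tc: "t \<in> carrier A" using tj F T0_carrier by blast
    obtain i where "i < r" "t = \<tau> i" using \<tau>(1) tj(1) by blast
    then obtain y where y: "y \<in> carrier C" "s (t' t) = y [^]\<^bsub>C\<^esub> (p ^ N)" using C(2) by blast
    \<comment> \<open>The bases in the expansion of \<open>s t\<close> in C: the root
      \<open>y\<close> for index 0, the roots of the prescribed values for the others. By
      \<open>digits_unique\<close> they agree modulo \<open>w\<close> with the images of the roots
      of the digits in \<open>U\<close>.\<close>
    define x where "x = (\<lambda>j. case j of 0 \<Rightarrow> y | Suc k \<Rightarrow> s (b (t, Suc k)))"
    have xc: "x j \<in> carrier C" for j using y(1) b(1) by (auto simp: x_def split: nat.split)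
    have sb: "s (\<beta> v) = s (b v) [^]\<^bsub>C\<^esub> (p ^ N)" for v using ring_hom_pow[OF s A.is_cring C.is_cring b(1)] b(2) by simp
    have "s t = s (t' t \<oplus>\<^bsub>A\<^esub> w \<otimes>\<^bsub>A\<^esub> c t)" using t'eq[OF tj(1)] by simp
    also have "\<dots> = s (t' t) \<oplus>\<^bsub>C\<^esub> s w \<otimes>\<^bsub>C\<^esub> s (c t)" using t'c[OF tj(1)] cc by simp
    also have "s (c t) = psum C (s w) (\<lambda>j. x (Suc j) [^]\<^bsub>C\<^esub> (p ^ N)) N'"
      unfolding c_def using psum_hom[OF s A.is_cring C.is_cring A.w_closed \<beta>c] by (simp add: comp_def x_def sb)
    also have "s (t' t) \<oplus>\<^bsub>C\<^esub> s w \<otimes>\<^bsub>C\<^esub> psum C (s w) (\<lambda>j. x (Suc j) [^]\<^bsub>C\<^esub> (p ^ N)) N' = psum C (s w) (\<lambda>j. x j [^]\<^bsub>C\<^esub> (p ^ N)) N"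
      unfolding N_def by (subst C.psum_shift) (use xc y in \<open>auto simp: comp_def x_def N_def\<close>)
    finally have st: "s t = psum C (s w) (\<lambda>j. x j [^]\<^bsub>C\<^esub> (p ^ N)) N" .
    have "\<forall>j. \<exists>z. z \<in> carrier U \<and> U.dig (u t) j = z [^] (p ^ N)"
      using U.dig_tm[OF u_closed[OF tc]] unfolding U.tm_def by blast
    then obtain z where z: "\<And>j. z j \<in> carrier U" "\<And>j. U.dig (u t) j = z j [^] (p ^ N)" by metis
    have hz: "h (U.dig (u t) j) = h (z j) [^]\<^bsub>C\<^esub> (p ^ N)" for j
      using z ring_hom_pow[OF hh U.is_cring C.is_cring z(1)] by simp
    have "cg C (h (u w)) N (h (u t)) (h (psum U (u w) (U.dig (u t)) N))"
      by (rule cg_hom[OF U.cg_expansion[OF u_closed[OF tc]] hh U.is_cring C.is_cring]) simp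
    moreover have "h (psum U (u w) (U.dig (u t)) N) = psum C (s w) (\<lambda>j. h (z j) [^]\<^bsub>C\<^esub> (p ^ N)) N"
      using psum_hom[OF hh U.is_cring C.is_cring U.w_closed, of N "U.dig (u t)"] u_closed[OF tc] by (simp add: comp_def hz hw)
    ultimately have "cg C (s w) N (psum C (s w) (\<lambda>j. x j [^]\<^bsub>C\<^esub> (p ^ N)) N) (psum C (s w) (\<lambda>j. h (z j) [^]\<^bsub>C\<^esub> (p ^ N)) N)"
      using st hw hu[OF tc] by simp
    then have "cg C (s w) 1 (x j) (h (z j))"
      by (rule C.digits_unique[where M = N, rotated 3]) (use xc z tj in auto)
    then have "cg C (s w) 1 (x j [^]\<^bsub>C\<^esub> (p ^ N)) (h (z j) [^]\<^bsub>C\<^esub> (p ^ N))" by (rule C.cg_pow) simp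
    then have "cg C (s w) 1 (h (z j) [^]\<^bsub>C\<^esub> (p ^ N)) (x j [^]\<^bsub>C\<^esub> (p ^ N))" by (rule C.cgs)
    moreover have "d v = U.dig (u t) j" using v tc by (simp add: d_def)
    moreover have "x j [^]\<^bsub>C\<^esub> (p ^ N) = s (\<beta> v)" using tj(2) v sb by (cases j) (auto simp: x_def)
    ultimately show ?thesis using hz by simp
  qed
  have "\<not> cg C (s w) 1 (h v) \<zero>\<^bsub>C\<^esub>"
  proof
    assume "cg C (s w) 1 (h v) \<zero>\<^bsub>C\<^esub>"
    then have "cg C (s w) 1 (h v [^]\<^bsub>C\<^esub> (p ^ n)) (\<zero>\<^bsub>C\<^esub> [^]\<^bsub>C\<^esub> (p ^ n))" by (rule C.cg_pow) simp
    then have 1: "cg C (s w) 1 (h (v [^] (p ^ n))) \<zero>\<^bsub>C\<^esub>"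
      using ring_hom_pow[OF hh U.is_cring C.is_cring v(1), of "p ^ n"] A.p_gt_1 by (simp add: C.nat_pow_zero)
    have 2: "cg C (s w) 1 (h (v [^] (p ^ n))) (h e)"
      using cg_hom[OF e(2) hh U.is_cring C.is_cring U.w_closed] hw by simp
    have "h e = ev C s (h \<circ> d) P"
      using ev_hom[OF hh U.is_cring, of P u d] P u_closed dc ev_cong_coefs[of P "h \<circ> u" s C "h \<circ> d"] hu by (auto simp: subset_iff)
    moreover have "cg C (s w) 1 (ev C s (h \<circ> d) P) (ev C s (s \<circ> \<beta>) P)"
      by (rule C.ev_cg) (use P(1) key in auto)
    moreover have "s (ev A (\<lambda>a. a) \<beta> P) = ev C s (s \<circ> \<beta>) P"
      using ev_hom[OF s A.is_cring, of P "\<lambda>a. a" \<beta>] P(1) \<beta>c by (auto simp: comp_def)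
    ultimately have "cg C (s w) 1 (h e) (s (ev A (\<lambda>a. a) \<beta> P))" by simp
    then have "cg C (s w) 1 (s (ev A (\<lambda>a. a) \<beta> P)) (s \<zero>\<^bsub>A\<^esub>)"
      using C.cgt[OF C.cgs[OF C.cgt[OF 2]] 1] by simp
    then have "cg A w 1 (ev A (\<lambda>a. a) \<beta> P) \<zero>\<^bsub>A\<^esub>"
      by (rule cg_of_hom[OF C.is_cring s C(4), rotated 2]) (use P(1) \<beta>c in \<open>auto intro!: A.ev_closed\<close>)
    then show False using \<beta>(2) by blast
  qed
  then show ?thesis using C(1,3,4) h by blast
qed

lemma (in pcr) nilpotent_mod:
  assumes x: "x \<in> carrier R" and "cg R w 1 (x [^] (m::nat)) \<zero>" shows "cg R w 1 x \<zero>"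
proof -
  have "m < 2 ^ m" by (rule less_exp)
  also have "\<dots> \<le> p ^ m" using p_gt_1 by (intro power_mono) auto
  finally have "x [^] (p ^ m) = x [^] m \<otimes> x [^] (p ^ m - m)" using x by (simp add: nat_pow_mult)
  moreover have "cg R w 1 (x [^] m \<otimes> x [^] (p ^ m - m)) \<zero>" by (rule cg_shift_zero(1)) (use assms in auto)
  ultimately have "cg R w 1 (x [^] (p ^ m)) \<zero>" by simp
  then show ?thesis by (rule red_n[OF x])
qed

text \<open>\<open>y ^ p\<close> agrees with a Teichmueller element modulo \<open>w\<^sup>2\<close>, so \<open>b\<close> cancels the second digit.\<close>

lemma (in pcr) second_digit:
  assumes d: "tm d0" "d1 \<in> carrier R" and T: "cg R w 2 T (d0 \<oplus> w \<otimes> d1)"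
    and b: "b \<in> carrier R" and y: "y \<in> carrier R" "T \<oplus> w \<otimes> b = y [^] p"
  shows "cg R w 1 d1 (\<ominus> b)"
proof -
  have wc: "w \<in> carrier R" by simp
  have d0: "d0 \<in> carrier R" by (rule tm_closed[OF d(1)])
  have Tc: "T \<in> carrier R" by (rule cg_carrier(1)[OF T])
  have m1: "cg R w 1 (w \<otimes> z) \<zero>" if "z \<in> carrier R" for z using cg_multiple[OF that wc, of 1] by simp
  have "cg R w 1 (y [^] p) (T \<oplus> \<zero>)" unfolding y(2)[symmetric] by (rule cg_add[OF cg_refl[OF Tc wc] m1[OF b] wc])
  also have "cg R w 1 (T \<oplus> \<zero>) ((d0 \<oplus> \<zero>) \<oplus> \<zero>)"
    by (rule cg_add[OF cgt[OF cg_mono[OF T] cg_add[OF cg_refl[OF d0 wc] m1[OF d(2)] wc]] cg_refl]) auto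
  finally have yd: "cg R w 1 (y [^] p) d0" using d0 by simp
  have ty: "cg R w 1 (tau y [^] p) (y [^] p)" by (rule cg_pow[OF tau(2)[OF y(1)] wc])
  have "tau y [^] p = d0" by (rule tm_unique[OF tm_pow[OF tau(1)[OF y(1)]] d(1) cgt[OF ty yd]])
  then have "cg R w 2 d0 (y [^] p)" using frob_lift[OF tau(2)[OF y(1)]] by (simp add: numeral_2_eq_2)
  then have 1: "cg R w 2 (T \<oplus> w \<otimes> b) d0" unfolding y(2) by (rule cgs)
  have 2: "cg R w 2 (T \<oplus> w \<otimes> b) (d0 \<oplus> w \<otimes> d1 \<oplus> w \<otimes> b)" by (rule cg_add[OF T cg_refl]) (use b in auto)
  have "cg R w 2 (d0 \<oplus> w \<otimes> d1 \<oplus> w \<otimes> b \<ominus> d0) (d0 \<ominus> d0)"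
    by (rule cg_minus[OF cgt[OF cgs[OF 2] 1] cg_refl]) (use d0 in auto)
  moreover have "d0 \<oplus> w \<otimes> d1 \<oplus> w \<otimes> b \<ominus> d0 = w \<otimes> (d1 \<oplus> b)" by (use d0 d b wc in \<open>simp add: ring_nf\<close>)
  moreover have "d0 \<ominus> d0 = w \<otimes> \<zero>" using d0 by (simp add: a_minus_def r_neg)
  ultimately have "cg R w (Suc 1) (w \<otimes> (d1 \<oplus> b)) (w \<otimes> \<zero>)" by (simp add: numeral_2_eq_2)
  then have "cg R w 1 (d1 \<oplus> b) \<zero>" by (rule cg_cancel1) (use d b in auto)
  then have "cg R w 1 (d1 \<oplus> b \<oplus> \<ominus> b) (\<zero> \<oplus> \<ominus> b)" by (rule cg_add[OF _ cg_refl]) (use b in auto)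
  then show ?thesis using d b by (simp add: a_assoc r_neg)
qed

lemma tm_hom:
  assumes R: "pcr R w p" and S: "pcr S v p" and h: "h \<in> ring_hom R S" and x: "pcr.tm R p x"
  shows "pcr.tm S p (h x)"
proof -
  interpret R: pcr R w p by fact
  interpret S: pcr S v p by fact
  show ?thesis
    unfolding S.tm_def
  proof
    fix n
    obtain y where "y \<in> carrier R" "x = y [^]\<^bsub>R\<^esub> (p ^ n)" using x unfolding R.tm_def by blast
    then show "\<exists>y\<in>carrier S. h x = y [^]\<^bsub>S\<^esub> (p ^ n)"
      using ring_hom_pow[OF h R.is_cring S.is_cring] ring_hom_closed[OF h] by (intro bexI[of _ "h y"]) auto
  qed
qed

context cring
begin

lemma add_minus_cancel: "x \<in> carrier R \<Longrightarrow> y \<in> carrier R \<Longrightarrow> x \<oplus> y \<oplus> \<ominus> x = y"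
  by (simp add: a_comm[of x y] a_assoc r_neg)

lemma psum_split:
  assumes "x \<in> carrier R" "\<And>j. d j \<in> carrier R"
  shows "psum R x d (m + k) = psum R x d m \<oplus> x [^] m \<otimes> psum R x (\<lambda>j. d (m + j)) k"
  using assms by (induction k) (auto simp: r_distr a_assoc nat_pow_mult[symmetric] m_assoc)

lemma psum_cg_base:
  assumes "w \<in> carrier R" "cg R w n x y" "\<And>j. d j \<in> carrier R"
  shows "cg R w n (psum R x d k) (psum R y d k)"
  using assms by (induction k) (auto intro!: cg_add cg_mult cg_refl cg_pow)

lemma psum_zero_base: "(\<And>j. d j \<in> carrier R) \<Longrightarrow> psum R \<zero> d (Suc k) = d 0"
  by (induction k) (auto simp: nat_pow_zero)

end

section \<open>Elements algebraic over A\<close>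

text \<open>\<open>h0_inj\<close> and \<open>h0_frac\<close> express by elements that the residue
  field of \<open>G\<close> is the fraction field of the residue ring of \<open>U\<close>.
  \<open>S0\<close> stands for the elements of \<open>G\<close> algebraic over \<open>K\<close>;
  \<open>S0_algebraic\<close> takes coefficients in \<open>A\<close>, from which common powers of
  \<open>w\<close> can be removed, and \<open>S0_divide\<close> says that \<open>S0\<close> is
  saturated.\<close>

locale generic = initial A w p U u K i for A :: "'a ring" and w p and U :: "'b ring" and u and K :: "'k ring" and i +
  fixes G :: "'b ring" (structure) and g :: "'a \<Rightarrow> 'b" and h0 :: "'b \<Rightarrow> 'b" and S0 :: "'b set"
  assumes G_CRP: "CRP p A G g" and h0: "h0 \<in> alg_homs A U u G g"
    and h0_inj: "x \<in> carrier U \<Longrightarrow> cg G (g w) 1 (h0 x) \<zero> \<Longrightarrow> cg U (u w) 1 x \<zero>\<^bsub>U\<^esub>"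
    and h0_frac: "x \<in> carrier G \<Longrightarrow>
      \<exists>a\<in>carrier U. \<exists>b\<in>carrier U. \<not> cg U (u w) 1 b \<zero>\<^bsub>U\<^esub> \<and> cg G (g w) 1 (h0 b \<otimes> x) (h0 a)"
    and G_cdv: "cdv G (g w) p"
    and S0: "subring S0 G" "\<And>a. a \<in> carrier A \<Longrightarrow> g a \<in> S0"
    and S0_divide: "\<And>x. x \<in> carrier G \<Longrightarrow> g w \<otimes> x \<in> S0 \<Longrightarrow> x \<in> S0"
    and S0_algebraic: "\<And>x. x \<in> S0 \<Longrightarrow> \<exists>n c. (\<forall>j. c j \<in> carrier A) \<and> (\<exists>j<n. c j \<noteq> \<zero>\<^bsub>A\<^esub>) \<and> psum G x (\<lambda>j. g (c j)) n = \<zero>"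
begin

lemma g_hom: "g \<in> ring_hom A G" and G_pcr: "pcr G (g w) p"
  using G_CRP by (simp_all add: CRP_iff)

lemma h0_hom: "h0 \<in> ring_hom U G" and h0_u: "a \<in> carrier A \<Longrightarrow> h0 (u a) = g a"
  using h0 by (auto simp: alg_homs_def)

end

sublocale generic \<subseteq> G: pcr G "g w" p by (rule G_pcr)

sublocale generic \<subseteq> G: cdv G "g w" p by (rule G_cdv)

context generic
begin

lemma g_closed: "a \<in> carrier A \<Longrightarrow> g a \<in> carrier G" by (rule ring_hom_closed[OF g_hom])

lemma S0_carrier: "x \<in> S0 \<Longrightarrow> x \<in> carrier G" using subringE(1)[OF S0(1)] by blast

text \<open>After division by the common power of \<open>w\<close> the relation is nontrivial modulo
  \<open>w\<close>. As \<open>z\<close> is a unit, it may also be divided by the power of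
  \<open>z\<close> belonging to the first coefficient not divisible by \<open>w\<close>. The gain is
  a constant term that is a unit.\<close>

lemma reduced_relation:
  assumes z: "z \<in> S0" "\<not> cg G (g w) 1 z \<zero>"
  shows "\<exists>N d. (\<forall>j. d j \<in> carrier A) \<and> \<not> cg A w 1 (d 0) \<zero>\<^bsub>A\<^esub> \<and> N > 0 \<and>
    cg G (g w) 1 (psum G z (\<lambda>j. g (d j)) N) \<zero>"
proof -
  have zc: "z \<in> carrier G" by (rule S0_carrier[OF z(1)])
  have gw: "g w \<in> carrier G" by simp
  obtain n c j0 where c: "\<And>j. c j \<in> carrier A" "j0 < n" "c j0 \<noteq> \<zero>\<^bsub>A\<^esub>" "psum G z (\<lambda>j. g (c j)) n = \<zero>"
    using S0_algebraic[OF z(1)] by blast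
  obtain m b j1 where b: "b \<in> {..<n} \<rightarrow> carrier A" "\<And>j. j \<in> {..<n} \<Longrightarrow> c j = w [^]\<^bsub>A\<^esub> (m::nat) \<otimes>\<^bsub>A\<^esub> b j"
    "j1 \<in> {..<n}" "\<not> cg A w 1 (b j1) \<zero>\<^bsub>A\<^esub>"
  proof (rule A.common_factor[of "{..<n}" c j0])
    show "c \<in> {..<n} \<rightarrow> carrier A" "j0 \<in> {..<n}" "c j0 \<noteq> \<zero>\<^bsub>A\<^esub>" using c by auto
  qed (simp, rule that)
  define b' where "b' = (\<lambda>j. if j < n then b j else \<zero>\<^bsub>A\<^esub>)"
  have b'c: "b' j \<in> carrier A" for j using b(1) by (auto simp: b'_def)
  have cb: "c j = w [^]\<^bsub>A\<^esub> m \<otimes>\<^bsub>A\<^esub> b' j" if "j < n" for j using b(2) that by (simp add: b'_def)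
  have gc: "g (c j) = g w [^] m \<otimes> g (b' j)" if "j < n" for j
    using cb[OF that] ring_hom_mult[OF g_hom _ b'c, of "w [^]\<^bsub>A\<^esub> m"] ring_hom_pow[OF g_hom A.is_cring G.is_cring A.w_closed] by simp
  have gb: "g (b' j) \<in> carrier G" for j by (rule g_closed[OF b'c])
  have "psum G z (\<lambda>j. g (c j)) k = g w [^] m \<otimes> psum G z (\<lambda>j. g (b' j)) k" if "k \<le> n" for k
    using that by (induction k) (use zc gb gc in \<open>auto simp: G.r_distr G.m_lcomm\<close>)
  then have "g w [^] m \<otimes> psum G z (\<lambda>j. g (b' j)) n = g w [^] m \<otimes> \<zero>" using c(4) by simp
  then have z0: "psum G z (\<lambda>j. g (b' j)) n = \<zero>" by (rule G.cancel_w_pow[rotated 2]) (use zc gb in auto)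
  define k where "k = (LEAST j. \<not> cg A w 1 (b' j) \<zero>\<^bsub>A\<^esub>)"
  have nz1: "\<not> cg A w 1 (b' j1) \<zero>\<^bsub>A\<^esub>" using b(3,4) by (simp add: b'_def)
  have k: "\<not> cg A w 1 (b' k) \<zero>\<^bsub>A\<^esub>" unfolding k_def by (rule LeastI[of "\<lambda>j. \<not> cg A w 1 (b' j) \<zero>\<^bsub>A\<^esub>", OF nz1])
  have kl: "cg A w 1 (b' j) \<zero>\<^bsub>A\<^esub>" if "j < k" for j using not_less_Least[of j "\<lambda>j. \<not> cg A w 1 (b' j) \<zero>\<^bsub>A\<^esub>"] that by (simp add: k_def)
  have kn: "k < n"
  proof -
    have "k \<le> j1" unfolding k_def by (rule Least_le) (rule nz1)
    then show ?thesis using b(3) by simp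
  qed
  have low: "cg G (g w) 1 (psum G z (\<lambda>j. g (b' j)) l) \<zero>" if "l \<le> k" for l
    using that
  proof (induction l)
    case (Suc l)
    have "cg G (g w) 1 (g (b' l)) (g \<zero>\<^bsub>A\<^esub>)" by (rule cg_hom[OF kl g_hom A.is_cring G.is_cring]) (use Suc.prems in auto)
    then have 1: "cg G (g w) 1 (g (b' l)) \<zero>" using ring_hom_zero[OF g_hom A.ring_axioms G.ring_axioms] by simp
    have "cg G (g w) 1 (psum G z (\<lambda>j. g (b' j)) l \<oplus> z [^] l \<otimes> g (b' l)) (\<zero> \<oplus> \<zero>)"
      by (rule G.cg_add[OF Suc.IH G.cg_shift_zero(2)[OF 1] gw]) (use Suc.prems zc in auto)
    then show ?case by simp
  qed (simp add: G.cg_refl)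
  define d where "d = (\<lambda>j. b' (k + j))"
  define Y where "Y = psum G z (\<lambda>j. g (d j)) (n - k)"
  have Yc: "Y \<in> carrier G" unfolding Y_def d_def using zc gb by simp
  have e: "\<zero> = psum G z (\<lambda>j. g (b' j)) k \<oplus> z [^] k \<otimes> Y"
    using G.psum_split[where m = k and k = "n - k", OF zc gb] kn z0 by (simp add: Y_def d_def)
  have "cg G (g w) 1 (psum G z (\<lambda>j. g (b' j)) k \<oplus> z [^] k \<otimes> Y) (\<zero> \<oplus> z [^] k \<otimes> Y)"
    by (rule G.cg_add[OF low G.cg_refl]) (use zc Yc in auto)
  then have "cg G (g w) 1 \<zero> (\<zero> \<oplus> z [^] k \<otimes> Y)" by (simp only: e[symmetric])
  then have "cg G (g w) 1 \<zero> (z [^] k \<otimes> Y)" using zc Yc by simp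
  then have "cg G (g w) 1 (z [^] k \<otimes> Y) \<zero>" by (rule G.cgs)
  moreover have "\<not> cg G (g w) 1 (z [^] k) \<zero>" using G.pow_w[OF zc] z(2) by blast
  ultimately have "cg G (g w) 1 Y \<zero>" using G.prime_w[of "z [^] k" Y] zc Yc by simp
  then show ?thesis unfolding Y_def using b'c k kn
    by (intro exI[of _ "n - k"] exI[of _ d]) (auto simp: d_def)
qed

text \<open>Let x have residue a'/b, and let C be an object in which b survives. There the image of
  a'/b is purely inseparable, so its q-th power is the residue of some a in \<open>A\<close>. If z =
  x^q - a were nonzero modulo \<open>w\<close>, a relation for z with unit constant term, cleared of
  denominators, would hold in the residue ring of \<open>U\<close>. In C, where the numerator of z
  vanishes, only the constant term times a power of b is left, a contradiction.\<close>

lemma power_in_A: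
  assumes x: "x \<in> S0" shows "\<exists>n. \<exists>a\<in>carrier A. cg G (g w) 1 (x [^] (p ^ n)) (g a)"
proof -
  have xc: "x \<in> carrier G" by (rule S0_carrier[OF x])
  have gw: "g w \<in> carrier G" by simp
  obtain a' b where ab: "a' \<in> carrier U" "b \<in> carrier U" "\<not> cg U (u w) 1 b \<zero>\<^bsub>U\<^esub>" "cg G (g w) 1 (h0 b \<otimes> x) (h0 a')"
    using h0_frac[OF xc] by blast
  obtain C :: "'b ring" and s h where C: "CRP p A C s"
      "\<And>x. x \<in> carrier C \<Longrightarrow> \<exists>n. \<exists>a\<in>carrier A. cg C (s w) 1 (x [^]\<^bsub>C\<^esub> (p ^ n)) (s a)"
      "\<not> cg C (s w) 1 \<one>\<^bsub>C\<^esub> \<zero>\<^bsub>C\<^esub>" "h \<in> alg_homs A U u C s" "\<not> cg C (s w) 1 (h b) \<zero>\<^bsub>C\<^esub>"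
    using exists_CRP_avoiding[OF ab(2,3)] by blast
  have s: "s \<in> ring_hom A C" and Cp: "pcr C (s w) p" using C(1) by (auto simp: CRP_iff)
  interpret C: pcr C "s w" p by (rule Cp)
  have hh: "h \<in> ring_hom U C" and hu: "\<And>a. a \<in> carrier A \<Longrightarrow> h (u a) = s a" using C(4) by (auto simp: alg_homs_def)
  interpret h: ring_hom_cring U C h using hh U.is_cring C.is_cring by (intro ring_hom_cringI) auto
  interpret h0: ring_hom_cring U G h0 using h0_hom U.is_cring G.is_cring by (intro ring_hom_cringI) auto
  interpret s: ring_hom_cring A C s using s A.is_cring C.is_cring by (intro ring_hom_cringI) auto
  have hw: "h (u w) = s w" by (rule hu) simp
  have sw: "s w \<in> carrier C" by simp
  have hb: "h b \<in> carrier C" "h a' \<in> carrier C" "h0 b \<in> carrier G" using ab by auto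
  obtain n1 a1 where a1: "a1 \<in> carrier A" "cg C (s w) 1 (h b [^]\<^bsub>C\<^esub> (p ^ n1)) (s a1)" using C(2)[OF hb(1)] by blast
  have "\<not> cg A w 1 a1 \<zero>\<^bsub>A\<^esub>"
  proof
    assume "cg A w 1 a1 \<zero>\<^bsub>A\<^esub>"
    then have "cg C (s w) 1 (s a1) (s \<zero>\<^bsub>A\<^esub>)" by (rule cg_hom[OF _ s A.is_cring C.is_cring A.w_closed])
    then have "cg C (s w) 1 (h b [^]\<^bsub>C\<^esub> (p ^ n1)) \<zero>\<^bsub>C\<^esub>" using C.cgt[OF a1(2)] by simp
    then show False using C.red_n[OF hb(1)] C(5) by blast
  qed
  then obtain e1 where e1: "e1 \<in> carrier A" "a1 \<otimes>\<^bsub>A\<^esub> e1 = \<one>\<^bsub>A\<^esub>" using A.unit a1(1) by blast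
  \<comment> \<open>An inverse of \<open>h b\<close> modulo \<open>w\<close>: a p-power of
    \<open>h b\<close> is congruent to the image of the unit \<open>a1\<close> of
    \<open>A\<close>.\<close>
  define f where "f = h b [^]\<^bsub>C\<^esub> (p ^ n1 - 1) \<otimes>\<^bsub>C\<^esub> s e1"
  have fc: "f \<in> carrier C" using hb e1 by (simp add: f_def)
  have hbf: "cg C (s w) 1 (h b \<otimes>\<^bsub>C\<^esub> f) \<one>\<^bsub>C\<^esub>"
  proof -
    have "Suc (p ^ n1 - 1) = p ^ n1" using A.p_gt_1 by simp
    then have "h b [^]\<^bsub>C\<^esub> (p ^ n1) = h b \<otimes>\<^bsub>C\<^esub> h b [^]\<^bsub>C\<^esub> (p ^ n1 - 1)" using C.nat_pow_Suc2[OF hb(1), of "p ^ n1 - 1"] by simp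
    then have "h b \<otimes>\<^bsub>C\<^esub> f = h b [^]\<^bsub>C\<^esub> (p ^ n1) \<otimes>\<^bsub>C\<^esub> s e1" using hb e1 by (simp add: f_def C.m_assoc)
    moreover have "s a1 \<otimes>\<^bsub>C\<^esub> s e1 = \<one>\<^bsub>C\<^esub>" using s.hom_mult[OF a1(1) e1(1)] e1(2) by simp
    ultimately show ?thesis using C.cg_mult[OF a1(2) C.cg_refl[of "s e1"] sw] e1 by simp
  qed
  define x' where "x' = f \<otimes>\<^bsub>C\<^esub> h a'"
  have x'c: "x' \<in> carrier C" using fc hb by (simp add: x'_def)
  have hbx: "cg C (s w) 1 (h b \<otimes>\<^bsub>C\<^esub> x') (h a')"
  proof -
    have "h b \<otimes>\<^bsub>C\<^esub> x' = (h b \<otimes>\<^bsub>C\<^esub> f) \<otimes>\<^bsub>C\<^esub> h a'" using fc hb by (simp add: x'_def C.m_assoc)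
    then show ?thesis using C.cg_mult[OF hbf C.cg_refl[OF hb(2) sw] sw] hb by simp
  qed
  obtain n a where a: "a \<in> carrier A" "cg C (s w) 1 (x' [^]\<^bsub>C\<^esub> (p ^ n)) (s a)" using C(2)[OF x'c] by blast
  define q where "q = p ^ n"
  define z where "z = x [^] q \<ominus> g a"
  have zS: "z \<in> S0"
    unfolding z_def a_minus_def using G.subring_pow_closed[OF S0(1) x] S0(2)[OF a(1)] subringE(5,7)[OF S0(1)] by blast
  have zc: "z \<in> carrier G" by (rule S0_carrier[OF zS])
  have "cg G (g w) 1 z \<zero>"
  proof (rule ccontr)
    assume nz: "\<not> cg G (g w) 1 z \<zero>"
    obtain N d where d: "\<And>j. d j \<in> carrier A" "\<not> cg A w 1 (d 0) \<zero>\<^bsub>A\<^esub>" "N > 0"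
      "cg G (g w) 1 (psum G z (\<lambda>j. g (d j)) N) \<zero>" using reduced_relation[OF zS nz] by blast
    \<comment> \<open>In \<open>G\<close>, \<open>z\<close> has the residue of the fraction y/B with
      B = b^q; numerator and denominator exist already in \<open>U\<close>.\<close>
    define B y where "B = b [^]\<^bsub>U\<^esub> q" and "y = a' [^]\<^bsub>U\<^esub> q \<ominus>\<^bsub>U\<^esub> u a \<otimes>\<^bsub>U\<^esub> B"
    have Bc: "B \<in> carrier U" and yc: "y \<in> carrier U" using ab u_closed[OF a(1)] by (auto simp: B_def y_def)
    have gac: "g a \<in> carrier G" "g (d j) \<in> carrier G" for j using g_closed a d by auto
    have h0B: "h0 B = h0 b [^] q" "h0 (a' [^]\<^bsub>U\<^esub> q) = h0 a' [^] q"
      using ring_hom_pow[OF h0_hom U.is_cring G.is_cring] ab by (auto simp: B_def)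
    have hB: "h B = h b [^]\<^bsub>C\<^esub> q" "h (a' [^]\<^bsub>U\<^esub> q) = h a' [^]\<^bsub>C\<^esub> q"
      using ring_hom_pow[OF hh U.is_cring C.is_cring] ab by (auto simp: B_def)
    have h0y: "cg G (g w) 1 (h0 y) (z \<otimes> h0 B)"
    proof -
      have "h0 y = h0 a' [^] q \<ominus> g a \<otimes> h0 B"
        using Bc ab u_closed[OF a(1)] h0B(2) h0_u[OF a(1)] by (simp add: y_def a_minus_def)
      moreover have "cg G (g w) 1 (h0 a' [^] q \<ominus> g a \<otimes> h0 B) ((h0 b \<otimes> x) [^] q \<ominus> g a \<otimes> h0 B)"
        by (rule G.cg_minus[OF G.cg_pow[OF G.cgs[OF ab(4)] gw] G.cg_refl]) (use Bc gac in auto)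
      moreover have "(h0 b \<otimes> x) [^] q \<ominus> g a \<otimes> h0 B = z \<otimes> h0 B"
      proof -
        define Xq Bq ga where "Xq = x [^] q" and "Bq = h0 B" and "ga = g a"
        have c: "Xq \<in> carrier G" "Bq \<in> carrier G" "ga \<in> carrier G" using xc Bc gac by (auto simp: Xq_def Bq_def ga_def)
        have "(h0 b \<otimes> x) [^] q = Bq \<otimes> Xq" using hb xc h0B by (simp add: G.nat_pow_distrib Xq_def Bq_def)
        moreover have "Bq \<otimes> Xq \<ominus> ga \<otimes> Bq = (Xq \<ominus> ga) \<otimes> Bq"
          by (use c in \<open>simp add: G.ring_nf\<close>)
        ultimately show ?thesis by (simp add: z_def Xq_def Bq_def ga_def)
      qed
      ultimately show ?thesis by simp
    qed
    have hy: "cg C (s w) 1 (h y) \<zero>\<^bsub>C\<^esub>"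
    proof -
      have sa: "s a \<in> carrier C" and hBc: "h B \<in> carrier C" using a Bc by auto
      have "h y = h a' [^]\<^bsub>C\<^esub> q \<ominus>\<^bsub>C\<^esub> s a \<otimes>\<^bsub>C\<^esub> h B"
        using Bc ab u_closed[OF a(1)] hB(2) hu[OF a(1)] by (simp add: y_def a_minus_def)
      moreover have "cg C (s w) 1 (h a' [^]\<^bsub>C\<^esub> q \<ominus>\<^bsub>C\<^esub> s a \<otimes>\<^bsub>C\<^esub> h B) (s a \<otimes>\<^bsub>C\<^esub> h B \<ominus>\<^bsub>C\<^esub> s a \<otimes>\<^bsub>C\<^esub> h B)"
      proof (rule C.cg_minus[OF _ C.cg_refl sw])
        have "cg C (s w) 1 (h a' [^]\<^bsub>C\<^esub> q) ((h b \<otimes>\<^bsub>C\<^esub> x') [^]\<^bsub>C\<^esub> q)" by (rule C.cg_pow[OF C.cgs[OF hbx] sw])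
        also have "(h b \<otimes>\<^bsub>C\<^esub> x') [^]\<^bsub>C\<^esub> q = x' [^]\<^bsub>C\<^esub> q \<otimes>\<^bsub>C\<^esub> h B" using hb x'c hB by (simp add: C.nat_pow_distrib C.m_comm)
        also have "cg C (s w) 1 (x' [^]\<^bsub>C\<^esub> q \<otimes>\<^bsub>C\<^esub> h B) (s a \<otimes>\<^bsub>C\<^esub> h B)"
          using C.cg_mult[OF a(2) C.cg_refl[OF hBc sw] sw] by (simp add: q_def)
        finally show "cg C (s w) 1 (h a' [^]\<^bsub>C\<^esub> q) (s a \<otimes>\<^bsub>C\<^esub> h B)" .
      qed (use sa hBc in auto)
      ultimately show ?thesis using sa hBc by (simp add: a_minus_def C.r_neg)
    qed
    \<comment> \<open>The relation homogenised in y and B: powers of B clear the denominators of z =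
      y/B, and the term of index 0 carries the full power B^N.\<close>
    define c where "c = (\<lambda>j. B [^]\<^bsub>U\<^esub> (N - j) \<otimes>\<^bsub>U\<^esub> u (d j))"
    have cc: "c j \<in> carrier U" for j using Bc u_closed[OF d(1)] by (simp add: c_def)
    define Y where "Y = psum U y c N"
    have Yc: "Y \<in> carrier U" using yc cc by (simp add: Y_def)
    have h0Bc: "h0 B \<in> carrier G" using Bc by simp
    have h0c: "h0 (c j) = h0 B [^] (N - j) \<otimes> g (d j)" for j
      using Bc u_closed[OF d(1)] h0_u[OF d(1)] ring_hom_pow[OF h0_hom U.is_cring G.is_cring Bc] by (simp add: c_def)
    have "cg G (g w) 1 (h0 Y) \<zero>"
    proof -
      have "h0 Y = psum G (h0 y) (\<lambda>j. h0 (c j)) N"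
        using psum_hom[OF h0_hom U.is_cring G.is_cring yc cc] by (simp add: Y_def comp_def)
      also have "cg G (g w) 1 \<dots> (psum G (z \<otimes> h0 B) (\<lambda>j. h0 (c j)) N)"
        by (rule G.psum_cg_base[OF gw h0y]) (use cc in auto)
      also have "psum G (z \<otimes> h0 B) (\<lambda>j. h0 (c j)) N = psum G z (\<lambda>j. h0 B [^] j \<otimes> h0 (c j)) N"
        by (rule G.psum_scale[OF zc h0Bc]) (use cc in auto)
      also have "\<dots> = h0 B [^] N \<otimes> psum G z (\<lambda>j. g (d j)) N"
      proof -
        have t: "h0 B [^] j \<otimes> h0 (c j) = h0 B [^] N \<otimes> g (d j)" if "j < N" for j
          using that h0Bc gac G.nat_pow_mult[OF h0Bc, of j "N - j"] by (simp add: h0c G.m_assoc[symmetric])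
        have "psum G z (\<lambda>j. h0 B [^] j \<otimes> h0 (c j)) k = h0 B [^] N \<otimes> psum G z (\<lambda>j. g (d j)) k" if "k \<le> N" for k
          using that by (induction k) (use zc h0Bc gac t in \<open>auto simp: G.r_distr G.m_lcomm\<close>)
        then show ?thesis by simp
      qed
      also have "cg G (g w) 1 \<dots> \<zero>" by (rule G.cg_shift_zero(2)[OF d(4)]) (use h0Bc in auto)
      finally show ?thesis .
    qed
    then have "cg U (u w) 1 Y \<zero>\<^bsub>U\<^esub>" by (rule h0_inj[OF Yc])
    then have hY: "cg C (s w) 1 (h Y) \<zero>\<^bsub>C\<^esub>"
      using cg_hom[OF _ hh U.is_cring C.is_cring U.w_closed] hw h.hom_zero by metis
    have hBc: "h B \<in> carrier C" using Bc by simp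
    obtain N' where N': "N = Suc N'" using d(3) by (cases N) auto
    have "h Y = psum C (h y) (\<lambda>j. h (c j)) N"
      using psum_hom[OF hh U.is_cring C.is_cring yc cc] by (simp add: Y_def comp_def)
    moreover have "cg C (s w) 1 (psum C (h y) (\<lambda>j. h (c j)) N) (psum C \<zero>\<^bsub>C\<^esub> (\<lambda>j. h (c j)) N)"
      by (rule C.psum_cg_base[OF sw hy]) (use cc in auto)
    moreover have "psum C \<zero>\<^bsub>C\<^esub> (\<lambda>j. h (c j)) N = h (c 0)"
      unfolding N' by (rule C.psum_zero_base) (use cc in auto)
    ultimately have "cg C (s w) 1 (h (c 0)) \<zero>\<^bsub>C\<^esub>" using C.cgt[OF C.cgs[of 1 "h Y" "h (c 0)"] hY] by simp
    moreover have "h (c 0) = h B [^]\<^bsub>C\<^esub> N \<otimes>\<^bsub>C\<^esub> s (d 0)"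
      using Bc u_closed[OF d(1)] hu[OF d(1)] ring_hom_pow[OF hh U.is_cring C.is_cring Bc] by (simp add: c_def)
    ultimately have 1: "cg C (s w) 1 (h B [^]\<^bsub>C\<^esub> N \<otimes>\<^bsub>C\<^esub> s (d 0)) \<zero>\<^bsub>C\<^esub>" by simp
    obtain e where e: "e \<in> carrier A" "d 0 \<otimes>\<^bsub>A\<^esub> e = \<one>\<^bsub>A\<^esub>" using A.unit d(1,2) by blast
    have "cg C (s w) 1 (h B [^]\<^bsub>C\<^esub> N \<otimes>\<^bsub>C\<^esub> s (d 0) \<otimes>\<^bsub>C\<^esub> s e) \<zero>\<^bsub>C\<^esub>" by (rule C.cg_shift_zero(1)[OF 1]) (use e in auto)
    moreover have "h B [^]\<^bsub>C\<^esub> N \<otimes>\<^bsub>C\<^esub> s (d 0) \<otimes>\<^bsub>C\<^esub> s e = h B [^]\<^bsub>C\<^esub> N"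
    proof -
      have "s (d 0) \<otimes>\<^bsub>C\<^esub> s e = \<one>\<^bsub>C\<^esub>" using s.hom_mult[OF d(1)[of 0] e(1)] e(2) by simp
      then show ?thesis using hBc d(1) e(1) by (simp add: C.m_assoc)
    qed
    ultimately have "cg C (s w) 1 (h B [^]\<^bsub>C\<^esub> N) \<zero>\<^bsub>C\<^esub>" by simp
    then have "cg C (s w) 1 (h B) \<zero>\<^bsub>C\<^esub>" by (rule C.nilpotent_mod[OF hBc])
    then have "cg C (s w) 1 (h b [^]\<^bsub>C\<^esub> q) \<zero>\<^bsub>C\<^esub>" by (simp add: hB)
    then have "cg C (s w) 1 (h b) \<zero>\<^bsub>C\<^esub>" by (rule C.nilpotent_mod[OF hb(1)])
    then show False using C(5) by blast
  qed
  then have "cg G (g w) 1 (x [^] (p ^ n)) (g a)"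
    using G.cg_diff_iff[of "x [^] q" "g a" "g w" 1] xc g_closed[OF a(1)] by (simp add: z_def q_def)
  then show ?thesis using a(1) by blast
qed

lemma generate_powers:
  assumes "e \<in> generate_ring A ((\<lambda>d. d [^]\<^bsub>A\<^esub> p) ` carrier A)"
  shows "\<exists>b\<in>carrier A. cg A w 1 e (b [^]\<^bsub>A\<^esub> p)"
  using assms
proof (induction rule: generate_ring.induct)
  case one
  then show ?case by (intro bexI[of _ "\<one>\<^bsub>A\<^esub>"]) (auto intro: A.cg_refl)
next
  case (incl x)
  then obtain b where "b \<in> carrier A" "x = b [^]\<^bsub>A\<^esub> p" by blast
  then show ?case by (intro bexI[of _ b]) (auto intro: A.cg_refl)
next
  case (a_inv x)
  then obtain b where b: "b \<in> carrier A" "cg A w 1 x (b [^]\<^bsub>A\<^esub> p)" by blast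
  have "cg A w 1 (\<ominus>\<^bsub>A\<^esub> x) ((\<ominus>\<^bsub>A\<^esub> b) [^]\<^bsub>A\<^esub> p)"
    using A.cgt[OF A.cg_neg[OF b(2) A.w_closed] A.cgs[OF A.frob_neg_n[OF b(1), of 1, unfolded power_one_right]]] .
  then show ?case using b by blast
next
  case (eng_add x y)
  then obtain b c where b: "b \<in> carrier A" "cg A w 1 x (b [^]\<^bsub>A\<^esub> p)" "c \<in> carrier A" "cg A w 1 y (c [^]\<^bsub>A\<^esub> p)" by blast
  have "cg A w 1 (x \<oplus>\<^bsub>A\<^esub> y) ((b \<oplus>\<^bsub>A\<^esub> c) [^]\<^bsub>A\<^esub> p)"
    by (rule A.cgt[OF A.cg_add[OF b(2,4) A.w_closed] A.cgs[OF A.frob_add[OF b(1,3)]]])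
  then show ?case using b by blast
next
  case (eng_mult x y)
  then obtain b c where b: "b \<in> carrier A" "cg A w 1 x (b [^]\<^bsub>A\<^esub> p)" "c \<in> carrier A" "cg A w 1 y (c [^]\<^bsub>A\<^esub> p)" by blast
  have "cg A w 1 (x \<otimes>\<^bsub>A\<^esub> y) ((b \<otimes>\<^bsub>A\<^esub> c) [^]\<^bsub>A\<^esub> p)"
    using A.cg_mult[OF b(2,4) A.w_closed] b by (simp add: A.nat_pow_distrib)
  then show ?case using b by blast
qed

text \<open>In an object where t + w a' is a p-th power, the second digit of t has residue - a'. If
  a p-power of that digit has its residue in \<open>A\<close>, this residue has to fit every choice
  of a' at once.\<close>

lemma second_digit_specialization:
  assumes t: "t \<in> carrier A" "\<And>b. b \<in> carrier A \<Longrightarrow> \<not> cg A w 1 t (b [^]\<^bsub>A\<^esub> p)"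
    and c: "c \<in> carrier A" "cg U (u w) 1 (U.dig (u t) 1 [^]\<^bsub>U\<^esub> (p ^ n)) (\<ominus>\<^bsub>U\<^esub> u c)" and a': "a' \<in> carrier A"
  shows "cg A w 1 (a' [^]\<^bsub>A\<^esub> (p ^ n)) c"
proof -
  define t' where "t' = t \<oplus>\<^bsub>A\<^esub> w \<otimes>\<^bsub>A\<^esub> a'"
  have t'c: "t' \<in> carrier A" using t a' by (simp add: t'_def)
  have t't: "cg A w 1 t' t" by (rule A.cgI[of _ _ a']) (use t a' in \<open>auto simp: t'_def\<close>)
  obtain C :: "'b ring" and s where C: "CRP p A C s" "\<And>k. k < (1::nat) \<Longrightarrow> \<exists>y\<in>carrier C. s t' = y [^]\<^bsub>C\<^esub> (p ^ 1)"
    "\<not> cg C (s w) 1 \<one>\<^bsub>C\<^esub> \<zero>\<^bsub>C\<^esub>"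
  \<comment> \<open>A single root of height one is prescribed. There are no preceding elements, so
    the independence condition only says that \<open>t'\<close> is not a p-th power modulo
    \<open>w\<close>.\<close>
  proof (rule exists_CRP[OF K u_hom U_pcr U_nontriv, where r = 1 and t = "\<lambda>_. t'" and M = 1])
    show "\<not> cg A w 1 t' e" if k: "k < 1" "e \<in> generate_ring A ((\<lambda>d. d [^]\<^bsub>A\<^esub> p) ` carrier A \<union> (\<lambda>_. t') ` {..<k})" for k :: nat and e
    proof
      assume a: "cg A w 1 t' e"
      obtain b where b: "b \<in> carrier A" "cg A w 1 e (b [^]\<^bsub>A\<^esub> p)" using generate_powers[of e] k by auto
      have "cg A w 1 t (b [^]\<^bsub>A\<^esub> p)" using A.cgt[OF A.cgs[OF t't] A.cgt[OF a b(2)]] .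
      then show False using t(2)[OF b(1)] by blast
    qed
  qed (rule t'c, rule that)
  obtain h where h: "h \<in> alg_homs A U u C s" using init C(1) unfolding CRP_initial_def by blast
  have s: "s \<in> ring_hom A C" and Cp: "pcr C (s w) p" using C(1) by (auto simp: CRP_iff)
  interpret C: pcr C "s w" p by (rule Cp)
  have hh: "h \<in> ring_hom U C" and hu: "\<And>a. a \<in> carrier A \<Longrightarrow> h (u a) = s a" using h by (auto simp: alg_homs_def)
  interpret h: ring_hom_cring U C h using hh U.is_cring C.is_cring by (intro ring_hom_cringI) auto
  interpret s: ring_hom_cring A C s using s A.is_cring C.is_cring by (intro ring_hom_cringI) auto
  have hw: "h (u w) = s w" by (rule hu) simp
  obtain y where y: "y \<in> carrier C" "s t' = y [^]\<^bsub>C\<^esub> p" using C(2)[of 0] by auto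
  have ut: "u t \<in> carrier U" by (rule u_closed[OF t(1)])
  define d1 where "d1 = U.dig (u t) 1"
  have d1c: "d1 \<in> carrier U" using ut by (simp add: d1_def)
  have exp: "cg U (u w) 2 (u t) (U.dig (u t) 0 \<oplus>\<^bsub>U\<^esub> u w \<otimes>\<^bsub>U\<^esub> d1)"
    using U.cg_expansion[OF ut, of 2] ut by (simp add: numeral_2_eq_2 d1_def)
  have sa: "s a' \<in> carrier C" using a' by simp
  have "cg C (s w) 1 (h d1) (\<ominus>\<^bsub>C\<^esub> s a')"
  proof (rule C.second_digit)
    show "C.tm (h (U.dig (u t) 0))" by (rule tm_hom[OF U_pcr Cp hh U.dig_tm[OF ut]])
    show "cg C (s w) 2 (s t) (h (U.dig (u t) 0) \<oplus>\<^bsub>C\<^esub> s w \<otimes>\<^bsub>C\<^esub> h d1)"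
      using cg_hom[OF exp hh U.is_cring C.is_cring U.w_closed] ut d1c hw hu[OF t(1)] by simp
    show "s t \<oplus>\<^bsub>C\<^esub> s w \<otimes>\<^bsub>C\<^esub> s a' = y [^]\<^bsub>C\<^esub> p" using y(2) t(1) a' by (simp add: t'_def)
  qed (use d1c sa y in auto)
  then have "cg C (s w) 1 (h d1 [^]\<^bsub>C\<^esub> (p ^ n)) ((\<ominus>\<^bsub>C\<^esub> s a') [^]\<^bsub>C\<^esub> (p ^ n))" by (rule C.cg_pow) simp
  also have "cg C (s w) 1 ((\<ominus>\<^bsub>C\<^esub> s a') [^]\<^bsub>C\<^esub> (p ^ n)) (\<ominus>\<^bsub>C\<^esub> (s a' [^]\<^bsub>C\<^esub> (p ^ n)))" by (rule C.frob_neg_n[OF sa])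
  finally have 1: "cg C (s w) 1 (h d1 [^]\<^bsub>C\<^esub> (p ^ n)) (\<ominus>\<^bsub>C\<^esub> (s a' [^]\<^bsub>C\<^esub> (p ^ n)))" .
  have uc: "u c \<in> carrier U" by (rule u_closed[OF c(1)])
  have "cg C (s w) 1 (h (d1 [^]\<^bsub>U\<^esub> (p ^ n))) (h (\<ominus>\<^bsub>U\<^esub> u c))"
    using cg_hom[OF c(2) hh U.is_cring C.is_cring U.w_closed] hw by (simp add: d1_def)
  moreover have "h (d1 [^]\<^bsub>U\<^esub> (p ^ n)) = h d1 [^]\<^bsub>C\<^esub> (p ^ n)" by (rule ring_hom_pow[OF hh U.is_cring C.is_cring d1c])
  moreover have "h (\<ominus>\<^bsub>U\<^esub> u c) = \<ominus>\<^bsub>C\<^esub> s c" using uc hu[OF c(1)] by simp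
  ultimately have "cg C (s w) 1 (h d1 [^]\<^bsub>C\<^esub> (p ^ n)) (\<ominus>\<^bsub>C\<^esub> s c)" by simp
  then have "cg C (s w) 1 (\<ominus>\<^bsub>C\<^esub> (s a' [^]\<^bsub>C\<^esub> (p ^ n))) (\<ominus>\<^bsub>C\<^esub> s c)" by (rule C.cgt[OF C.cgs[OF 1]])
  then have "cg C (s w) 1 (\<ominus>\<^bsub>C\<^esub> (\<ominus>\<^bsub>C\<^esub> (s a' [^]\<^bsub>C\<^esub> (p ^ n)))) (\<ominus>\<^bsub>C\<^esub> (\<ominus>\<^bsub>C\<^esub> s c))" by (rule C.cg_neg) simp
  then have "cg C (s w) 1 (s (a' [^]\<^bsub>A\<^esub> (p ^ n))) (s c)"
    using sa c(1) ring_hom_pow[OF s A.is_cring C.is_cring a'] by simp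
  then show ?thesis by (rule cg_of_hom[OF C.is_cring s C(3), rotated 2]) (use a' c in auto)
qed

text \<open>Suppose t is not a p-th power modulo \<open>w\<close>. In x^p = t + w b the element b
  lies in \<open>S0\<close> again, and - b has the residue of the second digit of t. By
  \<open>power_in_A\<close> some p-power of that digit has its residue in \<open>A\<close>, already
  in \<open>U\<close> by injectivity, which \<open>second_digit_specialization\<close> refutes with
  a' = 0 and a' = 1.\<close>

lemma p_root_in_A:
  assumes x: "x \<in> S0" and t: "t \<in> carrier A" "cg G (g w) 1 (x [^] p) (g t)"
  shows "\<exists>a\<in>carrier A. cg G (g w) 1 x (g a)"
proof (cases "\<exists>b\<in>carrier A. cg A w 1 t (b [^]\<^bsub>A\<^esub> p)")
  case True
  then obtain b where b: "b \<in> carrier A" "cg A w 1 t (b [^]\<^bsub>A\<^esub> p)" by blast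
  have "cg G (g w) 1 (g t) (g (b [^]\<^bsub>A\<^esub> p))" by (rule cg_hom[OF b(2) g_hom A.is_cring G.is_cring]) simp
  then have "cg G (g w) 1 (x [^] p) (g b [^] p)"
    using G.cgt[OF t(2)] ring_hom_pow[OF g_hom A.is_cring G.is_cring b(1)] by simp
  then have "cg G (g w) 1 x (g b)"
    using G.frob_inj_n[OF S0_carrier[OF x] g_closed[OF b(1)], of 1] by simp
  then show ?thesis using b by blast
next
  case False
  then have np: "\<And>b. b \<in> carrier A \<Longrightarrow> \<not> cg A w 1 t (b [^]\<^bsub>A\<^esub> p)" by blast
  have xc: "x \<in> carrier G" by (rule S0_carrier[OF x])
  have gt: "g t \<in> carrier G" by (rule g_closed[OF t(1)])
  interpret h0: ring_hom_cring U G h0 using h0_hom U.is_cring G.is_cring by (intro ring_hom_cringI) auto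
  have h0w: "h0 (u w) = g w" by (rule h0_u) simp
  obtain b where b: "b \<in> carrier G" "x [^] p = g t \<oplus> g w \<otimes> b" using t(2) by (auto simp: cg_def)
  have "b \<in> S0"
  proof (rule S0_divide[OF b(1)])
    define q where "q = g w \<otimes> b"
    have qc: "q \<in> carrier G" using b by (simp add: q_def)
    have "(g t \<oplus> q) \<oplus> \<ominus> g t = q" by (rule G.add_minus_cancel[OF gt qc])
    moreover have "x [^] p \<oplus> \<ominus> g t \<in> S0"
      using G.subring_pow_closed[OF S0(1) x] S0(2)[OF t(1)] subringE(5,7)[OF S0(1)] by blast
    ultimately show "g w \<otimes> b \<in> S0" using b(2) by (simp add: q_def)
  qed
  then obtain n c where c: "c \<in> carrier A" "cg G (g w) 1 (b [^] (p ^ n)) (g c)" using power_in_A by blast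
  have ut: "u t \<in> carrier U" by (rule u_closed[OF t(1)])
  have uc: "u c \<in> carrier U" by (rule u_closed[OF c(1)])
  define d1 where "d1 = U.dig (u t) 1"
  have d1c: "d1 \<in> carrier U" using ut by (simp add: d1_def)
  have exp: "cg U (u w) 2 (u t) (U.dig (u t) 0 \<oplus>\<^bsub>U\<^esub> u w \<otimes>\<^bsub>U\<^esub> d1)"
    using U.cg_expansion[OF ut, of 2] ut by (simp add: numeral_2_eq_2 d1_def)
  have "cg G (g w) 1 (h0 d1) (\<ominus> b)"
  proof (rule G.second_digit)
    show "G.tm (h0 (U.dig (u t) 0))" by (rule tm_hom[OF U_pcr G_pcr h0_hom U.dig_tm[OF ut]])
    show "cg G (g w) 2 (g t) (h0 (U.dig (u t) 0) \<oplus> g w \<otimes> h0 d1)"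
      using cg_hom[OF exp h0_hom U.is_cring G.is_cring U.w_closed] ut d1c h0w h0_u[OF t(1)] by simp
    show "g t \<oplus> g w \<otimes> b = x [^] p" using b(2) by simp
  qed (use d1c b xc in auto)
  then have "cg G (g w) 1 (h0 d1 [^] (p ^ n)) ((\<ominus> b) [^] (p ^ n))" by (rule G.cg_pow) simp
  also have "cg G (g w) 1 ((\<ominus> b) [^] (p ^ n)) (\<ominus> (b [^] (p ^ n)))" by (rule G.frob_neg_n[OF b(1)])
  also have "cg G (g w) 1 (\<ominus> (b [^] (p ^ n))) (\<ominus> g c)" by (rule G.cg_neg[OF c(2)]) simp
  finally have 1: "cg G (g w) 1 (h0 d1 [^] (p ^ n)) (\<ominus> g c)" .
  have "cg U (u w) 1 (d1 [^]\<^bsub>U\<^esub> (p ^ n) \<ominus>\<^bsub>U\<^esub> \<ominus>\<^bsub>U\<^esub> u c) \<zero>\<^bsub>U\<^esub>"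
  proof (rule h0_inj)
    have "h0 (d1 [^]\<^bsub>U\<^esub> (p ^ n)) = h0 d1 [^] (p ^ n)" by (rule ring_hom_pow[OF h0_hom U.is_cring G.is_cring d1c])
    then have "h0 (d1 [^]\<^bsub>U\<^esub> (p ^ n) \<ominus>\<^bsub>U\<^esub> \<ominus>\<^bsub>U\<^esub> u c) = h0 d1 [^] (p ^ n) \<ominus> \<ominus> g c"
      using d1c uc h0_u[OF c(1)] g_closed[OF c(1)] by (simp add: a_minus_def)
    then show "cg G (g w) 1 (h0 (d1 [^]\<^bsub>U\<^esub> (p ^ n) \<ominus>\<^bsub>U\<^esub> \<ominus>\<^bsub>U\<^esub> u c)) \<zero>"
      using 1 G.cg_diff_iff[of "h0 d1 [^] (p ^ n)" "\<ominus> g c" "g w" 1] d1c g_closed[OF c(1)] by simp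
  qed (use d1c uc in auto)
  then have 2: "cg U (u w) 1 (U.dig (u t) 1 [^]\<^bsub>U\<^esub> (p ^ n)) (\<ominus>\<^bsub>U\<^esub> u c)"
    using U.cg_diff_iff[of "d1 [^]\<^bsub>U\<^esub> (p ^ n)" "\<ominus>\<^bsub>U\<^esub> u c" "u w" 1] d1c uc by (simp add: d1_def)
  have "cg A w 1 (\<zero>\<^bsub>A\<^esub> [^]\<^bsub>A\<^esub> (p ^ n)) c" "cg A w 1 (\<one>\<^bsub>A\<^esub> [^]\<^bsub>A\<^esub> (p ^ n)) c"
    by (rule second_digit_specialization[OF t(1) np c(1) 2]; simp)+
  then have "cg A w 1 \<zero>\<^bsub>A\<^esub> c" and "cg A w 1 \<one>\<^bsub>A\<^esub> c" using A.p_gt_1 by (simp_all add: A.nat_pow_zero)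
  then show ?thesis using A.nontriv A.cgt[OF _ A.cgs, of 1 "\<one>\<^bsub>A\<^esub>" c "\<zero>\<^bsub>A\<^esub>"] by blast
qed

lemma residue_in_A:
  assumes x: "x \<in> S0" shows "\<exists>a\<in>carrier A. cg G (g w) 1 x (g a)"
proof -
  have *: "x \<in> S0 \<Longrightarrow> \<exists>a\<in>carrier A. cg G (g w) 1 (x [^] (p ^ n)) (g a) \<Longrightarrow> \<exists>a\<in>carrier A. cg G (g w) 1 x (g a)" for n x
  proof (induction n arbitrary: x)
    case 0
    then show ?case using S0_carrier by simp
  next
    case (Suc n)
    have "x [^] (p ^ Suc n) = (x [^] p) [^] (p ^ n)" using S0_carrier[OF Suc.prems(1)] by (simp add: G.nat_pow_pow)
    then have "\<exists>a\<in>carrier A. cg G (g w) 1 (x [^] p) (g a)"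
      using Suc.IH[OF G.subring_pow_closed[OF S0(1) Suc.prems(1)]] Suc.prems(2) by simp
    then show ?case using p_root_in_A[OF Suc.prems(1)] by blast
  qed
  show ?thesis using power_in_A[OF x] *[OF x] by blast
qed

lemma cg_of_g: "a \<in> carrier A \<Longrightarrow> b \<in> carrier A \<Longrightarrow> cg G (g w) n (g a) (g b) \<Longrightarrow> cg A w n a b"
proof (induction n arbitrary: a b)
  case 0
  then show ?case by (simp add: A.cg_0)
next
  case (Suc n)
  interpret g: ring_hom_cring A G g using g_hom A.is_cring G.is_cring by (intro ring_hom_cringI) auto
  have "cg G (g w) 1 (g a) (g b)" by (rule G.cg_mono[OF Suc.prems(3)]) auto
  then have "cg A w 1 a b" by (rule cg_of_hom[OF G.is_cring g_hom G.nontriv Suc.prems(1,2)])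
  then obtain c where c: "c \<in> carrier A" "a = b \<oplus>\<^bsub>A\<^esub> w \<otimes>\<^bsub>A\<^esub> c" by (auto simp: cg_def)
  define q where "q = g w \<otimes> g c"
  have gc: "q \<in> carrier G" "g b \<in> carrier G" "g c \<in> carrier G" using c Suc.prems by (auto simp: q_def)
  have "cg G (g w) (Suc n) ((g b \<oplus> q) \<ominus> g b) (g b \<ominus> g b)"
    using G.cg_minus[OF Suc.prems(3) G.cg_refl[OF gc(2) G.w_closed] G.w_closed] c Suc.prems by (simp add: q_def)
  moreover have "(g b \<oplus> q) \<ominus> g b = q" using G.add_minus_cancel[OF gc(2,1)] by (simp add: a_minus_def)
  moreover have "g b \<ominus> g b = g w \<otimes> \<zero>" using gc by (simp add: a_minus_def G.r_neg)
  ultimately have "cg G (g w) (Suc n) (g w \<otimes> g c) (g w \<otimes> \<zero>)" by (simp add: q_def)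
  then have "cg G (g w) n (g c) \<zero>" by (rule G.cg_cancel1) (use gc in auto)
  then have "cg A w n c \<zero>\<^bsub>A\<^esub>" using Suc.IH[OF c(1) A.zero_closed] by simp
  then have "cg A w (1 + n) (w [^]\<^bsub>A\<^esub> (1::nat) \<otimes>\<^bsub>A\<^esub> c) (w [^]\<^bsub>A\<^esub> (1::nat) \<otimes>\<^bsub>A\<^esub> \<zero>\<^bsub>A\<^esub>)" by (rule A.cg_mult_pow) simp
  then have "cg A w (Suc n) (w \<otimes>\<^bsub>A\<^esub> c) \<zero>\<^bsub>A\<^esub>" by simp
  then have "cg A w (Suc n) (b \<oplus>\<^bsub>A\<^esub> w \<otimes>\<^bsub>A\<^esub> c) (b \<oplus>\<^bsub>A\<^esub> \<zero>\<^bsub>A\<^esub>)"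
    by (rule A.cg_add[OF A.cg_refl[OF Suc.prems(2) A.w_closed] _ A.w_closed])
  then show ?case using c Suc.prems by simp
qed

theorem S0_eq:
  assumes x: "x \<in> S0" shows "\<exists>a\<in>carrier A. x = g a"
proof -
  interpret g: ring_hom_cring A G g using g_hom A.is_cring G.is_cring by (intro ring_hom_cringI) auto
  have "\<exists>a y. a \<in> carrier A \<and> y \<in> S0 \<and> x = g a \<oplus> g w [^] n \<otimes> y" for n :: nat
  proof (induction n)
    case 0
    show ?case using S0_carrier[OF x] x by (intro exI[of _ "\<zero>\<^bsub>A\<^esub>"] exI[of _ x]) auto
  next
    case (Suc n)
    then obtain a y where a: "a \<in> carrier A" "y \<in> S0" "x = g a \<oplus> g w [^] n \<otimes> y" by blast
    obtain b where b: "b \<in> carrier A" "cg G (g w) 1 y (g b)" using residue_in_A[OF a(2)] by blast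
    obtain z where z: "z \<in> carrier G" "y = g b \<oplus> g w \<otimes> z" using b(2) by (auto simp: cg_def)
    have c: "g a \<in> carrier G" "g b \<in> carrier G" using a b by auto
    \<comment> \<open>Saturation keeps the remainder in \<open>S0\<close>, so that its residue comes
      from \<open>A\<close> again.\<close>
    have "z \<in> S0"
    proof (rule S0_divide[OF z(1)])
      define q where "q = g w \<otimes> z"
      have qc: "q \<in> carrier G" using z by (simp add: q_def)
      have "(g b \<oplus> q) \<oplus> \<ominus> g b = q" by (rule G.add_minus_cancel[OF c(2) qc])
      moreover have "y \<oplus> \<ominus> g b \<in> S0" using a(2) S0(2)[OF b(1)] subringE(5,7)[OF S0(1)] by blast
      ultimately show "g w \<otimes> z \<in> S0" using z(2) by (simp add: q_def)
    qed
    moreover have "x = g (a \<oplus>\<^bsub>A\<^esub> w [^]\<^bsub>A\<^esub> n \<otimes>\<^bsub>A\<^esub> b) \<oplus> g w [^] Suc n \<otimes> z"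
    proof -
      have "g (a \<oplus>\<^bsub>A\<^esub> w [^]\<^bsub>A\<^esub> n \<otimes>\<^bsub>A\<^esub> b) = g a \<oplus> g w [^] n \<otimes> g b"
        using a b ring_hom_pow[OF g_hom A.is_cring G.is_cring A.w_closed] by simp
      then show ?thesis using a(3) z c by (simp add: G.r_distr G.a_assoc G.m_assoc)
    qed
    moreover have "a \<oplus>\<^bsub>A\<^esub> w [^]\<^bsub>A\<^esub> n \<otimes>\<^bsub>A\<^esub> b \<in> carrier A" using a b by simp
    ultimately show ?case by blast
  qed
  then obtain a y where a: "\<And>n. a n \<in> carrier A" "\<And>n. y n \<in> S0" "\<And>n. x = g (a n) \<oplus> g w [^] (n::nat) \<otimes> y n" by metis
  have xa: "cg G (g w) n x (g (a n))" for n
    by (rule G.cgI[OF _ _ _ a(3)]) (use a(1) S0_carrier[OF a(2)] in auto)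
  have "cg A w n (a (Suc n)) (a n)" for n
    by (rule cg_of_g[OF a(1) a(1)], rule G.cgt[OF G.cgs[OF G.cg_mono[OF xa[of "Suc n"]]] xa]) auto
  then obtain b where b: "\<And>n. cg A w n b (a n)" using A.complete[of a] by blast
  have bc: "b \<in> carrier A" by (rule cg_carrier(1)[OF b[of 0]])
  have "cg G (g w) n x (g b)" for n
    using G.cgt[OF xa G.cgs[OF cg_hom[OF b g_hom A.is_cring G.is_cring A.w_closed]]] .
  then have "x = g b" by (rule G.eq_if_cg_all)
  then show ?thesis using bc by blast
qed

end

section \<open>Fraction fields\<close>

text \<open>Brings the hypothesis on residue rings into the form of the axioms of
  \<open>generic\<close>. That \<open>G\<close> is a discrete valuation ring follows because its
  residue ring is a field and completeness lifts inverses.\<close>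

lemma (in base) residue_field_extension:
  assumes U: "CRP p A U u" and G: "CRP p A G g" and h: "h \<in> alg_homs A U u G g"
    and ff: "fraction_field (residual_ring A U u) (residual_ring A G g) (residual_map A G g h)"
  shows "\<not> cg U (u w) 1 \<one>\<^bsub>U\<^esub> \<zero>\<^bsub>U\<^esub>"
    and "x \<in> carrier U \<Longrightarrow> cg G (g w) 1 (h x) \<zero>\<^bsub>G\<^esub> \<Longrightarrow> cg U (u w) 1 x \<zero>\<^bsub>U\<^esub>"
    and "y \<in> carrier G \<Longrightarrow>
      \<exists>a\<in>carrier U. \<exists>b\<in>carrier U. \<not> cg U (u w) 1 b \<zero>\<^bsub>U\<^esub> \<and> cg G (g w) 1 (h b \<otimes>\<^bsub>G\<^esub> y) (h a)"
    and "cdv G (g w) p"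
proof -
  have u: "u \<in> ring_hom A U" and Up: "pcr U (u w) p" using U by (auto simp: CRP_iff)
  have g: "g \<in> ring_hom A G" and Gp: "pcr G (g w) p" using G by (auto simp: CRP_iff)
  interpret U: pcr U "u w" p by (rule Up)
  interpret G: pcr G "g w" p by (rule Gp)
  have hh: "h \<in> ring_hom U G" and hu: "\<And>a. a \<in> carrier A \<Longrightarrow> h (u a) = g a" using h by (auto simp: alg_homs_def)
  interpret h: ring_hom_cring U G h using hh U.is_cring G.is_cring by (intro ring_hom_cringI) auto
  have hw: "h (u w) = g w" by (rule hu) simp
  have uw: "u w \<in> carrier U" and gw: "g w \<in> carrier G" by auto
  define I J where "I = PIdl\<^bsub>U\<^esub> (u w)" and "J = PIdl\<^bsub>G\<^esub> (g w)"
  define rm where "rm = residual_map A G g h"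
  have rU: "residual_ring A U u = U Quot I" by (simp add: residual_ring_def ext_ideal_eq[OF U.is_cring u] I_def)
  have rG: "residual_ring A G g = G Quot J" by (simp add: residual_ring_def ext_ideal_eq[OF G.is_cring g] J_def)
  note Ieq = U.Quot_eq_iff[OF uw, folded I_def] and Jeq = G.Quot_eq_iff[OF gw, folded J_def]
  note Jhom = G.Quot_hom[OF gw, folded J_def]
  have map: "rm (I +>\<^bsub>U\<^esub> x) = J +>\<^bsub>G\<^esub> h x" if x: "x \<in> carrier U" for x
  proof -
    have m1: "J +>\<^bsub>G\<^esub> h z = J +>\<^bsub>G\<^esub> h x" if z: "z \<in> I +>\<^bsub>U\<^esub> x" for z
    proof -
      obtain r where r: "r \<in> carrier U" "z = r \<otimes>\<^bsub>U\<^esub> u w \<oplus>\<^bsub>U\<^esub> x"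
        using z by (auto simp: I_def a_r_coset_def' cgenideal_def)
      have "cg U (u w) 1 z x" by (rule U.cgI[OF x uw r(1)]) (use r x in \<open>simp add: U.a_comm U.m_comm\<close>)
      then have "cg G (g w) 1 (h z) (h x)" using cg_hom[OF _ hh U.is_cring G.is_cring uw] hw by metis
      then show ?thesis using Jeq[of "h z" "h x"] cg_carrier by metis
    qed
    have m2: "x \<in> I +>\<^bsub>U\<^esub> x"
    proof -
      have "\<zero>\<^bsub>U\<^esub> \<otimes>\<^bsub>U\<^esub> u w \<in> I" unfolding I_def cgenideal_def by blast
      then have "\<zero>\<^bsub>U\<^esub> \<otimes>\<^bsub>U\<^esub> u w \<oplus>\<^bsub>U\<^esub> x \<in> I +>\<^bsub>U\<^esub> x" unfolding a_r_coset_def' by blast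
      then show ?thesis using x by simp
    qed
    show ?thesis
      unfolding rm_def residual_map_def ext_ideal_eq[OF G.is_cring g] J_def[symmetric]
      by (rule UN_constant_eq[OF m2]) (use m1 in blast)
  qed
  have D: "domain (U Quot I)" and F: "field (G Quot J)" and rm: "rm \<in> ring_hom (U Quot I) (G Quot J)"
    and inj: "inj_on rm (carrier (U Quot I))"
    and fr: "\<forall>x\<in>carrier (G Quot J). \<exists>a\<in>carrier (U Quot I). \<exists>b\<in>carrier (U Quot I) - {\<zero>\<^bsub>U Quot I\<^esub>}.
      x = rm a \<otimes>\<^bsub>G Quot J\<^esub> inv\<^bsub>G Quot J\<^esub> (rm b)"
    using ff unfolding fraction_field_def rU rG rm_def[symmetric] by auto
  interpret F: field "G Quot J" by (rule F)
  note U0 = U.Quot_zero[OF uw, folded I_def] U.Quot_one[OF uw, folded I_def]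
  note G0 = G.Quot_zero[OF gw, folded J_def] G.Quot_one[OF gw, folded J_def]
  show "\<not> cg U (u w) 1 \<one>\<^bsub>U\<^esub> \<zero>\<^bsub>U\<^esub>"
    using domain.one_not_zero[OF D] Ieq[of "\<one>\<^bsub>U\<^esub>" "\<zero>\<^bsub>U\<^esub>"] by (simp add: U0)
  have injz: "cg U (u w) 1 x \<zero>\<^bsub>U\<^esub>" if x: "x \<in> carrier U" "cg G (g w) 1 (h x) \<zero>\<^bsub>G\<^esub>" for x
  proof -
    have "rm (I +>\<^bsub>U\<^esub> x) = rm (I +>\<^bsub>U\<^esub> \<zero>\<^bsub>U\<^esub>)"
      using map[OF x(1)] map[OF U.zero_closed] Jeq[of "h x" "\<zero>\<^bsub>G\<^esub>"] x by simp
    then have "I +>\<^bsub>U\<^esub> x = I +>\<^bsub>U\<^esub> \<zero>\<^bsub>U\<^esub>" by (rule inj_onD[OF inj]) (use x in \<open>auto simp: U.Quot_carrier\<close>)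
    then show ?thesis using Ieq[of x "\<zero>\<^bsub>U\<^esub>"] x by simp
  qed
  then show "x \<in> carrier U \<Longrightarrow> cg G (g w) 1 (h x) \<zero>\<^bsub>G\<^esub> \<Longrightarrow> cg U (u w) 1 x \<zero>\<^bsub>U\<^esub>" by blast
  show "\<exists>a\<in>carrier U. \<exists>b\<in>carrier U. \<not> cg U (u w) 1 b \<zero>\<^bsub>U\<^esub> \<and> cg G (g w) 1 (h b \<otimes>\<^bsub>G\<^esub> y) (h a)" if y: "y \<in> carrier G"
  proof -
    have "J +>\<^bsub>G\<^esub> y \<in> carrier (G Quot J)" using y by (auto simp: G.Quot_carrier)
    then obtain ca cb where cab: "ca \<in> carrier (U Quot I)" "cb \<in> carrier (U Quot I)" "cb \<noteq> \<zero>\<^bsub>U Quot I\<^esub>"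
      "J +>\<^bsub>G\<^esub> y = rm ca \<otimes>\<^bsub>G Quot J\<^esub> inv\<^bsub>G Quot J\<^esub> (rm cb)" using fr by blast
    obtain a b where ab: "a \<in> carrier U" "ca = I +>\<^bsub>U\<^esub> a" "b \<in> carrier U" "cb = I +>\<^bsub>U\<^esub> b"
      using cab(1,2) by (auto simp: U.Quot_carrier)
    have bnz: "\<not> cg U (u w) 1 b \<zero>\<^bsub>U\<^esub>" using cab(3) Ieq[of b "\<zero>\<^bsub>U\<^esub>"] ab by (simp add: U0)
    have c: "J +>\<^bsub>G\<^esub> h a \<in> carrier (G Quot J)" "J +>\<^bsub>G\<^esub> h b \<in> carrier (G Quot J)" using ab by (auto simp: G.Quot_carrier)
    have "J +>\<^bsub>G\<^esub> h b \<noteq> \<zero>\<^bsub>G Quot J\<^esub>" using bnz injz[OF ab(3)] Jeq[of "h b" "\<zero>\<^bsub>G\<^esub>"] ab by (auto simp: G0)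
    then have "(J +>\<^bsub>G\<^esub> h b) \<in> Units (G Quot J)" using c F.field_Units by simp
    then have inv: "inv\<^bsub>G Quot J\<^esub> (J +>\<^bsub>G\<^esub> h b) \<in> carrier (G Quot J)"
      "(J +>\<^bsub>G\<^esub> h b) \<otimes>\<^bsub>G Quot J\<^esub> inv\<^bsub>G Quot J\<^esub> (J +>\<^bsub>G\<^esub> h b) = \<one>\<^bsub>G Quot J\<^esub>" by auto
    have "J +>\<^bsub>G\<^esub> (h b \<otimes>\<^bsub>G\<^esub> y) = (J +>\<^bsub>G\<^esub> h b) \<otimes>\<^bsub>G Quot J\<^esub> (J +>\<^bsub>G\<^esub> y)"
      using ring_hom_mult[OF Jhom, of "h b" y] ab y by simp
    also have "\<dots> = (J +>\<^bsub>G\<^esub> h b) \<otimes>\<^bsub>G Quot J\<^esub> ((J +>\<^bsub>G\<^esub> h a) \<otimes>\<^bsub>G Quot J\<^esub> inv\<^bsub>G Quot J\<^esub> (J +>\<^bsub>G\<^esub> h b))"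
      unfolding cab(4) ab(2,4) map[OF ab(1)] map[OF ab(3)] ..
    also have "\<dots> = (J +>\<^bsub>G\<^esub> h a) \<otimes>\<^bsub>G Quot J\<^esub> ((J +>\<^bsub>G\<^esub> h b) \<otimes>\<^bsub>G Quot J\<^esub> inv\<^bsub>G Quot J\<^esub> (J +>\<^bsub>G\<^esub> h b))"
      by (rule F.m_lcomm[OF c(2,1) inv(1)])
    also have "\<dots> = J +>\<^bsub>G\<^esub> h a" using inv(2) c by simp
    finally have "cg G (g w) 1 (h b \<otimes>\<^bsub>G\<^esub> y) (h a)" using Jeq[of "h b \<otimes>\<^bsub>G\<^esub> y" "h a"] ab y by simp
    then show ?thesis using ab bnz by blast
  qed
  have Gnt: "\<not> cg G (g w) 1 \<one>\<^bsub>G\<^esub> \<zero>\<^bsub>G\<^esub>"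
    using F.one_not_zero Jeq[of "\<one>\<^bsub>G\<^esub>" "\<zero>\<^bsub>G\<^esub>"] by (simp add: G0)
  show "cdv G (g w) p"
  proof (rule cdv.intro[OF G.cunif_axioms], rule cdv_axioms.intro)
    show "\<exists>y\<in>carrier G. x \<otimes>\<^bsub>G\<^esub> y = \<one>\<^bsub>G\<^esub>" if x: "x \<in> carrier G" "\<not> cg G (g w) 1 x \<zero>\<^bsub>G\<^esub>" for x
    proof -
      have "J +>\<^bsub>G\<^esub> x \<in> carrier (G Quot J)" using x by (auto simp: G.Quot_carrier)
      moreover have "J +>\<^bsub>G\<^esub> x \<noteq> \<zero>\<^bsub>G Quot J\<^esub>" using x Jeq[of x "\<zero>\<^bsub>G\<^esub>"] by (simp add: G0)
      ultimately have "(J +>\<^bsub>G\<^esub> x) \<in> Units (G Quot J)" using F.field_Units by simp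
      then have inv: "inv\<^bsub>G Quot J\<^esub> (J +>\<^bsub>G\<^esub> x) \<in> carrier (G Quot J)"
        "(J +>\<^bsub>G\<^esub> x) \<otimes>\<^bsub>G Quot J\<^esub> inv\<^bsub>G Quot J\<^esub> (J +>\<^bsub>G\<^esub> x) = \<one>\<^bsub>G Quot J\<^esub>" by auto
      obtain y where y: "y \<in> carrier G" "inv\<^bsub>G Quot J\<^esub> (J +>\<^bsub>G\<^esub> x) = J +>\<^bsub>G\<^esub> y" using inv(1) by (auto simp: G.Quot_carrier)
      have "J +>\<^bsub>G\<^esub> (x \<otimes>\<^bsub>G\<^esub> y) = J +>\<^bsub>G\<^esub> \<one>\<^bsub>G\<^esub>"
        using ring_hom_mult[OF Jhom, of x y] x y inv(2) by (simp add: G0)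
      then have "cg G (g w) 1 (x \<otimes>\<^bsub>G\<^esub> y) \<one>\<^bsub>G\<^esub>" using Jeq[of "x \<otimes>\<^bsub>G\<^esub> y" "\<one>\<^bsub>G\<^esub>"] x y by simp
      then obtain z where "z \<in> carrier G" "x \<otimes>\<^bsub>G\<^esub> y \<otimes>\<^bsub>G\<^esub> z = \<one>\<^bsub>G\<^esub>" using G.one_plus_inverse by blast
      then show ?thesis using x y by (intro bexI[of _ "y \<otimes>\<^bsub>G\<^esub> z"]) (auto simp: G.m_assoc)
    qed
  qed (rule Gnt)
qed

section \<open>Denominators and maps on fraction fields\<close>

lemma (in cdv) factor_w:
  assumes "a \<in> carrier R" "a \<noteq> \<zero>"
  shows "\<exists>n c. c \<in> carrier R \<and> a = w [^] (n::nat) \<otimes> c \<and> \<not> cg R w 1 c \<zero>"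
proof -
  obtain n b and e1 :: unit where "b \<in> {()} \<rightarrow> carrier R" "\<And>e. e \<in> {()} \<Longrightarrow> a = w [^] (n::nat) \<otimes> b e"
    "e1 \<in> {()}" "\<not> cg R w 1 (b e1) \<zero>"
  proof (rule common_factor[of "{()}" "\<lambda>_. a" "()"])
    show "(\<lambda>_. a) \<in> {()} \<rightarrow> carrier R" "a \<noteq> \<zero>" using assms by auto
  qed (simp, simp, rule that)
  then show ?thesis by auto
qed

lemma common_denominator:
  assumes ff: "fraction_field A K i" and c: "\<And>k. k < (n::nat) \<Longrightarrow> c k \<in> carrier K"
  shows "\<exists>D a. D \<in> carrier A \<and> D \<noteq> \<zero>\<^bsub>A\<^esub> \<and> (\<forall>k. a k \<in> carrier A) \<and> (\<forall>k<n. i D \<otimes>\<^bsub>K\<^esub> c k = i (a k))"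
proof -
  have dA: "domain A" and fK: "field K" and i: "i \<in> ring_hom A K" and ii: "inj_on i (carrier A)"
    and fr: "\<And>x. x \<in> carrier K \<Longrightarrow> \<exists>a\<in>carrier A. \<exists>b\<in>carrier A - {\<zero>\<^bsub>A\<^esub>}. x = i a \<otimes>\<^bsub>K\<^esub> inv\<^bsub>K\<^esub> (i b)"
    using ff by (auto simp: fraction_field_def)
  interpret A: domain A by fact
  interpret K: field K by fact
  interpret i: ring_hom_cring A K i using i A.is_cring K.is_cring by (intro ring_hom_cringI) auto
  show ?thesis
    using c
  proof (induction n)
    case 0
    show ?case by (intro exI[of _ "\<one>\<^bsub>A\<^esub>"] exI[of _ "\<lambda>_. \<one>\<^bsub>A\<^esub>"]) auto
  next
    case (Suc n)
    then obtain D a where D: "D \<in> carrier A" "D \<noteq> \<zero>\<^bsub>A\<^esub>" "\<And>k. a k \<in> carrier A" "\<And>k. k < n \<Longrightarrow> i D \<otimes>\<^bsub>K\<^esub> c k = i (a k)" by auto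
    obtain e b where e: "e \<in> carrier A" "b \<in> carrier A" "b \<noteq> \<zero>\<^bsub>A\<^esub>" "c n = i e \<otimes>\<^bsub>K\<^esub> inv\<^bsub>K\<^esub> (i b)" using fr[of "c n"] Suc.prems by blast
    have "i b \<noteq> \<zero>\<^bsub>K\<^esub>" using inj_onD[OF ii, of b "\<zero>\<^bsub>A\<^esub>"] e by auto
    then have "i b \<in> Units K" using e K.field_Units by simp
    then have cb: "i b \<otimes>\<^bsub>K\<^esub> c n = i e" using e by (simp add: K.m_comm[of "i b"] K.m_assoc)
    have cn: "c n \<in> carrier K" using Suc.prems by simp
    define a' where "a' = (\<lambda>k. if k = n then D \<otimes>\<^bsub>A\<^esub> e else b \<otimes>\<^bsub>A\<^esub> a k)"
    have "i (D \<otimes>\<^bsub>A\<^esub> b) \<otimes>\<^bsub>K\<^esub> c k = i (a' k)" if k: "k < Suc n" for k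
    proof (cases "k = n")
      case True
      then show ?thesis using D(1) e(1,2) cn cb by (simp add: a'_def K.m_assoc)
    next
      case False
      have ck: "c k \<in> carrier K" using Suc.prems k by simp
      have "i (D \<otimes>\<^bsub>A\<^esub> b) \<otimes>\<^bsub>K\<^esub> c k = i b \<otimes>\<^bsub>K\<^esub> (i D \<otimes>\<^bsub>K\<^esub> c k)" using D(1) e(2) ck by (simp add: K.m_assoc K.m_comm[of "i D" "i b"])
      then show ?thesis using False k D(3,4) e(2) by (simp add: a'_def)
    qed
    moreover have "D \<otimes>\<^bsub>A\<^esub> b \<noteq> \<zero>\<^bsub>A\<^esub>" using D e A.integral by blast
    ultimately show ?case using D(1,3) e(1,2)
      by (intro exI[of _ "D \<otimes>\<^bsub>A\<^esub> b"] exI[of _ a']) (auto simp: a'_def)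
  qed
qed

text \<open>The value at x is characterised by all presentations of x as a fraction simultaneously,
  so that additivity and multiplicativity can be checked with any common denominator.\<close>

lemma fraction_field_extend:
  assumes ff: "fraction_field A K i" and L: "field L" and f: "f \<in> ring_hom A L" "inj_on f (carrier A)"
  shows "\<exists>j\<in>ring_hom K L. \<forall>a\<in>carrier A. j (i a) = f a"
proof -
  have dA: "domain A" and fK: "field K" and i: "i \<in> ring_hom A K" and ii: "inj_on i (carrier A)"
    using ff by (auto simp: fraction_field_def)
  interpret A: domain A by fact
  interpret K: field K by fact
  interpret L: field L by fact
  interpret i: ring_hom_cring A K i using i A.is_cring K.is_cring by (intro ring_hom_cringI) auto
  interpret f: ring_hom_cring A L f using f A.is_cring L.is_cring by (intro ring_hom_cringI) auto
  have fnz: "f b \<noteq> \<zero>\<^bsub>L\<^esub>" if "b \<in> carrier A" "b \<noteq> \<zero>\<^bsub>A\<^esub>" for b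
    using inj_onD[OF f(2), of b "\<zero>\<^bsub>A\<^esub>"] that by auto
  have "\<exists>y. y \<in> carrier L \<and> (\<forall>D\<in>carrier A. \<forall>a\<in>carrier A. i D \<otimes>\<^bsub>K\<^esub> x = i a \<longrightarrow> f D \<otimes>\<^bsub>L\<^esub> y = f a)"
    if x: "x \<in> carrier K" for x
  proof -
    obtain d c where d: "d \<in> carrier A" "d \<noteq> \<zero>\<^bsub>A\<^esub>" "c \<in> carrier A" "i d \<otimes>\<^bsub>K\<^esub> x = i c"
      using common_denominator[OF ff, of 1 "\<lambda>_. x"] x by auto
    have fd: "f d \<in> Units L" using fnz d L.field_Units by simp
    define y where "y = inv\<^bsub>L\<^esub> (f d) \<otimes>\<^bsub>L\<^esub> f c"
    have y: "y \<in> carrier L" "f d \<otimes>\<^bsub>L\<^esub> y = f c" using d fd by (simp_all add: y_def L.m_assoc[symmetric])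
    have "f D \<otimes>\<^bsub>L\<^esub> y = f a" if D: "D \<in> carrier A" "a \<in> carrier A" "i D \<otimes>\<^bsub>K\<^esub> x = i a" for D a
    proof -
      have "i (d \<otimes>\<^bsub>A\<^esub> a) = i d \<otimes>\<^bsub>K\<^esub> (i D \<otimes>\<^bsub>K\<^esub> x)" using D d by simp
      also have "\<dots> = i D \<otimes>\<^bsub>K\<^esub> (i d \<otimes>\<^bsub>K\<^esub> x)" by (rule K.m_lcomm) (use D d x in auto)
      also have "\<dots> = i (D \<otimes>\<^bsub>A\<^esub> c)" using D d by simp
      finally have e: "d \<otimes>\<^bsub>A\<^esub> a = D \<otimes>\<^bsub>A\<^esub> c" by (rule inj_onD[OF ii]) (use D d in auto)
      have "f d \<otimes>\<^bsub>L\<^esub> (f D \<otimes>\<^bsub>L\<^esub> y) = f D \<otimes>\<^bsub>L\<^esub> (f d \<otimes>\<^bsub>L\<^esub> y)" by (rule L.m_lcomm) (use D d y in auto)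
      also have "\<dots> = f (d \<otimes>\<^bsub>A\<^esub> a)" unfolding y(2) e using D d by simp
      finally show ?thesis using D d y fnz[OF d(1,2)] by (simp add: L.m_lcancel)
    qed
    then show ?thesis using y(1) by blast
  qed
  then obtain j where j: "\<And>x. x \<in> carrier K \<Longrightarrow> j x \<in> carrier L"
    "\<And>x D a. x \<in> carrier K \<Longrightarrow> D \<in> carrier A \<Longrightarrow> a \<in> carrier A \<Longrightarrow> i D \<otimes>\<^bsub>K\<^esub> x = i a \<Longrightarrow> f D \<otimes>\<^bsub>L\<^esub> j x = f a"
    by metis
  have ja: "j (i a) = f a" if "a \<in> carrier A" for a using j(2)[of "i a" "\<one>\<^bsub>A\<^esub>" a] j(1)[of "i a"] that by simp
  have "j \<in> ring_hom K L"
  proof (rule ring_hom_memI)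
    show "j \<one>\<^bsub>K\<^esub> = \<one>\<^bsub>L\<^esub>" using ja[of "\<one>\<^bsub>A\<^esub>"] by simp
    fix x y assume xy: "x \<in> carrier K" "y \<in> carrier K"
    obtain D a where D: "D \<in> carrier A" "D \<noteq> \<zero>\<^bsub>A\<^esub>" "\<And>k. a k \<in> carrier A"
        "\<And>k. k < (2::nat) \<Longrightarrow> i D \<otimes>\<^bsub>K\<^esub> (if k = 0 then x else y) = i (a k)"
    proof -
      have "\<exists>D a. D \<in> carrier A \<and> D \<noteq> \<zero>\<^bsub>A\<^esub> \<and> (\<forall>k. a k \<in> carrier A) \<and>
          (\<forall>k<(2::nat). i D \<otimes>\<^bsub>K\<^esub> (if k = 0 then x else y) = i (a k))"
        by (rule common_denominator[OF ff]) (use xy in auto)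
      then show thesis using that by blast
    qed
    have Dx: "i D \<otimes>\<^bsub>K\<^esub> x = i (a 0)" and Dy: "i D \<otimes>\<^bsub>K\<^esub> y = i (a 1)" using D(4)[of 0] D(4)[of 1] by auto
    have fx: "f D \<otimes>\<^bsub>L\<^esub> j x = f (a 0)" and fy: "f D \<otimes>\<^bsub>L\<^esub> j y = f (a 1)"
      using j(2)[OF xy(1) D(1,3) Dx] j(2)[OF xy(2) D(1,3) Dy] .
    have c: "f D \<in> carrier L" "j x \<in> carrier L" "j y \<in> carrier L" "i D \<in> carrier K" using D(1) j(1) xy by auto
    have "i D \<otimes>\<^bsub>K\<^esub> (x \<oplus>\<^bsub>K\<^esub> y) = i (a 0 \<oplus>\<^bsub>A\<^esub> a 1)" using D(3) c xy by (simp add: K.r_distr Dx Dy)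
    then have "f D \<otimes>\<^bsub>L\<^esub> j (x \<oplus>\<^bsub>K\<^esub> y) = f (a 0 \<oplus>\<^bsub>A\<^esub> a 1)" by (rule j(2)[rotated 3]) (use xy D in auto)
    also have "\<dots> = f D \<otimes>\<^bsub>L\<^esub> (j x \<oplus>\<^bsub>L\<^esub> j y)" using D(3) c by (simp add: L.r_distr fx fy)
    finally show "j (x \<oplus>\<^bsub>K\<^esub> y) = j x \<oplus>\<^bsub>L\<^esub> j y" using fnz[OF D(1,2)] c xy j(1) by (simp add: L.m_lcancel)
    have "i (D \<otimes>\<^bsub>A\<^esub> D) \<otimes>\<^bsub>K\<^esub> (x \<otimes>\<^bsub>K\<^esub> y) = i D \<otimes>\<^bsub>K\<^esub> x \<otimes>\<^bsub>K\<^esub> (i D \<otimes>\<^bsub>K\<^esub> y)"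
      using D(1) xy by (simp add: K.m_ac)
    also have "\<dots> = i (a 0 \<otimes>\<^bsub>A\<^esub> a 1)" using D(3) by (simp add: Dx Dy)
    finally have "f (D \<otimes>\<^bsub>A\<^esub> D) \<otimes>\<^bsub>L\<^esub> j (x \<otimes>\<^bsub>K\<^esub> y) = f (a 0 \<otimes>\<^bsub>A\<^esub> a 1)" by (rule j(2)[rotated 3]) (use xy D in auto)
    also have "\<dots> = f D \<otimes>\<^bsub>L\<^esub> j x \<otimes>\<^bsub>L\<^esub> (f D \<otimes>\<^bsub>L\<^esub> j y)" using D(3) by (simp add: fx fy)
    also have "\<dots> = f (D \<otimes>\<^bsub>A\<^esub> D) \<otimes>\<^bsub>L\<^esub> (j x \<otimes>\<^bsub>L\<^esub> j y)" using D(1) c by (simp add: L.m_ac)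
    finally show "j (x \<otimes>\<^bsub>K\<^esub> y) = j x \<otimes>\<^bsub>L\<^esub> j y"
      using fnz[of "D \<otimes>\<^bsub>A\<^esub> D"] A.integral[of D D] D(1,2) c xy j(1) L.m_lcancel[of "f (D \<otimes>\<^bsub>A\<^esub> D)"] by force
  qed (rule j(1))
  then show ?thesis using ja by blast
qed

theorem lemma2p6:
  fixes p :: nat
    and A :: "'a ring"
    and K :: "'k ring" and i :: "'a \<Rightarrow> 'k"
    and Ag :: "'b ring" and g :: "'a \<Rightarrow> 'b"
    and Kg :: "'l ring" and ig :: "'b \<Rightarrow> 'l"
  assumes "Factorial_Ring.prime p"
    and "complete_dvr A"
    and "has_char (A Quot max_ideal A) p"
    and "fraction_field A K i"
    and "generic_residual_perfection p A Ag g"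
    and "fraction_field Ag Kg ig"
  shows "\<exists>j \<in> ring_hom K Kg. (\<forall>a\<in>carrier A. j (i a) = ig (g a)) \<and>
           algebraically_closed_in (j ` carrier K) Kg"
proof -
  obtain w where w: "cdv A w p" "max_ideal A = PIdl\<^bsub>A\<^esub> w" "domain A"
    by (rule complete_dvr_uniformizer[OF assms(2,3,1)])
  interpret A: cdv A w p by (rule w(1))
  interpret b: base A w p by (rule base.intro[OF w(1)], rule base_axioms.intro) (rule w(2))
  obtain U :: "'b ring" and u h0 where Uu: "CRP_initial p A U u" "h0 \<in> alg_homs A U u Ag g"
    "fraction_field (residual_ring A U u) (residual_ring A Ag g) (residual_map A Ag g h0)"
    and G: "CRP p A Ag g" using assms(5) unfolding generic_residual_perfection_def by blast
  have U: "CRP p A U u" using Uu(1) by (simp add: CRP_initial_def)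
  note res = b.residue_field_extension[OF U G Uu(2,3)]
  interpret G: cdv Ag "g w" p by (rule res(4))
  have fK: "field K" and i: "i \<in> ring_hom A K" using assms(4) by (auto simp: fraction_field_def)
  have fL: "field Kg" and ig: "ig \<in> ring_hom Ag Kg" and igi: "inj_on ig (carrier Ag)"
    and Gfr: "\<And>x. x \<in> carrier Kg \<Longrightarrow> \<exists>a\<in>carrier Ag. \<exists>b\<in>carrier Ag - {\<zero>\<^bsub>Ag\<^esub>}. x = ig a \<otimes>\<^bsub>Kg\<^esub> inv\<^bsub>Kg\<^esub> (ig b)"
    using assms(6) by (auto simp: fraction_field_def)
  have g: "g \<in> ring_hom A Ag" using G by (simp add: b.CRP_iff)
  interpret K: field K by fact
  interpret L: field Kg by fact
  interpret ig: ring_hom_cring Ag Kg ig using ig G.is_cring L.is_cring by (intro ring_hom_cringI) auto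
  interpret g: ring_hom_cring A Ag g using g A.is_cring G.is_cring by (intro ring_hom_cringI) auto
  have ig0: "ig x = \<zero>\<^bsub>Kg\<^esub> \<longleftrightarrow> x = \<zero>\<^bsub>Ag\<^esub>" if "x \<in> carrier Ag" for x
    using inj_onD[OF igi, of x "\<zero>\<^bsub>Ag\<^esub>"] that by auto
  \<comment> \<open>A nonzero element is a power of \<open>w\<close> times a unit; in
    \<open>Ag\<close> multiplication by \<open>g w\<close> is injective, and a unit cannot map to
    zero in a nonzero ring.\<close>
  have gz: "a = \<zero>\<^bsub>A\<^esub>" if a: "a \<in> carrier A" "g a = \<zero>\<^bsub>Ag\<^esub>" for a
  proof (rule ccontr)
    assume "a \<noteq> \<zero>\<^bsub>A\<^esub>"
    then obtain n c where c: "c \<in> carrier A" "a = w [^]\<^bsub>A\<^esub> (n::nat) \<otimes>\<^bsub>A\<^esub> c" "\<not> cg A w 1 c \<zero>\<^bsub>A\<^esub>"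
      using A.factor_w[OF a(1)] by blast
    then have "g w [^]\<^bsub>Ag\<^esub> n \<otimes>\<^bsub>Ag\<^esub> g c = g w [^]\<^bsub>Ag\<^esub> n \<otimes>\<^bsub>Ag\<^esub> \<zero>\<^bsub>Ag\<^esub>"
      using a(2) ring_hom_pow[OF g A.is_cring G.is_cring A.w_closed] by simp
    then have gc: "g c = \<zero>\<^bsub>Ag\<^esub>" by (rule G.cancel_w_pow[rotated 2]) (use c in auto)
    obtain d where "d \<in> carrier A" "c \<otimes>\<^bsub>A\<^esub> d = \<one>\<^bsub>A\<^esub>" using A.unit c by blast
    then have "\<one>\<^bsub>Ag\<^esub> = \<zero>\<^bsub>Ag\<^esub>" using g.hom_mult[OF c(1), of d] gc by simp
    then show False using G.nontriv G.cg_refl[OF G.zero_closed G.w_closed] by simp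
  qed
  have ginj: "inj_on g (carrier A)"
  proof (rule inj_onI)
    fix a c assume ac: "a \<in> carrier A" "c \<in> carrier A" "g a = g c"
    have "g (a \<ominus>\<^bsub>A\<^esub> c) = \<zero>\<^bsub>Ag\<^esub>" using ac by (simp add: a_minus_def G.r_neg)
    then have "a \<ominus>\<^bsub>A\<^esub> c = \<zero>\<^bsub>A\<^esub>" using gz ac by simp
    then show "a = c" using ac by simp
  qed
  have f: "ig \<circ> g \<in> ring_hom A Kg" by (rule ring_hom_trans[OF g ig])
  have fi: "inj_on (ig \<circ> g) (carrier A)"
    by (rule comp_inj_on[OF ginj inj_on_subset[OF igi]]) auto
  obtain j where j: "j \<in> ring_hom K Kg" "\<And>a. a \<in> carrier A \<Longrightarrow> j (i a) = ig (g a)"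
    using fraction_field_extend[OF assms(4) fL f fi] by auto
  interpret j: ring_hom_cring K Kg j using j(1) K.is_cring L.is_cring by (intro ring_hom_cringI) auto
  define F where "F = j ` carrier K"
  have F: "subfield F Kg"
    unfolding F_def by (rule ring_hom_ring.img_is_subfield(2)[OF ring_hom_ringI2[OF K.ring_axioms L.ring_axioms j(1)] K.carrier_is_subfield L.one_not_zero])
  define Alg where "Alg = {x \<in> carrier Kg. (L.algebraic over F) x}"
  have Alg: "subfield Alg Kg" unfolding Alg_def by (rule L.subfield_of_algebraics[OF F])
  have AlgS: "subring Alg Kg" by (rule subfieldE(1)[OF Alg])
  have F_Alg: "x \<in> Alg" if "x \<in> F" for x
    using L.algebraic_self[OF subfieldE(1)[OF F] that] subfieldE(3)[OF F] that by (auto simp: Alg_def)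
  have igA: "ig (g a) \<in> F" if "a \<in> carrier A" for a
    using j(2)[OF that] ring_hom_closed[OF i that] unfolding F_def by (metis image_eqI)
  have gw0: "g w \<noteq> \<zero>\<^bsub>Ag\<^esub>" using G.nzd[OF G.one_closed] G.nontriv G.cg_refl[OF G.zero_closed G.w_closed] by auto
  define W where "W = ig (g w)"
  have WF: "W \<in> F" using igA[OF A.w_closed] by (simp add: W_def)
  have W0: "W \<noteq> \<zero>\<^bsub>Kg\<^esub>" and Wc: "W \<in> carrier Kg" using ig0[OF G.w_closed] gw0 by (auto simp: W_def)
  have WU: "W \<in> Units Kg" using W0 Wc L.field_Units by simp
  \<comment> \<open>Saturation of this ring comes from the field \<open>Alg\<close>, which contains
    the inverse of \<open>W\<close>.\<close>
  define S0 where "S0 = {y \<in> carrier Ag. ig y \<in> Alg}"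
  interpret gen: generic A w p U u K i Ag g h0 S0
  proof (rule generic.intro, rule initial.intro, rule b.base_axioms, rule initial_axioms.intro)
    show "CRP_initial p A U u" by (rule Uu(1))
    show "fraction_field A K i" by (rule assms(4))
    show "\<not> cg U (u w) 1 \<one>\<^bsub>U\<^esub> \<zero>\<^bsub>U\<^esub>" by (rule res(1))
    show "generic_axioms A w p U u Ag g h0 S0"
    proof (rule generic_axioms.intro)
      show "CRP p A Ag g" "h0 \<in> alg_homs A U u Ag g" "cdv Ag (g w) p" by (rule G, rule Uu(2), rule res(4))
      show "cg U (u w) 1 x \<zero>\<^bsub>U\<^esub>" if "x \<in> carrier U" "cg Ag (g w) 1 (h0 x) \<zero>\<^bsub>Ag\<^esub>" for x by (rule res(2)[OF that])
      show "\<exists>a\<in>carrier U. \<exists>b\<in>carrier U. \<not> cg U (u w) 1 b \<zero>\<^bsub>U\<^esub> \<and> cg Ag (g w) 1 (h0 b \<otimes>\<^bsub>Ag\<^esub> x) (h0 a)"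
        if "x \<in> carrier Ag" for x by (rule res(3)[OF that])
      show "subring S0 Ag"
      proof (rule G.subringI)
        show "S0 \<subseteq> carrier Ag" by (auto simp: S0_def)
        show "\<one>\<^bsub>Ag\<^esub> \<in> S0" using subringE(3)[OF AlgS] by (simp add: S0_def)
        show "\<ominus>\<^bsub>Ag\<^esub> x \<in> S0" if "x \<in> S0" for x using that subringE(5)[OF AlgS] by (simp add: S0_def)
        show "x \<otimes>\<^bsub>Ag\<^esub> y \<in> S0" if "x \<in> S0" "y \<in> S0" for x y using that subringE(6)[OF AlgS] by (simp add: S0_def)
        show "x \<oplus>\<^bsub>Ag\<^esub> y \<in> S0" if "x \<in> S0" "y \<in> S0" for x y using that subringE(7)[OF AlgS] by (simp add: S0_def)
      qed
      show "g a \<in> S0" if "a \<in> carrier A" for a using that F_Alg[OF igA[OF that]] by (simp add: S0_def)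
      show "x \<in> S0" if x: "x \<in> carrier Ag" "g w \<otimes>\<^bsub>Ag\<^esub> x \<in> S0" for x
      proof -
        have "W \<otimes>\<^bsub>Kg\<^esub> ig x \<in> Alg" using x by (simp add: S0_def W_def)
        moreover have "inv\<^bsub>Kg\<^esub> W \<in> Alg" using L.subfield_m_inv(1)[OF Alg, of W] F_Alg[OF WF] W0 by simp
        ultimately have "inv\<^bsub>Kg\<^esub> W \<otimes>\<^bsub>Kg\<^esub> (W \<otimes>\<^bsub>Kg\<^esub> ig x) \<in> Alg" using subringE(6)[OF AlgS] by blast
        moreover have "inv\<^bsub>Kg\<^esub> W \<otimes>\<^bsub>Kg\<^esub> (W \<otimes>\<^bsub>Kg\<^esub> ig x) = ig x"
          using WU Wc x by (simp add: L.m_assoc[symmetric])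
        ultimately show ?thesis using x by (simp add: S0_def)
      qed
      show "\<exists>n c. (\<forall>k. c k \<in> carrier A) \<and> (\<exists>k<n. c k \<noteq> \<zero>\<^bsub>A\<^esub>) \<and> psum Ag x (\<lambda>k. g (c k)) n = \<zero>\<^bsub>Ag\<^esub>" if x: "x \<in> S0" for x
      proof -
        have xc: "x \<in> carrier Ag" "ig x \<in> carrier Kg" and al: "(L.algebraic over F) (ig x)" using x by (auto simp: S0_def Alg_def)
        obtain P where P: "P \<in> carrier (F[X]\<^bsub>Kg\<^esub>)" "P \<noteq> []" "L.eval P (ig x) = \<zero>\<^bsub>Kg\<^esub>"
          by (rule L.algebraicE[OF subfieldE(1)[OF F] xc(2) al])
        have PF: "set P \<subseteq> F" "hd P \<noteq> \<zero>\<^bsub>Kg\<^esub>" using P(1,2) unfolding univ_poly_carrier[symmetric] polynomial_def by auto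
        define n where "n = length P"
        define d where "d = (\<lambda>k. rev P ! k)"
        have Pd: "P = rev (map d [0..<n])" by (metis d_def n_def length_rev map_nth rev_rev_ident)
        have dF: "d k \<in> F" if "k < n" for k using that PF(1) nth_mem[of k "rev P"] by (auto simp: d_def n_def)
        have n0: "n > 0" using P(2) by (simp add: n_def)
        \<comment> \<open>\<open>P\<close> lists its leading coefficient first; after reversal the
          nonzero one has index n - 1, and it stays nonzero after multiplication by the common
          denominator.\<close>
        have dl: "d (n - 1) \<noteq> \<zero>\<^bsub>Kg\<^esub>" using PF(2) P(2) n0 by (simp add: d_def n_def rev_nth hd_conv_nth)
        have dc: "d k \<in> carrier Kg" if "k < n" for k using dF[OF that] subfieldE(3)[OF F] by blast
        have ps: "psum Kg (ig x) d n = \<zero>\<^bsub>Kg\<^esub>" using P(3) L.eval_rev_map[OF xc(2) dc] Pd by simp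
        have "\<forall>k. \<exists>c. k < n \<longrightarrow> c \<in> carrier K \<and> d k = j c" using dF unfolding F_def by blast
        then obtain c where c: "\<And>k. k < n \<Longrightarrow> c k \<in> carrier K" "\<And>k. k < n \<Longrightarrow> d k = j (c k)" by metis
        obtain D a where D: "D \<in> carrier A" "D \<noteq> \<zero>\<^bsub>A\<^esub>" "\<And>k. a k \<in> carrier A" "\<And>k. k < n \<Longrightarrow> i D \<otimes>\<^bsub>K\<^esub> c k = i (a k)"
        proof -
          have "\<exists>D a. D \<in> carrier A \<and> D \<noteq> \<zero>\<^bsub>A\<^esub> \<and> (\<forall>k. a k \<in> carrier A) \<and> (\<forall>k<n. i D \<otimes>\<^bsub>K\<^esub> c k = i (a k))"
            by (rule common_denominator[OF assms(4)]) (rule c(1))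
          then show thesis using that by blast
        qed
        define e where "e = ig (g D)"
        have ec: "e \<in> carrier Kg" "e \<noteq> \<zero>\<^bsub>Kg\<^esub>" using D(1,2) ig0[of "g D"] gz[of D] by (auto simp: e_def)
        have ed: "e \<otimes>\<^bsub>Kg\<^esub> d k = ig (g (a k))" if k: "k < n" for k
        proof -
          have "e \<otimes>\<^bsub>Kg\<^esub> d k = j (i D \<otimes>\<^bsub>K\<^esub> c k)" using j.hom_mult[OF ring_hom_closed[OF i D(1)] c(1)[OF k]] c(2)[OF k] j(2)[OF D(1)] by (simp add: e_def)
          then show ?thesis using D(4)[OF k] j(2)[OF D(3)] by simp
        qed
        have "e \<otimes>\<^bsub>Kg\<^esub> psum Kg (ig x) d k = ig (psum Ag x (\<lambda>k. g (a k)) k)" if "k \<le> n" for k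
          using that
        proof (induction k)
          case (Suc k)
          have px: "ig (x [^]\<^bsub>Ag\<^esub> k) = ig x [^]\<^bsub>Kg\<^esub> k" by (rule ring_hom_pow[OF ig G.is_cring L.is_cring xc(1)])
          have k: "k < n" using Suc.prems by simp
          have pc: "psum Kg (ig x) d k \<in> carrier Kg" by (rule L.psum_closed[OF xc(2) dc]) (use k in simp)
          have pg: "psum Ag x (\<lambda>k. g (a k)) k \<in> carrier Ag" by (rule G.psum_closed[OF xc(1)]) (use D(3) in simp)
          have "e \<otimes>\<^bsub>Kg\<^esub> (psum Kg (ig x) d k \<oplus>\<^bsub>Kg\<^esub> ig x [^]\<^bsub>Kg\<^esub> k \<otimes>\<^bsub>Kg\<^esub> d k) =
            e \<otimes>\<^bsub>Kg\<^esub> psum Kg (ig x) d k \<oplus>\<^bsub>Kg\<^esub> ig x [^]\<^bsub>Kg\<^esub> k \<otimes>\<^bsub>Kg\<^esub> (e \<otimes>\<^bsub>Kg\<^esub> d k)"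
            using ec(1) pc xc(2) dc[OF k] by (simp add: L.r_distr L.m_lcomm)
          also have "\<dots> = ig (psum Ag x (\<lambda>k. g (a k)) k \<oplus>\<^bsub>Ag\<^esub> x [^]\<^bsub>Ag\<^esub> k \<otimes>\<^bsub>Ag\<^esub> g (a k))"
            using Suc.IH Suc.prems ed[OF k] pg xc(1) D(3) px by simp
          finally show ?case by simp
        qed (use ec in simp)
        then have "ig (psum Ag x (\<lambda>k. g (a k)) n) = \<zero>\<^bsub>Kg\<^esub>" using ps ec(1) by (metis L.r_null order_refl)
        then have "psum Ag x (\<lambda>k. g (a k)) n = \<zero>\<^bsub>Ag\<^esub>"
          using ig0[OF G.psum_closed[OF xc(1), of n "\<lambda>k. g (a k)"]] D(3) by simp
        moreover have "a (n - 1) \<noteq> \<zero>\<^bsub>A\<^esub>"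
        proof
          assume "a (n - 1) = \<zero>\<^bsub>A\<^esub>"
          then have "e \<otimes>\<^bsub>Kg\<^esub> d (n - 1) = \<zero>\<^bsub>Kg\<^esub>" using ed[of "n - 1"] n0 by simp
          then show False using L.integral[of e "d (n - 1)"] ec dl dc[of "n - 1"] n0 by simp
        qed
        ultimately show ?thesis using D(3) n0 by (intro exI[of _ n] exI[of _ a]) (auto intro: exI[of _ "n - 1"])
      qed
    qed
  qed
  have "x \<in> F" if x: "x \<in> carrier Kg" "(L.algebraic over F) x" for x
  proof -
    have xA: "x \<in> Alg" using x by (simp add: Alg_def)
    obtain y1 y2 where y: "y1 \<in> carrier Ag" "y2 \<in> carrier Ag" "y2 \<noteq> \<zero>\<^bsub>Ag\<^esub>" "x = ig y1 \<otimes>\<^bsub>Kg\<^esub> inv\<^bsub>Kg\<^esub> (ig y2)" using Gfr[OF x(1)] by blast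
    \<comment> \<open>Up to a unit of \<open>Ag\<close> the denominator is a power of
      \<open>w\<close>, whose image lies in \<open>F\<close>. Multiplication by it brings
      \<open>x\<close> into the image of \<open>S0\<close> without leaving the algebraic
      elements.\<close>
    obtain n y3 where y3: "y3 \<in> carrier Ag" "y2 = g w [^]\<^bsub>Ag\<^esub> (n::nat) \<otimes>\<^bsub>Ag\<^esub> y3" "\<not> cg Ag (g w) 1 y3 \<zero>\<^bsub>Ag\<^esub>"
      using G.factor_w[OF y(2,3)] by blast
    obtain y4 where y4: "y4 \<in> carrier Ag" "y3 \<otimes>\<^bsub>Ag\<^esub> y4 = \<one>\<^bsub>Ag\<^esub>" using G.unit[OF y3(1,3)] by blast
    have i2: "ig y2 \<in> Units Kg" using y(2,3) ig0 L.field_Units by simp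
    have Wn: "W [^]\<^bsub>Kg\<^esub> n = ig (g w [^]\<^bsub>Ag\<^esub> n)" using ring_hom_pow[OF ig G.is_cring L.is_cring G.w_closed] by (simp add: W_def)
    have WnF: "W [^]\<^bsub>Kg\<^esub> n \<in> F" by (rule L.subring_pow_closed[OF subfieldE(1)[OF F] WF])
    have Wn0: "W [^]\<^bsub>Kg\<^esub> n \<noteq> \<zero>\<^bsub>Kg\<^esub>" using L.Units_pow_closed[OF WU] L.field_Units by simp
    have Wnc: "W [^]\<^bsub>Kg\<^esub> n \<in> carrier Kg" using Wc by simp
    have x2: "x \<otimes>\<^bsub>Kg\<^esub> ig y2 = ig y1" using y i2 by (simp add: L.m_assoc)
    have w24: "g w [^]\<^bsub>Ag\<^esub> n = y2 \<otimes>\<^bsub>Ag\<^esub> y4" using y3 y4 by (simp add: G.m_assoc)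
    have e: "x \<otimes>\<^bsub>Kg\<^esub> W [^]\<^bsub>Kg\<^esub> n = ig (y1 \<otimes>\<^bsub>Ag\<^esub> y4)"
      unfolding Wn w24 using x(1) y(1,2) y4(1) x2 by (simp add: L.m_assoc[symmetric])
    have "x \<otimes>\<^bsub>Kg\<^esub> W [^]\<^bsub>Kg\<^esub> n \<in> Alg" using subringE(6)[OF AlgS xA F_Alg[OF WnF]] .
    then have "y1 \<otimes>\<^bsub>Ag\<^esub> y4 \<in> S0" using e y(1) y4(1) by (simp add: S0_def)
    then obtain a where a: "a \<in> carrier A" "y1 \<otimes>\<^bsub>Ag\<^esub> y4 = g a" using gen.S0_eq by blast
    then have "x \<otimes>\<^bsub>Kg\<^esub> W [^]\<^bsub>Kg\<^esub> n \<in> F" using e igA by simp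
    moreover have "inv\<^bsub>Kg\<^esub> (W [^]\<^bsub>Kg\<^esub> n) \<in> F" using L.subfield_m_inv(1)[OF F, of "W [^]\<^bsub>Kg\<^esub> n"] WnF Wn0 by simp
    ultimately have "x \<otimes>\<^bsub>Kg\<^esub> W [^]\<^bsub>Kg\<^esub> n \<otimes>\<^bsub>Kg\<^esub> inv\<^bsub>Kg\<^esub> (W [^]\<^bsub>Kg\<^esub> n) \<in> F" using subringE(6)[OF subfieldE(1)[OF F]] by blast
    moreover have "x \<otimes>\<^bsub>Kg\<^esub> W [^]\<^bsub>Kg\<^esub> n \<otimes>\<^bsub>Kg\<^esub> inv\<^bsub>Kg\<^esub> (W [^]\<^bsub>Kg\<^esub> n) = x"
      using x(1) Wnc L.Units_pow_closed[OF WU, of n] by (simp add: L.m_assoc)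
    ultimately show ?thesis by simp
  qed
  then have "algebraically_closed_in F Kg" using F by (simp add: algebraically_closed_in_def)
  then show ?thesis using j unfolding F_def by blast
qed

end
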